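(* Let $\mathbb{G}$ be a Kac algebra. Then $\mathcal{AP}(C_0(\mathbb{G}))=\mathcal{P}^\infty(\mathbb{G})$, and $\mathbb{AP}(C_0(\mathbb{G}))=\mathbb{P}^\infty(\mathbb{G})$.
   Context: A Kac algebra (Enock–Schwartz) is viewed as a locally compact quantum group (Kustermans–Vaes) whose scaling group $(\tau_t)$ is trivial and whose modular element is affiliated with the centre of $L^\infty(\mathbb{G})$; in particular its antipode $S=R$ is bounded. $(L^\infty(\mathbb{G}),\Delta)$ is the von Neumann algebra with coproduct, and $C_0(\mathbb{G})\subseteq M(C_0(\mathbb{G}))\subseteq L^\infty(\mathbb{G})$ is the reduced C$^*$-algebra. $\mathcal{P}^\infty(\mathbb{G})$ is the set of $x\in L^\infty(\mathbb{G})$ such that $\Delta(x)$ is a finite-rank tensor (lies in the algebraic tensor product $L^\infty(\mathbb{G})\odot L^\infty(\mathbb{G})$), and $\mathbb{P}^\infty(\mathbb{G})$ is its norm closure. A (finite-dimensional) corepresentation of $C_0(\mathbb{G})$ is $U=(U_{ij})\in\mathbb{M}_n(M(C_0(\mathbb{G})))$ with $\Delta(U_{ij})=\sum_kU_{ik}\otimes U_{kj}$; it is admissible if both $U$ and $U^\top=(U_{ji})$ are invertible. $\mathcal{AP}(C_0(\mathbb{G}))$ is the set of all elements of linear spans of the entries $U_{ij}$ of admissible corepresentations of $C_0(\mathbb{G})$, and $\mathbb{AP}(C_0(\mathbb{G}))$ is its norm closure. *)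

theory Defs
  imports "HOL-Analysis.Analysis"
begin

section \<open>Complex Hilbert spaces and their tensor products\<close>

text \<open>
  The inner product is linear in the first variable. The norm and the completeness are those of
  the underlying real Hilbert space; positive definiteness comes from \<^class>\<open>real_inner\<close>.
\<close>

class complex_hilbert = real_inner + complete_space +
  fixes scaleC :: "complex \<Rightarrow> 'a \<Rightarrow> 'a" (infixr "*\<^sub>C" 75)
    and cinner :: "'a \<Rightarrow> 'a \<Rightarrow> complex"
  assumes scaleC_add_right: "c *\<^sub>C (x + y) = c *\<^sub>C x + c *\<^sub>C y"
    and scaleC_add_left: "(c + d) *\<^sub>C x = c *\<^sub>C x + d *\<^sub>C x"
    and scaleC_scaleC: "c *\<^sub>C d *\<^sub>C x = (c * d) *\<^sub>C x"
    and scaleR_scaleC: "r *\<^sub>R x = complex_of_real r *\<^sub>C x"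
    and cinner_add_left: "cinner (x + y) z = cinner x z + cinner y z"
    and cinner_scaleC_left: "cinner (c *\<^sub>C x) y = c * cinner x y"
    and cinner_commute: "cinner x y = cnj (cinner y x)"
    and inner_eq_Re_cinner: "inner x y = Re (cinner x y)"

text \<open>
  \<open>t a b\<close> is the elementary tensor \<open>a \<otimes> b\<close>, and the type \<open>'c\<close> is the Hilbert space tensor
  product of \<open>'a\<close> and \<open>'b\<close>. Elementary tensors are closed under complex scalars, so the real
  span is already the algebraic tensor product.
\<close>

locale hilbert_tensor =
  fixes t :: "'a::complex_hilbert \<Rightarrow> 'b::complex_hilbert \<Rightarrow> 'c::complex_hilbert"
  assumes add_left: "t (a + a') b = t a b + t a' b"
    and add_right: "t a (b + b') = t a b + t a b'"
    and scale_left: "t (c *\<^sub>C a) b = c *\<^sub>C t a b"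
    and scale_right: "t a (c *\<^sub>C b) = c *\<^sub>C t a b"
    and cinner_tensor: "cinner (t a b) (t a' b') = cinner a a' * cinner b b'"
    and dense: "closure (span {t a b | a b. True}) = UNIV"

text \<open>
  \<open>H \<otimes> H\<close> and \<open>H \<otimes> H \<otimes> H\<close>, the latter formed both as \<open>(H \<otimes> H) \<otimes> H\<close> (map \<open>tL\<close>) and as
  \<open>H \<otimes> (H \<otimes> H)\<close> (map \<open>tR\<close>), with the canonical identification of the two.
\<close>

locale tensor_cube =
  t: hilbert_tensor t + tL: hilbert_tensor tL + tR: hilbert_tensor tR
  for t :: "'h::complex_hilbert \<Rightarrow> 'h \<Rightarrow> 'k::complex_hilbert"
    and tL :: "'k \<Rightarrow> 'h \<Rightarrow> 'l::complex_hilbert"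
    and tR :: "'h \<Rightarrow> 'k \<Rightarrow> 'l" +
  assumes tensor_assoc: "tL (t a b) c = tR a (t b c)"

section \<open>Bounded operators and von Neumann algebras\<close>

type_synonym 'h oper = "'h \<Rightarrow>\<^sub>L 'h"

text \<open>
  Elements of \<^typ>\<open>'h oper\<close> are only real linear; \<open>bounded_ops\<close> is \<open>B(H)\<close>. The norm and the
  norm topology of \<^typ>\<open>'h oper\<close> restrict to those of \<open>B(H)\<close>.
\<close>

definition bounded_ops :: "'h::complex_hilbert oper set" where
  "bounded_ops = {x. \<forall>c \<xi>. blinfun_apply x (c *\<^sub>C \<xi>) = c *\<^sub>C blinfun_apply x \<xi>}"

definition cscale :: "complex \<Rightarrow> 'h::complex_hilbert oper \<Rightarrow> 'h oper" where
  "cscale c x = Blinfun (\<lambda>\<xi>. c *\<^sub>C blinfun_apply x \<xi>)"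

definition cspan :: "'h::complex_hilbert oper set \<Rightarrow> 'h oper set" where
  "cspan S = {\<Sum>x\<in>F. cscale (c x) x | F c. finite F \<and> F \<subseteq> S}"

definition cadj :: "'h::complex_hilbert oper \<Rightarrow> 'h oper" where
  "cadj x = (THE y. \<forall>\<xi> \<eta>. cinner (blinfun_apply x \<xi>) \<eta> = cinner \<xi> (blinfun_apply y \<eta>))"

definition positive_op :: "'h::complex_hilbert oper \<Rightarrow> bool" where
  "positive_op x \<longleftrightarrow> x \<in> bounded_ops \<and> (\<forall>\<xi>. cinner (blinfun_apply x \<xi>) \<xi> \<in> \<real>\<^sub>\<ge>\<^sub>0)"

definition pos_cone :: "'h::complex_hilbert oper set \<Rightarrow> 'h oper set" where
  "pos_cone M = {x \<in> M. positive_op x}"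

definition commutant :: "'h::complex_hilbert oper set \<Rightarrow> 'h oper set" where
  "commutant A = {x \<in> bounded_ops. \<forall>y\<in>A. x o\<^sub>L y = y o\<^sub>L x}"

definition centre :: "'h::complex_hilbert oper set \<Rightarrow> 'h oper set" where
  "centre M = M \<inter> commutant M"

definition von_neumann_algebra :: "'h::complex_hilbert oper set \<Rightarrow> bool" where
  "von_neumann_algebra M \<longleftrightarrow>
     M \<subseteq> bounded_ops \<and> (\<forall>x\<in>M. cadj x \<in> M) \<and> commutant (commutant M) = M"

text \<open>\<open>op_tensor t x y\<close> is \<open>x \<otimes> y\<close>, acting on the tensor product given by \<open>t\<close>.\<close>

definition op_tensor ::
  "('a::complex_hilbert \<Rightarrow> 'b::complex_hilbert \<Rightarrow> 'c::complex_hilbert) \<Rightarrow>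
    'a oper \<Rightarrow> 'b oper \<Rightarrow> 'c oper" where
  "op_tensor t x y =
     (THE z. \<forall>a b. blinfun_apply z (t a b) = t (blinfun_apply x a) (blinfun_apply y b))"

definition vn_tensor ::
  "('a::complex_hilbert \<Rightarrow> 'b::complex_hilbert \<Rightarrow> 'c::complex_hilbert) \<Rightarrow>
    'a oper set \<Rightarrow> 'b oper set \<Rightarrow> 'c oper set" where
  "vn_tensor t A B = commutant (commutant {op_tensor t x y | x y. x \<in> A \<and> y \<in> B})"

definition alg_tensor ::
  "('a::complex_hilbert \<Rightarrow> 'b::complex_hilbert \<Rightarrow> 'c::complex_hilbert) \<Rightarrow>
    'a oper set \<Rightarrow> 'b oper set \<Rightarrow> 'c oper set" where
  "alg_tensor t A B = {\<Sum>i<n. op_tensor t (x i) (y i) | (n::nat) x y.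
     \<forall>i<n. x i \<in> A \<and> y i \<in> B}"

section \<open>Normal functionals, slice maps and normal homomorphisms\<close>

text \<open>
  The normal functionals on \<open>B(H)\<close>, and by restriction those on a von Neumann algebra on \<open>H\<close>, are
  the \<open>\<omega> = \<Sum>n. \<omega>\<^bsub>\<xi>(n),\<eta>(n)\<^esub>\<close> with \<open>\<xi>\<close>, \<open>\<eta>\<close> square summable; the positive ones are those with
  \<open>\<xi> = \<eta>\<close>. They are represented by the pair \<open>\<xi>\<close>, \<open>\<eta>\<close>.
\<close>

definition l2_seq :: "(nat \<Rightarrow> 'h::complex_hilbert) \<Rightarrow> bool" where
  "l2_seq \<xi> \<longleftrightarrow> summable (\<lambda>n. (norm (\<xi> n))\<^sup>2)"

definition normal_fun ::
  "(nat \<Rightarrow> 'h::complex_hilbert) \<Rightarrow> (nat \<Rightarrow> 'h) \<Rightarrow> 'h oper \<Rightarrow> complex" where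
  "normal_fun \<xi> \<eta> x = (\<Sum>n. cinner (blinfun_apply x (\<xi> n)) (\<eta> n))"

text \<open>With \<open>\<omega> = normal_fun \<xi> \<eta>\<close>, these are \<open>(\<omega> \<otimes> id)(X)\<close> and \<open>(id \<otimes> \<omega>)(X)\<close>.\<close>

definition slice_left ::
  "('h::complex_hilbert \<Rightarrow> 'h \<Rightarrow> 'k::complex_hilbert) \<Rightarrow>
    (nat \<Rightarrow> 'h) \<Rightarrow> (nat \<Rightarrow> 'h) \<Rightarrow> 'k oper \<Rightarrow> 'h oper" where
  "slice_left t \<xi> \<eta> X = (THE y. \<forall>\<zeta> \<zeta>'. cinner (blinfun_apply y \<zeta>) \<zeta>' =
     (\<Sum>n. cinner (blinfun_apply X (t (\<xi> n) \<zeta>)) (t (\<eta> n) \<zeta>')))"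

definition slice_right ::
  "('h::complex_hilbert \<Rightarrow> 'h \<Rightarrow> 'k::complex_hilbert) \<Rightarrow>
    (nat \<Rightarrow> 'h) \<Rightarrow> (nat \<Rightarrow> 'h) \<Rightarrow> 'k oper \<Rightarrow> 'h oper" where
  "slice_right t \<xi> \<eta> X = (THE y. \<forall>\<zeta> \<zeta>'. cinner (blinfun_apply y \<zeta>) \<zeta>' =
     (\<Sum>n. cinner (blinfun_apply X (t \<zeta> (\<xi> n))) (t \<zeta>' (\<eta> n))))"

text \<open>
  \<open>\<omega>(x\<^sup>*x + xx\<^sup>*)\<close> for \<open>\<omega> = normal_fun \<xi> \<xi>\<close>. These are the squared seminorms of the
  \<open>\<sigma>\<close>-strong* topology; they are directed, so a single \<open>\<xi>\<close> suffices to test closures.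
\<close>

definition sstar :: "(nat \<Rightarrow> 'h::complex_hilbert) \<Rightarrow> 'h oper \<Rightarrow> real" where
  "sstar \<xi> x =
     (\<Sum>n. (norm (blinfun_apply x (\<xi> n)))\<^sup>2 + (norm (blinfun_apply (cadj x) (\<xi> n)))\<^sup>2)"

definition normal_hom ::
  "'a::complex_hilbert oper set \<Rightarrow> 'b::complex_hilbert oper set \<Rightarrow>
    ('a oper \<Rightarrow> 'b oper) \<Rightarrow> bool" where
  "normal_hom A B \<Phi> \<longleftrightarrow>
     \<Phi> ` A \<subseteq> B \<and> \<Phi> id_blinfun = id_blinfun \<and>
     (\<forall>x\<in>A. \<forall>y\<in>A. \<Phi> (x + y) = \<Phi> x + \<Phi> y \<and> \<Phi> (x o\<^sub>L y) = \<Phi> x o\<^sub>L \<Phi> y) \<and>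
     (\<forall>c. \<forall>x\<in>A. \<Phi> (cscale c x) = cscale c (\<Phi> x)) \<and>
     (\<forall>x\<in>A. \<Phi> (cadj x) = cadj (\<Phi> x)) \<and>
     (\<forall>\<xi> \<eta>. l2_seq \<xi> \<and> l2_seq \<eta> \<longrightarrow>
        (\<exists>\<xi>' \<eta>'. l2_seq \<xi>' \<and> l2_seq \<eta>' \<and>
           (\<forall>x\<in>A. normal_fun \<xi> \<eta> (\<Phi> x) = normal_fun \<xi>' \<eta>' x)))"

section \<open>Weights\<close>

text \<open>The left ideal of elements with \<open>\<phi>(x\<^sup>*x) < \<infinity>\<close>.\<close>

definition nideal ::
  "'h::complex_hilbert oper set \<Rightarrow> ('h oper \<Rightarrow> ennreal) \<Rightarrow> 'h oper set" where
  "nideal M \<phi> = {x \<in> M. \<phi> (cadj x o\<^sub>L x) < top}"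

text \<open>Normal semifinite faithful weights; only the values of \<open>\<phi>\<close> on \<open>pos_cone M\<close> matter.\<close>

locale nsf_weight =
  fixes M :: "'h::complex_hilbert oper set" and \<phi> :: "'h oper \<Rightarrow> ennreal"
  assumes weight_add: "\<lbrakk>x \<in> pos_cone M; y \<in> pos_cone M\<rbrakk> \<Longrightarrow> \<phi> (x + y) = \<phi> x + \<phi> y"
    and weight_scale: "\<lbrakk>x \<in> pos_cone M; 0 \<le> r\<rbrakk> \<Longrightarrow> \<phi> (r *\<^sub>R x) = ennreal r * \<phi> x"
    and faithful: "\<lbrakk>x \<in> pos_cone M; \<phi> x = 0\<rbrakk> \<Longrightarrow> x = 0"
    and normal: "\<lbrakk>D \<subseteq> pos_cone M; D \<noteq> {};
        \<And>x y. \<lbrakk>x \<in> D; y \<in> D\<rbrakk> \<Longrightarrow> \<exists>z\<in>D. positive_op (z - x) \<and> positive_op (z - y);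
        s \<in> pos_cone M; \<And>x. x \<in> D \<Longrightarrow> positive_op (s - x);
        \<And>u. \<lbrakk>u \<in> pos_cone M; \<And>x. x \<in> D \<Longrightarrow> positive_op (u - x)\<rbrakk> \<Longrightarrow> positive_op (u - s)\<rbrakk>
      \<Longrightarrow> \<phi> s = (SUP x\<in>D. \<phi> x)"
    and semifinite: "\<lbrakk>x \<in> M; l2_seq \<xi>; 0 < \<epsilon>\<rbrakk> \<Longrightarrow> \<exists>y\<in>nideal M \<phi>. sstar \<xi> (x - y) < \<epsilon>"

text \<open>
  The linear extension of \<open>\<phi>\<close> to the linear span of \<open>{x \<in> pos_cone M. \<phi> x < top}\<close>, as a relation:
  \<open>y\<close> lies in this span and \<open>\<phi>(y) = z\<close>.
\<close>

definition weight_ext ::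
  "'h::complex_hilbert oper set \<Rightarrow> ('h oper \<Rightarrow> ennreal) \<Rightarrow> 'h oper \<Rightarrow> complex \<Rightarrow> bool" where
  "weight_ext M \<phi> y z \<longleftrightarrow> (\<exists>p::nat \<Rightarrow> 'h oper.
     (\<forall>k<4. p k \<in> pos_cone M \<and> \<phi> (p k) < top) \<and>
     y = (\<Sum>k<4. cscale (\<i> ^ k) (p k)) \<and>
     z = (\<Sum>k<4. \<i> ^ k * complex_of_real (enn2real (\<phi> (p k)))))"

text \<open>\<open>x = (id \<otimes> \<phi>)(X)\<close>, that is, \<open>\<omega>(x) = \<phi>((\<omega> \<otimes> id)(X))\<close> for all normal \<open>\<omega>\<close>.\<close>

definition weight_slice ::
  "('h::complex_hilbert \<Rightarrow> 'h \<Rightarrow> 'k::complex_hilbert) \<Rightarrow> 'h oper set \<Rightarrow>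
    ('h oper \<Rightarrow> ennreal) \<Rightarrow> 'k oper \<Rightarrow> 'h oper \<Rightarrow> bool" where
  "weight_slice t M \<phi> X x \<longleftrightarrow> x \<in> M \<and>
     (\<forall>\<xi> \<eta>. l2_seq \<xi> \<and> l2_seq \<eta> \<longrightarrow>
        weight_ext M \<phi> (slice_left t \<xi> \<eta> X) (normal_fun \<xi> \<eta> x))"

section \<open>Locally compact quantum groups\<close>

definition coassociative ::
  "('h::complex_hilbert \<Rightarrow> 'h \<Rightarrow> 'k::complex_hilbert) \<Rightarrow>
    ('k \<Rightarrow> 'h \<Rightarrow> 'l::complex_hilbert) \<Rightarrow> ('h \<Rightarrow> 'k \<Rightarrow> 'l) \<Rightarrow>
    'h oper set \<Rightarrow> ('h oper \<Rightarrow> 'k oper) \<Rightarrow> bool" where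
  "coassociative t tL tR M \<Delta> \<longleftrightarrow>
     (\<exists>\<Delta>_id id_\<Delta>.
        normal_hom (vn_tensor t M M) (vn_tensor tL (vn_tensor t M M) M) \<Delta>_id \<and>
        normal_hom (vn_tensor t M M) (vn_tensor tR M (vn_tensor t M M)) id_\<Delta> \<and>
        (\<forall>x\<in>M. \<forall>y\<in>M.
           \<Delta>_id (op_tensor t x y) = op_tensor tL (\<Delta> x) y \<and>
           id_\<Delta> (op_tensor t x y) = op_tensor tR x (\<Delta> y)) \<and>
        (\<forall>x\<in>M. \<Delta>_id (\<Delta> x) = id_\<Delta> (\<Delta> x)))"

definition left_invariant ::
  "('h::complex_hilbert \<Rightarrow> 'h \<Rightarrow> 'k::complex_hilbert) \<Rightarrow> 'h oper set \<Rightarrow>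
    ('h oper \<Rightarrow> 'k oper) \<Rightarrow> ('h oper \<Rightarrow> ennreal) \<Rightarrow> bool" where
  "left_invariant t M \<Delta> \<phi> \<longleftrightarrow> (\<forall>\<xi> x. l2_seq \<xi> \<and> x \<in> pos_cone M \<and> \<phi> x < top \<longrightarrow>
     \<phi> (slice_left t \<xi> \<xi> (\<Delta> x)) = ennreal (\<Sum>n. (norm (\<xi> n))\<^sup>2) * \<phi> x)"

definition right_invariant ::
  "('h::complex_hilbert \<Rightarrow> 'h \<Rightarrow> 'k::complex_hilbert) \<Rightarrow> 'h oper set \<Rightarrow>
    ('h oper \<Rightarrow> 'k oper) \<Rightarrow> ('h oper \<Rightarrow> ennreal) \<Rightarrow> bool" where
  "right_invariant t M \<Delta> \<psi> \<longleftrightarrow> (\<forall>\<xi> x. l2_seq \<xi> \<and> x \<in> pos_cone M \<and> \<psi> x < top \<longrightarrow>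
     \<psi> (slice_right t \<xi> \<xi> (\<Delta> x)) = ennreal (\<Sum>n. (norm (\<xi> n))\<^sup>2) * \<psi> x)"

text \<open>
  A locally compact quantum group in the von Neumann algebraic sense of Kustermans and Vaes, with
  \<open>M\<close> represented on \<open>L\<^sup>2(G)\<close>, the GNS space of the left Haar weight \<open>\<phi>\<close>, by means of the GNS
  map \<open>\<Lambda>\<close>.
\<close>

locale lc_quantum_group = tensor_cube t tL tR + nsf_weight M \<phi>
  for t :: "'h::complex_hilbert \<Rightarrow> 'h \<Rightarrow> 'k::complex_hilbert"
    and tL :: "'k \<Rightarrow> 'h \<Rightarrow> 'l::complex_hilbert"
    and tR :: "'h \<Rightarrow> 'k \<Rightarrow> 'l"
    and M :: "'h oper set"
    and \<Delta> :: "'h oper \<Rightarrow> 'k oper"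
    and \<phi> :: "'h oper \<Rightarrow> ennreal"
    and \<Lambda> :: "'h oper \<Rightarrow> 'h" +
  assumes vn_algebra: "von_neumann_algebra M"
    and coproduct: "normal_hom M (vn_tensor t M M) \<Delta>"
    and coassoc: "coassociative t tL tR M \<Delta>"
    and left_haar: "left_invariant t M \<Delta> \<phi>"
    and right_haar: "\<exists>\<psi>. nsf_weight M \<psi> \<and> right_invariant t M \<Delta> \<psi>"
    and gns_add: "\<lbrakk>x \<in> nideal M \<phi>; y \<in> nideal M \<phi>\<rbrakk> \<Longrightarrow> \<Lambda> (x + y) = \<Lambda> x + \<Lambda> y"
    and gns_scale: "x \<in> nideal M \<phi> \<Longrightarrow> \<Lambda> (cscale c x) = c *\<^sub>C \<Lambda> x"
    and gns_norm: "x \<in> nideal M \<phi> \<Longrightarrow> ennreal ((norm (\<Lambda> x))\<^sup>2) = \<phi> (cadj x o\<^sub>L x)"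
    and gns_module: "\<lbrakk>x \<in> M; y \<in> nideal M \<phi>\<rbrakk> \<Longrightarrow> \<Lambda> (x o\<^sub>L y) = blinfun_apply x (\<Lambda> y)"
    and gns_dense: "closure (\<Lambda> ` nideal M \<phi>) = UNIV"

section \<open>Antipode, scaling group and modular element\<close>

text \<open>
  The antipode \<open>S\<close>, as a graph: the \<open>\<sigma>\<close>-strong* closed linear map having as a core the span of
  the elements \<open>(id \<otimes> \<phi>)(\<Delta>(a\<^sup>*)(1 \<otimes> b))\<close> with \<open>a, b\<close> in the left ideal of \<open>\<phi>\<close>, on which
  \<open>S((id \<otimes> \<phi>)(\<Delta>(a\<^sup>*)(1 \<otimes> b))) = (id \<otimes> \<phi>)((1 \<otimes> a\<^sup>*)\<Delta>(b))\<close>. Replacing \<open>b\<close> by a multiple shows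
  that the set of these pairs is closed under complex scalars, so the real span is the complex one.
\<close>

definition antipode_core ::
  "('h::complex_hilbert \<Rightarrow> 'h \<Rightarrow> 'k::complex_hilbert) \<Rightarrow> 'h oper set \<Rightarrow>
    ('h oper \<Rightarrow> 'k oper) \<Rightarrow> ('h oper \<Rightarrow> ennreal) \<Rightarrow> ('h oper \<times> 'h oper) set" where
  "antipode_core t M \<Delta> \<phi> = {(x, y). \<exists>a\<in>nideal M \<phi>. \<exists>b\<in>nideal M \<phi>.
     weight_slice t M \<phi> (\<Delta> (cadj a) o\<^sub>L op_tensor t id_blinfun b) x \<and>
     weight_slice t M \<phi> (op_tensor t id_blinfun (cadj a) o\<^sub>L \<Delta> b) y}"

definition antipode ::
  "('h::complex_hilbert \<Rightarrow> 'h \<Rightarrow> 'k::complex_hilbert) \<Rightarrow> 'h oper set \<Rightarrow>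
    ('h oper \<Rightarrow> 'k oper) \<Rightarrow> ('h oper \<Rightarrow> ennreal) \<Rightarrow> ('h oper \<times> 'h oper) set" where
  "antipode t M \<Delta> \<phi> = {(x, y). x \<in> M \<and> y \<in> M \<and>
     (\<forall>\<xi> \<epsilon>. l2_seq \<xi> \<and> 0 < \<epsilon> \<longrightarrow>
        (\<exists>(x', y')\<in>span (antipode_core t M \<Delta> \<phi>).
           sstar \<xi> (x - x') < \<epsilon> \<and> sstar \<xi> (y - y') < \<epsilon>))}"

definition automorphism_group ::
  "'h::complex_hilbert oper set \<Rightarrow> (real \<Rightarrow> 'h oper \<Rightarrow> 'h oper) \<Rightarrow> bool" where
  "automorphism_group M \<tau> \<longleftrightarrow>
     (\<forall>r. normal_hom M M (\<tau> r)) \<and>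
     (\<forall>x\<in>M. \<tau> 0 x = x) \<and>
     (\<forall>r s. \<forall>x\<in>M. \<tau> (r + s) x = \<tau> r (\<tau> s x)) \<and>
     (\<forall>x\<in>M. \<forall>\<xi> \<eta>. l2_seq \<xi> \<and> l2_seq \<eta> \<longrightarrow>
        continuous_on UNIV (\<lambda>r. normal_fun \<xi> \<eta> (\<tau> r x)))"

text \<open>The graph of the analytic extension \<open>\<tau>\<^bsub>-i/2\<^esub>\<close>.\<close>

definition analytic_extension ::
  "'h::complex_hilbert oper set \<Rightarrow> (real \<Rightarrow> 'h oper \<Rightarrow> 'h oper) \<Rightarrow>
    ('h oper \<times> 'h oper) set" where
  "analytic_extension M \<tau> = {(x, y). x \<in> M \<and> (\<exists>F :: complex \<Rightarrow> 'h oper.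
     (\<forall>z. -1/2 \<le> Im z \<and> Im z \<le> 0 \<longrightarrow> F z \<in> M) \<and>
     (\<forall>r. F (complex_of_real r) = \<tau> r x) \<and> F (- \<i> / 2) = y \<and>
     (\<forall>\<xi> \<eta>. l2_seq \<xi> \<and> l2_seq \<eta> \<longrightarrow>
        continuous_on {z. -1/2 \<le> Im z \<and> Im z \<le> 0} (\<lambda>z. normal_fun \<xi> \<eta> (F z)) \<and>
        (\<lambda>z. normal_fun \<xi> \<eta> (F z)) holomorphic_on {z. -1/2 < Im z \<and> Im z < 0}))}"

definition involutive_antiautomorphism ::
  "'h::complex_hilbert oper set \<Rightarrow> ('h oper \<Rightarrow> 'h oper) \<Rightarrow> bool" where
  "involutive_antiautomorphism M R \<longleftrightarrow>
     R ` M \<subseteq> M \<and>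
     (\<forall>x\<in>M. R (R x) = x \<and> R (cadj x) = cadj (R x)) \<and>
     (\<forall>x\<in>M. \<forall>y\<in>M. R (x + y) = R x + R y \<and> R (x o\<^sub>L y) = R y o\<^sub>L R x) \<and>
     (\<forall>c. \<forall>x\<in>M. R (cscale c x) = cscale c (R x))"

text \<open>
  The polar decomposition \<open>S = R \<tau>\<^bsub>-i/2\<^esub>\<close>, which determines the unitary antipode \<open>R\<close> and the
  scaling group \<open>\<tau>\<close> on \<open>M\<close>.
\<close>

definition antipode_polar_decomposition ::
  "('h::complex_hilbert \<Rightarrow> 'h \<Rightarrow> 'k::complex_hilbert) \<Rightarrow> 'h oper set \<Rightarrow>
    ('h oper \<Rightarrow> 'k oper) \<Rightarrow> ('h oper \<Rightarrow> ennreal) \<Rightarrow>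
    ('h oper \<Rightarrow> 'h oper) \<Rightarrow> (real \<Rightarrow> 'h oper \<Rightarrow> 'h oper) \<Rightarrow> bool" where
  "antipode_polar_decomposition t M \<Delta> \<phi> R \<tau> \<longleftrightarrow>
     involutive_antiautomorphism M R \<and> automorphism_group M \<tau> \<and>
     (\<forall>r. \<forall>x\<in>M. R (\<tau> r x) = \<tau> r (R x)) \<and>
     antipode t M \<Delta> \<phi> = {(x, R y) | x y. (x, y) \<in> analytic_extension M \<tau>}"

text \<open>
  Unbounded operators are given by their graphs. A relation that is equal to its adjoint and has
  dense domain is the graph of a self-adjoint operator.
\<close>

definition positive_selfadjoint :: "('h::complex_hilbert \<times> 'h) set \<Rightarrow> bool" where
  "positive_selfadjoint h \<longleftrightarrow>
     closure (Domain h) = UNIV \<and>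
     h = {(\<xi>, \<eta>). \<forall>(a, b)\<in>h. cinner b \<xi> = cinner a \<eta>} \<and>
     (\<forall>(\<xi>, \<eta>)\<in>h. cinner \<eta> \<xi> \<in> \<real>\<^sub>\<ge>\<^sub>0)"

definition affiliated :: "'h::complex_hilbert oper set \<Rightarrow> ('h \<times> 'h) set \<Rightarrow> bool" where
  "affiliated N h \<longleftrightarrow>
     (\<forall>u\<in>commutant N. \<forall>(\<xi>, \<eta>)\<in>h. (blinfun_apply u \<xi>, blinfun_apply u \<eta>) \<in> h)"

text \<open>
  \<open>\<delta>\<close> is the modular element: it is strictly positive, affiliated with \<open>M\<close>, and the right Haar
  weight \<open>\<psi> = \<phi> \<circ> R\<close> is \<open>\<phi>(\<delta>\<^bsup>1/2\<^esup> \<cdot> \<delta>\<^bsup>1/2\<^esup>)\<close> in the sense of Vaes. With \<open>h = \<delta>\<^bsup>1/2\<^esup>\<close>, the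
  pairs \<open>(a, b)\<close> in \<open>N\<close> are those for which \<open>a\<delta>\<^bsup>1/2\<^esup>\<close> is bounded and its closure \<open>b\<close> is in the left
  ideal of \<open>\<phi>\<close>; the GNS map of \<open>\<psi>\<close> is the closure, for the \<open>\<sigma>\<close>-strong* and norm topologies, of
  \<open>a \<mapsto> \<Lambda>(b)\<close>. Vaes asks in addition that \<open>\<delta>\<close> be relatively invariant under the modular
  automorphism group of \<open>\<phi>\<close>. This is automatic for \<open>\<delta>\<close> affiliated with the centre of \<open>M\<close>, the only
  case to which the definition is applied.
\<close>

definition modular_element ::
  "'h::complex_hilbert oper set \<Rightarrow> ('h oper \<Rightarrow> ennreal) \<Rightarrow> ('h oper \<Rightarrow> 'h oper) \<Rightarrow>
    ('h \<times> 'h) set \<Rightarrow> bool" where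
  "modular_element M \<phi> R \<delta> \<longleftrightarrow>
     positive_selfadjoint \<delta> \<and> (\<forall>\<xi>. (\<xi>, 0) \<in> \<delta> \<longrightarrow> \<xi> = 0) \<and> affiliated M \<delta> \<and>
     (\<exists>h. positive_selfadjoint h \<and> h O h = \<delta> \<and>
        (let N = {(a, b). a \<in> M \<and> b \<in> nideal M \<phi> \<and>
                    (\<forall>(\<xi>, \<eta>)\<in>h. blinfun_apply b \<xi> = blinfun_apply a \<eta>)}
         in (\<forall>(a, b)\<in>N. \<phi> (R (cadj a o\<^sub>L a)) = \<phi> (cadj b o\<^sub>L b)) \<and>
            (\<forall>x\<in>nideal M (\<phi> \<circ> R). \<forall>\<xi> \<epsilon>. l2_seq \<xi> \<and> 0 < \<epsilon> \<longrightarrow>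
               (\<exists>(a, b)\<in>N. sstar \<xi> (x - a) < \<epsilon> \<and>
                  \<phi> (R (cadj (x - a) o\<^sub>L (x - a))) < ennreal \<epsilon>))))"

text \<open>
  A Kac algebra: the scaling group is trivial and the modular element is affiliated with the
  centre of \<open>M\<close>.
\<close>

locale kac_algebra = lc_quantum_group t tL tR M \<Delta> \<phi> \<Lambda>
  for t :: "'h::complex_hilbert \<Rightarrow> 'h \<Rightarrow> 'k::complex_hilbert"
    and tL :: "'k \<Rightarrow> 'h \<Rightarrow> 'l::complex_hilbert"
    and tR :: "'h \<Rightarrow> 'k \<Rightarrow> 'l"
    and M :: "'h oper set"
    and \<Delta> :: "'h oper \<Rightarrow> 'k oper"
    and \<phi> :: "'h oper \<Rightarrow> ennreal"
    and \<Lambda> :: "'h oper \<Rightarrow> 'h" +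
  assumes kac: "\<exists>R \<tau>. antipode_polar_decomposition t M \<Delta> \<phi> R \<tau> \<and>
      (\<forall>r. \<forall>x\<in>M. \<tau> r x = x) \<and>
      (\<exists>\<delta>. modular_element M \<phi> R \<delta> \<and> affiliated (centre M) \<delta>)"

section \<open>The reduced C*-algebra and its admissible corepresentations\<close>

text \<open>
  The multiplicative unitary \<open>W\<close>, characterised by
  \<open>(\<omega> \<otimes> id)(W\<^sup>*) \<Lambda>(x) = \<Lambda>((\<omega> \<otimes> id)\<Delta>(x))\<close>; then \<open>\<Delta>(x) = W\<^sup>*(1 \<otimes> x)W\<close>.
\<close>

definition mult_unitary ::
  "('h::complex_hilbert \<Rightarrow> 'h \<Rightarrow> 'k::complex_hilbert) \<Rightarrow> 'h oper set \<Rightarrow>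
    ('h oper \<Rightarrow> 'k oper) \<Rightarrow> ('h oper \<Rightarrow> ennreal) \<Rightarrow> ('h oper \<Rightarrow> 'h) \<Rightarrow> 'k oper" where
  "mult_unitary t M \<Delta> \<phi> \<Lambda> = (THE W. W \<in> bounded_ops \<and>
     (\<forall>\<xi> \<eta>. l2_seq \<xi> \<and> l2_seq \<eta> \<longrightarrow> (\<forall>x\<in>nideal M \<phi>.
        blinfun_apply (slice_left t \<xi> \<eta> (cadj W)) (\<Lambda> x) = \<Lambda> (slice_left t \<xi> \<eta> (\<Delta> x)))))"

definition C0 ::
  "('h::complex_hilbert \<Rightarrow> 'h \<Rightarrow> 'k::complex_hilbert) \<Rightarrow> 'h oper set \<Rightarrow>
    ('h oper \<Rightarrow> 'k oper) \<Rightarrow> ('h oper \<Rightarrow> ennreal) \<Rightarrow> ('h oper \<Rightarrow> 'h) \<Rightarrow> 'h oper set" where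
  "C0 t M \<Delta> \<phi> \<Lambda> =
     closure {slice_right t \<xi> \<eta> (mult_unitary t M \<Delta> \<phi> \<Lambda>) | \<xi> \<eta>. l2_seq \<xi> \<and> l2_seq \<eta>}"

text \<open>
  \<open>M(C\<^sub>0(G))\<close>, realised as the idealiser of \<open>C\<^sub>0(G)\<close> in its bicommutant \<open>L\<^sup>\<infinity>(G) = M\<close>.
\<close>

definition multiplier_C0 ::
  "('h::complex_hilbert \<Rightarrow> 'h \<Rightarrow> 'k::complex_hilbert) \<Rightarrow> 'h oper set \<Rightarrow>
    ('h oper \<Rightarrow> 'k oper) \<Rightarrow> ('h oper \<Rightarrow> ennreal) \<Rightarrow> ('h oper \<Rightarrow> 'h) \<Rightarrow> 'h oper set" where
  "multiplier_C0 t M \<Delta> \<phi> \<Lambda> =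
     {x \<in> M. \<forall>a\<in>C0 t M \<Delta> \<phi> \<Lambda>. x o\<^sub>L a \<in> C0 t M \<Delta> \<phi> \<Lambda> \<and> a o\<^sub>L x \<in> C0 t M \<Delta> \<phi> \<Lambda>}"

text \<open>An \<open>n \<times> n\<close> matrix over \<open>A\<close> is a function on pairs of indices, used below \<open>n\<close> only.\<close>

definition invertible_matrix ::
  "'h::complex_hilbert oper set \<Rightarrow> nat \<Rightarrow> (nat \<Rightarrow> nat \<Rightarrow> 'h oper) \<Rightarrow> bool" where
  "invertible_matrix A n U \<longleftrightarrow> (\<exists>V. \<forall>i<n. \<forall>j<n. V i j \<in> A \<and>
     (\<Sum>k<n. U i k o\<^sub>L V k j) = (if i = j then id_blinfun else 0) \<and>
     (\<Sum>k<n. V i k o\<^sub>L U k j) = (if i = j then id_blinfun else 0))"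

definition corepresentation ::
  "('h::complex_hilbert \<Rightarrow> 'h \<Rightarrow> 'k::complex_hilbert) \<Rightarrow> 'h oper set \<Rightarrow>
    ('h oper \<Rightarrow> 'k oper) \<Rightarrow> ('h oper \<Rightarrow> ennreal) \<Rightarrow> ('h oper \<Rightarrow> 'h) \<Rightarrow>
    nat \<Rightarrow> (nat \<Rightarrow> nat \<Rightarrow> 'h oper) \<Rightarrow> bool" where
  "corepresentation t M \<Delta> \<phi> \<Lambda> n U \<longleftrightarrow> (\<forall>i<n. \<forall>j<n. U i j \<in> multiplier_C0 t M \<Delta> \<phi> \<Lambda> \<and>
     \<Delta> (U i j) = (\<Sum>k<n. op_tensor t (U i k) (U k j)))"

definition admissible ::
  "('h::complex_hilbert \<Rightarrow> 'h \<Rightarrow> 'k::complex_hilbert) \<Rightarrow> 'h oper set \<Rightarrow>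
    ('h oper \<Rightarrow> 'k oper) \<Rightarrow> ('h oper \<Rightarrow> ennreal) \<Rightarrow> ('h oper \<Rightarrow> 'h) \<Rightarrow>
    nat \<Rightarrow> (nat \<Rightarrow> nat \<Rightarrow> 'h oper) \<Rightarrow> bool" where
  "admissible t M \<Delta> \<phi> \<Lambda> n U \<longleftrightarrow> corepresentation t M \<Delta> \<phi> \<Lambda> n U \<and>
     invertible_matrix (multiplier_C0 t M \<Delta> \<phi> \<Lambda>) n U \<and>
     invertible_matrix (multiplier_C0 t M \<Delta> \<phi> \<Lambda>) n (\<lambda>i j. U j i)"

text \<open>
  \<open>AP_alg\<close>, \<open>Pinf_alg\<close> are the algebraic versions \<open>\<A>\<P>(C\<^sub>0(G))\<close>, \<open>\<P>\<^sup>\<infinity>(G)\<close>, and \<open>AP\<close>, \<open>Pinf\<close> their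
  norm closures.
\<close>

definition AP_alg ::
  "('h::complex_hilbert \<Rightarrow> 'h \<Rightarrow> 'k::complex_hilbert) \<Rightarrow> 'h oper set \<Rightarrow>
    ('h oper \<Rightarrow> 'k oper) \<Rightarrow> ('h oper \<Rightarrow> ennreal) \<Rightarrow> ('h oper \<Rightarrow> 'h) \<Rightarrow> 'h oper set" where
  "AP_alg t M \<Delta> \<phi> \<Lambda> =
     cspan {U i j | n U i j. admissible t M \<Delta> \<phi> \<Lambda> n U \<and> i < n \<and> j < n}"

definition AP ::
  "('h::complex_hilbert \<Rightarrow> 'h \<Rightarrow> 'k::complex_hilbert) \<Rightarrow> 'h oper set \<Rightarrow>
    ('h oper \<Rightarrow> 'k oper) \<Rightarrow> ('h oper \<Rightarrow> ennreal) \<Rightarrow> ('h oper \<Rightarrow> 'h) \<Rightarrow> 'h oper set" where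
  "AP t M \<Delta> \<phi> \<Lambda> = closure (AP_alg t M \<Delta> \<phi> \<Lambda>)"

definition Pinf_alg ::
  "('h::complex_hilbert \<Rightarrow> 'h \<Rightarrow> 'k::complex_hilbert) \<Rightarrow> 'h oper set \<Rightarrow>
    ('h oper \<Rightarrow> 'k oper) \<Rightarrow> 'h oper set" where
  "Pinf_alg t M \<Delta> = {x \<in> M. \<Delta> x \<in> alg_tensor t M M}"

definition Pinf ::
  "('h::complex_hilbert \<Rightarrow> 'h \<Rightarrow> 'k::complex_hilbert) \<Rightarrow> 'h oper set \<Rightarrow>
    ('h oper \<Rightarrow> 'k oper) \<Rightarrow> 'h oper set" where
  "Pinf t M \<Delta> = closure (Pinf_alg t M \<Delta>)"

end

theory Submission
  imports Defs "HOL-Complex_Analysis.Complex_Analysis"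
begin

text \<open>
  Let \<open>W\<close> be the multiplicative unitary, so that \<open>\<Delta>(y) = W\<^sup>*(1 \<otimes> y)W\<close>. It is first obtained as a coisometry from
  left invariance. As the scaling group is trivial, \<open>S = R\<close>, and the pairs in the core of \<open>S\<close> show that
  \<open>R((id \<otimes> \<omega>)(W)) = (id \<otimes> \<omega>)(W\<^sup>*)\<close>. The modular element gives a conjugate-linear isometry \<open>J\<close> with
  \<open>y J = J R(y)\<^sup>*\<close>, and these two facts, with the pentagon equation, make \<open>W\<close> unitary.

  If \<open>\<Delta>(x)\<close> has finite rank, then \<open>x\<close> lies in the span of a linearly independent family \<open>y\<^sub>j\<close> with
  \<open>\<Delta>(y\<^sub>j) = \<Sum>\<^sub>i V\<^sub>j\<^sub>i \<otimes> y\<^sub>i\<close>, and coassociativity makes \<open>V\<close> a corepresentation. Applying \<open>R\<close> to the right slices of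
  \<open>W \<Delta>(y\<^sub>j) = (1 \<otimes> y\<^sub>j) W\<close> yields \<open>\<Sum>\<^sub>i R(V\<^sub>j\<^sub>i) V\<^sub>i\<^sub>k = \<delta>\<^sub>j\<^sub>k\<close>; this identity, the same one for the adjoint
  family, and their images under \<open>R\<close> say that \<open>(R(V\<^sub>i\<^sub>j))\<close> and \<open>(R(V\<^sub>j\<^sub>i))\<close> are inverse to \<open>V\<close> and its transpose.
  A slice of \<open>W\<close> times an entry of \<open>V\<close> is then a sum of slices of \<open>W\<close>, so the entries are multipliers of
  \<open>C\<^sub>0(G)\<close>. Finally \<open>z\<^sub>k = \<Sum>\<^sub>j R(V\<^sub>k\<^sub>j) y\<^sub>j\<close> satisfies \<open>\<Delta>(z\<^sub>k) = 1 \<otimes> z\<^sub>k\<close>, hence is a scalar \<open>c\<^sub>k\<close>, and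
  \<open>y\<^sub>j = \<Sum>\<^sub>k c\<^sub>k V\<^sub>j\<^sub>k\<close>.
\<close>

section \<open>Real Hilbert spaces\<close>

text \<open>Left invariance makes \<open>Wst\<close>, the adjoint of W, isometric but leaves its
  range open. The range is reached indirectly: an operator that intertwines the commutant of
  \<open>M\<close> in the second leg and kills the range of \<open>Wst\<close> also kills
  \<Delta>(b) for every b in the left ideal of the weight, hence \<Delta>(1) = 1, by normality and
  semifiniteness. To obtain such an operator from a vector in the kernel of W, the range projection
  of \<open>Wst\<close> has to commute with the second leg of W, and for this the leg must be closed
  under adjoints; R supplies that.

  \<open>J\<close> compares two descriptions of the GNS space of \<phi> \<circ> R, one through R and
  one through the square root of the modular element. It lets R act on vector functionals, so
  identities for R need only be checked on slices of W.

  Admissibility rests on S = R commuting with adjoints: the antipode identity for the adjoint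
  family, read back, inverts the transpose of V. The scalars c stand for the values at y of a
  counit, which need not be defined on \<open>M\<close>; the products R(V) y replace it.\<close>

class real_hilbert = real_inner + banach

subclass (in complex_hilbert) real_hilbert ..

lemma inner_eqI:
  fixes x y :: "'a::real_inner"
  assumes "\<And>z. inner z x = inner z y"
  shows "x = y"
proof -
  have "inner (x - y) (x - y) = 0"
    using assms[of "x - y"] by (simp add: inner_diff_right)
  then show ?thesis by simp
qed

lemma closed_subspace_closure:
  fixes G :: "'a::real_normed_vector set"
  assumes "subspace G"
  shows "subspace (closure G)"
proof (rule subspaceI)
  show "0 \<in> closure G"
    using assms closure_subset subspace_0 by blast
next
  fix x y assume "x \<in> closure G" "y \<in> closure G"
  then obtain f g where "\<And>n. f n \<in> G" "f \<longlonglongrightarrow> x" "\<And>n. g n \<in> G" "g \<longlonglongrightarrow> y"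
    unfolding closure_sequential by metis
  then have "(\<lambda>n. f n + g n) \<longlonglongrightarrow> x + y" "\<And>n. f n + g n \<in> G"
    using assms by (auto intro: tendsto_add subspace_add)
  then show "x + y \<in> closure G"
    unfolding closure_sequential by (metis (mono_tags, lifting))
next
  fix c x assume "x \<in> closure G"
  then obtain f where "\<And>n. f n \<in> G" "f \<longlonglongrightarrow> x"
    unfolding closure_sequential by metis
  then have "(\<lambda>n. c *\<^sub>R f n) \<longlonglongrightarrow> c *\<^sub>R x" "\<And>n. c *\<^sub>R f n \<in> G"
    using assms by (auto intro: tendsto_scaleR subspace_scale)
  then show "c *\<^sub>R x \<in> closure G"
    unfolding closure_sequential by (metis (mono_tags, lifting))
qed

text \<open>Operators are built from a set of pairs because the formulas that prescribe them come as
  families such as \<open>\<Lambda> (u a)\<close> against \<open>\<Lambda> b\<close>, with no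
  evident function behind them. The bound, applied to the difference of two pairs with the same
  first component, also shows that the pairs are single valued.\<close>

lemma bounded_extension:
  fixes G :: "('a::real_normed_vector \<times> 'b::banach) set"
  assumes G: "subspace G"
    and bd: "\<And>u w. (u, w) \<in> G \<Longrightarrow> norm w \<le> C * norm u"
    and dense: "closure (fst ` G) = UNIV"
  obtains T :: "'a \<Rightarrow>\<^sub>L 'b" where "\<And>u w. (u, w) \<in> G \<Longrightarrow> blinfun_apply T u = w"
    and "\<And>x. norm (blinfun_apply T x) \<le> C * norm x"
proof -
  have cG: "subspace (closure G)" by (rule closed_subspace_closure[OF G])
  have bdc: "norm w \<le> C * norm u" if "(u, w) \<in> closure G" for u w
  proof -
    have "closed {z :: 'a \<times> 'b. norm (snd z) \<le> C * norm (fst z)}"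
      by (intro closed_Collect_le continuous_intros)
    moreover have "G \<subseteq> {z. norm (snd z) \<le> C * norm (fst z)}"
      using bd by auto
    ultimately have "closure G \<subseteq> {z. norm (snd z) \<le> C * norm (fst z)}"
      by (rule closure_minimal[rotated])
    then show ?thesis using that by auto
  qed
  have ex: "\<exists>w. (x, w) \<in> closure G" for x
  proof -
    have "x \<in> closure (fst ` G)" using dense by simp
    then obtain f where f: "\<And>n. f n \<in> fst ` G" "f \<longlonglongrightarrow> x"
      unfolding closure_sequential by metis
    have "\<forall>n. \<exists>w. (f n, w) \<in> G" using f(1) by (metis imageE prod.collapse)
    then obtain g where g: "\<And>n. (f n, g n) \<in> G" by metis
    have "Cauchy g"
    proof (rule metric_CauchyI)
      fix e :: real assume "e > 0"
      \<comment> \<open>\<open>C\<close> may be zero, so the Cauchy estimate divides by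
        \<open>\<bar>C\<bar> + 1\<close>.\<close>
      have pos: "\<bar>C\<bar> + 1 > 0" by simp
      then have "e / (\<bar>C\<bar> + 1) > 0" using \<open>e > 0\<close> by simp
      then obtain N where N: "\<And>m n. m \<ge> N \<Longrightarrow> n \<ge> N \<Longrightarrow> dist (f m) (f n) < e / (\<bar>C\<bar> + 1)"
        using LIMSEQ_imp_Cauchy[OF f(2)] unfolding Cauchy_def by meson
      have "dist (g m) (g n) < e" if "m \<ge> N" "n \<ge> N" for m n
      proof -
        have "(f m - f n, g m - g n) \<in> G"
          using subspace_diff[OF G g[of m] g[of n]] by simp
        then have "dist (g m) (g n) \<le> C * dist (f m) (f n)"
          using bd by (simp add: dist_norm)
        also have "\<dots> \<le> (\<bar>C\<bar> + 1) * dist (f m) (f n)"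
          by (intro mult_right_mono) auto
        also have "\<dots> < e" using N[OF that] pos by (simp add: pos_less_divide_eq mult.commute)
        finally show ?thesis .
      qed
      then show "\<exists>M. \<forall>m\<ge>M. \<forall>n\<ge>M. dist (g m) (g n) < e" by blast
    qed
    then obtain w where "g \<longlonglongrightarrow> w" using Cauchy_convergent convergent_def by blast
    then have "(\<lambda>n. (f n, g n)) \<longlonglongrightarrow> (x, w)" using f(2) by (intro tendsto_Pair)
    then show ?thesis unfolding closure_sequential using g by (intro exI[of _ w] exI[of _ "\<lambda>n. (f n, g n)"]) auto
  qed
  have uniq: "w = w'" if "(x, w) \<in> closure G" "(x, w') \<in> closure G" for x w w'
    using subspace_diff[OF cG that] bdc[of 0 "w - w'"] by simp
  define T where "T x = (THE w. (x, w) \<in> closure G)" for x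
  have T: "(x, T x) \<in> closure G" for x
    unfolding T_def by (rule theI') (use ex uniq in blast)
  have Teq: "T x = w" if "(x, w) \<in> closure G" for x w
    using T uniq that by blast
  have "bounded_linear T"
  proof (rule bounded_linear_intro)
    show "T (x + y) = T x + T y" for x y
      using subspace_add[OF cG T[of x] T[of y]] by (intro Teq) simp
    show "T (r *\<^sub>R x) = r *\<^sub>R T x" for r x
      using subspace_scale[OF cG T[of x], of r] by (intro Teq) simp
    show "norm (T x) \<le> norm x * C" for x
      using bdc[OF T] by (simp add: mult.commute)
  qed
  then have "blinfun_apply (Blinfun T) = T" by (rule bounded_linear_Blinfun_apply)
  then show ?thesis
    using that[of "Blinfun T"] Teq bdc[OF T] closure_subset[of G] by auto
qed

section \<open>Orthogonal projection, Riesz representation and the real adjoint\<close>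

lemma orthogonal_projection_exists:
  fixes S :: "'a::real_hilbert set"
  assumes S: "subspace S" "closed S"
  obtains p where "p \<in> S" "\<And>s. s \<in> S \<Longrightarrow> inner (x - p) s = 0"
proof -
  define d where "d = infdist x S"
  have ne: "S \<noteq> {}" using S(1) subspace_0 by auto
  have d0: "d \<ge> 0" unfolding d_def by (rule infdist_nonneg)
  have dle: "d \<le> norm (x - s)" if "s \<in> S" for s
    using infdist_le[OF that, of x] by (simp add: d_def dist_norm)
  have "\<exists>s\<in>S. dist x s < d + 1 / real (Suc n)" for n
    using ne unfolding d_def infdist_def
    by (subst cINF_less_iff[symmetric]) (auto intro!: bdd_belowI[of _ 0])
  then obtain s where s: "\<And>n. s n \<in> S" "\<And>n. dist x (s n) < d + 1 / real (Suc n)"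
    by metis
  \<comment> \<open>Parallelogram law at the midpoint \<open>?h\<close>, which lies in
    \<open>S\<close> and therefore has distance at least \<open>d\<close> from \<open>x\<close>. It
    makes the minimising sequence Cauchy.\<close>
  have par: "(norm (s m - s n))\<^sup>2 \<le> 2 * (norm (x - s m))\<^sup>2 + 2 * (norm (x - s n))\<^sup>2 - 4 * d\<^sup>2" for m n
  proof -
    let ?h = "(1/2) *\<^sub>R (s m + s n)"
    have "?h \<in> S" using s S by (intro subspace_scale subspace_add)
    then have "d\<^sup>2 \<le> (norm (x - ?h))\<^sup>2" using dle d0 by (intro power_mono) auto
    moreover have "(norm (s m - s n))\<^sup>2 + 4 * (norm (x - ?h))\<^sup>2
        = 2 * (norm (x - s m))\<^sup>2 + 2 * (norm (x - s n))\<^sup>2"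
      unfolding power2_norm_eq_inner by (simp add: inner_simps algebra_simps inner_commute)
    ultimately show ?thesis by linarith
  qed
  have lim: "(\<lambda>n. (d + 1 / real (Suc n))\<^sup>2) \<longlonglongrightarrow> d\<^sup>2"
    using tendsto_power[OF tendsto_add[OF tendsto_const LIMSEQ_inverse_real_of_nat], of d 2]
    by (simp add: inverse_eq_divide)
  have "Cauchy s"
  proof (rule metric_CauchyI)
    fix e :: real assume "e > 0"
    then have e2: "e\<^sup>2 / 4 > 0" by simp
    have "\<forall>\<^sub>F n in sequentially. (d + 1 / real (Suc n))\<^sup>2 < d\<^sup>2 + e\<^sup>2 / 4"
      using order_tendstoD(2)[OF lim, of "d\<^sup>2 + e\<^sup>2 / 4"] e2 by simp
    then obtain N where N: "\<And>n. n \<ge> N \<Longrightarrow> (d + 1 / real (Suc n))\<^sup>2 < d\<^sup>2 + e\<^sup>2 / 4"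
      unfolding eventually_sequentially by blast
    have sN: "(norm (x - s n))\<^sup>2 < d\<^sup>2 + e\<^sup>2 / 4" if "n \<ge> N" for n
    proof -
      have "(norm (x - s n))\<^sup>2 \<le> (d + 1 / real (Suc n))\<^sup>2"
        using s(2)[of n] by (intro power_mono) (auto simp: dist_norm)
      then show ?thesis using N[OF that] by linarith
    qed
    have "dist (s m) (s n) < e" if "m \<ge> N" "n \<ge> N" for m n
    proof -
      have "(norm (s m - s n))\<^sup>2 < e\<^sup>2"
        using par[of m n] sN[OF that(1)] sN[OF that(2)] by linarith
      then show ?thesis using \<open>e > 0\<close> by (simp add: dist_norm power2_less_imp_less)
    qed
    then show "\<exists>M. \<forall>m\<ge>M. \<forall>n\<ge>M. dist (s m) (s n) < e" by blast
  qed
  then obtain p where p: "s \<longlonglongrightarrow> p" using Cauchy_convergent convergent_def by blast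
  have pS: "p \<in> S" using closed_sequentially[OF S(2) _ p] s(1) by blast
  have "(\<lambda>n. dist x (s n)) \<longlonglongrightarrow> dist x p" by (intro tendsto_intros p)
  moreover have "(\<lambda>n. d + 1 / real (Suc n)) \<longlonglongrightarrow> d"
    using tendsto_add[OF tendsto_const LIMSEQ_inverse_real_of_nat, of d] by (simp add: inverse_eq_divide)
  ultimately have pd: "norm (x - p) \<le> d"
    using s(2) unfolding dist_norm by (intro LIMSEQ_le[of _ "norm (x - p)" _ d]) (auto intro: less_imp_le)
  have "inner (x - p) v = 0" if v: "v \<in> S" for v
  proof (rule ccontr)
    assume nz: "inner (x - p) v \<noteq> 0"
    then have vv: "inner v v > 0" by auto
    \<comment> \<open>The coefficient that minimises the distance from \<open>x\<close> to
      \<open>p + c v\<close>; a nonzero value would improve on the minimal distance.\<close>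
    define c where "c = inner (x - p) v / inner v v"
    have "p + c *\<^sub>R v \<in> S" using pS v S by (intro subspace_add subspace_scale)
    then have "d \<le> norm (x - (p + c *\<^sub>R v))" by (rule dle)
    then have "(norm (x - p))\<^sup>2 \<le> (norm (x - (p + c *\<^sub>R v)))\<^sup>2"
      using pd by (intro power_mono) auto
    also have "\<dots> = (norm (x - p))\<^sup>2 - 2 * c * inner (x - p) v + c\<^sup>2 * inner v v"
      unfolding power2_norm_eq_inner by (simp add: inner_simps algebra_simps inner_commute power2_eq_square)
    also have "\<dots> = (norm (x - p))\<^sup>2 - (inner (x - p) v)\<^sup>2 / inner v v"
      unfolding c_def using vv by (simp add: power2_eq_square field_simps)
    finally show False using nz vv by (simp add: divide_le_0_iff)
  qed
  then show ?thesis using that pS by blast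
qed

lemma closed_subspace_eq_UNIV:
  fixes S :: "'a::real_hilbert set"
  assumes "subspace S" "closed S" "\<And>x. (\<And>s. s \<in> S \<Longrightarrow> inner x s = 0) \<Longrightarrow> x = 0"
  shows "S = UNIV"
proof -
  have "x \<in> S" for x
  proof -
    obtain p where p: "p \<in> S" "\<And>s. s \<in> S \<Longrightarrow> inner (x - p) s = 0"
      using orthogonal_projection_exists[OF assms(1,2)] by blast
    then have "x - p = 0" using assms(3) by blast
    then show ?thesis using p(1) by simp
  qed
  then show ?thesis by blast
qed

lemma riesz_representation:
  fixes f :: "'a::real_hilbert \<Rightarrow> real"
  assumes f: "bounded_linear f"
  obtains y where "\<And>x. f x = inner x y"
proof (cases "\<forall>x. f x = 0")
  case True
  then show ?thesis using that[of 0] by simp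
next
  case False
  then obtain z where z: "f z \<noteq> 0" by blast
  interpret f: bounded_linear f by (rule f)
  define K where "K = {x. f x = 0}"
  have K: "subspace K" "closed K"
    unfolding K_def subspace_def
    by (auto simp: f.add f.scaleR f.zero intro!: closed_Collect_eq continuous_on_const
        linear_continuous_on f)
  obtain p where p: "p \<in> K" "\<And>s. s \<in> K \<Longrightarrow> inner (z - p) s = 0"
    using orthogonal_projection_exists[OF K] by blast
  define v where "v = z - p"
  have fv: "f v = f z" using p(1) by (simp add: v_def f.diff K_def)
  then have "v \<noteq> 0" using z f.zero by auto
  then have vv: "inner v v > 0" by simp
  have "f x = inner x ((f v / inner v v) *\<^sub>R v)" for x
  proof -
    have "x - (f x / f v) *\<^sub>R v \<in> K" using fv z by (simp add: K_def f.diff f.scaleR)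
    then have "inner v (x - (f x / f v) *\<^sub>R v) = 0" using p(2) v_def by simp
    then have "inner v x = f x / f v * inner v v" by (simp add: inner_diff_right)
    then show ?thesis using vv fv z by (simp add: field_simps inner_commute)
  qed
  then show ?thesis by (rule that)
qed

text \<open>The adjoint for the real inner product. On complex-linear operators it is
  \<open>cadj\<close> (\<open>cadj_eq_radj\<close>), and it also covers operators that are not
  complex linear, such as the conjugate-linear \<open>J\<close>.\<close>

definition radj :: "('a::real_hilbert \<Rightarrow>\<^sub>L 'b::real_hilbert) \<Rightarrow> ('b \<Rightarrow>\<^sub>L 'a)" where
  "radj T = (SOME S. \<forall>x y. inner (blinfun_apply T x) y = inner x (blinfun_apply S y))"

lemma radj_ex:
  fixes T :: "'a::real_hilbert \<Rightarrow>\<^sub>L 'b::real_hilbert"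
  shows "\<exists>S. \<forall>x y. inner (blinfun_apply T x) y = inner x (blinfun_apply S y)"
proof -
  have "\<exists>z. \<forall>x. inner (blinfun_apply T x) y = inner x z" for y
    using riesz_representation[OF bounded_linear_compose[OF bounded_linear_inner_left[of y] blinfun.bounded_linear_right[of T]]]
    by metis
  then obtain g where g: "\<And>x y. inner (blinfun_apply T x) y = inner x (g y)" by metis
  have "bounded_linear g"
  proof (rule bounded_linear_intro)
    show "g (x + y) = g x + g y" for x y
      by (rule inner_eqI) (simp add: g[symmetric] inner_add_right)
    show "g (r *\<^sub>R x) = r *\<^sub>R g x" for r x
      by (rule inner_eqI) (simp add: g[symmetric])
    show "norm (g x) \<le> norm x * norm T" for x
    proof (cases "g x = 0")
      case False
      have "(norm (g x))\<^sup>2 = inner (blinfun_apply T (g x)) x"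
        by (simp add: g power2_norm_eq_inner)
      also have "\<dots> \<le> norm (blinfun_apply T (g x)) * norm x" by (rule norm_cauchy_schwarz)
      also have "\<dots> \<le> norm T * norm (g x) * norm x"
        by (intro mult_right_mono norm_blinfun) auto
      finally show ?thesis using False by (simp add: power2_eq_square mult.commute)
    qed simp
  qed
  then have "blinfun_apply (Blinfun g) = g" by (rule bounded_linear_Blinfun_apply)
  then show ?thesis using g by metis
qed

lemma inner_radj: "inner (blinfun_apply T x) y = inner x (blinfun_apply (radj T) y)"
  unfolding radj_def using someI_ex[OF radj_ex[of T]] by blast

lemma inner_radj': "inner x (blinfun_apply T y) = inner (blinfun_apply (radj T) x) y"
  by (metis inner_commute inner_radj)

lemma radj_unique:
  assumes "\<And>x y. inner (blinfun_apply T x) y = inner x (blinfun_apply S y)"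
  shows "radj T = S"
proof (rule blinfun_eqI)
  fix y
  show "blinfun_apply (radj T) y = blinfun_apply S y"
    by (rule inner_eqI) (simp add: assms[symmetric] inner_radj[symmetric])
qed

lemma radj_radj [simp]: "radj (radj T) = T"
  by (rule radj_unique) (metis inner_commute inner_radj)

lemma radj_compose: "radj (S o\<^sub>L T) = radj T o\<^sub>L radj S"
  by (rule radj_unique) (simp add: inner_radj)

lemma radj_add: "radj (S + T) = radj S + radj T"
  by (rule radj_unique) (simp add: blinfun.add_left inner_add_left inner_add_right inner_radj)

lemma radj_diff: "radj (S - T) = radj S - radj T"
  by (rule radj_unique) (simp add: blinfun.diff_left inner_diff_left inner_diff_right inner_radj)

lemma radj_zero [simp]: "radj 0 = 0"
  by (rule radj_unique) simp

lemma radj_id [simp]: "radj id_blinfun = id_blinfun"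
  by (rule radj_unique) simp

lemma radj_sum: "radj (\<Sum>i\<in>I. f i) = (\<Sum>i\<in>I. radj (f i))"
  by (induction I rule: infinite_finite_induct) (auto simp: radj_add)

lemma norm_radj_le: "norm (radj T) \<le> norm T"
proof (rule norm_blinfun_bound)
  fix x
  show "norm (blinfun_apply (radj T) x) \<le> norm T * norm x"
  proof (cases "blinfun_apply (radj T) x = 0")
    case False
    let ?g = "blinfun_apply (radj T) x"
    have "(norm ?g)\<^sup>2 = inner (blinfun_apply T ?g) x"
      by (simp add: inner_radj power2_norm_eq_inner)
    also have "\<dots> \<le> norm (blinfun_apply T ?g) * norm x" by (rule norm_cauchy_schwarz)
    also have "\<dots> \<le> norm T * norm ?g * norm x"
      by (intro mult_right_mono norm_blinfun) auto
    finally show ?thesis using False by (simp add: power2_eq_square)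
  qed simp
qed simp

lemma norm_radj [simp]: "norm (radj T) = norm T"
  by (metis norm_radj_le radj_radj order_antisym)

lemma bounded_linear_radj: "bounded_linear radj"
proof (rule bounded_linear_intro)
  show "radj (r *\<^sub>R T) = r *\<^sub>R radj T" for r and T :: "'a \<Rightarrow>\<^sub>L 'b"
    by (rule radj_unique) (simp add: blinfun.scaleR_left inner_radj)
  show "norm (radj T) \<le> norm T * 1" for T :: "'a \<Rightarrow>\<^sub>L 'b" by simp
qed (rule radj_add)

section \<open>Complex Hilbert spaces\<close>

lemma scaleC_one [simp]: "1 *\<^sub>C x = (x::'a::complex_hilbert)"
  using scaleR_scaleC[of 1 x] by simp

lemma scaleC_zero_left [simp]: "0 *\<^sub>C x = (0::'a::complex_hilbert)"
  using scaleR_scaleC[of 0 x] by simp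

lemma scaleC_zero_right [simp]: "c *\<^sub>C (0::'a::complex_hilbert) = 0"
  by (metis scaleC_zero_left scaleC_scaleC mult_zero_right)

lemma scaleC_minus_one: "(-1) *\<^sub>C x = - (x::'a::complex_hilbert)"
  using scaleR_scaleC[of "-1" x] by simp

lemma scaleC_scaleR_commute: "c *\<^sub>C r *\<^sub>R x = r *\<^sub>R c *\<^sub>C (x::'a::complex_hilbert)"
  by (simp add: scaleR_scaleC scaleC_scaleC mult.commute)

lemma scaleC_minus_right: "c *\<^sub>C (- x) = - (c *\<^sub>C (x::'a::complex_hilbert))"
  by (metis scaleC_minus_one scaleC_scaleC mult.commute)

lemma scaleC_diff_right: "c *\<^sub>C (x - y) = c *\<^sub>C x - c *\<^sub>C (y::'a::complex_hilbert)"
  using scaleC_add_right[of c x "- y"] by (simp add: scaleC_minus_right)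

lemma scaleC_minus_left: "(- c) *\<^sub>C x = - (c *\<^sub>C (x::'a::complex_hilbert))"
  by (metis scaleC_minus_one scaleC_scaleC mult_minus1)

lemma cinner_add_right: "cinner x (y + z) = cinner x y + cinner x (z::'a::complex_hilbert)"
  by (metis cinner_add_left cinner_commute complex_cnj_add)

lemma cinner_scaleC_right: "cinner x (c *\<^sub>C y) = cnj c * cinner x (y::'a::complex_hilbert)"
  by (metis cinner_scaleC_left cinner_commute complex_cnj_mult)

lemma cinner_zero [simp]: "cinner 0 (x::'a::complex_hilbert) = 0" "cinner x (0::'a::complex_hilbert) = 0"
  using cinner_add_left[of 0 0 x] cinner_add_right[of x 0 0] by auto

lemma cinner_minus [simp]:
  "cinner (- x) (y::'a::complex_hilbert) = - cinner x y" "cinner x (- y) = - cinner x y"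
  using cinner_scaleC_left[of "-1" x y] cinner_scaleC_right[of x "-1" y]
  by (simp_all add: scaleC_minus_one)

lemma cinner_diff_left: "cinner (x - y) z = cinner x z - cinner y (z::'a::complex_hilbert)"
  using cinner_add_left[of x "- y" z] by simp

lemma cinner_diff_right: "cinner x (y - z) = cinner x y - cinner x (z::'a::complex_hilbert)"
  using cinner_add_right[of x y "- z"] by simp

lemma cinner_scaleR [simp]:
  "cinner (r *\<^sub>R x) (y::'a::complex_hilbert) = of_real r * cinner x y"
  "cinner x (r *\<^sub>R y) = of_real r * cinner x y"
  by (simp_all add: scaleR_scaleC cinner_scaleC_left cinner_scaleC_right)

lemma cinner_sum_left: "cinner (\<Sum>i\<in>I. f i) (y::'a::complex_hilbert) = (\<Sum>i\<in>I. cinner (f i) y)"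
  by (induction I rule: infinite_finite_induct) (auto simp: cinner_add_left)

lemma cinner_self: "cinner x x = of_real ((norm (x::'a::complex_hilbert))\<^sup>2)"
proof -
  have "Im (cinner x x) = 0"
    by (metis cinner_commute complex_cnj_cancel_iff complex_is_Real_iff Reals_cnj_iff)
  then show ?thesis
    by (auto simp: complex_eq_iff power2_norm_eq_inner inner_eq_Re_cinner)
qed

text \<open>The bridge from real to complex statements: orthogonality in the real sense against a
  set closed under multiplication by \<i> is complex orthogonality.\<close>

lemma cinner_eq_inner:
  "cinner x y = Complex (inner x y) (inner x (\<i> *\<^sub>C (y::'a::complex_hilbert)))"
  by (simp add: inner_eq_Re_cinner cinner_scaleC_right complex_eq_iff)

lemma cinner_eqI:
  fixes x y :: "'a::complex_hilbert"
  assumes "\<And>z. cinner x z = cinner y z"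
  shows "x = y"
  by (rule inner_eqI) (metis assms inner_commute inner_eq_Re_cinner)

lemma norm_scaleC [simp]: "norm (c *\<^sub>C x) = cmod c * norm (x::'a::complex_hilbert)"
proof -
  have "complex_of_real ((norm (c *\<^sub>C x))\<^sup>2) = of_real ((cmod c * norm x)\<^sup>2)"
    unfolding cinner_self[symmetric] cinner_scaleC_left cinner_scaleC_right
    by (simp add: cinner_self power_mult_distrib complex_norm_square mult_ac del: of_real_power)
  then have "(norm (c *\<^sub>C x))\<^sup>2 = (cmod c * norm x)\<^sup>2" using of_real_eq_iff by blast
  then show ?thesis by (simp add: power2_eq_iff_nonneg)
qed

lemma cmod_cinner_le: "cmod (cinner x y) \<le> norm x * norm (y::'a::complex_hilbert)"
proof (cases "cinner x y = 0")
  case False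
  \<comment> \<open>The phase that rotates \<open>cinner x y\<close> onto the positive axis, where
    the real Cauchy-Schwarz inequality applies.\<close>
  define c where "c = cnj (cinner x y) / cmod (cinner x y)"
  have c: "cmod c = 1" using False by (simp add: c_def norm_divide)
  have "cinner (c *\<^sub>C x) y = of_real (cmod (cinner x y))"
    using False complex_norm_square[of "cinner x y"]
    by (simp add: cinner_scaleC_left c_def field_simps power2_eq_square)
  then have "cmod (cinner x y) = inner (c *\<^sub>C x) y" by (simp add: inner_eq_Re_cinner)
  also have "\<dots> \<le> norm (c *\<^sub>C x) * norm y" by (rule norm_cauchy_schwarz)
  finally show ?thesis using c by simp
qed simp

lemma bounded_bilinear_cinner: "bounded_bilinear (cinner :: 'a::complex_hilbert \<Rightarrow> 'a \<Rightarrow> complex)"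
proof
  show "\<exists>K. \<forall>a b::'a. norm (cinner a b) \<le> norm a * norm b * K"
    by (rule exI[of _ 1]) (simp add: cmod_cinner_le)
qed (simp_all add: cinner_add_left cinner_add_right scaleR_conv_of_real)

lemma bounded_bilinear_scaleC: "bounded_bilinear (scaleC :: complex \<Rightarrow> 'a::complex_hilbert \<Rightarrow> 'a)"
proof
  show "\<exists>K. \<forall>(a::complex) b::'a. norm (a *\<^sub>C b) \<le> norm a * norm b * K"
    by (rule exI[of _ 1]) simp
qed (simp_all add: scaleC_add_left scaleC_add_right scaleC_scaleR_commute scaleR_scaleC
      scaleC_scaleC scaleR_conv_of_real mult.commute)

interpretation cinner: bounded_bilinear "cinner :: 'a::complex_hilbert \<Rightarrow> 'a \<Rightarrow> complex"
  by (rule bounded_bilinear_cinner)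

interpretation scaleC: bounded_bilinear "scaleC :: complex \<Rightarrow> 'a::complex_hilbert \<Rightarrow> 'a"
  by (rule bounded_bilinear_scaleC)

text \<open>Converts preservation of norms into preservation of inner products; used for
  \<open>pre_W\<close>, for \<open>Wst\<close> and, in conjugate form, for \<open>J\<close>.\<close>

lemma cpolarization:
  fixes x y :: "'a::complex_hilbert"
  shows "4 * cinner x y = of_real ((norm (x + y))\<^sup>2) - of_real ((norm (x - y))\<^sup>2)
     + \<i> * of_real ((norm (x + \<i> *\<^sub>C y))\<^sup>2) - \<i> * of_real ((norm (x - \<i> *\<^sub>C y))\<^sup>2)"
  unfolding cinner_self[symmetric]
  by (simp add: cinner_add_left cinner_add_right cinner_diff_left cinner_diff_right
      cinner_scaleC_left cinner_scaleC_right algebra_simps)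

section \<open>Complex-linear and conjugate-linear operators\<close>

definition clin :: "('a::complex_hilbert \<Rightarrow>\<^sub>L 'b::complex_hilbert) \<Rightarrow> bool" where
  "clin T \<longleftrightarrow> (\<forall>c x. blinfun_apply T (c *\<^sub>C x) = c *\<^sub>C blinfun_apply T x)"

definition aclin :: "('a::complex_hilbert \<Rightarrow>\<^sub>L 'b::complex_hilbert) \<Rightarrow> bool" where
  "aclin T \<longleftrightarrow> (\<forall>c x. blinfun_apply T (c *\<^sub>C x) = cnj c *\<^sub>C blinfun_apply T x)"

lemma bounded_ops_iff: "x \<in> bounded_ops \<longleftrightarrow> clin x"
  by (simp add: bounded_ops_def clin_def)

lemma clinD: "clin T \<Longrightarrow> blinfun_apply T (c *\<^sub>C x) = c *\<^sub>C blinfun_apply T x"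
  by (simp add: clin_def)

lemma aclinD: "aclin T \<Longrightarrow> blinfun_apply T (c *\<^sub>C x) = cnj c *\<^sub>C blinfun_apply T x"
  by (simp add: aclin_def)

lemma clin_id [simp]: "clin id_blinfun" by (simp add: clin_def)
lemma clin_zero [simp]: "clin 0" by (simp add: clin_def)
lemma clin_compose: "clin S \<Longrightarrow> clin T \<Longrightarrow> clin (S o\<^sub>L T)" by (simp add: clin_def)
lemma clin_add: "clin S \<Longrightarrow> clin T \<Longrightarrow> clin (S + T)"
  by (simp add: clin_def blinfun.add_left scaleC_add_right)
lemma clin_diff: "clin S \<Longrightarrow> clin T \<Longrightarrow> clin (S - T)"
  by (simp add: clin_def blinfun.diff_left scaleC_diff_right)
lemma clin_scaleR: "clin S \<Longrightarrow> clin (r *\<^sub>R S)"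
  by (simp add: clin_def blinfun.scaleR_left scaleC_scaleR_commute)
lemma clin_sum: "(\<And>i. i \<in> I \<Longrightarrow> clin (f i)) \<Longrightarrow> clin (\<Sum>i\<in>I. f i)"
  by (induction I rule: infinite_finite_induct) (auto simp: clin_add)

text \<open>The imaginary part of \<open>cinner\<close> is the real inner product against
  \<open>\<i>\<close> times the second vector, and a complex-linear \<open>T\<close> commutes with
  \<open>\<i>\<close>; so the real adjoint is also the complex one.\<close>

lemma cinner_radj:
  assumes "clin T"
  shows "cinner (blinfun_apply T x) y = cinner x (blinfun_apply (radj T) y)"
proof -
  have swap: "inner a (\<i> *\<^sub>C b) = - inner (\<i> *\<^sub>C a) b" for a b :: "'c::complex_hilbert"
    by (simp add: inner_eq_Re_cinner cinner_scaleC_left cinner_scaleC_right)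
  have "inner (blinfun_apply T x) (\<i> *\<^sub>C y) = inner x (\<i> *\<^sub>C blinfun_apply (radj T) y)"
    by (simp add: swap inner_radj[symmetric] clinD[OF assms])
  then show ?thesis by (simp add: cinner_eq_inner inner_radj)
qed

lemma cinner_radj':
  assumes "clin T"
  shows "cinner x (blinfun_apply T y) = cinner (blinfun_apply (radj T) x) y"
  by (metis assms cinner_commute cinner_radj)

lemma clin_radj [simp]: "clin T \<Longrightarrow> clin (radj T)"
  unfolding clin_def[of "radj T"]
  by (intro allI cinner_eqI)
    (simp add: cinner_radj'[symmetric] cinner_scaleC_left)

lemma cadj_eq_radj:
  assumes "clin x"
  shows "cadj x = radj x"
  unfolding cadj_def
proof (rule the_equality)
  show "\<forall>\<xi> \<eta>. cinner (blinfun_apply x \<xi>) \<eta> = cinner \<xi> (blinfun_apply (radj x) \<eta>)"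
    using cinner_radj[OF assms] by blast
next
  fix y assume "\<forall>\<xi> \<eta>. cinner (blinfun_apply x \<xi>) \<eta> = cinner \<xi> (blinfun_apply y \<eta>)"
  then show "y = radj x"
    by (intro radj_unique[symmetric]) (simp add: inner_eq_Re_cinner)
qed

lemma cscale_apply [simp]: "blinfun_apply (cscale c x) \<xi> = c *\<^sub>C blinfun_apply x \<xi>"
  unfolding cscale_def
  by (subst bounded_linear_Blinfun_apply)
    (auto intro: scaleC.bounded_linear_right[THEN bounded_linear_compose] blinfun.bounded_linear_right)

lemma clin_cscale: "clin x \<Longrightarrow> clin (cscale c x)"
  by (simp add: clin_def scaleC_scaleC mult.commute)

lemma cscale_of_real: "cscale (of_real r) x = r *\<^sub>R x"
  by (rule blinfun_eqI) (simp add: scaleR_scaleC blinfun.scaleR_left)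

lemma cscale_cscale: "cscale c (cscale d x) = cscale (c * d) x"
  by (rule blinfun_eqI) (simp add: scaleC_scaleC)

lemma cscale_one [simp]: "cscale 1 x = x"
  by (rule blinfun_eqI) simp

lemma cscale_zero [simp]: "cscale 0 x = 0" "cscale c 0 = 0"
  by (rule blinfun_eqI, simp)+

lemma cscale_add: "cscale c (x + y) = cscale c x + cscale c y"
  by (rule blinfun_eqI) (simp add: blinfun.add_left scaleC_add_right)

lemma cscale_add_left: "cscale (c + d) x = cscale c x + cscale d x"
  by (rule blinfun_eqI) (simp add: blinfun.add_left scaleC_add_left)

lemma cscale_diff: "cscale c (x - y) = cscale c x - cscale c y"
  by (rule blinfun_eqI) (simp add: blinfun.diff_left scaleC_diff_right)

lemma cscale_sum: "cscale c (\<Sum>i\<in>I. f i) = (\<Sum>i\<in>I. cscale c (f i))"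
  by (induction I rule: infinite_finite_induct) (auto simp: cscale_add)

lemma cscale_minus_one: "cscale (-1) x = - x"
  by (rule blinfun_eqI) (simp add: scaleC_minus_one blinfun.minus_left)

lemma compose_cscale_left: "cscale c x o\<^sub>L y = cscale c (x o\<^sub>L y)"
  by (rule blinfun_eqI) simp

lemma compose_cscale_right: "clin x \<Longrightarrow> x o\<^sub>L cscale c y = cscale c (x o\<^sub>L y)"
  by (rule blinfun_eqI) (simp add: clinD)

lemma radj_cscale: "clin x \<Longrightarrow> radj (cscale c x) = cscale (cnj c) (radj x)"
proof (rule radj_unique)
  fix \<xi> \<eta> assume "clin x"
  then show "inner (blinfun_apply (cscale c x) \<xi>) \<eta> = inner \<xi> (blinfun_apply (cscale (cnj c) (radj x)) \<eta>)"
    by (simp add: inner_eq_Re_cinner cinner_scaleC_left cinner_scaleC_right cinner_radj)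
qed

lemma compose_sum_left: "(\<Sum>i\<in>I. f i) o\<^sub>L y = (\<Sum>i\<in>I. f i o\<^sub>L y)"
  by (rule blinfun_eqI) (simp add: blinfun.sum_left)

lemma compose_sum_right: "y o\<^sub>L (\<Sum>i\<in>I. f i) = (\<Sum>i\<in>I. y o\<^sub>L f i)"
  by (rule blinfun_eqI) (simp add: blinfun.sum_left blinfun.sum_right)

lemma compose_add_left: "(x + x') o\<^sub>L y = (x o\<^sub>L y) + (x' o\<^sub>L y)"
  by (rule blinfun_eqI) (simp add: blinfun.add_left)

lemma compose_add_right: "y o\<^sub>L (x + x') = (y o\<^sub>L x) + (y o\<^sub>L x')"
  by (rule blinfun_eqI) (simp add: blinfun.add_left blinfun.add_right)

lemma compose_diff_left: "(x - x') o\<^sub>L y = (x o\<^sub>L y) - (x' o\<^sub>L y)"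
  by (rule blinfun_eqI) (simp add: blinfun.diff_left)

lemma compose_diff_right: "y o\<^sub>L (x - x') = (y o\<^sub>L x) - (y o\<^sub>L x')"
  by (rule blinfun_eqI) (simp add: blinfun.diff_left blinfun.diff_right)

lemma compose_assoc: "(x o\<^sub>L y) o\<^sub>L z = x o\<^sub>L (y o\<^sub>L z)"
  by (rule blinfun_eqI) simp

lemma compose_id [simp]: "x o\<^sub>L id_blinfun = x" "id_blinfun o\<^sub>L x = x"
  by (rule blinfun_eqI, simp)+

lemma compose_zero [simp]: "x o\<^sub>L 0 = 0" "0 o\<^sub>L x = 0"
  by (rule blinfun_eqI, simp)+

lemma compose_scaleR: "(r *\<^sub>R x) o\<^sub>L y = r *\<^sub>R (x o\<^sub>L y)" "x o\<^sub>L (r *\<^sub>R y) = r *\<^sub>R (x o\<^sub>L y)"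
  by (rule blinfun_eqI, simp add: blinfun.scaleR_left blinfun.scaleR_right)+

lemma oper_eqI:
  fixes S T :: "'a::complex_hilbert \<Rightarrow>\<^sub>L 'b::complex_hilbert"
  assumes "\<And>\<xi> \<eta>. cinner (blinfun_apply S \<xi>) \<eta> = cinner (blinfun_apply T \<xi>) \<eta>"
  shows "S = T"
  using assms by (intro blinfun_eqI cinner_eqI)

lemma clin_limit:
  assumes "\<And>n. clin (f n)" "f \<longlonglongrightarrow> T"
  shows "clin T"
  unfolding clin_def
proof (intro allI)
  fix c x
  have 1: "(\<lambda>n. blinfun_apply (f n) (c *\<^sub>C x)) \<longlonglongrightarrow> blinfun_apply T (c *\<^sub>C x)"
    by (intro blinfun.tendsto assms tendsto_const)
  have "(\<lambda>n. c *\<^sub>C blinfun_apply (f n) x) \<longlonglongrightarrow> c *\<^sub>C blinfun_apply T x"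
    by (intro scaleC.tendsto blinfun.tendsto assms tendsto_const)
  then have "(\<lambda>n. blinfun_apply (f n) (c *\<^sub>C x)) \<longlonglongrightarrow> c *\<^sub>C blinfun_apply T x"
    using assms(1) by (simp add: clin_def)
  then show "blinfun_apply T (c *\<^sub>C x) = c *\<^sub>C blinfun_apply T x"
    using 1 LIMSEQ_unique by blast
qed

lemma clin_suminf:
  fixes f :: "nat \<Rightarrow> ('a::complex_hilbert \<Rightarrow>\<^sub>L 'b::complex_hilbert)"
  assumes "\<And>n. clin (f n)" "summable f"
  shows "clin (suminf f)"
  by (rule clin_limit[OF _ summable_LIMSEQ[OF assms(2)]]) (intro clin_sum assms)

text \<open>The spaces need not be separable, so a basis is a set and the expansions along it are
  unordered sums. Totality is expressed by a trivial orthogonal complement, which is what maximality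
  in Zorn's lemma gives.\<close>

definition is_onb :: "'a::complex_hilbert set \<Rightarrow> bool" where
  "is_onb B \<longleftrightarrow> (\<forall>e\<in>B. norm e = 1) \<and> (\<forall>e\<in>B. \<forall>f\<in>B. e \<noteq> f \<longrightarrow> cinner e f = 0) \<and>
     (\<forall>x. (\<forall>e\<in>B. cinner x e = 0) \<longrightarrow> x = 0)"

lemma onb_exists: "\<exists>B :: 'a::complex_hilbert set. is_onb B"
proof -
  define \<A> where "\<A> = {B :: 'a set. (\<forall>e\<in>B. norm e = 1) \<and> (\<forall>e\<in>B. \<forall>f\<in>B. e \<noteq> f \<longrightarrow> cinner e f = 0)}"
  have "\<exists>M\<in>\<A>. \<forall>X\<in>\<A>. M \<subseteq> X \<longrightarrow> X = M"
  proof (rule subset_Zorn')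
    fix \<C> assume C: "subset.chain \<A> \<C>"
    show "\<Union>\<C> \<in> \<A>"
      unfolding \<A>_def
    proof (intro CollectI conjI ballI impI)
      fix e assume "e \<in> \<Union>\<C>"
      then show "norm e = 1" using C unfolding subset.chain_def \<A>_def by auto
    next
      fix e f assume "e \<in> \<Union>\<C>" "f \<in> \<Union>\<C>" "e \<noteq> f"
      then obtain X Y where XY: "X \<in> \<C>" "Y \<in> \<C>" "e \<in> X" "f \<in> Y" by blast
      have "X \<in> \<A>" "Y \<in> \<A>" "X \<subseteq> Y \<or> Y \<subseteq> X"
        using C XY unfolding subset.chain_def by auto
      then obtain Z where "Z \<in> \<A>" "e \<in> Z" "f \<in> Z" using XY by blast
      then show "cinner e f = 0" using \<open>e \<noteq> f\<close> unfolding \<A>_def by simp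
    qed
  qed
  then obtain B where B: "B \<in> \<A>" "\<And>X. X \<in> \<A> \<Longrightarrow> B \<subseteq> X \<Longrightarrow> X = B" by blast
  have "x = 0" if x: "\<forall>e\<in>B. cinner x e = 0" for x
  proof (rule ccontr)
    assume "x \<noteq> 0"
    define u where "u = (1 / norm x) *\<^sub>R x"
    have u: "norm u = 1" "\<forall>e\<in>B. cinner u e = 0" "\<forall>e\<in>B. cinner e u = 0"
      using \<open>x \<noteq> 0\<close> x cinner_commute[of _ x] by (auto simp: u_def)
    then have "insert u B \<in> \<A>" using B(1) unfolding \<A>_def by auto
    then have "u \<in> B" using B(2) by blast
    then have "cinner u u = 0" using u(2) by blast
    then show False using u(1) by (simp add: cinner_self)
  qed
  then have "is_onb B" using B(1) unfolding is_onb_def \<A>_def by auto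
  then show ?thesis by blast
qed

section \<open>Square-summable sequences and the density of \<open>*\<close>-algebras in their bicommutants\<close>

text \<open>On this space a normal functional becomes a vector functional: the real part of
  \<open>normal_fun \<xi> \<eta> y\<close> is the inner product of
  \<open>l2_map y (Abs_l2 \<xi>)\<close> with \<open>Abs_l2 \<eta>\<close>. Hence the density
  argument below can be run on a single vector.\<close>

typedef (overloaded) ('a::real_hilbert) l2 = "{f :: nat \<Rightarrow> 'a. summable (\<lambda>n. (norm (f n))\<^sup>2)}"
  morphisms l2_nth Abs_l2
  by (rule exI[of _ "\<lambda>_. 0"]) simp

setup_lifting type_definition_l2

lemma summable_norm_sq_add:
  fixes f g :: "nat \<Rightarrow> 'a::real_inner"
  assumes "summable (\<lambda>n. (norm (f n))\<^sup>2)" "summable (\<lambda>n. (norm (g n))\<^sup>2)"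
  shows "summable (\<lambda>n. (norm (f n + g n))\<^sup>2)"
proof (rule summable_comparison_test')
  show "summable (\<lambda>n. 2 * (norm (f n))\<^sup>2 + 2 * (norm (g n))\<^sup>2)"
    by (intro summable_add summable_mult assms)
  show "norm ((norm (f n + g n))\<^sup>2) \<le> 2 * (norm (f n))\<^sup>2 + 2 * (norm (g n))\<^sup>2" if "n \<ge> 0" for n
  proof -
    have "(norm (f n + g n))\<^sup>2 + (norm (f n - g n))\<^sup>2 = 2 * (norm (f n))\<^sup>2 + 2 * (norm (g n))\<^sup>2"
      by (simp add: power2_norm_eq_inner inner_simps algebra_simps inner_commute)
    then show ?thesis by (simp add: add_increasing2 del: power2_norm_eq_inner)
        (smt (verit) zero_le_power2)
  qed
qed

lemma abs_mult_le_sum_squares: "\<bar>a\<bar> * \<bar>b\<bar> \<le> a\<^sup>2 + (b::real)\<^sup>2"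
proof -
  have "0 \<le> (\<bar>a\<bar> - \<bar>b\<bar>)\<^sup>2" by simp
  then have "2 * (\<bar>a\<bar> * \<bar>b\<bar>) \<le> a\<^sup>2 + b\<^sup>2" by (simp add: power2_diff)
  moreover have "0 \<le> \<bar>a\<bar> * \<bar>b\<bar>" by simp
  ultimately show ?thesis by linarith
qed

lemma summable_norm_mult:
  assumes "summable (\<lambda>n. (norm (f n :: 'a::real_normed_vector))\<^sup>2)"
    "summable (\<lambda>n. (norm (g n :: 'b::real_normed_vector))\<^sup>2)"
  shows "summable (\<lambda>n. norm (f n) * norm (g n))"
proof (rule summable_comparison_test')
  show "summable (\<lambda>n. (norm (f n))\<^sup>2 + (norm (g n))\<^sup>2)"
    by (intro summable_add assms)
  show "norm (norm (f n) * norm (g n)) \<le> (norm (f n))\<^sup>2 + (norm (g n))\<^sup>2" if "n \<ge> 0" for n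
    using abs_mult_le_sum_squares[of "norm (f n)" "norm (g n)"] by simp
qed

lemma summable_inner_l2:
  fixes f g :: "nat \<Rightarrow> 'a::real_inner"
  assumes "summable (\<lambda>n. (norm (f n))\<^sup>2)" "summable (\<lambda>n. (norm (g n))\<^sup>2)"
  shows "summable (\<lambda>n. inner (f n) (g n))"
  by (rule summable_comparison_test'[OF summable_norm_mult[OF assms]])
    (auto simp: Cauchy_Schwarz_ineq2)

instantiation l2 :: (real_hilbert) real_vector
begin
lift_definition zero_l2 :: "'a l2" is "\<lambda>_. 0" by simp
lift_definition plus_l2 :: "'a l2 \<Rightarrow> 'a l2 \<Rightarrow> 'a l2" is "\<lambda>f g n. f n + g n"
  by (rule summable_norm_sq_add)
lift_definition uminus_l2 :: "'a l2 \<Rightarrow> 'a l2" is "\<lambda>f n. - f n" by simp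
lift_definition scaleR_l2 :: "real \<Rightarrow> 'a l2 \<Rightarrow> 'a l2" is "\<lambda>r f n. r *\<^sub>R f n"
  by (simp add: power_mult_distrib summable_mult)
definition minus_l2 :: "'a l2 \<Rightarrow> 'a l2 \<Rightarrow> 'a l2" where "minus_l2 f g = f + - g"
instance
  by standard (simp_all add: minus_l2_def, (transfer, simp add: algebra_simps fun_eq_iff)+)
end

instantiation l2 :: (real_hilbert) real_inner
begin
definition inner_l2 :: "'a l2 \<Rightarrow> 'a l2 \<Rightarrow> real" where
  "inner_l2 f g = (\<Sum>n. inner (l2_nth f n) (l2_nth g n))"
definition norm_l2 :: "'a l2 \<Rightarrow> real" where "norm_l2 f = sqrt (inner f f)"
definition dist_l2 :: "'a l2 \<Rightarrow> 'a l2 \<Rightarrow> real" where "dist_l2 f g = norm (f - g)"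
definition sgn_l2 :: "'a l2 \<Rightarrow> 'a l2" where "sgn_l2 f = f /\<^sub>R norm f"
definition uniformity_l2 :: "('a l2 \<times> 'a l2) filter" where
  "uniformity_l2 = (INF e\<in>{0<..}. principal {(x, y). dist x y < e})"
definition open_l2 :: "'a l2 set \<Rightarrow> bool" where
  "open_l2 U \<longleftrightarrow> (\<forall>x\<in>U. \<forall>\<^sub>F (x', y) in uniformity. x' = x \<longrightarrow> y \<in> U)"
instance
proof
  fix f g h :: "'a l2" and r :: real
  have sm: "summable (\<lambda>n. inner (l2_nth f n) (l2_nth g n))" for f g :: "'a l2"
    using l2_nth[of f] l2_nth[of g] by (intro summable_inner_l2) auto
  show "inner f g = inner g f" by (simp add: inner_l2_def inner_commute)
  show "inner (f + g) h = inner f h + inner g h"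
    by (simp add: inner_l2_def plus_l2.rep_eq inner_add_left suminf_add[OF sm sm])
  show "inner (r *\<^sub>R f) g = r * inner f g"
    by (simp add: inner_l2_def scaleR_l2.rep_eq suminf_mult[OF sm])
  show "0 \<le> inner f f" by (simp add: inner_l2_def suminf_nonneg[OF sm])
  show "(inner f f = 0) = (f = 0)"
  proof
    assume "inner f f = 0"
    then have "\<forall>n. inner (l2_nth f n) (l2_nth f n) = 0"
      unfolding inner_l2_def using suminf_eq_zero_iff[OF sm[of f f]] by simp
    then show "f = 0" by (intro l2_nth_inject[THEN iffD1] ext) (simp add: zero_l2.rep_eq)
  next
    assume "f = 0"
    then show "inner f f = 0" by (simp add: inner_l2_def zero_l2.rep_eq)
  qed
qed (fact norm_l2_def dist_l2_def sgn_l2_def uniformity_l2_def open_l2_def)+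
end

lemma summable_l2_norm: "summable (\<lambda>n. (norm (l2_nth f n))\<^sup>2)"
  using l2_nth[of f] by simp

lemma norm_l2_sq: "(norm (f :: 'a::real_hilbert l2))\<^sup>2 = (\<Sum>n. (norm (l2_nth f n))\<^sup>2)"
  unfolding power2_norm_eq_inner by (simp add: inner_l2_def)

lemma l2_nth_diff: "l2_nth (f - g) n = l2_nth f n - l2_nth g n"
  unfolding minus_l2_def plus_l2.rep_eq uminus_l2.rep_eq by simp

lemma sum_norm_l2_le: "(\<Sum>n<K. (norm (l2_nth f n))\<^sup>2) \<le> (norm f)\<^sup>2"
  unfolding norm_l2_sq by (rule sum_le_suminf[OF summable_l2_norm]) auto

lemma norm_l2_nth_le: "norm (l2_nth f n) \<le> norm f"
proof -
  have "(norm (l2_nth f n))\<^sup>2 \<le> (\<Sum>n<Suc n. (norm (l2_nth f n))\<^sup>2)"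
    by (rule member_le_sum) auto
  then have "(norm (l2_nth f n))\<^sup>2 \<le> (norm f)\<^sup>2"
    using sum_norm_l2_le[of f "Suc n"] by linarith
  then show ?thesis by (simp add: power2_le_iff_abs_le)
qed

instance l2 :: (real_hilbert) real_hilbert
proof
  fix X :: "nat \<Rightarrow> 'a l2" assume X: "Cauchy X"
  have "Cauchy (\<lambda>m. l2_nth (X m) n)" for n
  proof (rule metric_CauchyI)
    fix e :: real assume "e > 0"
    then obtain N where N: "\<And>m p. m \<ge> N \<Longrightarrow> p \<ge> N \<Longrightarrow> dist (X m) (X p) < e"
      using X unfolding Cauchy_def by meson
    have "dist (l2_nth (X m) n) (l2_nth (X p) n) < e" if "m \<ge> N" "p \<ge> N" for m p
      using norm_l2_nth_le[of "X m - X p" n] N[OF that] by (simp add: dist_norm l2_nth_diff)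
    then show "\<exists>M. \<forall>m\<ge>M. \<forall>p\<ge>M. dist (l2_nth (X m) n) (l2_nth (X p) n) < e" by blast
  qed
  then have "\<forall>n. \<exists>l. (\<lambda>m. l2_nth (X m) n) \<longlonglongrightarrow> l"
    using Cauchy_convergent convergent_def by blast
  then obtain f where f: "\<And>n. (\<lambda>m. l2_nth (X m) n) \<longlonglongrightarrow> f n" by metis
  \<comment> \<open>The estimate is made on finite partial sums, uniformly in \<open>K\<close>,
    since only these pass directly to the coordinatewise limit.\<close>
  have bd: "\<exists>N. \<forall>m\<ge>N. \<forall>K. (\<Sum>n<K. (norm (l2_nth (X m) n - f n))\<^sup>2) \<le> e\<^sup>2" if "e > 0" for e
  proof -
    obtain N where N: "\<And>m p. m \<ge> N \<Longrightarrow> p \<ge> N \<Longrightarrow> dist (X m) (X p) < e"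
      using X \<open>e > 0\<close> unfolding Cauchy_def by meson
    have "(\<Sum>n<K. (norm (l2_nth (X m) n - f n))\<^sup>2) \<le> e\<^sup>2" if m: "m \<ge> N" for m K
    proof (rule LIMSEQ_le_const2)
      show "(\<lambda>p. \<Sum>n<K. (norm (l2_nth (X m) n - l2_nth (X p) n))\<^sup>2)
          \<longlonglongrightarrow> (\<Sum>n<K. (norm (l2_nth (X m) n - f n))\<^sup>2)"
        by (intro tendsto_intros f)
      have "(\<Sum>n<K. (norm (l2_nth (X m) n - l2_nth (X p) n))\<^sup>2) \<le> e\<^sup>2" if "p \<ge> N" for p
      proof -
        have "(\<Sum>n<K. (norm (l2_nth (X m) n - l2_nth (X p) n))\<^sup>2) \<le> (norm (X m - X p))\<^sup>2"
          using sum_norm_l2_le[of "X m - X p" K] by (simp add: l2_nth_diff)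
        also have "\<dots> \<le> e\<^sup>2"
          using N[OF m that] by (intro power_mono) (auto simp: dist_norm)
        finally show ?thesis .
      qed
      then show "\<exists>N. \<forall>p\<ge>N. (\<Sum>n<K. (norm (l2_nth (X m) n - l2_nth (X p) n))\<^sup>2) \<le> e\<^sup>2" by blast
    qed
    then show ?thesis by blast
  qed
  have sm: "summable (\<lambda>n. (norm (l2_nth (X m) n - f n))\<^sup>2)"
    if "\<forall>K. (\<Sum>n<K. (norm (l2_nth (X m) n - f n))\<^sup>2) \<le> c" for m c
    using that by (intro bounded_imp_summable[of _ c]) (auto simp: lessThan_Suc_atMost[symmetric] simp del: sum.lessThan_Suc)
  obtain N1 where N1: "\<And>m K. m \<ge> N1 \<Longrightarrow> (\<Sum>n<K. (norm (l2_nth (X m) n - f n))\<^sup>2) \<le> 1\<^sup>2"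
    using bd[of 1] by auto
  have "summable (\<lambda>n. (norm (l2_nth (X N1) n + - (l2_nth (X N1) n - f n)))\<^sup>2)"
    using sm[of N1 "1\<^sup>2"] N1[of N1] summable_l2_norm[of "X N1"]
    by (intro summable_norm_sq_add) (simp_all add: norm_minus_commute)
  then have fl: "summable (\<lambda>n. (norm (f n))\<^sup>2)" by simp
  define F where "F = Abs_l2 f"
  have F: "l2_nth F = f" unfolding F_def using fl by (simp add: Abs_l2_inverse)
  have "X \<longlonglongrightarrow> F"
  proof (rule metric_LIMSEQ_I)
    fix r :: real assume "r > 0"
    then obtain N where N: "\<And>m K. m \<ge> N \<Longrightarrow> (\<Sum>n<K. (norm (l2_nth (X m) n - f n))\<^sup>2) \<le> (r/2)\<^sup>2"
      using bd[of "r/2"] by auto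
    have "dist (X m) F < r" if "m \<ge> N" for m
    proof -
      have "(norm (X m - F))\<^sup>2 \<le> (r/2)\<^sup>2"
        unfolding norm_l2_sq
        using N[OF that] summable_l2_norm[of "X m - F"]
        by (intro suminf_le_const) (auto simp: l2_nth_diff F)
      then have "norm (X m - F) \<le> r/2"
        using \<open>r > 0\<close> by (simp add: power2_le_iff_abs_le)
      then show ?thesis using \<open>r > 0\<close> by (simp add: dist_norm)
    qed
    then show "\<exists>N. \<forall>m\<ge>N. dist (X m) F < r" by blast
  qed
  then show "convergent X" by (auto simp: convergent_def)
qed

lift_definition l2_single :: "nat \<Rightarrow> 'a::real_hilbert \<Rightarrow> 'a l2" is "\<lambda>n v m. if m = n then v else 0"
  by (rule summable_finite[of "{n}" for n]) auto

lemma inner_l2_single: "inner (l2_single n v) x = inner v (l2_nth x n)"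
proof -
  have "(\<Sum>m. inner (l2_nth (l2_single n v) m) (l2_nth x m))
      = (\<Sum>m\<in>{n}. inner (l2_nth (l2_single n v) m) (l2_nth x m))"
    by (rule suminf_finite) (auto simp: l2_single.rep_eq)
  then show ?thesis by (simp add: inner_l2_def l2_single.rep_eq)
qed

lift_definition l2_map :: "('a::real_hilbert \<Rightarrow>\<^sub>L 'a) \<Rightarrow> 'a l2 \<Rightarrow> 'a l2" is "\<lambda>T f n. blinfun_apply T (f n)"
proof -
  fix T :: "'a \<Rightarrow>\<^sub>L 'a" and f :: "nat \<Rightarrow> 'a"
  assume "summable (\<lambda>n. (norm (f n))\<^sup>2)"
  then have "summable (\<lambda>n. (norm T)\<^sup>2 * (norm (f n))\<^sup>2)" by (rule summable_mult)
  then show "summable (\<lambda>n. (norm (blinfun_apply T (f n)))\<^sup>2)"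
  proof (rule summable_comparison_test')
    show "norm ((norm (blinfun_apply T (f n)))\<^sup>2) \<le> (norm T)\<^sup>2 * (norm (f n))\<^sup>2" for n
      using power_mono[OF norm_blinfun[of T "f n"], of 2] by (simp add: power_mult_distrib)
  qed
qed

lemma l2_eqI: "(\<And>n. l2_nth x n = l2_nth y n) \<Longrightarrow> x = y"
  by (metis ext l2_nth_inject)

lemma l2_map_linear:
  "l2_map T (x + y) = l2_map T x + l2_map T y" "l2_map T (r *\<^sub>R x) = r *\<^sub>R l2_map T x"
  by (rule l2_eqI, simp add: l2_map.rep_eq plus_l2.rep_eq scaleR_l2.rep_eq blinfun.add_right blinfun.scaleR_right)+

lemma bounded_linear_l2_map: "bounded_linear (l2_map T)"
proof (rule bounded_linear_intro)
  show "norm (l2_map T x) \<le> norm x * norm T" for x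
  proof -
    have "(norm (l2_map T x))\<^sup>2 \<le> (\<Sum>n. (norm T)\<^sup>2 * (norm (l2_nth x n))\<^sup>2)"
      unfolding norm_l2_sq
    proof (rule suminf_le)
      show "(norm (l2_nth (l2_map T x) n))\<^sup>2 \<le> (norm T)\<^sup>2 * (norm (l2_nth x n))\<^sup>2" for n
        using power_mono[OF norm_blinfun[of T "l2_nth x n"], of 2]
        by (simp add: power_mult_distrib l2_map.rep_eq)
    qed (intro summable_l2_norm summable_mult)+
    also have "\<dots> = (norm x * norm T)\<^sup>2"
      by (simp add: suminf_mult summable_l2_norm norm_l2_sq[symmetric] power_mult_distrib)
    finally show ?thesis by (simp add: power2_le_iff_abs_le)
  qed
qed (simp_all add: l2_map_linear)

lemma inner_l2_map: "inner (l2_map T x) y = inner x (l2_map (radj T) y)"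
  by (simp add: inner_l2_def l2_map.rep_eq inner_radj)

lemma l2_seq_Abs: "l2_seq \<xi> \<Longrightarrow> l2_nth (Abs_l2 \<xi>) = \<xi>"
  by (simp add: l2_seq_def Abs_l2_inverse)

lemma summable_norm_mult_l2_seq: "l2_seq \<xi> \<Longrightarrow> l2_seq \<eta> \<Longrightarrow> summable (\<lambda>n. norm (\<xi> n) * norm (\<eta> n))"
  unfolding l2_seq_def by (rule summable_norm_mult)

lemma summable_normal_fun:
  assumes "l2_seq \<xi>" "l2_seq \<eta>"
  shows "summable (\<lambda>n. cinner (blinfun_apply X (\<xi> n)) (\<eta> n))"
proof (rule summable_comparison_test')
  show "summable (\<lambda>n. norm X * (norm (\<xi> n) * norm (\<eta> n)))"
    by (intro summable_mult summable_norm_mult_l2_seq assms)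
  show "norm (cinner (blinfun_apply X (\<xi> n)) (\<eta> n)) \<le> norm X * (norm (\<xi> n) * norm (\<eta> n))" for n
  proof -
    have "norm (cinner (blinfun_apply X (\<xi> n)) (\<eta> n)) \<le> norm (blinfun_apply X (\<xi> n)) * norm (\<eta> n)"
      by (rule cmod_cinner_le)
    also have "\<dots> \<le> norm X * norm (\<xi> n) * norm (\<eta> n)"
      by (intro mult_right_mono norm_blinfun) auto
    finally show ?thesis by (simp add: mult.assoc)
  qed
qed

lemma bounded_linear_scaleC: "bounded_linear (\<lambda>x::'a::complex_hilbert. c *\<^sub>C x)"
  by (rule scaleC.bounded_linear_right)

text \<open>Von Neumann's density argument in the amplification. The projection \<open>P\<close>
  onto the closed orbit of \<open>\<xi>\<close> commutes with \<open>S\<close> acting on sequences,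
  so its matrix entries lie in the commutant of \<open>S\<close> and \<open>X\<close> commutes with
  them. Hence \<open>X\<close> commutes with \<open>P\<close>, and since the identity is in
  \<open>S\<close>, \<open>P\<close> fixes \<open>\<xi>\<close>. The factors \<open>c\<close> make
  the orbit stable under complex scalars.\<close>

lemma bicommutant_mem_closure:
  fixes S :: "'k::complex_hilbert oper set" and \<xi> :: "'k l2"
  assumes S: "S \<subseteq> bounded_ops" "id_blinfun \<in> S" "\<And>x. x \<in> S \<Longrightarrow> cadj x \<in> S"
      "\<And>x y. x \<in> S \<Longrightarrow> y \<in> S \<Longrightarrow> x o\<^sub>L y \<in> S"
    and X: "X \<in> commutant (commutant S)"
  shows "l2_map X \<xi> \<in> closure (span {l2_map (cscale c y) \<xi> | c y. y \<in> S})"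
proof -
  define G where "G = {l2_map (cscale c y) \<xi> | c y. y \<in> S}"
  define K where "K = closure (span G)"
  have K: "subspace K" "closed K"
    unfolding K_def by (rule closed_subspace_closure[OF subspace_span], rule closed_closure)
  have inv: "l2_map T v \<in> K" if T: "\<And>g. g \<in> G \<Longrightarrow> l2_map T g \<in> G" and v: "v \<in> K" for T v
  proof -
    interpret b: bounded_linear "l2_map T" by (rule bounded_linear_l2_map)
    have "l2_map T ` span G \<subseteq> span G"
      unfolding linear_span_image[OF b.linear_axioms, symmetric]
      using T by (intro span_mono) auto
    then have "l2_map T ` closure (span G) \<subseteq> closure (span G)"
      by (intro image_closure_subset linear_continuous_on bounded_linear_l2_map closed_closure)
        (use closure_subset in blast)
    then show ?thesis using v K_def by blast
  qed
  have "\<forall>x. \<exists>p. p \<in> K \<and> (\<forall>s\<in>K. inner (x - p) s = 0)"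
    using orthogonal_projection_exists[OF K] by metis
  then obtain P where P: "\<And>x. P x \<in> K" "\<And>x s. s \<in> K \<Longrightarrow> inner (x - P x) s = 0" by metis
  have Puniq: "P x = p" if "p \<in> K" "\<And>s. s \<in> K \<Longrightarrow> inner (x - p) s = 0" for x p
  proof -
    have d: "P x - p \<in> K" using P(1) that(1) K(1) by (rule subspace_diff[rotated])
    have "inner (P x - p) (P x - p) = inner (x - p) (P x - p) - inner (x - P x) (P x - p)"
      by (simp add: inner_diff_left)
    then show ?thesis using that(2)[OF d] P(2)[OF d] by simp
  qed
  have Pcomm: "P (l2_map T x) = l2_map T (P x)"
    if "\<And>v. v \<in> K \<Longrightarrow> l2_map T v \<in> K" "\<And>v. v \<in> K \<Longrightarrow> l2_map (radj T) v \<in> K" for T x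
  proof (rule Puniq)
    interpret b: bounded_linear "l2_map T" by (rule bounded_linear_l2_map)
    show "l2_map T (P x) \<in> K" using that(1) P(1) by blast
    fix s assume "s \<in> K"
    have "inner (l2_map T x - l2_map T (P x)) s = inner (x - P x) (l2_map (radj T) s)"
      by (simp add: b.diff[symmetric] inner_l2_map)
    then show "inner (l2_map T x - l2_map T (P x)) s = 0"
      using P(2) that(2) \<open>s \<in> K\<close> by simp
  qed
  have Pbl: "bounded_linear P"
  proof (rule bounded_linear_intro)
    show "P (x + y) = P x + P y" for x y
    proof (rule Puniq)
      show "P x + P y \<in> K" by (intro subspace_add K P(1))
      fix s assume "s \<in> K"
      have "inner (x + y - (P x + P y)) s = inner (x - P x) s + inner (y - P y) s"
        by (simp add: inner_add_left inner_diff_left)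
      then show "inner (x + y - (P x + P y)) s = 0" using P(2) \<open>s \<in> K\<close> by simp
    qed
    show "P (r *\<^sub>R x) = r *\<^sub>R P x" for r x
      by (rule Puniq) (auto intro!: subspace_scale K P(1) simp: P(2) scaleR_diff_right[symmetric])
    show "norm (P x) \<le> norm x * 1" for x
    proof -
      have "(norm x)\<^sup>2 = (norm (x - P x))\<^sup>2 + (norm (P x))\<^sup>2"
        using P(2)[OF P(1), of x x]
        by (simp add: power2_norm_eq_inner inner_diff_left inner_diff_right inner_commute)
      then have "(norm (P x))\<^sup>2 \<le> (norm x)\<^sup>2" by simp
      then show ?thesis by (simp add: power2_le_iff_abs_le)
    qed
  qed
  have single_bl: "bounded_linear (l2_single n :: 'k \<Rightarrow> 'k l2)" for n
  proof (rule bounded_linear_intro)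
    show "l2_single n (x + y) = l2_single n x + l2_single n (y::'k)" for x y
      by (rule l2_eqI) (simp add: l2_single.rep_eq plus_l2.rep_eq)
    show "l2_single n (r *\<^sub>R x) = r *\<^sub>R l2_single n (x::'k)" for r x
      by (rule l2_eqI) (simp add: l2_single.rep_eq scaleR_l2.rep_eq)
    show "norm (l2_single n x) \<le> norm x * 1" for x :: 'k
      by (simp add: norm_eq_sqrt_inner inner_l2_single) (simp add: l2_single.rep_eq)
  qed
  have nth_bl: "bounded_linear (\<lambda>x :: 'k l2. l2_nth x m)" for m
    by (rule bounded_linear_intro[where K = 1])
      (auto simp: plus_l2.rep_eq scaleR_l2.rep_eq norm_l2_nth_le)
  \<comment> \<open>The entries of the matrix of \<open>P\<close> with respect to the coordinates of
    the sequence space.\<close>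
  define E where "E m n = Blinfun (\<lambda>v. l2_nth (P (l2_single n v)) m)" for m n
  have E: "blinfun_apply (E m n) v = l2_nth (P (l2_single n v)) m" for m n v
    unfolding E_def
    using bounded_linear_compose[OF nth_bl bounded_linear_compose[OF Pbl single_bl]]
    by (simp add: bounded_linear_Blinfun_apply)
  have map_single: "l2_map T (l2_single n v) = l2_single n (blinfun_apply T v)" for T n and v :: 'k
    by (rule l2_eqI) (simp add: l2_map.rep_eq l2_single.rep_eq)
  \<comment> \<open>Multiplication by a scalar, as a real-linear operator: that \<open>P\<close>
    commutes with its amplification is what makes the entries of \<open>P\<close> complex
    linear.\<close>
  define \<I> where "\<I> c = Blinfun (\<lambda>x::'k. c *\<^sub>C x)" for c
  have I: "blinfun_apply (\<I> c) x = c *\<^sub>C x" for c x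
    unfolding \<I>_def by (simp add: bounded_linear_Blinfun_apply bounded_linear_scaleC)
  have radjI: "radj (\<I> c) = \<I> (cnj c)" for c
    by (rule radj_unique) (simp add: I inner_eq_Re_cinner cinner_scaleC_left cinner_scaleC_right)
  have GI: "l2_map (\<I> c) g \<in> G" if gG: "g \<in> G" for c g
  proof -
    obtain d y where g: "g = l2_map (cscale d y) \<xi>" "y \<in> S" using gG unfolding G_def by blast
    have "l2_map (\<I> c) g = l2_map (cscale (c * d) y) \<xi>"
      unfolding g by (rule l2_eqI) (simp add: l2_map.rep_eq I scaleC_scaleC)
    then show ?thesis unfolding G_def using g(2) by blast
  qed
  have GS: "l2_map y g \<in> G" if gG: "g \<in> G" and y: "y \<in> S" for y g
  proof -
    obtain d z where g: "g = l2_map (cscale d z) \<xi>" "z \<in> S" using gG unfolding G_def by blast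
    have "clin y" using y S(1) bounded_ops_iff by blast
    then have "l2_map y g = l2_map (cscale d (y o\<^sub>L z)) \<xi>"
      unfolding g by (intro l2_eqI) (simp add: l2_map.rep_eq clinD)
    then show ?thesis unfolding G_def using S(4)[OF y g(2)] by blast
  qed
  have "E m n \<in> commutant S" for m n
  proof -
    have "clin (E m n)"
      unfolding clin_def
    proof (intro allI)
      fix c v
      have "P (l2_map (\<I> c) (l2_single n v)) = l2_map (\<I> c) (P (l2_single n v))"
        by (rule Pcomm) (auto simp: radjI intro!: inv GI)
      then show "blinfun_apply (E m n) (c *\<^sub>C v) = c *\<^sub>C blinfun_apply (E m n) v"
        by (simp add: E map_single I l2_map.rep_eq)
    qed
    moreover have "E m n o\<^sub>L y = y o\<^sub>L E m n" if y: "y \<in> S" for y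
    proof (rule blinfun_eqI)
      fix v
      have "clin y" using y S(1) bounded_ops_iff by blast
      then have "radj y \<in> S" using S(3)[OF y] by (simp add: cadj_eq_radj)
      then have "P (l2_map y (l2_single n v)) = l2_map y (P (l2_single n v))"
        by (intro Pcomm) (auto intro!: inv GS y)
      then show "blinfun_apply (E m n o\<^sub>L y) v = blinfun_apply (y o\<^sub>L E m n) v"
        by (simp add: E map_single l2_map.rep_eq)
    qed
    ultimately show ?thesis by (simp add: commutant_def bounded_ops_iff)
  qed
  then have XE: "X o\<^sub>L E m n = E m n o\<^sub>L X" for m n
    using X unfolding commutant_def by blast
  \<comment> \<open>Commutation with \<open>P\<close> is known entry by entry, that is, on the
    vectors \<open>l2_single n v\<close>. These are total, and the vectors on which it holds form a
    closed subspace.\<close>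
  define D where "D = {x. P (l2_map X x) = l2_map X (P x)}"
  have Xbl: "bounded_linear (l2_map X)" by (rule bounded_linear_l2_map)
  have "D = UNIV"
  proof (rule closed_subspace_eq_UNIV)
    interpret P: bounded_linear P by (rule Pbl)
    interpret X: bounded_linear "l2_map X" by (rule Xbl)
    show "subspace D"
      by (auto simp: subspace_def D_def P.add X.add P.scaleR X.scaleR P.zero X.zero)
    show "closed D"
      unfolding D_def
      by (intro closed_Collect_eq linear_continuous_on bounded_linear_compose[OF Pbl Xbl]
          bounded_linear_compose[OF Xbl Pbl])
    fix x assume x: "\<And>s. s \<in> D \<Longrightarrow> inner x s = 0"
    have "l2_single n v \<in> D" for n v
    proof -
      have "blinfun_apply (X o\<^sub>L E m n) v = blinfun_apply (E m n o\<^sub>L X) v" for m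
        by (simp add: XE)
      then show ?thesis
        by (auto simp: D_def map_single E l2_map.rep_eq intro!: l2_eqI)
    qed
    then have "inner v (l2_nth x n) = 0" for n v
      using x[of "l2_single n v"] by (simp add: inner_l2_single[symmetric] inner_commute)
    then have "inner (l2_nth x n) (l2_nth x n) = 0" for n by blast
    then show "x = 0" by (intro l2_eqI) (simp add: zero_l2.rep_eq)
  qed
  then have "P (l2_map X \<xi>) = l2_map X (P \<xi>)" unfolding D_def by blast
  moreover have "P \<xi> = \<xi>"
  proof (rule Puniq)
    have "l2_map (cscale 1 id_blinfun) \<xi> \<in> G" unfolding G_def using S(2) by blast
    moreover have "l2_map (cscale 1 id_blinfun) \<xi> = \<xi>"
      by (rule l2_eqI) (simp add: l2_map.rep_eq)
    ultimately show "\<xi> \<in> K"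
      unfolding K_def using span_base closure_subset by fastforce
  qed simp
  ultimately have "l2_map X \<xi> \<in> K" using P(1) by metis
  then show ?thesis unfolding K_def G_def .
qed

text \<open>Normal functionals are continuous for the topology in which \<open>S\<close> is dense in
  its bicommutant: the orbit of \<open>Abs_l2 \<xi>\<close> under \<open>S\<close> is orthogonal to
  \<open>Abs_l2 \<eta>\<close>, hence so is its closure.\<close>

lemma normal_fun_zero_on_bicommutant:
  fixes S :: "'k::complex_hilbert oper set"
  assumes S: "S \<subseteq> bounded_ops" "id_blinfun \<in> S" "\<And>x. x \<in> S \<Longrightarrow> cadj x \<in> S"
      "\<And>x y. x \<in> S \<Longrightarrow> y \<in> S \<Longrightarrow> x o\<^sub>L y \<in> S"
    and X: "X \<in> commutant (commutant S)"
    and \<xi>: "l2_seq \<xi>" and \<eta>: "l2_seq \<eta>"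
    and z: "\<And>y. y \<in> S \<Longrightarrow> normal_fun \<xi> \<eta> y = 0"
  shows "normal_fun \<xi> \<eta> X = 0"
proof -
  have part: "inner (l2_map (cscale c y) (Abs_l2 \<xi>)) (Abs_l2 \<eta>) = Re (c * normal_fun \<xi> \<eta> y)" for c y
  proof -
    note sm = summable_normal_fun[OF \<xi> \<eta>, of y]
    have "Re (c * normal_fun \<xi> \<eta> y) = Re (\<Sum>n. c * cinner (blinfun_apply y (\<xi> n)) (\<eta> n))"
      by (simp only: normal_fun_def suminf_mult[OF sm])
    also have "\<dots> = (\<Sum>n. Re (c * cinner (blinfun_apply y (\<xi> n)) (\<eta> n)))"
      by (rule bounded_linear.suminf[OF bounded_linear_Re summable_mult[OF sm]])
    finally show ?thesis
      by (simp add: inner_l2_def l2_map.rep_eq l2_seq_Abs \<xi> \<eta> inner_eq_Re_cinner cinner_scaleC_left)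
  qed
  have zero: "inner v (Abs_l2 \<eta>) = 0"
    if v: "v \<in> closure (span {l2_map (cscale c y) (Abs_l2 \<xi>) | c y. y \<in> S})" for v
  proof -
    let ?Z = "{v. inner v (Abs_l2 \<eta>) = 0}"
    have "subspace ?Z" by (simp add: subspace_def inner_add_left)
    then have "span {l2_map (cscale c y) (Abs_l2 \<xi>) | c y. y \<in> S} \<subseteq> ?Z"
      using part z by (intro span_minimal) auto
    then have "closure (span {l2_map (cscale c y) (Abs_l2 \<xi>) | c y. y \<in> S}) \<subseteq> ?Z"
      by (intro closure_minimal closed_Collect_eq continuous_intros)
    then show ?thesis using v by blast
  qed
  have XI: "cscale c X \<in> commutant (commutant S)" for c
  proof -
    have "clin X" using X by (simp add: commutant_def bounded_ops_iff)
    then show ?thesis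
      using X by (auto simp: commutant_def bounded_ops_iff clin_cscale compose_cscale_left compose_cscale_right)
  qed
  have "inner (l2_map (cscale c X) (Abs_l2 \<xi>)) (Abs_l2 \<eta>) = 0" for c
    by (rule zero, rule bicommutant_mem_closure[OF S XI])
  then have "Re (c * normal_fun \<xi> \<eta> X) = 0" for c by (simp only: part)
  \<comment> \<open>The real inner product sees only real parts; \<open>c = 1\<close> and
    \<open>c = \<i>\<close> recover both components.\<close>
  from this[of 1] this[of "\<i>"] show ?thesis by (simp add: complex_eq_iff)
qed

text \<open>Normal functionals are given by pairs of sequences, so their addition has to be
  performed on the sequences: interleaving adds the two functionals, and with a sign on one sequence
  it subtracts them.\<close>

definition interleave :: "(nat \<Rightarrow> 'a) \<Rightarrow> (nat \<Rightarrow> 'a) \<Rightarrow> nat \<Rightarrow> 'a" where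
  "interleave f g n = (if even n then f (n div 2) else g (n div 2))"

lemma sums_interleave:
  fixes f g :: "nat \<Rightarrow> 'a::real_normed_vector"
  assumes "f sums a" "g sums b"
  shows "interleave f g sums (a + b)"
proof -
  have "odd n" if "n \<notin> range (\<lambda>n. 2 * n)" for n :: nat
    using that rangeI[of "\<lambda>n. 2 * n" "n div 2"] by (metis dvd_mult_div_cancel)
  then have "(\<lambda>n. if even n then f (n div 2) else 0) sums a"
    using assms(1) by (subst sums_mono_reindex[of "\<lambda>n. 2 * n", symmetric])
      (simp_all add: strict_mono_def)
  moreover have "even n" if "n \<notin> range (\<lambda>n. 2 * n + 1)" for n :: nat
    using that rangeI[of "\<lambda>n. 2 * n + 1" "n div 2"] by (metis odd_two_times_div_two_succ)
  then have "(\<lambda>n. if odd n then g (n div 2) else 0) sums b"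
    using assms(2) by (subst sums_mono_reindex[of "\<lambda>n. 2 * n + 1", symmetric])
      (simp_all add: strict_mono_def)
  ultimately have "(\<lambda>n. (if even n then f (n div 2) else 0) + (if odd n then g (n div 2) else 0)) sums (a + b)"
    by (rule sums_add)
  moreover have "(\<lambda>n. (if even n then f (n div 2) else 0) + (if odd n then g (n div 2) else 0))
      = interleave f g"
    by (auto simp: interleave_def fun_eq_iff)
  ultimately show ?thesis by simp
qed

lemma interleave_map: "(\<lambda>n. F (interleave f g n) (interleave f' g' n))
    = interleave (\<lambda>n. F (f n) (f' n)) (\<lambda>n. F (g n) (g' n))"
  by (auto simp: interleave_def)

lemma l2_seq_interleave: "l2_seq f \<Longrightarrow> l2_seq g \<Longrightarrow> l2_seq (interleave f g)"
  unfolding l2_seq_def interleave_map[of "\<lambda>x y. (norm x)\<^sup>2" f g f g]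
  by (rule sums_summable[OF sums_interleave[OF summable_sums summable_sums]])

lemma normal_fun_interleave:
  assumes "l2_seq f" "l2_seq f'" "l2_seq g" "l2_seq g'"
  shows "normal_fun (interleave f g) (interleave f' g') X = normal_fun f f' X + normal_fun g g' X"
  unfolding normal_fun_def interleave_map[of "\<lambda>x y. cinner (blinfun_apply X x) y"]
  by (rule sums_unique[symmetric], rule sums_interleave)
    (intro summable_sums summable_normal_fun assms)+

lemma l2_seq_minus: "l2_seq f \<Longrightarrow> l2_seq (\<lambda>n. - f n)"
  by (simp add: l2_seq_def)

lemma normal_fun_minus: "l2_seq f \<Longrightarrow> l2_seq g \<Longrightarrow> normal_fun f (\<lambda>n. - g n) X = - normal_fun f g X"
  unfolding normal_fun_def using suminf_minus[OF summable_normal_fun] by simp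

lemma normal_fun_eq_on_bicommutant:
  fixes S :: "'k::complex_hilbert oper set"
  assumes S: "S \<subseteq> bounded_ops" "id_blinfun \<in> S" "\<And>x. x \<in> S \<Longrightarrow> cadj x \<in> S"
      "\<And>x y. x \<in> S \<Longrightarrow> y \<in> S \<Longrightarrow> x o\<^sub>L y \<in> S"
    and X: "X \<in> commutant (commutant S)"
    and l2: "l2_seq \<xi>" "l2_seq \<eta>" "l2_seq \<xi>'" "l2_seq \<eta>'"
    and eq: "\<And>y. y \<in> S \<Longrightarrow> normal_fun \<xi> \<eta> y = normal_fun \<xi>' \<eta>' y"
  shows "normal_fun \<xi> \<eta> X = normal_fun \<xi>' \<eta>' X"
proof -
  note i = normal_fun_interleave[OF l2(1,2) l2(3) l2_seq_minus[OF l2(4)]] normal_fun_minus[OF l2(3,4)]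
  have "normal_fun (interleave \<xi> \<xi>') (interleave \<eta> (\<lambda>n. - \<eta>' n)) X = 0"
  proof (rule normal_fun_zero_on_bicommutant[OF S X])
    show "l2_seq (interleave \<xi> \<xi>')" by (rule l2_seq_interleave[OF l2(1,3)])
    show "l2_seq (interleave \<eta> (\<lambda>n. - \<eta>' n))" by (rule l2_seq_interleave[OF l2(2) l2_seq_minus[OF l2(4)]])
  qed (simp_all add: i eq)
  then show ?thesis by (simp add: i)
qed

section \<open>Hilbert space tensor products\<close>

lemma norm_sum_orthogonal:
  fixes f :: "'i \<Rightarrow> 'a::real_inner"
  assumes "finite F" "\<And>i j. i \<in> F \<Longrightarrow> j \<in> F \<Longrightarrow> i \<noteq> j \<Longrightarrow> inner (f i) (f j) = 0"
  shows "(norm (\<Sum>i\<in>F. f i))\<^sup>2 = (\<Sum>i\<in>F. (norm (f i))\<^sup>2)"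
  using assms
proof (induction F rule: finite_induct)
  case (insert i F)
  have "inner (f i) (\<Sum>j\<in>F. f j) = 0"
    unfolding inner_sum_right using insert by (intro sum.neutral) auto
  moreover have "(norm (\<Sum>i\<in>F. f i))\<^sup>2 = (\<Sum>i\<in>F. (norm (f i))\<^sup>2)"
    using insert by auto
  ultimately show ?case
    using insert(1,2) by (simp add: power2_norm_eq_inner inner_add_left inner_add_right inner_commute)
qed simp

text \<open>Completeness is about sequences while the finite partial sums form a net. An increasing
  sequence of finite sets with small remainders yields the limit, and orthogonality bounds every
  larger partial sum by these remainders.\<close>

lemma summable_orthogonal:
  fixes f :: "'i \<Rightarrow> 'a::real_hilbert"
  assumes orth: "\<And>i j. i \<in> B \<Longrightarrow> j \<in> B \<Longrightarrow> i \<noteq> j \<Longrightarrow> inner (f i) (f j) = 0"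
    and sm: "((\<lambda>i. (norm (f i))\<^sup>2) has_sum S) B"
  obtains x where "(f has_sum x) B"
proof -
  have lim: "((\<lambda>F. \<Sum>i\<in>F. (norm (f i))\<^sup>2) \<longlongrightarrow> S) (finite_subsets_at_top B)"
    using sm by (simp add: has_sum_def)
  have "\<exists>F. finite F \<and> F \<subseteq> B \<and> (\<forall>G. finite G \<and> F \<subseteq> G \<and> G \<subseteq> B \<longrightarrow>
      \<bar>(\<Sum>i\<in>G. (norm (f i))\<^sup>2) - S\<bar> < (1 / real (Suc n))\<^sup>2)" for n
  proof -
    have "\<forall>\<^sub>F G in finite_subsets_at_top B. dist (\<Sum>i\<in>G. (norm (f i))\<^sup>2) S < (1 / real (Suc n))\<^sup>2"
      by (rule tendstoD[OF lim]) simp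
    then show ?thesis by (simp add: eventually_finite_subsets_at_top dist_real_def)
  qed
  then obtain F where F: "\<And>n. finite (F n)" "\<And>n. F n \<subseteq> B"
    "\<And>n G. finite G \<Longrightarrow> F n \<subseteq> G \<Longrightarrow> G \<subseteq> B \<Longrightarrow> \<bar>(\<Sum>i\<in>G. (norm (f i))\<^sup>2) - S\<bar> < (1 / real (Suc n))\<^sup>2"
    by metis
  \<comment> \<open>Unions of the chosen sets, so that the sequence is increasing; the remainder
    estimate persists for larger sets.\<close>
  define K where "K n = (\<Union>m\<le>n. F m)" for n
  have K: "finite (K n)" "K n \<subseteq> B" "F n \<subseteq> K n" "m \<le> n \<Longrightarrow> K m \<subseteq> K n" for m n
    using F by (auto simp: K_def intro: order_trans)
  have near: "norm ((\<Sum>i\<in>G. f i) - (\<Sum>i\<in>K n. f i)) \<le> 2 / real (Suc n)"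
    if G: "finite G" "K n \<subseteq> G" "G \<subseteq> B" for G n
  proof -
    have "(norm ((\<Sum>i\<in>G. f i) - (\<Sum>i\<in>K n. f i)))\<^sup>2 = (norm (\<Sum>i\<in>G - K n. f i))\<^sup>2"
      using G K by (simp add: sum_diff)
    also have "\<dots> = (\<Sum>i\<in>G - K n. (norm (f i))\<^sup>2)"
      using G(1,3) by (intro norm_sum_orthogonal orth) auto
    also have "\<dots> = (\<Sum>i\<in>G. (norm (f i))\<^sup>2) - (\<Sum>i\<in>K n. (norm (f i))\<^sup>2)"
      using G K by (simp add: sum_diff)
    also have "\<dots> \<le> 2 * (1 / real (Suc n))\<^sup>2"
      using F(3)[OF G(1) order_trans[OF K(3) G(2)] G(3)] F(3)[OF K(1)[of n] K(3) K(2)] by linarith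
    also have "\<dots> \<le> (2 / real (Suc n))\<^sup>2" by (simp add: power_divide divide_right_mono)
    finally show ?thesis by (rule power2_le_imp_le) simp
  qed
  have lim0: "(\<lambda>n. 2 / real (Suc n)) \<longlonglongrightarrow> 0"
    using tendsto_mult[OF tendsto_const LIMSEQ_inverse_real_of_nat, of 2] by (simp add: divide_inverse)
  have small: "\<exists>N. \<forall>n\<ge>N. 2 / real (Suc n) < e" if "e > 0" for e :: real
    using LIMSEQ_D[OF lim0 that] by simp
  have "Cauchy (\<lambda>n. \<Sum>i\<in>K n. f i)"
  proof (rule metric_CauchyI)
    fix e :: real assume "e > 0"
    then obtain N where N: "\<And>n. n \<ge> N \<Longrightarrow> 2 / real (Suc n) < e / 2" using small[of "e / 2"] by auto
    have "dist (\<Sum>i\<in>K m. f i) (\<Sum>i\<in>K n. f i) < e" if mn: "m \<ge> N" "n \<ge> N" for m n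
    proof -
      have "dist (\<Sum>i\<in>K m. f i) (\<Sum>i\<in>K N. f i) \<le> 2 / real (Suc N)"
        "dist (\<Sum>i\<in>K n. f i) (\<Sum>i\<in>K N. f i) \<le> 2 / real (Suc N)"
        using near[OF K(1) K(4) K(2)] mn by (auto simp: dist_norm)
      then show ?thesis
        using N[of N] dist_triangle2[of "\<Sum>i\<in>K m. f i" "\<Sum>i\<in>K n. f i" "\<Sum>i\<in>K N. f i"] by linarith
    qed
    then show "\<exists>M. \<forall>m\<ge>M. \<forall>n\<ge>M. dist (\<Sum>i\<in>K m. f i) (\<Sum>i\<in>K n. f i) < e" by blast
  qed
  then obtain x where x: "(\<lambda>n. \<Sum>i\<in>K n. f i) \<longlonglongrightarrow> x"
    using Cauchy_convergent convergent_def by blast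
  have "(f has_sum x) B"
    unfolding has_sum_def
  proof (rule tendstoI)
    fix e :: real assume "e > 0"
    then obtain N where N: "\<And>n. n \<ge> N \<Longrightarrow> 2 / real (Suc n) < e / 2" using small[of "e / 2"] by auto
    obtain N' where N': "\<And>n. n \<ge> N' \<Longrightarrow> dist (\<Sum>i\<in>K n. f i) x < e / 2"
      using metric_LIMSEQ_D[OF x, of "e / 2"] \<open>e > 0\<close> by auto
    define n where "n = max N N'"
    have "dist (\<Sum>i\<in>G. f i) x < e" if "finite G" "K n \<subseteq> G" "G \<subseteq> B" for G
      using near[OF that] N[of n] N'[of n] dist_triangle[of "\<Sum>i\<in>G. f i" x "\<Sum>i\<in>K n. f i"]
      by (simp add: n_def dist_norm)
    then show "\<forall>\<^sub>F G in finite_subsets_at_top B. dist (\<Sum>i\<in>G. f i) x < e"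
      unfolding eventually_finite_subsets_at_top using K(1,2) by (intro exI[of _ "K n"]) simp
  qed
  then show ?thesis by (rule that)
qed

text \<open>Creation operators. The adjoint of \<open>tleft t a\<close> removes the first leg of a
  vector by pairing it with \<open>a\<close>; all slices of operators are built from these
  maps.\<close>

definition tleft :: "('a \<Rightarrow> 'b \<Rightarrow> 'c) \<Rightarrow> 'a::complex_hilbert \<Rightarrow> ('b::complex_hilbert \<Rightarrow>\<^sub>L 'c::complex_hilbert)" where
  "tleft t a = Blinfun (t a)"

definition tright :: "('a \<Rightarrow> 'b \<Rightarrow> 'c) \<Rightarrow> 'b::complex_hilbert \<Rightarrow> ('a::complex_hilbert \<Rightarrow>\<^sub>L 'c::complex_hilbert)" where
  "tright t b = Blinfun (\<lambda>a. t a b)"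

context hilbert_tensor
begin

lemma norm_tensor: "norm (t a b) = norm a * norm b"
proof -
  have "complex_of_real ((norm (t a b))\<^sup>2) = of_real ((norm a * norm b)\<^sup>2)"
    unfolding cinner_self[symmetric] cinner_tensor by (simp add: cinner_self power_mult_distrib)
  then have "(norm (t a b))\<^sup>2 = (norm a * norm b)\<^sup>2" using of_real_eq_iff by blast
  then show ?thesis by (simp add: power2_eq_iff_nonneg)
qed

lemma bounded_bilinear_tensor: "bounded_bilinear t"
proof
  show "\<exists>K. \<forall>a b. norm (t a b) \<le> norm a * norm b * K"
    by (rule exI[of _ 1]) (simp add: norm_tensor)
qed (simp_all add: add_left add_right scaleR_scaleC scale_left scale_right)

sublocale bb: bounded_bilinear t
  by (rule bounded_bilinear_tensor)

lemma tleft_apply [simp]: "blinfun_apply (tleft t a) b = t a b"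
  unfolding tleft_def by (simp add: bounded_linear_Blinfun_apply bb.bounded_linear_right)

lemma tright_apply [simp]: "blinfun_apply (tright t b) a = t a b"
  unfolding tright_def by (simp add: bounded_linear_Blinfun_apply bb.bounded_linear_left)

lemma clin_tleft [simp]: "clin (tleft t a)" by (simp add: clin_def scale_right)
lemma clin_tright [simp]: "clin (tright t b)" by (simp add: clin_def scale_left)

lemma radj_tleft_tensor: "blinfun_apply (radj (tleft t a)) (t a' b) = cinner a' a *\<^sub>C b"
  by (rule cinner_eqI) (simp add: cinner_radj[of "radj _", simplified] cinner_tensor cinner_scaleC_left)

lemma radj_tright_tensor: "blinfun_apply (radj (tright t b)) (t a b') = cinner b' b *\<^sub>C a"
  by (rule cinner_eqI)
    (simp add: cinner_radj[of "radj _", simplified] cinner_tensor cinner_scaleC_left mult.commute)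

lemma cinner_tleft: "cinner (blinfun_apply (radj (tleft t a)) v) b = cinner v (t a b)"
  by (simp add: cinner_radj[of "radj _", simplified])

lemma cinner_tright: "cinner (blinfun_apply (radj (tright t b)) v) a = cinner v (t a b)"
  by (simp add: cinner_radj[of "radj _", simplified])

lemma cinner_tright': "cinner a (blinfun_apply (radj (tright t b)) v) = cinner (t a b) v"
  by (metis cinner_commute cinner_tright)

lemma closed_subspace_tensor_UNIV:
  assumes "subspace S" "closed S" "\<And>a b. t a b \<in> S"
  shows "S = UNIV"
proof -
  have "span {t a b | a b. True} \<subseteq> S" using assms by (intro span_minimal) auto
  then have "closure (span {t a b | a b. True}) \<subseteq> S" using assms(2) by (rule closure_minimal)
  then show ?thesis using dense by auto
qed

lemma tensor_blinfun_eqI: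
  fixes X Y :: "'c \<Rightarrow>\<^sub>L 'd::real_normed_vector"
  assumes "\<And>a b. blinfun_apply X (t a b) = blinfun_apply Y (t a b)"
  shows "X = Y"
proof -
  have "{v. blinfun_apply X v = blinfun_apply Y v} = UNIV"
    by (rule closed_subspace_tensor_UNIV)
      (auto simp: subspace_def blinfun.add_right blinfun.scaleR_right assms
        intro!: closed_Collect_eq linear_continuous_on blinfun.bounded_linear_right)
  then show ?thesis by (intro blinfun_eqI) auto
qed

lemma tensor_inner_zero:
  assumes "\<And>a b. inner v (t a b) = 0"
  shows "v = 0"
proof -
  have "{w. inner v w = 0} = UNIV"
    by (rule closed_subspace_tensor_UNIV)
      (auto simp: subspace_def inner_add_right assms intro!: closed_Collect_eq continuous_intros)
  then have "inner v v = 0" by blast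
  then show ?thesis by simp
qed

lemma tensor_cinner_eqI:
  assumes "\<And>a b. cinner v (t a b) = cinner w (t a b)"
  shows "v = w"
proof -
  have "v - w = 0"
    by (rule tensor_inner_zero) (simp add: inner_eq_Re_cinner cinner_diff_left assms)
  then show ?thesis by simp
qed

lemma tensor_oper_eqI:
  fixes X Y :: "'c oper"
  assumes "\<And>a b a' b'. cinner (blinfun_apply X (t a b)) (t a' b') = cinner (blinfun_apply Y (t a b)) (t a' b')"
  shows "X = Y"
  using assms by (intro tensor_blinfun_eqI tensor_cinner_eqI)

text \<open>Transfers every result on the first leg to the second one.\<close>

lemma flip_tensor: "hilbert_tensor (\<lambda>b a. t a b)"
proof
  have "{t a b |b a. True} = {t a b |a b. True}" by blast
  then show "closure (span {t a b |b a. True}) = UNIV" using dense by metis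
qed (simp_all add: add_left add_right scale_left scale_right cinner_tensor)

text \<open>The partial sums are projections, so what remains is a contraction uniformly in the
  finite set. Hence it suffices to treat the dense set \<open>G\<close> of vectors on which the
  partial sums are eventually constant, and each \<open>t e b\<close> with \<open>e\<close> in the
  basis belongs to it.\<close>

lemma tensor_expansion_left:
  assumes B: "is_onb B"
  shows "((\<lambda>e. t e (blinfun_apply (radj (tleft t e)) v)) has_sum v) B"
proof -
  define P where "P F w = (\<Sum>e\<in>F. t e (blinfun_apply (radj (tleft t e)) w))" for F w
  have P_lin: "P F (w + w') = P F w + P F w'" "P F (r *\<^sub>R w) = r *\<^sub>R P F w" "P F 0 = 0"
    "P F (w - w') = P F w - P F w'" for F w w' r
    by (simp_all add: P_def blinfun.add_right blinfun.diff_right blinfun.scaleR_right bb.add_right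
        bb.diff_right bb.scaleR_right sum.distrib scaleR_sum_right sum_subtractf bb.zero_right)
  have orth: "inner (t e a) (t f b) = 0" if "e \<in> B" "f \<in> B" "e \<noteq> f" for e f a b
    using B that by (simp add: inner_eq_Re_cinner cinner_tensor is_onb_def)
  have one: "norm e = 1" if "e \<in> B" for e using B that by (simp add: is_onb_def)
  have contr: "norm (w - P F w) \<le> norm w" if F: "finite F" "F \<subseteq> B" for F w
  proof -
    have n: "(norm (P F w))\<^sup>2 = (\<Sum>e\<in>F. (norm (blinfun_apply (radj (tleft t e)) w))\<^sup>2)"
      unfolding P_def using F orth one
      by (subst norm_sum_orthogonal) (auto simp: norm_tensor subset_iff intro!: sum.cong)
    have "inner w (P F w) = (\<Sum>e\<in>F. (norm (blinfun_apply (radj (tleft t e)) w))\<^sup>2)"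
      unfolding P_def inner_sum_right
    proof (rule sum.cong)
      fix e assume "e \<in> F"
      have "cinner w (t e (blinfun_apply (radj (tleft t e)) w))
          = of_real ((norm (blinfun_apply (radj (tleft t e)) w))\<^sup>2)"
        by (simp add: cinner_tleft[symmetric] cinner_self)
      then show "inner w (t e (blinfun_apply (radj (tleft t e)) w)) = (norm (blinfun_apply (radj (tleft t e)) w))\<^sup>2"
        by (simp add: inner_eq_Re_cinner)
    qed simp
    then have "(norm (w - P F w))\<^sup>2 = (norm w)\<^sup>2 - (norm (P F w))\<^sup>2"
      using n by (simp add: power2_norm_eq_inner inner_diff_left inner_diff_right inner_commute)
    then have "(norm (w - P F w))\<^sup>2 \<le> (norm w)\<^sup>2" by simp
    then show ?thesis by (simp add: power2_le_iff_abs_le)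
  qed
  define G where "G = {w. \<exists>F. finite F \<and> F \<subseteq> B \<and> (\<forall>F'. finite F' \<and> F \<subseteq> F' \<and> F' \<subseteq> B \<longrightarrow> P F' w = w)}"
  have subG: "subspace G"
  proof (rule subspaceI)
    show "0 \<in> G" unfolding G_def using P_lin by auto
  next
    fix x y assume "x \<in> G" "y \<in> G"
    then obtain F F' where "finite F" "F \<subseteq> B" "finite F'" "F' \<subseteq> B"
      "\<And>H. finite H \<Longrightarrow> F \<subseteq> H \<Longrightarrow> H \<subseteq> B \<Longrightarrow> P H x = x"
      "\<And>H. finite H \<Longrightarrow> F' \<subseteq> H \<Longrightarrow> H \<subseteq> B \<Longrightarrow> P H y = y"
      unfolding G_def by auto
    then show "x + y \<in> G"
      unfolding G_def by (intro CollectI exI[of _ "F \<union> F'"]) (simp add: P_lin)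
  next
    fix r x assume "x \<in> G"
    then obtain F where "finite F" "F \<subseteq> B" "\<And>H. finite H \<Longrightarrow> F \<subseteq> H \<Longrightarrow> H \<subseteq> B \<Longrightarrow> P H x = x"
      unfolding G_def by auto
    then show "r *\<^sub>R x \<in> G"
      unfolding G_def by (intro CollectI exI[of _ F]) (simp add: P_lin)
  qed
  have memG: "t e b \<in> G" if e: "e \<in> B" for e b
  proof -
    have "P F (t e b) = t e b" if F: "finite F" "e \<in> F" "F \<subseteq> B" for F
    proof -
      have "t f (blinfun_apply (radj (tleft t f)) (t e b)) = 0" if f: "f \<in> F" "f \<noteq> e" for f
      proof -
        have "f \<in> B" using f F by blast
        then have "cinner e f = 0" using B e f unfolding is_onb_def by metis
        then show ?thesis by (simp add: radj_tleft_tensor bb.zero_right)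
      qed
      then have "P F (t e b) = (\<Sum>f\<in>F. if f = e then t e b else 0)"
        unfolding P_def using one[OF e] by (intro sum.cong) (auto simp: radj_tleft_tensor cinner_self)
      then show ?thesis using F by simp
    qed
    then show ?thesis unfolding G_def using e by (intro CollectI exI[of _ "{e}"]) auto
  qed
  have "closure G = UNIV"
  proof (rule closed_subspace_eq_UNIV)
    show "subspace (closure G)" by (rule closed_subspace_closure[OF subG])
    fix x assume x: "\<And>s. s \<in> closure G \<Longrightarrow> inner x s = 0"
    have zero: "cinner x (t e b) = 0" if "e \<in> B" for e b
    proof -
      have "inner x (t e b) = 0" "inner x (t e (\<i> *\<^sub>C b)) = 0"
        using x memG[OF that] closure_subset by blast+
      then show ?thesis by (simp add: complex_eq_iff inner_eq_Re_cinner scale_right cinner_scaleC_right)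
    qed
    \<comment> \<open>Density of \<open>G\<close>: a vector orthogonal to all \<open>t e b\<close>
      has right slices orthogonal to the basis, so all its right slices vanish.\<close>
    have "cinner (blinfun_apply (radj (tright t b)) x) e = 0" if "e \<in> B" for e b
      using zero[OF that] by (simp add: cinner_tright)
    then have z: "blinfun_apply (radj (tright t b)) x = 0" for b
      using B unfolding is_onb_def by blast
    show "x = 0"
      by (rule tensor_cinner_eqI) (simp add: cinner_tright[symmetric] z)
  qed simp
  then have "v \<in> closure G" by simp
  show ?thesis
    unfolding has_sum_def
  proof (rule tendstoI)
    fix \<epsilon> :: real assume "\<epsilon> > 0"
    then obtain s where s: "s \<in> G" "dist s v < \<epsilon>"
      using \<open>v \<in> closure G\<close> unfolding closure_approachable by blast
    then obtain F where F: "finite F" "F \<subseteq> B" "\<And>H. finite H \<Longrightarrow> F \<subseteq> H \<Longrightarrow> H \<subseteq> B \<Longrightarrow> P H s = s"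
      unfolding G_def by auto
    have "dist (P H v) v < \<epsilon>" if "finite H" "F \<subseteq> H" "H \<subseteq> B" for H
    proof -
      have "v - P H v = (v - s) - P H (v - s)" using F(3)[OF that] by (simp add: P_lin)
      then have "norm (v - P H v) \<le> norm (v - s)" using contr[OF that(1,3), of "v - s"] by metis
      then show ?thesis using s(2) by (simp add: dist_norm norm_minus_commute)
    qed
    then show "\<forall>\<^sub>F H in finite_subsets_at_top B.
        dist (\<Sum>e\<in>H. t e (blinfun_apply (radj (tleft t e)) v)) v < \<epsilon>"
      unfolding eventually_finite_subsets_at_top P_def[symmetric] using F(1,2) by (intro exI[of _ F]) simp
  qed
qed

lemma parseval_left:
  assumes B: "is_onb B"
  shows "((\<lambda>e. (norm (blinfun_apply (radj (tleft t e)) v))\<^sup>2) has_sum (norm v)\<^sup>2) B"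
proof -
  have "((\<lambda>e. inner v (t e (blinfun_apply (radj (tleft t e)) v))) has_sum inner v v) B"
    by (rule has_sum_bounded_linear[OF bounded_linear_inner_right tensor_expansion_left[OF B], unfolded o_def])
  moreover have "inner v (t e (blinfun_apply (radj (tleft t e)) v)) = (norm (blinfun_apply (radj (tleft t e)) v))\<^sup>2" for e
    by (simp add: inner_eq_Re_cinner cinner_tleft[symmetric] cinner_self)
  ultimately show ?thesis by (simp add: power2_norm_eq_inner)
qed

end

lemma tleft_flip: "tleft (\<lambda>b a. t a b) = tright t" "tright (\<lambda>b a. t a b) = tleft t"
  by (simp_all add: tleft_def tright_def fun_eq_iff)

context hilbert_tensor
begin

lemma parseval_right:
  assumes B: "is_onb B"
  shows "((\<lambda>e. (norm (blinfun_apply (radj (tright t e)) v))\<^sup>2) has_sum (norm v)\<^sup>2) B"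
  using hilbert_tensor.parseval_left[OF flip_tensor B, of v] unfolding tleft_flip(1)[of t] .

text \<open>Boundedness on the algebraic tensor product comes from the second leg: every right slice
  of the image is \<open>x\<close> applied to the same slice of the argument, and Parseval's
  identity adds up the slices.\<close>

lemma ampliation_left:
  assumes x: "clin (x :: 'a oper)"
  obtains X :: "'c oper" where "clin X" "\<And>a b. blinfun_apply X (t a b) = t (blinfun_apply x a) b"
    "norm X \<le> norm x"
proof -
  obtain B :: "'b set" where B: "is_onb B" using onb_exists by blast
  define G where "G = span {(t a b, t (blinfun_apply x a) b) | a b. True}"
  have slice: "blinfun_apply (radj (tright t e)) w = blinfun_apply x (blinfun_apply (radj (tright t e)) u)"
    if "(u, w) \<in> G" for u w e
  proof -
    let ?S = "{p :: 'c \<times> 'c. blinfun_apply (radj (tright t e)) (snd p)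
        = blinfun_apply x (blinfun_apply (radj (tright t e)) (fst p))}"
    have "subspace ?S" by (auto simp: subspace_def blinfun.add_right blinfun.scaleR_right)
    then have "G \<subseteq> ?S"
      unfolding G_def by (intro span_minimal) (auto simp: radj_tright_tensor clinD[OF x])
    then show ?thesis using that by auto
  qed
  have bd: "norm w \<le> norm x * norm u" if "(u, w) \<in> G" for u w
  proof -
    have "(norm w)\<^sup>2 \<le> (norm x)\<^sup>2 * (norm u)\<^sup>2"
    proof (rule has_sum_mono)
      show "((\<lambda>e. (norm (blinfun_apply (radj (tright t e)) w))\<^sup>2) has_sum (norm w)\<^sup>2) B"
        by (rule parseval_right[OF B])
      show "((\<lambda>e. (norm x)\<^sup>2 * (norm (blinfun_apply (radj (tright t e)) u))\<^sup>2) has_sum (norm x)\<^sup>2 * (norm u)\<^sup>2) B"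
        by (rule has_sum_cmult_right[OF parseval_right[OF B]])
      show "(norm (blinfun_apply (radj (tright t e)) w))\<^sup>2 \<le> (norm x)\<^sup>2 * (norm (blinfun_apply (radj (tright t e)) u))\<^sup>2" for e
        using power_mono[OF norm_blinfun[of x "blinfun_apply (radj (tright t e)) u"], of 2]
        by (simp add: slice[OF that] power_mult_distrib)
    qed
    then have "(norm w)\<^sup>2 \<le> (norm x * norm u)\<^sup>2" by (simp add: power_mult_distrib)
    then show ?thesis by (rule power2_le_imp_le) simp
  qed
  have "fst ` G = span {t a b | a b. True}"
  proof -
    have "fst ` G = span (fst ` {(t a b, t (blinfun_apply x a) b) | a b. True})"
      unfolding G_def by (rule linear_span_image[symmetric]) (rule linear_fst)
    moreover have "fst ` {(t a b, t (blinfun_apply x a) b) | a b. True} = {t a b | a b. True}"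
      by force
    ultimately show ?thesis by simp
  qed
  then have dn: "closure (fst ` G) = UNIV" using dense by simp
  have sG: "subspace G" unfolding G_def by (rule subspace_span)
  obtain X where X: "\<And>u w. (u, w) \<in> G \<Longrightarrow> blinfun_apply X u = w"
      "\<And>v. norm (blinfun_apply X v) \<le> norm x * norm v"
    using bounded_extension[OF sG bd dn, where thesis = thesis] by metis
  have Xt: "blinfun_apply X (t a b) = t (blinfun_apply x a) b" for a b
    by (rule X(1)) (auto simp: G_def intro: span_base)
  have "X o\<^sub>L cscale c id_blinfun = cscale c X" for c
    by (rule tensor_blinfun_eqI) (simp add: scale_left[symmetric] Xt clinD[OF x])
  then have "blinfun_apply (X o\<^sub>L cscale c id_blinfun) v = blinfun_apply (cscale c X) v" for c v by simp
  then have "clin X" by (simp add: clin_def)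
  moreover have "norm X \<le> norm x" by (rule norm_blinfun_bound) (simp_all add: X(2))
  ultimately show ?thesis using Xt that by blast
qed

end

section \<open>Tensor products of operators\<close>

context hilbert_tensor
begin

lemma op_tensor_ex:
  assumes "clin x" "clin y"
  obtains z where "clin z" "\<And>a b. blinfun_apply z (t a b) = t (blinfun_apply x a) (blinfun_apply y b)"
proof -
  obtain X where X: "clin X" "\<And>a b. blinfun_apply X (t a b) = t (blinfun_apply x a) b"
    by (rule ampliation_left[OF assms(1)]) (rule that)
  obtain Y where Y: "clin Y" "\<And>a b. blinfun_apply Y (t a b) = t a (blinfun_apply y b)"
    by (rule hilbert_tensor.ampliation_left[OF flip_tensor assms(2)]) (rule that)
  show ?thesis by (rule that[of "X o\<^sub>L Y"]) (simp_all add: X Y clin_compose)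
qed

lemma
  assumes "clin x" "clin y"
  shows op_tensor_apply [simp]: "blinfun_apply (op_tensor t x y) (t a b) = t (blinfun_apply x a) (blinfun_apply y b)"
    and clin_op_tensor [simp]: "clin (op_tensor t x y)"
proof -
  obtain z where z: "clin z" "\<And>a b. blinfun_apply z (t a b) = t (blinfun_apply x a) (blinfun_apply y b)"
    using op_tensor_ex[OF assms] by blast
  have "op_tensor t x y = z"
    unfolding op_tensor_def by (rule the_equality) (auto simp: z intro!: tensor_blinfun_eqI)
  then show "blinfun_apply (op_tensor t x y) (t a b) = t (blinfun_apply x a) (blinfun_apply y b)"
    "clin (op_tensor t x y)" using z by auto
qed

lemma norm_op_tensor_id_right_le:
  assumes "clin y"
  shows "norm (op_tensor t id_blinfun y) \<le> norm y"
proof -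
  obtain Y where Y: "\<And>a b. blinfun_apply Y (t a b) = t a (blinfun_apply y b)" "norm Y \<le> norm y"
    by (rule hilbert_tensor.ampliation_left[OF flip_tensor assms]) (rule that)
  have "op_tensor t id_blinfun y = Y"
    by (rule tensor_blinfun_eqI) (simp add: Y assms)
  then show ?thesis using Y(2) by simp
qed

lemma op_tensor_compose:
  assumes "clin x" "clin y" "clin x'" "clin y'"
  shows "op_tensor t x y o\<^sub>L op_tensor t x' y' = op_tensor t (x o\<^sub>L x') (y o\<^sub>L y')"
  by (rule tensor_blinfun_eqI) (simp add: assms clin_compose)

lemma op_tensor_id [simp]: "op_tensor t id_blinfun id_blinfun = id_blinfun"
  by (rule tensor_blinfun_eqI) simp

lemma radj_op_tensor:
  assumes "clin x" "clin y"
  shows "radj (op_tensor t x y) = op_tensor t (radj x) (radj y)"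
  by (rule tensor_oper_eqI) (simp add: assms cinner_radj'[symmetric] cinner_tensor)

lemma op_tensor_add_left:
  assumes "clin x" "clin x'" "clin y"
  shows "op_tensor t (x + x') y = op_tensor t x y + op_tensor t x' y"
  by (rule tensor_blinfun_eqI) (simp add: assms clin_add blinfun.add_left bb.add_left)

lemma op_tensor_add_right:
  assumes "clin x" "clin y'" "clin y"
  shows "op_tensor t x (y + y') = op_tensor t x y + op_tensor t x y'"
  by (rule tensor_blinfun_eqI) (simp add: assms clin_add blinfun.add_left bb.add_right)

lemma op_tensor_cscale:
  assumes "clin x" "clin y"
  shows "op_tensor t (cscale c x) y = cscale c (op_tensor t x y)"
    "op_tensor t x (cscale c y) = cscale c (op_tensor t x y)"
  by (rule tensor_blinfun_eqI, simp add: assms clin_cscale scale_left scale_right)+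

lemma op_tensor_zero [simp]:
  "clin y \<Longrightarrow> op_tensor t 0 y = 0" "clin x \<Longrightarrow> op_tensor t x 0 = 0"
  by (rule tensor_blinfun_eqI, simp add: bb.zero_left bb.zero_right)+

lemma op_tensor_sum_left:
  assumes "\<And>i. i \<in> I \<Longrightarrow> clin (x i)" "clin y"
  shows "op_tensor t (\<Sum>i\<in>I. x i) y = (\<Sum>i\<in>I. op_tensor t (x i) y)"
  using assms by (induction I rule: infinite_finite_induct) (auto simp: op_tensor_add_left clin_sum)

lemma op_tensor_sum_right:
  assumes "\<And>i. i \<in> I \<Longrightarrow> clin (y i)" "clin x"
  shows "op_tensor t x (\<Sum>i\<in>I. y i) = (\<Sum>i\<in>I. op_tensor t x (y i))"
  using assms by (induction I rule: infinite_finite_induct) (auto simp: op_tensor_add_right clin_sum)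

end

section \<open>Slices and von Neumann algebras\<close>

instance real :: real_hilbert ..

lemma suminf_mult_le_l2:
  fixes a b :: "nat \<Rightarrow> real"
  assumes "summable (\<lambda>n. (a n)\<^sup>2)" "summable (\<lambda>n. (b n)\<^sup>2)"
  shows "(\<Sum>n. a n * b n)\<^sup>2 \<le> (\<Sum>n. (a n)\<^sup>2) * (\<Sum>n. (b n)\<^sup>2)"
proof -
  have nth: "l2_nth (Abs_l2 a) = a" "l2_nth (Abs_l2 b) = b"
    using assms by (simp_all add: Abs_l2_inverse)
  have "(inner (Abs_l2 a) (Abs_l2 b))\<^sup>2 \<le> inner (Abs_l2 a) (Abs_l2 a) * inner (Abs_l2 b) (Abs_l2 b)"
    by (rule Cauchy_Schwarz_ineq)
  then show ?thesis by (simp add: inner_l2_def nth power2_eq_square)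
qed

text \<open>The slice of \<open>X\<close> in the first leg by the vector functional of
  \<open>\<xi>\<close> and \<open>\<eta>\<close>; \<open>rsl\<close> slices the second leg. Being a
  composition of bounded operators it needs no existence argument, and \<open>slice_left\<close> for
  sequences is a norm convergent series of such slices.\<close>

definition lsl :: "('a \<Rightarrow> 'b \<Rightarrow> 'c) \<Rightarrow> 'a::complex_hilbert \<Rightarrow> 'a \<Rightarrow> 'c::complex_hilbert oper \<Rightarrow> 'b::complex_hilbert oper"
  where "lsl t \<xi> \<eta> X = radj (tleft t \<eta>) o\<^sub>L (X o\<^sub>L tleft t \<xi>)"

definition rsl :: "('a \<Rightarrow> 'b \<Rightarrow> 'c) \<Rightarrow> 'b::complex_hilbert \<Rightarrow> 'b \<Rightarrow> 'c::complex_hilbert oper \<Rightarrow> 'a::complex_hilbert oper"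
  where "rsl t \<zeta> \<zeta>' X = radj (tright t \<zeta>') o\<^sub>L (X o\<^sub>L tright t \<zeta>)"

lemma lsl_flip: "lsl (\<lambda>b a. t a b) = rsl t"
  by (simp add: fun_eq_iff lsl_def rsl_def tleft_flip(1)[of t])

context hilbert_tensor
begin

lemma norm_tleft_le: "norm (tleft t a) \<le> norm a"
  by (rule norm_blinfun_bound) (simp_all add: norm_tensor)

lemma norm_tright_le: "norm (tright t b) \<le> norm b"
  by (rule norm_blinfun_bound) (simp_all add: norm_tensor mult.commute)

lemma cinner_lsl: "cinner (blinfun_apply (lsl t \<xi> \<eta> X) \<zeta>) \<zeta>' = cinner (blinfun_apply X (t \<xi> \<zeta>)) (t \<eta> \<zeta>')"
  by (simp add: lsl_def cinner_tleft)

lemma cinner_rsl: "cinner (blinfun_apply (rsl t \<zeta> \<zeta>' X) \<xi>) \<eta> = cinner (blinfun_apply X (t \<xi> \<zeta>)) (t \<eta> \<zeta>')"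
  by (simp add: rsl_def cinner_tright)

lemma lsl_apply: "blinfun_apply (lsl t \<xi> \<eta> X) \<zeta> = blinfun_apply (radj (tleft t \<eta>)) (blinfun_apply X (t \<xi> \<zeta>))"
  by (simp add: lsl_def)

lemma rsl_apply: "blinfun_apply (rsl t \<zeta> \<zeta>' X) \<xi> = blinfun_apply (radj (tright t \<zeta>')) (blinfun_apply X (t \<xi> \<zeta>))"
  by (simp add: rsl_def)

lemma clin_lsl [simp]: "clin X \<Longrightarrow> clin (lsl t \<xi> \<eta> X)"
  by (simp add: lsl_def clin_compose)

lemma clin_rsl [simp]: "clin X \<Longrightarrow> clin (rsl t \<xi> \<eta> X)"
  by (simp add: rsl_def clin_compose)

lemma radj_lsl: "radj (lsl t \<xi> \<eta> X) = lsl t \<eta> \<xi> (radj X)"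
  by (simp add: lsl_def radj_compose compose_assoc)

lemma radj_rsl: "radj (rsl t \<xi> \<eta> X) = rsl t \<eta> \<xi> (radj X)"
  by (simp add: rsl_def radj_compose compose_assoc)

lemma norm_lsl_le: "norm (lsl t \<xi> \<eta> X) \<le> norm X * (norm \<xi> * norm \<eta>)"
proof (rule norm_blinfun_bound)
  fix \<zeta>
  have "norm (blinfun_apply (lsl t \<xi> \<eta> X) \<zeta>) \<le> norm (radj (tleft t \<eta>)) * norm (blinfun_apply X (t \<xi> \<zeta>))"
    unfolding lsl_apply by (rule norm_blinfun)
  also have "\<dots> \<le> norm \<eta> * (norm X * norm (t \<xi> \<zeta>))"
    by (intro mult_mono norm_blinfun) (simp_all add: norm_tleft_le)
  finally show "norm (blinfun_apply (lsl t \<xi> \<eta> X) \<zeta>) \<le> norm X * (norm \<xi> * norm \<eta>) * norm \<zeta>"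
    by (simp add: norm_tensor mult_ac)
qed simp

lemma lsl_add: "lsl t \<xi> \<eta> (X + Y) = lsl t \<xi> \<eta> X + lsl t \<xi> \<eta> Y"
  by (simp add: lsl_def compose_add_left compose_add_right)

lemma lsl_add_left:
  "lsl t (\<xi> + \<xi>') \<eta> X = lsl t \<xi> \<eta> X + lsl t \<xi>' \<eta> X"
  by (rule blinfun_eqI) (simp add: lsl_apply bb.add_left blinfun.add_right blinfun.add_left)

lemma lsl_add_right:
  "lsl t \<xi> (\<eta> + \<eta>') X = lsl t \<xi> \<eta> X + lsl t \<xi> \<eta>' X"
  by (rule oper_eqI) (simp add: cinner_lsl bb.add_left cinner_add_right cinner_add_left blinfun.add_left)

lemma lsl_scale_left:
  "clin X \<Longrightarrow> lsl t (c *\<^sub>C \<xi>) \<eta> X = cscale c (lsl t \<xi> \<eta> X)"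
  by (rule oper_eqI) (simp add: cinner_lsl scale_left clinD cinner_scaleC_left)

lemma lsl_scale_right:
  "lsl t \<xi> (c *\<^sub>C \<eta>) X = cscale (cnj c) (lsl t \<xi> \<eta> X)"
  by (rule oper_eqI) (simp add: cinner_lsl scale_left cinner_scaleC_left cinner_scaleC_right)

lemma lsl_op_tensor:
  "clin x \<Longrightarrow> clin y \<Longrightarrow> lsl t \<xi> \<eta> (op_tensor t x y) = cscale (cinner (blinfun_apply x \<xi>) \<eta>) y"
  by (rule oper_eqI) (simp add: cinner_lsl cinner_tensor cinner_scaleC_left)

lemma lsl_eqI:
  assumes "\<And>\<xi> \<eta>. lsl t \<xi> \<eta> X = lsl t \<xi> \<eta> Y"
  shows "X = Y"
  by (rule tensor_oper_eqI) (metis assms cinner_lsl)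

end

definition l2_norm :: "(nat \<Rightarrow> 'h::complex_hilbert) \<Rightarrow> real" where
  "l2_norm \<xi> = sqrt (\<Sum>n. (norm (\<xi> n))\<^sup>2)"

lemma l2_norm_nonneg: "l2_seq \<xi> \<Longrightarrow> 0 \<le> l2_norm \<xi>"
  by (simp add: l2_norm_def l2_seq_def suminf_nonneg)

lemma l2_norm_sq: "l2_seq \<xi> \<Longrightarrow> (l2_norm \<xi>)\<^sup>2 = (\<Sum>n. (norm (\<xi> n))\<^sup>2)"
  by (simp add: l2_norm_def l2_seq_def suminf_nonneg)

text \<open>Makes a vector functional an instance of a normal functional given by sequences, so that
  statements about all square-summable sequences can be tested on single vectors.\<close>

definition single_seq :: "'h::complex_hilbert \<Rightarrow> nat \<Rightarrow> 'h" where
  "single_seq \<xi> n = (if n = 0 then \<xi> else 0)"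

lemma l2_seq_single [simp]: "l2_seq (single_seq \<xi>)"
  unfolding l2_seq_def by (rule summable_finite[of "{0}"]) (auto simp: single_seq_def)

lemma suminf_single_seq:
  fixes F :: "'h::complex_hilbert \<Rightarrow> 'h \<Rightarrow> 'b::real_normed_vector"
  assumes "F 0 0 = 0"
  shows "(\<Sum>n. F (single_seq \<xi> n) (single_seq \<eta> n)) = F \<xi> \<eta>"
proof -
  have "(\<Sum>n. F (single_seq \<xi> n) (single_seq \<eta> n)) = (\<Sum>n\<in>{0}. F (single_seq \<xi> n) (single_seq \<eta> n))"
    by (rule suminf_finite) (auto simp: single_seq_def assms)
  then show ?thesis by (simp add: single_seq_def)
qed

lemma normal_fun_single [simp]:
  "normal_fun (single_seq \<xi>) (single_seq \<eta>) x = cinner (blinfun_apply x \<xi>) \<eta>"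
  unfolding normal_fun_def by (rule suminf_single_seq[of "\<lambda>a b. cinner (blinfun_apply x a) b"]) simp

lemma l2_norm_single_sq: "(\<Sum>n. (norm (single_seq \<xi> n))\<^sup>2) = (norm \<xi>)\<^sup>2"
  using suminf_single_seq[of "\<lambda>a b. (norm a)\<^sup>2" \<xi> \<xi>] by simp

lemma l2_norm_single [simp]: "l2_norm (single_seq \<xi>) = norm \<xi>"
  by (simp add: l2_norm_def l2_norm_single_sq)

locale hilbert_square = hilbert_tensor t
  for t :: "'h::complex_hilbert \<Rightarrow> 'h \<Rightarrow> 'k::complex_hilbert"
begin

lemma summable_lsl:
  assumes "l2_seq \<xi>" "l2_seq \<eta>"
  shows "summable (\<lambda>n. lsl t (\<xi> n) (\<eta> n) X)"
proof (rule summable_norm_cancel, rule summable_comparison_test')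
  show "summable (\<lambda>n. norm X * (norm (\<xi> n) * norm (\<eta> n)))"
    by (intro summable_mult summable_norm_mult_l2_seq assms)
qed (simp add: norm_lsl_le)

lemma slice_left_sums:
  assumes "l2_seq \<xi>" "l2_seq \<eta>"
  shows "(\<lambda>n. cinner (blinfun_apply X (t (\<xi> n) \<zeta>)) (t (\<eta> n) \<zeta>')) sums
    cinner (blinfun_apply (\<Sum>n. lsl t (\<xi> n) (\<eta> n) X) \<zeta>) \<zeta>'"
proof -
  have "(\<lambda>n. lsl t (\<xi> n) (\<eta> n) X) sums (\<Sum>n. lsl t (\<xi> n) (\<eta> n) X)"
    by (rule summable_sums[OF summable_lsl[OF assms]])
  from bounded_linear.sums[OF bounded_linear_compose[OF cinner.bounded_linear_left blinfun.bounded_linear_left] this]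
  show ?thesis by (simp add: cinner_lsl)
qed

lemma slice_left_eq:
  assumes "l2_seq \<xi>" "l2_seq \<eta>"
  shows "slice_left t \<xi> \<eta> X = (\<Sum>n. lsl t (\<xi> n) (\<eta> n) X)"
  unfolding slice_left_def
proof (rule the_equality)
  show "\<forall>\<zeta> \<zeta>'. cinner (blinfun_apply (\<Sum>n. lsl t (\<xi> n) (\<eta> n) X) \<zeta>) \<zeta>' =
      (\<Sum>n. cinner (blinfun_apply X (t (\<xi> n) \<zeta>)) (t (\<eta> n) \<zeta>'))"
    using sums_unique[OF slice_left_sums[OF assms]] by simp
next
  fix y assume "\<forall>\<zeta> \<zeta>'. cinner (blinfun_apply y \<zeta>) \<zeta>' = (\<Sum>n. cinner (blinfun_apply X (t (\<xi> n) \<zeta>)) (t (\<eta> n) \<zeta>'))"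
  then show "y = (\<Sum>n. lsl t (\<xi> n) (\<eta> n) X)"
    using sums_unique[OF slice_left_sums[OF assms]] by (intro oper_eqI) simp
qed

lemma cinner_slice_left:
  assumes "l2_seq \<xi>" "l2_seq \<eta>"
  shows "cinner (blinfun_apply (slice_left t \<xi> \<eta> X) \<zeta>) \<zeta>' =
    (\<Sum>n. cinner (blinfun_apply X (t (\<xi> n) \<zeta>)) (t (\<eta> n) \<zeta>'))"
  unfolding slice_left_eq[OF assms] by (rule sums_unique[OF slice_left_sums[OF assms]])

lemma clin_slice_left:
  assumes "l2_seq \<xi>" "l2_seq \<eta>" "clin X"
  shows "clin (slice_left t \<xi> \<eta> X)"
  unfolding slice_left_eq[OF assms(1,2)] by (rule clin_suminf) (simp_all add: assms summable_lsl)

lemma lsl_zero [simp]: "lsl t 0 \<eta> X = 0" "lsl t \<xi> 0 X = 0"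
  by (rule oper_eqI, simp add: cinner_lsl bb.zero_left)+

lemma slice_left_single [simp]: "slice_left t (single_seq \<xi>) (single_seq \<eta>) X = lsl t \<xi> \<eta> X"
  by (simp add: slice_left_eq suminf_single_seq[of "\<lambda>a b. lsl t a b X"])

lemma l2_seq_tensor: "l2_seq \<xi> \<Longrightarrow> l2_seq (\<lambda>n. t (\<xi> n) \<zeta>)"
  unfolding l2_seq_def by (simp add: norm_tensor power_mult_distrib summable_mult2)

lemma l2_seq_tensor': "l2_seq \<xi> \<Longrightarrow> l2_seq (\<lambda>n. t \<zeta> (\<xi> n))"
  unfolding l2_seq_def by (simp add: norm_tensor power_mult_distrib summable_mult)

lemma summable_apply_l2:
  assumes "l2_seq \<xi>"
  shows "summable (\<lambda>n. (norm (blinfun_apply X (\<xi> n)))\<^sup>2)"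
proof (rule summable_comparison_test')
  show "summable (\<lambda>n. (norm X)\<^sup>2 * (norm (\<xi> n))\<^sup>2)"
    using assms by (intro summable_mult) (simp add: l2_seq_def)
  show "norm ((norm (blinfun_apply X (\<xi> n)))\<^sup>2) \<le> (norm X)\<^sup>2 * (norm (\<xi> n))\<^sup>2" for n
    using power_mono[OF norm_blinfun[of X "\<xi> n"], of 2] by (simp add: power_mult_distrib)
qed

lemma cinner_slice_left_diag:
  assumes "l2_seq \<xi>" "clin X"
  shows "cinner (blinfun_apply (slice_left t \<xi> \<xi> (radj X o\<^sub>L X)) \<zeta>) \<zeta>
    = of_real (\<Sum>n. (norm (blinfun_apply X (t (\<xi> n) \<zeta>)))\<^sup>2)"
proof -
  have "cinner (blinfun_apply (radj X o\<^sub>L X) (t (\<xi> n) \<zeta>)) (t (\<xi> n) \<zeta>)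
      = of_real ((norm (blinfun_apply X (t (\<xi> n) \<zeta>)))\<^sup>2)" for n
    by (simp add: cinner_radj'[OF assms(2), symmetric] cinner_self)
  then show ?thesis
    unfolding cinner_slice_left[OF assms(1,1)]
    by (simp only: suminf_of_real[OF summable_apply_l2[OF l2_seq_tensor[OF assms(1)]]])
qed

text \<open>A Cauchy-Schwarz inequality for slices: up to the constant, the right-hand side is the
  quadratic form of the slice of \<open>radj X o X\<close> by the positive functional of
  \<open>\<xi>\<close>. Left invariance speaks of positive functionals only, and this carries its
  consequences to slices by arbitrary pairs.\<close>

lemma norm_slice_left_apply_le:
  assumes "l2_seq \<xi>" "l2_seq \<eta>"
  shows "(norm (blinfun_apply (slice_left t \<xi> \<eta> X) \<zeta>))\<^sup>2
    \<le> (\<Sum>n. (norm (\<eta> n))\<^sup>2) * (\<Sum>n. (norm (blinfun_apply X (t (\<xi> n) \<zeta>)))\<^sup>2)"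
proof -
  define v where "v = blinfun_apply (slice_left t \<xi> \<eta> X) \<zeta>"
  define A where "A = (\<Sum>n. (norm (\<eta> n))\<^sup>2)"
  define C where "C = (\<Sum>n. (norm (blinfun_apply X (t (\<xi> n) \<zeta>)))\<^sup>2)"
  have smX: "summable (\<lambda>n. (norm (blinfun_apply X (t (\<xi> n) \<zeta>)))\<^sup>2)"
    by (rule summable_apply_l2[OF l2_seq_tensor[OF assms(1)]])
  have sme: "summable (\<lambda>n. (norm (\<eta> n))\<^sup>2)" using assms(2) by (simp add: l2_seq_def)
  have smp: "summable (\<lambda>n. norm (blinfun_apply X (t (\<xi> n) \<zeta>)) * norm (\<eta> n))"
    by (rule summable_norm_mult[OF smX sme])
  have "(norm v)\<^sup>2 = cmod (cinner v v)" by (simp add: cinner_self norm_power)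
  also have "\<dots> = cmod (\<Sum>n. cinner (blinfun_apply X (t (\<xi> n) \<zeta>)) (t (\<eta> n) v))"
    using cinner_slice_left[OF assms, of X \<zeta> v] unfolding v_def by simp
  also have "\<dots> \<le> (\<Sum>n. norm (blinfun_apply X (t (\<xi> n) \<zeta>)) * norm (\<eta> n) * norm v)"
  proof (rule norm_suminf_le)
    show "cmod (cinner (blinfun_apply X (t (\<xi> n) \<zeta>)) (t (\<eta> n) v))
        \<le> norm (blinfun_apply X (t (\<xi> n) \<zeta>)) * norm (\<eta> n) * norm v" for n
      using cmod_cinner_le[of "blinfun_apply X (t (\<xi> n) \<zeta>)" "t (\<eta> n) v"]
      by (simp add: norm_tensor mult_ac)
  qed (intro summable_mult2 smp)
  also have "\<dots> = (\<Sum>n. norm (blinfun_apply X (t (\<xi> n) \<zeta>)) * norm (\<eta> n)) * norm v"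
    by (rule suminf_mult2[OF smp, symmetric])
  finally have le: "(norm v)\<^sup>2 \<le> (\<Sum>n. norm (blinfun_apply X (t (\<xi> n) \<zeta>)) * norm (\<eta> n)) * norm v" .
  have le2: "norm v \<le> (\<Sum>n. norm (blinfun_apply X (t (\<xi> n) \<zeta>)) * norm (\<eta> n))"
  proof (cases "v = 0")
    case True
    then show ?thesis by (simp add: suminf_nonneg[OF smp])
  next
    case False
    then show ?thesis using le by (simp add: power2_eq_square)
  qed
  have "(norm v)\<^sup>2 \<le> (\<Sum>n. norm (blinfun_apply X (t (\<xi> n) \<zeta>)) * norm (\<eta> n))\<^sup>2"
    by (rule power_mono[OF le2]) simp
  also have "\<dots> \<le> C * A"
    unfolding A_def C_def by (rule suminf_mult_le_l2[OF smX sme])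
  finally show ?thesis by (simp add: v_def A_def C_def mult.commute)
qed

end

section \<open>Von Neumann algebras and their tensor squares\<close>

locale vn_algebra =
  fixes M :: "'h::complex_hilbert oper set"
  assumes vna: "von_neumann_algebra M"
begin

lemma M_clin: "x \<in> M \<Longrightarrow> clin x"
  using vna by (auto simp: von_neumann_algebra_def bounded_ops_iff)

lemma M_radj: "x \<in> M \<Longrightarrow> radj x \<in> M"
  using vna M_clin by (metis cadj_eq_radj von_neumann_algebra_def)

lemma commutant_clin: "u \<in> commutant M \<Longrightarrow> clin u"
  by (simp add: commutant_def bounded_ops_iff)

lemma commutant_commutes: "u \<in> commutant M \<Longrightarrow> x \<in> M \<Longrightarrow> u o\<^sub>L x = x o\<^sub>L u"
  by (simp add: commutant_def)

lemma commutant_radj: "u \<in> commutant M \<Longrightarrow> radj u \<in> commutant M"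
proof -
  assume u: "u \<in> commutant M"
  have "radj u o\<^sub>L x = x o\<^sub>L radj u" if "x \<in> M" for x
    using arg_cong[OF commutant_commutes[OF u M_radj[OF that]], of radj]
    by (simp add: radj_compose)
  then show ?thesis using commutant_clin[OF u] by (simp add: commutant_def bounded_ops_iff)
qed

text \<open>Membership by the bicommutant property: each closure property of \<open>M\<close>
  becomes a commutation check.\<close>

lemma M_I: "clin x \<Longrightarrow> (\<And>u. u \<in> commutant M \<Longrightarrow> x o\<^sub>L u = u o\<^sub>L x) \<Longrightarrow> x \<in> M"
  using vna unfolding von_neumann_algebra_def commutant_def bounded_ops_iff[symmetric] by blast

lemma M_id [simp]: "id_blinfun \<in> M"
  by (rule M_I) auto

lemma M_zero [simp]: "0 \<in> M"
  by (rule M_I) auto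

lemma M_add:
  assumes "x \<in> M" "y \<in> M"
  shows "x + y \<in> M"
proof (rule M_I)
  fix u assume u: "u \<in> commutant M"
  show "(x + y) o\<^sub>L u = u o\<^sub>L (x + y)"
    by (simp add: compose_add_left compose_add_right commutant_commutes[OF u assms(1)] commutant_commutes[OF u assms(2)])
qed (simp add: clin_add M_clin assms)

lemma M_diff:
  assumes "x \<in> M" "y \<in> M"
  shows "x - y \<in> M"
proof (rule M_I)
  fix u assume u: "u \<in> commutant M"
  show "(x - y) o\<^sub>L u = u o\<^sub>L (x - y)"
    by (simp add: compose_diff_left compose_diff_right commutant_commutes[OF u assms(1)] commutant_commutes[OF u assms(2)])
qed (simp add: clin_diff M_clin assms)

lemma M_compose:
  assumes "x \<in> M" "y \<in> M"
  shows "x o\<^sub>L y \<in> M"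
proof (rule M_I)
  fix u assume u: "u \<in> commutant M"
  show "(x o\<^sub>L y) o\<^sub>L u = u o\<^sub>L (x o\<^sub>L y)"
    by (metis commutant_commutes[OF u assms(1)] commutant_commutes[OF u assms(2)] compose_assoc)
qed (simp add: clin_compose M_clin assms)

lemma M_cscale:
  assumes "x \<in> M"
  shows "cscale c x \<in> M"
proof (rule M_I)
  fix u assume u: "u \<in> commutant M"
  show "cscale c x o\<^sub>L u = u o\<^sub>L cscale c x"
    by (simp add: compose_cscale_left compose_cscale_right commutant_clin[OF u] commutant_commutes[OF u assms])
qed (simp add: clin_cscale M_clin assms)

lemma M_scaleR: "x \<in> M \<Longrightarrow> r *\<^sub>R x \<in> M"
  using M_cscale[of x "of_real r"] by (simp add: cscale_of_real)

lemma M_sum: "(\<And>i. i \<in> I \<Longrightarrow> f i \<in> M) \<Longrightarrow> (\<Sum>i\<in>I. f i) \<in> M"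
  by (induction I rule: infinite_finite_induct) (auto simp: M_add)

lemma M_cadj: "x \<in> M \<Longrightarrow> cadj x = radj x"
  by (simp add: cadj_eq_radj M_clin)

end

lemma commutant_antimono: "A \<subseteq> B \<Longrightarrow> commutant B \<subseteq> commutant A"
  by (auto simp: commutant_def)

lemma subset_bicommutant: "A \<subseteq> bounded_ops \<Longrightarrow> A \<subseteq> commutant (commutant A)"
  by (auto simp: commutant_def)

lemma commutant_tricommutant:
  assumes "A \<subseteq> bounded_ops"
  shows "commutant (commutant (commutant A)) = commutant A"
proof
  show "commutant (commutant (commutant A)) \<subseteq> commutant A"
    by (rule commutant_antimono[OF subset_bicommutant[OF assms]])
  have "commutant A \<subseteq> bounded_ops" by (auto simp: commutant_def)
  then show "commutant A \<subseteq> commutant (commutant (commutant A))" by (rule subset_bicommutant)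
qed

lemma von_neumann_algebra_bicommutant:
  assumes A: "A \<subseteq> bounded_ops" "\<And>x. x \<in> A \<Longrightarrow> radj x \<in> A"
  shows "von_neumann_algebra (commutant (commutant A))"
  unfolding von_neumann_algebra_def
proof (intro conjI ballI)
  show "commutant (commutant A) \<subseteq> bounded_ops" by (auto simp: commutant_def)
  have star: "radj x \<in> commutant C" if "\<And>y. y \<in> C \<Longrightarrow> radj y \<in> C" "x \<in> commutant C" for x and C :: "'a oper set"
  proof -
    have "radj x o\<^sub>L y = y o\<^sub>L radj x" if "y \<in> C" for y
    proof -
      have "x o\<^sub>L radj y = radj y o\<^sub>L x"
        using \<open>x \<in> commutant C\<close> \<open>\<And>y. y \<in> C \<Longrightarrow> radj y \<in> C\<close> that by (simp add: commutant_def)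
      from arg_cong[OF this, of radj] show ?thesis by (simp add: radj_compose)
    qed
    then show ?thesis using that(2) by (simp add: commutant_def bounded_ops_iff)
  qed
  fix x assume x: "x \<in> commutant (commutant A)"
  then have "clin x" by (simp add: commutant_def bounded_ops_iff)
  then show "cadj x \<in> commutant (commutant A)"
    using x by (simp add: cadj_eq_radj star A)
next
  show "commutant (commutant (commutant (commutant A))) = commutant (commutant A)"
    using commutant_tricommutant[OF A(1)] by simp
qed

locale vn_square = hilbert_square t + vn_algebra M
  for t :: "'h::complex_hilbert \<Rightarrow> 'h \<Rightarrow> 'k::complex_hilbert" and M :: "'h oper set"
begin

definition MM :: "'k oper set" where "MM = vn_tensor t M M"

lemma elem_tensors_subset: "{op_tensor t x y | x y. x \<in> M \<and> y \<in> M} \<subseteq> bounded_ops"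
  using M_clin by (auto simp: bounded_ops_iff)

sublocale MM: vn_algebra MM
proof
  show "von_neumann_algebra MM"
    unfolding MM_def vn_tensor_def
    by (rule von_neumann_algebra_bicommutant[OF elem_tensors_subset])
      (auto, metis M_clin M_radj radj_op_tensor)
qed

lemma op_tensor_MM: "x \<in> M \<Longrightarrow> y \<in> M \<Longrightarrow> op_tensor t x y \<in> MM"
  using subset_bicommutant[OF elem_tensors_subset] unfolding MM_def vn_tensor_def by blast

text \<open>Commutation is checked on elementary tensors, and passing to the bicommutant does not
  change the commutant. Together with \<open>commutant_tensor_right\<close> this makes slices of
  elements of \<open>MM\<close> lie in \<open>M\<close>.\<close>

lemma commutant_tensor_left:
  assumes "u \<in> commutant M"
  shows "op_tensor t u id_blinfun \<in> commutant MM"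
proof -
  have "op_tensor t u id_blinfun \<in> commutant {op_tensor t x y | x y. x \<in> M \<and> y \<in> M}"
    using commutant_clin[OF assms] M_clin commutant_commutes[OF assms]
    by (auto simp: commutant_def bounded_ops_iff op_tensor_compose)
  then show ?thesis
    using commutant_tricommutant[OF elem_tensors_subset] by (simp add: MM_def vn_tensor_def)
qed

lemma commutant_tensor_right:
  assumes "u \<in> commutant M"
  shows "op_tensor t id_blinfun u \<in> commutant MM"
proof -
  have "op_tensor t id_blinfun u \<in> commutant {op_tensor t x y | x y. x \<in> M \<and> y \<in> M}"
    using commutant_clin[OF assms] M_clin commutant_commutes[OF assms]
    by (auto simp: commutant_def bounded_ops_iff op_tensor_compose)
  then show ?thesis
    using commutant_tricommutant[OF elem_tensors_subset] by (simp add: MM_def vn_tensor_def)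
qed

lemma MM_commutes_left: "X \<in> MM \<Longrightarrow> u \<in> commutant M \<Longrightarrow> X o\<^sub>L op_tensor t u id_blinfun = op_tensor t u id_blinfun o\<^sub>L X"
  using MM.commutant_commutes[OF commutant_tensor_left] by simp

lemma MM_commutes_right: "X \<in> MM \<Longrightarrow> u \<in> commutant M \<Longrightarrow> X o\<^sub>L op_tensor t id_blinfun u = op_tensor t id_blinfun u o\<^sub>L X"
  using MM.commutant_commutes[OF commutant_tensor_right] by simp

lemma lsl_in_M_if_commutes:
  assumes "clin X" "\<And>u. u \<in> commutant M \<Longrightarrow> X o\<^sub>L op_tensor t id_blinfun u = op_tensor t id_blinfun u o\<^sub>L X"
  shows "lsl t \<xi> \<eta> X \<in> M"
proof (rule M_I)
  fix u assume u: "u \<in> commutant M"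
  note cu = commutant_clin[OF u]
  show "lsl t \<xi> \<eta> X o\<^sub>L u = u o\<^sub>L lsl t \<xi> \<eta> X"
  proof (rule oper_eqI)
    fix \<zeta> \<zeta>'
    have "cinner (blinfun_apply (lsl t \<xi> \<eta> X o\<^sub>L u) \<zeta>) \<zeta>'
        = cinner (blinfun_apply (X o\<^sub>L op_tensor t id_blinfun u) (t \<xi> \<zeta>)) (t \<eta> \<zeta>')"
      using cu by (simp add: cinner_lsl)
    also have "\<dots> = cinner (blinfun_apply X (t \<xi> \<zeta>)) (blinfun_apply (radj (op_tensor t id_blinfun u)) (t \<eta> \<zeta>'))"
      using cu by (simp add: assms(2)[OF u] cinner_radj)
    also have "\<dots> = cinner (blinfun_apply (u o\<^sub>L lsl t \<xi> \<eta> X) \<zeta>) \<zeta>'"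
      using cu by (simp add: radj_op_tensor cinner_lsl cinner_radj)
    finally show "cinner (blinfun_apply (lsl t \<xi> \<eta> X o\<^sub>L u) \<zeta>) \<zeta>' = cinner (blinfun_apply (u o\<^sub>L lsl t \<xi> \<eta> X) \<zeta>) \<zeta>'" .
  qed
qed (simp add: assms)

text \<open>The condition concerns one leg only, because the lemma is applied to \<open>Wst\<close>,
  for which commutation is established in the first leg.\<close>

lemma rsl_in_M_if_commutes:
  assumes "clin X" "\<And>u. u \<in> commutant M \<Longrightarrow> X o\<^sub>L op_tensor t u id_blinfun = op_tensor t u id_blinfun o\<^sub>L X"
  shows "rsl t \<zeta> \<zeta>' X \<in> M"
proof (rule M_I)
  fix u assume u: "u \<in> commutant M"
  note cu = commutant_clin[OF u]
  show "rsl t \<zeta> \<zeta>' X o\<^sub>L u = u o\<^sub>L rsl t \<zeta> \<zeta>' X"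
  proof (rule oper_eqI)
    fix \<xi> \<eta>
    have "cinner (blinfun_apply (rsl t \<zeta> \<zeta>' X o\<^sub>L u) \<xi>) \<eta>
        = cinner (blinfun_apply (X o\<^sub>L op_tensor t u id_blinfun) (t \<xi> \<zeta>)) (t \<eta> \<zeta>')"
      using cu by (simp add: cinner_rsl)
    also have "\<dots> = cinner (blinfun_apply X (t \<xi> \<zeta>)) (blinfun_apply (radj (op_tensor t u id_blinfun)) (t \<eta> \<zeta>'))"
      using cu by (simp add: assms(2)[OF u] cinner_radj)
    also have "\<dots> = cinner (blinfun_apply (u o\<^sub>L rsl t \<zeta> \<zeta>' X) \<xi>) \<eta>"
      using cu by (simp add: radj_op_tensor cinner_rsl cinner_radj)
    finally show "cinner (blinfun_apply (rsl t \<zeta> \<zeta>' X o\<^sub>L u) \<xi>) \<eta> = cinner (blinfun_apply (u o\<^sub>L rsl t \<zeta> \<zeta>' X) \<xi>) \<eta>" .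
  qed
qed (simp add: assms)

lemma lsl_in_M: "X \<in> MM \<Longrightarrow> lsl t \<xi> \<eta> X \<in> M"
  by (rule lsl_in_M_if_commutes) (auto simp: MM.M_clin MM_commutes_right)

lemma slice_left_in_M:
  assumes "X \<in> MM" "l2_seq \<xi>" "l2_seq \<eta>"
  shows "slice_left t \<xi> \<eta> X \<in> M"
proof (rule M_I)
  show "clin (slice_left t \<xi> \<eta> X)" by (simp add: assms clin_slice_left MM.M_clin)
  fix u assume u: "u \<in> commutant M"
  note cu = commutant_clin[OF u]
  have eq: "cinner (blinfun_apply X (t a (blinfun_apply u b))) (t a' b')
      = cinner (blinfun_apply X (t a b)) (t a' (blinfun_apply (radj u) b'))" for a b a' b'
  proof -
    have "cinner (blinfun_apply (X o\<^sub>L op_tensor t id_blinfun u) (t a b)) (t a' b')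
        = cinner (blinfun_apply X (t a b)) (blinfun_apply (radj (op_tensor t id_blinfun u)) (t a' b'))"
      using cu by (simp add: MM_commutes_right[OF assms(1) u] cinner_radj)
    then show ?thesis using cu by (simp add: radj_op_tensor)
  qed
  show "slice_left t \<xi> \<eta> X o\<^sub>L u = u o\<^sub>L slice_left t \<xi> \<eta> X"
    by (rule oper_eqI) (simp add: cinner_slice_left assms cinner_radj[OF cu] eq)
qed

text \<open>Maps such as \<Delta> \<otimes> id are prescribed on elementary tensors only; for normal
  functionals agreement there extends to all of \<open>MM\<close>.\<close>

lemma normal_fun_eq_on_MM:
  assumes l2: "l2_seq \<xi>" "l2_seq \<eta>" "l2_seq \<xi>'" "l2_seq \<eta>'"
    and eq: "\<And>x y. x \<in> M \<Longrightarrow> y \<in> M \<Longrightarrow> normal_fun \<xi> \<eta> (op_tensor t x y) = normal_fun \<xi>' \<eta>' (op_tensor t x y)"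
    and X: "X \<in> MM"
  shows "normal_fun \<xi> \<eta> X = normal_fun \<xi>' \<eta>' X"
proof (rule normal_fun_eq_on_bicommutant[of "{op_tensor t x y | x y. x \<in> M \<and> y \<in> M}"])
  show "id_blinfun \<in> {op_tensor t x y |x y. x \<in> M \<and> y \<in> M}"
    using op_tensor_id M_id by (metis (mono_tags, lifting) mem_Collect_eq)
  show "cadj x \<in> {op_tensor t x y |x y. x \<in> M \<and> y \<in> M}" if x: "x \<in> {op_tensor t x y |x y. x \<in> M \<and> y \<in> M}" for x
  proof -
    obtain a b where ab: "x = op_tensor t a b" "a \<in> M" "b \<in> M" using x by blast
    then have "cadj x = op_tensor t (radj a) (radj b)"
      by (simp add: cadj_eq_radj M_clin radj_op_tensor)
    then show ?thesis using ab M_radj by blast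
  qed
  show "x o\<^sub>L y \<in> {op_tensor t x y |x y. x \<in> M \<and> y \<in> M}"
    if x: "x \<in> {op_tensor t x y |x y. x \<in> M \<and> y \<in> M}" and y: "y \<in> {op_tensor t x y |x y. x \<in> M \<and> y \<in> M}" for x y
  proof -
    obtain a b c d where ab: "x = op_tensor t a b" "a \<in> M" "b \<in> M" "y = op_tensor t c d" "c \<in> M" "d \<in> M"
      using x y by blast
    then have "x o\<^sub>L y = op_tensor t (a o\<^sub>L c) (b o\<^sub>L d)" by (simp add: M_clin op_tensor_compose)
    then show ?thesis using ab M_compose by blast
  qed
  show "X \<in> commutant (commutant {op_tensor t x y |x y. x \<in> M \<and> y \<in> M})"
    using X by (simp add: MM_def vn_tensor_def)
qed (use l2 eq elem_tensors_subset in auto)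

end

section \<open>Weights and their GNS maps\<close>

lemma positive_opI:
  assumes "clin x" "\<And>\<zeta>. cinner (blinfun_apply x \<zeta>) \<zeta> = of_real (r \<zeta>)" "\<And>\<zeta>. 0 \<le> r \<zeta>"
  shows "positive_op x"
  using assms by (auto simp: positive_op_def bounded_ops_iff)

lemma positive_op_Re_nonneg: "positive_op x \<Longrightarrow> 0 \<le> Re (cinner (blinfun_apply x \<zeta>) \<zeta>)"
  by (auto simp: positive_op_def complex_nonneg_Reals_iff)

lemma cinner_square: "clin x \<Longrightarrow> cinner (blinfun_apply (radj x o\<^sub>L x) \<zeta>) \<zeta> = of_real ((norm (blinfun_apply x \<zeta>))\<^sup>2)"
  by (simp add: cinner_radj'[symmetric] cinner_self)

lemma positive_op_square: "clin x \<Longrightarrow> positive_op (radj x o\<^sub>L x)"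
  by (rule positive_opI[OF _ cinner_square]) (auto intro: clin_compose)

locale gns_weight = vn_algebra M + nsf_weight M \<phi>
  for M :: "'h::complex_hilbert oper set" and \<phi> :: "'h oper \<Rightarrow> ennreal" +
  fixes \<Lambda> :: "'h oper \<Rightarrow> 'h"
  assumes gns_add: "\<lbrakk>x \<in> nideal M \<phi>; y \<in> nideal M \<phi>\<rbrakk> \<Longrightarrow> \<Lambda> (x + y) = \<Lambda> x + \<Lambda> y"
    and gns_scale: "x \<in> nideal M \<phi> \<Longrightarrow> \<Lambda> (cscale c x) = c *\<^sub>C \<Lambda> x"
    and gns_norm: "x \<in> nideal M \<phi> \<Longrightarrow> ennreal ((norm (\<Lambda> x))\<^sup>2) = \<phi> (cadj x o\<^sub>L x)"
    and gns_module: "\<lbrakk>x \<in> M; y \<in> nideal M \<phi>\<rbrakk> \<Longrightarrow> \<Lambda> (x o\<^sub>L y) = blinfun_apply x (\<Lambda> y)"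
    and gns_dense: "closure (\<Lambda> ` nideal M \<phi>) = UNIV"
begin

abbreviation N where "N \<equiv> nideal M \<phi>"

lemma N_iff: "x \<in> N \<longleftrightarrow> x \<in> M \<and> \<phi> (radj x o\<^sub>L x) < top"
  by (auto simp: nideal_def M_cadj)

lemma N_M: "x \<in> N \<Longrightarrow> x \<in> M"
  by (simp add: N_iff)

lemma weight_square: "x \<in> N \<Longrightarrow> \<phi> (radj x o\<^sub>L x) = ennreal ((norm (\<Lambda> x))\<^sup>2)"
  using gns_norm by (simp add: M_cadj N_M)

lemma square_pos_cone: "x \<in> M \<Longrightarrow> radj x o\<^sub>L x \<in> pos_cone M"
  by (simp add: pos_cone_def positive_op_square M_clin M_compose M_radj)

lemma weight_mono:
  assumes "x \<in> pos_cone M" "y \<in> M" "positive_op (y - x)"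
  shows "\<phi> x \<le> \<phi> y"
proof -
  have "y - x \<in> pos_cone M" using assms by (simp add: pos_cone_def M_diff)
  then have "\<phi> (x + (y - x)) = \<phi> x + \<phi> (y - x)" by (rule weight_add[OF assms(1)])
  then show ?thesis by simp
qed

lemma weight_dominated:
  assumes x: "x \<in> M" and p: "p \<in> pos_cone M" and c: "0 \<le> c"
    and le: "\<And>\<zeta>. (norm (blinfun_apply x \<zeta>))\<^sup>2 \<le> c * Re (cinner (blinfun_apply p \<zeta>) \<zeta>)"
  shows "\<phi> (radj x o\<^sub>L x) \<le> ennreal c * \<phi> p"
proof -
  have pM: "p \<in> M" and pos: "positive_op p" using p by (auto simp: pos_cone_def)
  have pr: "cinner (blinfun_apply p \<zeta>) \<zeta> = of_real (Re (cinner (blinfun_apply p \<zeta>) \<zeta>))" for \<zeta>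
    using pos by (auto simp: positive_op_def complex_nonneg_Reals_iff complex_eq_iff)
  have "positive_op (c *\<^sub>R p - (radj x o\<^sub>L x))"
  proof (rule positive_opI)
    show "clin (c *\<^sub>R p - (radj x o\<^sub>L x))"
      using x pM by (intro M_clin M_diff M_scaleR M_compose M_radj)
    show "cinner (blinfun_apply (c *\<^sub>R p - (radj x o\<^sub>L x)) \<zeta>) \<zeta>
        = of_real (c * Re (cinner (blinfun_apply p \<zeta>) \<zeta>) - (norm (blinfun_apply x \<zeta>))\<^sup>2)" for \<zeta>
      unfolding blinfun.diff_left cinner_diff_left cinner_square[OF M_clin[OF x]] blinfun.scaleR_left cinner_scaleR
      by (subst pr) simp
    show "0 \<le> c * Re (cinner (blinfun_apply p \<zeta>) \<zeta>) - (norm (blinfun_apply x \<zeta>))\<^sup>2" for \<zeta>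
      using le[of \<zeta>] by simp
  qed
  then have "\<phi> (radj x o\<^sub>L x) \<le> \<phi> (c *\<^sub>R p)"
    by (rule weight_mono[OF square_pos_cone[OF x] M_scaleR[OF pM]])
  then show ?thesis using weight_scale[OF p c] by simp
qed

text \<open>Elements of the left ideal and bounds on their GNS vectors are obtained by comparing
  quadratic forms with a positive element of known weight, so no operator inequality has to be
  manipulated afterwards.\<close>

lemma N_dominated:
  assumes x: "x \<in> M" and p: "p \<in> pos_cone M" "\<phi> p = ennreal r" and c: "0 \<le> c"
    and le: "\<And>\<zeta>. (norm (blinfun_apply x \<zeta>))\<^sup>2 \<le> c * Re (cinner (blinfun_apply p \<zeta>) \<zeta>)"
    and r: "0 \<le> r"
  shows "x \<in> N" "(norm (\<Lambda> x))\<^sup>2 \<le> c * r"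
proof -
  have le': "\<phi> (radj x o\<^sub>L x) \<le> ennreal (c * r)"
    using weight_dominated[OF x p(1) c le] p(2) c r by (simp add: ennreal_mult)
  then show N: "x \<in> N" using x by (auto simp: N_iff intro: le_less_trans)
  show "(norm (\<Lambda> x))\<^sup>2 \<le> c * r"
    using le' c r by (simp add: weight_square[OF N])
qed

lemma weight_zero: "\<phi> 0 = 0"
proof -
  have "0 \<in> pos_cone M" by (auto simp: pos_cone_def intro!: positive_opI[of _ "\<lambda>_. 0"])
  then show ?thesis using weight_scale[of 0 0] by simp
qed

lemma N_zero [simp]: "0 \<in> N" by (simp add: N_iff weight_zero)

lemma \<Lambda>_zero [simp]: "\<Lambda> 0 = 0"
  using gns_scale[OF N_zero, of 0] by simp

lemma N_add:
  assumes "x \<in> N" "y \<in> N"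
  shows "x + y \<in> N"
proof -
  \<comment> \<open>The factors 2 come from the parallelogram law, which bounds the square of a sum
    by twice the sum of the squares.\<close>
  let ?p = "2 *\<^sub>R (radj x o\<^sub>L x) + 2 *\<^sub>R (radj y o\<^sub>L y)"
  have M: "x \<in> M" "y \<in> M" using assms N_M by auto
  have px: "radj x o\<^sub>L x \<in> pos_cone M" "radj y o\<^sub>L y \<in> pos_cone M"
    using square_pos_cone M by auto
  have scaled: "2 *\<^sub>R q \<in> pos_cone M" if "q \<in> pos_cone M" for q
    using that by (auto simp: pos_cone_def M_scaleR positive_op_def bounded_ops_iff clin_scaleR
        blinfun.scaleR_left complex_nonneg_Reals_iff)
  have p1: "?p \<in> pos_cone M"
    using scaled[OF px(1)] scaled[OF px(2)]
    by (auto simp: pos_cone_def M_add positive_op_def bounded_ops_iff clin_add blinfun.add_left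
        cinner_add_left complex_nonneg_Reals_iff)
  have p2: "\<phi> ?p = ennreal (2 * (norm (\<Lambda> x))\<^sup>2 + 2 * (norm (\<Lambda> y))\<^sup>2)"
    using weight_add[OF scaled[OF px(1)] scaled[OF px(2)]] weight_scale[OF px(1), of 2]
      weight_scale[OF px(2), of 2]
    by (simp add: weight_square assms ennreal_mult' ennreal_plus)
  have p3: "(norm (blinfun_apply (x + y) \<zeta>))\<^sup>2 \<le> 1 * Re (cinner (blinfun_apply ?p \<zeta>) \<zeta>)" for \<zeta>
  proof -
    let ?a = "blinfun_apply x \<zeta>" and ?b = "blinfun_apply y \<zeta>"
    have "(norm (?a + ?b))\<^sup>2 + (norm (?a - ?b))\<^sup>2 = 2 * (norm ?a)\<^sup>2 + 2 * (norm ?b)\<^sup>2"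
      by (simp add: power2_norm_eq_inner inner_simps algebra_simps inner_commute)
    moreover have "0 \<le> (norm (?a - ?b))\<^sup>2" by simp
    ultimately have "(norm (?a + ?b))\<^sup>2 \<le> 2 * (norm ?a)\<^sup>2 + 2 * (norm ?b)\<^sup>2" by linarith
    moreover have "Re (cinner (blinfun_apply ?p \<zeta>) \<zeta>) = 2 * (norm ?a)\<^sup>2 + 2 * (norm ?b)\<^sup>2"
      unfolding blinfun.add_left blinfun.scaleR_left cinner_add_left cinner_scaleR
        cinner_square[OF M_clin[OF M(1)]] cinner_square[OF M_clin[OF M(2)]] by simp
    ultimately show ?thesis by (simp add: blinfun.add_left)
  qed
  show ?thesis by (rule N_dominated(1)[OF M_add[OF M] p1 p2 _ p3]) simp_all
qed

lemma N_mult: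
  assumes "y \<in> M" "x \<in> N"
  shows "y o\<^sub>L x \<in> N"
proof (rule N_dominated(1)[OF _ square_pos_cone weight_square[OF assms(2)], of _ "(norm y)\<^sup>2"])
  show "(norm (blinfun_apply (y o\<^sub>L x) \<zeta>))\<^sup>2 \<le> (norm y)\<^sup>2 * Re (cinner (blinfun_apply (radj x o\<^sub>L x) \<zeta>) \<zeta>)" for \<zeta>
    using power_mono[OF norm_blinfun[of y "blinfun_apply x \<zeta>"], of 2]
    unfolding cinner_square[OF M_clin[OF N_M[OF assms(2)]]] by (simp add: power_mult_distrib)
qed (use assms N_M M_compose in auto)

lemma N_cscale: "x \<in> N \<Longrightarrow> cscale c x \<in> N"
  using N_mult[OF M_cscale[OF M_id, of c]] by (simp add: compose_cscale_left)

lemma N_minus: "x \<in> N \<Longrightarrow> - x \<in> N"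
  using N_cscale[of x "-1"] by (simp add: cscale_minus_one)

lemma \<Lambda>_minus: "x \<in> N \<Longrightarrow> \<Lambda> (- x) = - \<Lambda> x"
  using gns_scale[of x "-1"] by (simp add: cscale_minus_one scaleC_minus_one)

lemma N_diff: "x \<in> N \<Longrightarrow> y \<in> N \<Longrightarrow> x - y \<in> N"
  using N_add[OF _ N_minus] by fastforce

lemma \<Lambda>_diff: "x \<in> N \<Longrightarrow> y \<in> N \<Longrightarrow> \<Lambda> (x - y) = \<Lambda> x - \<Lambda> y"
  using gns_add[OF _ N_minus] \<Lambda>_minus by fastforce

lemma N_sum: "(\<And>i. i \<in> I \<Longrightarrow> f i \<in> N) \<Longrightarrow> (\<Sum>i\<in>I. f i) \<in> N"
  by (induction I rule: infinite_finite_induct) (auto simp: N_add)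

lemma \<Lambda>_sum: "(\<And>i. i \<in> I \<Longrightarrow> f i \<in> N) \<Longrightarrow> \<Lambda> (\<Sum>i\<in>I. f i) = (\<Sum>i\<in>I. \<Lambda> (f i))"
  by (induction I rule: infinite_finite_induct) (auto simp: gns_add N_sum)

lemma \<Lambda>_inject: "x \<in> N \<Longrightarrow> \<Lambda> x = 0 \<Longrightarrow> x = 0"
proof -
  assume x: "x \<in> N" "\<Lambda> x = 0"
  then have "\<phi> (radj x o\<^sub>L x) = 0" by (simp add: weight_square)
  then have "radj x o\<^sub>L x = 0" by (rule faithful[OF square_pos_cone[OF N_M[OF x(1)]]])
  then have "of_real ((norm (blinfun_apply x \<zeta>))\<^sup>2) = (0::complex)" for \<zeta>
    using cinner_square[OF M_clin[OF N_M[OF x(1)]], of \<zeta>] by simp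
  then show "x = 0" by (intro blinfun_eqI) simp
qed

lemma weight_sum:
  assumes "finite I" "\<And>i. i \<in> I \<Longrightarrow> f i \<in> pos_cone M"
  shows "(\<Sum>i\<in>I. f i) \<in> pos_cone M" "\<phi> (\<Sum>i\<in>I. f i) = (\<Sum>i\<in>I. \<phi> (f i))"
proof -
  have *: "(\<Sum>i\<in>I. f i) \<in> pos_cone M \<and> \<phi> (\<Sum>i\<in>I. f i) = (\<Sum>i\<in>I. \<phi> (f i))"
    using assms
  proof (induction I rule: finite_induct)
    case empty
    then show ?case by (auto simp: weight_zero pos_cone_def intro!: positive_opI[of _ "\<lambda>_. 0"])
  next
    case (insert i I)
    then have a: "f i \<in> pos_cone M" "(\<Sum>i\<in>I. f i) \<in> pos_cone M" by auto
    then have "f i + (\<Sum>i\<in>I. f i) \<in> pos_cone M"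
      by (auto simp: pos_cone_def M_add positive_op_def bounded_ops_iff clin_add blinfun.add_left
        cinner_add_left complex_nonneg_Reals_iff)
    then show ?case using insert weight_add[OF a] by simp
  qed
  then show "(\<Sum>i\<in>I. f i) \<in> pos_cone M" "\<phi> (\<Sum>i\<in>I. f i) = (\<Sum>i\<in>I. \<phi> (f i))" by auto
qed

lemma N_approximates_id:
  assumes "l2_seq \<xi>" "0 < \<epsilon>"
  obtains d where "d \<in> N" "(\<Sum>n. (norm (\<xi> n - blinfun_apply d (\<xi> n)))\<^sup>2) < \<epsilon>"
proof -
  obtain y where y: "y \<in> N" "sstar \<xi> (id_blinfun - y) < \<epsilon>"
    using semifinite[OF M_id assms] by blast
  have sm: "summable (\<lambda>n. (norm (blinfun_apply X (\<xi> n)))\<^sup>2)" for X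
  proof (rule summable_comparison_test')
    show "summable (\<lambda>n. (norm X)\<^sup>2 * (norm (\<xi> n))\<^sup>2)"
      using assms by (intro summable_mult) (simp add: l2_seq_def)
    show "norm ((norm (blinfun_apply X (\<xi> n)))\<^sup>2) \<le> (norm X)\<^sup>2 * (norm (\<xi> n))\<^sup>2" for n
      using power_mono[OF norm_blinfun[of X "\<xi> n"], of 2] by (simp add: power_mult_distrib)
  qed
  have "(\<Sum>n. (norm (blinfun_apply (id_blinfun - y) (\<xi> n)))\<^sup>2) \<le> sstar \<xi> (id_blinfun - y)"
    unfolding sstar_def by (rule suminf_le) (auto intro!: summable_add sm)
  then show ?thesis using that[OF y(1)] y(2) by (simp add: blinfun.diff_left)
qed

end

section \<open>Unordered sums, bases and isometric graphs\<close>

lemma has_sum_of_bounds: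
  fixes f :: "'i \<Rightarrow> real"
  assumes nn: "\<And>i. i \<in> B \<Longrightarrow> 0 \<le> f i"
    and le: "\<And>F. finite F \<Longrightarrow> F \<subseteq> B \<Longrightarrow> sum f F \<le> S"
    and ge: "\<And>\<epsilon>. \<epsilon> > 0 \<Longrightarrow> \<exists>F. finite F \<and> F \<subseteq> B \<and> S - \<epsilon> < sum f F"
  shows "(f has_sum S) B"
  unfolding has_sum_def
proof (rule tendstoI)
  fix \<epsilon> :: real assume "\<epsilon> > 0"
  then obtain F where F: "finite F" "F \<subseteq> B" "S - \<epsilon> < sum f F" using ge by blast
  have "dist (sum f G) S < \<epsilon>" if "finite G" "F \<subseteq> G" "G \<subseteq> B" for G
  proof -
    have "sum f F \<le> sum f G" using that nn by (intro sum_mono2) auto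
    then show ?thesis using le[OF that(1,3)] F(3) by (simp add: dist_real_def)
  qed
  then show "\<forall>\<^sub>F G in finite_subsets_at_top B. dist (sum f G) S < \<epsilon>"
    unfolding eventually_finite_subsets_at_top using F by (intro exI[of _ F]) simp
qed

lemma onb_closed_subspace_UNIV:
  fixes S :: "'a::complex_hilbert set"
  assumes B: "is_onb B" and S: "subspace S" "closed S" "\<And>e c. e \<in> B \<Longrightarrow> c *\<^sub>C e \<in> S"
  shows "S = UNIV"
proof (rule closed_subspace_eq_UNIV[OF S(1,2)])
  fix x assume x: "\<And>s. s \<in> S \<Longrightarrow> inner x s = 0"
  have "cinner x e = 0" if "e \<in> B" for e
    using x[OF S(3)[OF that, of 1]] x[OF S(3)[OF that, of \<i>]] by (simp add: cinner_eq_inner complex_eq_iff)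
  then show "x = 0" using B unfolding is_onb_def by blast
qed

text \<open>Applied to the pairs (argument, value) of a prescribed isometry: preservation of inner
  products passes from the generators to the span one variable at a time, before it is known that
  the pairs define a function.\<close>

lemma inner_eq_on_span:
  fixes S :: "('a::real_inner \<times> 'b::real_inner) set"
  assumes S: "\<And>p q. p \<in> S \<Longrightarrow> q \<in> S \<Longrightarrow> inner (snd p) (snd q) = inner (fst p) (fst q)"
    and "p \<in> span S" "q \<in> span S"
  shows "inner (snd p) (snd q) = inner (fst p) (fst q)"
proof -
  have sub: "subspace {p. \<forall>q\<in>Q. inner (snd p) (snd q) = inner (fst p) (fst q)}" for Q :: "('a \<times> 'b) set"
    by (simp add: subspace_def inner_add_left)
  have "span S \<subseteq> {p. \<forall>q\<in>S. inner (snd p) (snd q) = inner (fst p) (fst q)}"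
    using S by (intro span_minimal sub) auto
  then have "inner (snd p) (snd q) = inner (fst p) (fst q)" if "p \<in> S" "q \<in> span S" for p q
    using that by (subst (1 2) inner_commute) blast
  then have "S \<subseteq> {p. \<forall>q\<in>span S. inner (snd p) (snd q) = inner (fst p) (fst q)}" by blast
  then have "span S \<subseteq> {p. \<forall>q\<in>span S. inner (snd p) (snd q) = inner (fst p) (fst q)}"
    by (intro span_minimal sub)
  then show ?thesis using assms by blast
qed

lemma inner_eqI_cinner: "cinner x y = cinner x' y' \<Longrightarrow> inner x y = inner x' y'"
  by (simp add: inner_eq_Re_cinner)

section \<open>The multiplicative unitary\<close>

locale quantum_group = lc_quantum_group t tL tR M \<Delta> \<phi> \<Lambda>
  for t :: "'h::complex_hilbert \<Rightarrow> 'h \<Rightarrow> 'k::complex_hilbert"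
    and tL :: "'k \<Rightarrow> 'h \<Rightarrow> 'l::complex_hilbert"
    and tR :: "'h \<Rightarrow> 'k \<Rightarrow> 'l"
    and M :: "'h oper set"
    and \<Delta> :: "'h oper \<Rightarrow> 'k oper"
    and \<phi> :: "'h oper \<Rightarrow> ennreal"
    and \<Lambda> :: "'h oper \<Rightarrow> 'h"
begin

sublocale vn_square t M
  by unfold_locales (rule vn_algebra)

sublocale gns_weight M \<phi> \<Lambda>
  by unfold_locales (fact gns_add gns_scale gns_norm gns_module gns_dense)+

lemma \<Delta>_hom: "normal_hom M MM \<Delta>"
  using coproduct by (simp add: MM_def)

lemma
  shows \<Delta>_MM: "x \<in> M \<Longrightarrow> \<Delta> x \<in> MM"
    and \<Delta>_id [simp]: "\<Delta> id_blinfun = id_blinfun"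
    and \<Delta>_add: "x \<in> M \<Longrightarrow> y \<in> M \<Longrightarrow> \<Delta> (x + y) = \<Delta> x + \<Delta> y"
    and \<Delta>_mult: "x \<in> M \<Longrightarrow> y \<in> M \<Longrightarrow> \<Delta> (x o\<^sub>L y) = \<Delta> x o\<^sub>L \<Delta> y"
    and \<Delta>_cscale: "x \<in> M \<Longrightarrow> \<Delta> (cscale c x) = cscale c (\<Delta> x)"
  using \<Delta>_hom unfolding normal_hom_def by blast+

lemma \<Delta>_clin: "x \<in> M \<Longrightarrow> clin (\<Delta> x)"
  using \<Delta>_MM MM.M_clin by blast

lemma \<Delta>_radj: "x \<in> M \<Longrightarrow> \<Delta> (radj x) = radj (\<Delta> x)"
  using \<Delta>_hom \<Delta>_clin[of x] unfolding normal_hom_def by (metis M_cadj cadj_eq_radj)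

lemma \<Delta>_zero [simp]: "\<Delta> 0 = 0"
  using \<Delta>_cscale[OF M_zero, of 0] by simp

lemma \<Delta>_sum: "(\<And>i. i \<in> I \<Longrightarrow> f i \<in> M) \<Longrightarrow> \<Delta> (\<Sum>i\<in>I. f i) = (\<Sum>i\<in>I. \<Delta> (f i))"
  by (induction I rule: infinite_finite_induct) (auto simp: \<Delta>_add M_sum)

lemma \<Delta>_normal:
  assumes "l2_seq \<xi>" "l2_seq \<eta>"
  obtains \<xi>' \<eta>' where "l2_seq \<xi>'" "l2_seq \<eta>'" "\<And>x. x \<in> M \<Longrightarrow> normal_fun \<xi> \<eta> (\<Delta> x) = normal_fun \<xi>' \<eta>' x"
proof -
  have "\<exists>\<xi>' \<eta>'. l2_seq \<xi>' \<and> l2_seq \<eta>' \<and> (\<forall>x\<in>M. normal_fun \<xi> \<eta> (\<Delta> x) = normal_fun \<xi>' \<eta>' x)"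
    using \<Delta>_hom assms unfolding normal_hom_def by simp
  then show ?thesis using that by metis
qed

section \<open>Left invariance and the construction of \<open>Wst\<close>\<close>

lemma weight_slice_square:
  assumes b: "b \<in> N" and \<xi>: "l2_seq \<xi>"
  shows "slice_left t \<xi> \<xi> (radj (\<Delta> b) o\<^sub>L \<Delta> b) \<in> pos_cone M"
    and "\<phi> (slice_left t \<xi> \<xi> (radj (\<Delta> b) o\<^sub>L \<Delta> b)) = ennreal ((l2_norm \<xi>)\<^sup>2 * (norm (\<Lambda> b))\<^sup>2)"
proof -
  have bM: "b \<in> M" by (rule N_M[OF b])
  note c = \<Delta>_clin[OF bM]
  have eq: "radj (\<Delta> b) o\<^sub>L \<Delta> b = \<Delta> (radj b o\<^sub>L b)"
    using bM by (simp add: \<Delta>_mult M_radj \<Delta>_radj)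
  have "slice_left t \<xi> \<xi> (radj (\<Delta> b) o\<^sub>L \<Delta> b) \<in> M"
    unfolding eq by (intro slice_left_in_M \<Delta>_MM M_compose M_radj bM \<xi>)
  moreover have "positive_op (slice_left t \<xi> \<xi> (radj (\<Delta> b) o\<^sub>L \<Delta> b))"
    by (rule positive_opI[OF _ cinner_slice_left_diag[OF \<xi> c]])
      (auto simp: c intro!: clin_slice_left \<xi> clin_compose suminf_nonneg summable_apply_l2 l2_seq_tensor)
  ultimately show "slice_left t \<xi> \<xi> (radj (\<Delta> b) o\<^sub>L \<Delta> b) \<in> pos_cone M"
    by (simp add: pos_cone_def)
  have "\<phi> (slice_left t \<xi> \<xi> (\<Delta> (radj b o\<^sub>L b))) = ennreal (\<Sum>n. (norm (\<xi> n))\<^sup>2) * \<phi> (radj b o\<^sub>L b)"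
    using left_haar square_pos_cone[OF bM] b \<xi> unfolding left_invariant_def by (auto simp: N_iff)
  then show "\<phi> (slice_left t \<xi> \<xi> (radj (\<Delta> b) o\<^sub>L \<Delta> b)) = ennreal ((l2_norm \<xi>)\<^sup>2 * (norm (\<Lambda> b))\<^sup>2)"
    unfolding eq by (simp add: weight_square[OF b] ennreal_mult l2_norm_sq[OF \<xi>, symmetric])
qed

lemma N_dominated_slice:
  assumes b: "b \<in> N" and \<xi>: "l2_seq \<xi>" and x: "x \<in> M" and c: "0 \<le> c"
    and le: "\<And>\<zeta>. (norm (blinfun_apply x \<zeta>))\<^sup>2 \<le> c * (\<Sum>n. (norm (blinfun_apply (\<Delta> b) (t (\<xi> n) \<zeta>)))\<^sup>2)"
  shows "x \<in> N" "(norm (\<Lambda> x))\<^sup>2 \<le> c * ((l2_norm \<xi>)\<^sup>2 * (norm (\<Lambda> b))\<^sup>2)"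
proof -
  have "(norm (blinfun_apply x \<zeta>))\<^sup>2 \<le> c * Re (cinner (blinfun_apply (slice_left t \<xi> \<xi> (radj (\<Delta> b) o\<^sub>L \<Delta> b)) \<zeta>) \<zeta>)" for \<zeta>
    using le[of \<zeta>] unfolding cinner_slice_left_diag[OF \<xi> \<Delta>_clin[OF N_M[OF b]]] by simp
  from N_dominated[OF x weight_slice_square[OF b \<xi>] c this]
  show "x \<in> N" "(norm (\<Lambda> x))\<^sup>2 \<le> c * ((l2_norm \<xi>)\<^sup>2 * (norm (\<Lambda> b))\<^sup>2)" by auto
qed

lemma N_slice_left:
  assumes b: "b \<in> N" and \<xi>: "l2_seq \<xi>" and \<eta>: "l2_seq \<eta>"
  shows "slice_left t \<xi> \<eta> (\<Delta> b) \<in> N"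
    and "norm (\<Lambda> (slice_left t \<xi> \<eta> (\<Delta> b))) \<le> l2_norm \<eta> * l2_norm \<xi> * norm (\<Lambda> b)"
proof -
  have *: "slice_left t \<xi> \<eta> (\<Delta> b) \<in> M" "0 \<le> (l2_norm \<eta>)\<^sup>2"
    by (intro slice_left_in_M \<Delta>_MM N_M b \<xi> \<eta>) simp
  note d = N_dominated_slice[OF b \<xi> * norm_slice_left_apply_le[OF \<xi> \<eta>, of "\<Delta> b", folded l2_norm_sq[OF \<eta>]]]
  show "slice_left t \<xi> \<eta> (\<Delta> b) \<in> N" by (rule d(1))
  have "(norm (\<Lambda> (slice_left t \<xi> \<eta> (\<Delta> b))))\<^sup>2 \<le> (l2_norm \<eta> * l2_norm \<xi> * norm (\<Lambda> b))\<^sup>2"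
    using d(2) by (simp add: power_mult_distrib mult.assoc)
  then show "norm (\<Lambda> (slice_left t \<xi> \<eta> (\<Delta> b))) \<le> l2_norm \<eta> * l2_norm \<xi> * norm (\<Lambda> b)"
    by (rule power2_le_imp_le) (simp add: l2_norm_nonneg \<xi> \<eta>)
qed

lemma N_lsl:
  assumes b: "b \<in> N"
  shows "lsl t \<xi> \<eta> (\<Delta> b) \<in> N" "norm (\<Lambda> (lsl t \<xi> \<eta> (\<Delta> b))) \<le> norm \<eta> * norm \<xi> * norm (\<Lambda> b)"
  using N_slice_left[OF b, of "single_seq \<xi>" "single_seq \<eta>"] by simp_all

definition onb :: "'h set" where "onb = (SOME B. is_onb B)"

lemma is_onb [simp]: "is_onb onb"
  unfolding onb_def by (rule someI_ex[OF onb_exists])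

lemma onb_norm: "e \<in> onb \<Longrightarrow> norm e = 1"
  using is_onb by (simp add: is_onb_def del: is_onb)

lemma onb_orth: "e \<in> onb \<Longrightarrow> f \<in> onb \<Longrightarrow> e \<noteq> f \<Longrightarrow> cinner e f = 0"
  using is_onb by (simp add: is_onb_def del: is_onb)

text \<open>Parseval's identity in the first leg, pushed through the weight. As quadratic forms, the
  squares of the slices by basis vectors add up to the slice \<open>s\<close> of
  \<open>radj (\<Delta> b) o \<Delta> b\<close> by \<open>\<xi>\<close>; normality gives the weight
  of \<open>s\<close> as the supremum over finite partial sums, and left invariance computes
  it.\<close>

lemma has_sum_norm_slices:
  assumes b: "b \<in> N"
  shows "((\<lambda>e. (norm (\<Lambda> (lsl t \<xi> e (\<Delta> b))))\<^sup>2) has_sum (norm \<xi>)\<^sup>2 * (norm (\<Lambda> b))\<^sup>2) onb"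
proof -
  define T where "T e = lsl t \<xi> e (\<Delta> b)" for e
  define s where "s = slice_left t (single_seq \<xi>) (single_seq \<xi>) (radj (\<Delta> b) o\<^sub>L \<Delta> b)"
  note bM = N_M[OF b]
  have TN: "T e \<in> N" for e unfolding T_def by (rule N_lsl(1)[OF b])
  have TM: "T e \<in> M" for e by (rule N_M[OF TN])
  have s: "s \<in> pos_cone M" "\<phi> s = ennreal ((norm \<xi>)\<^sup>2 * (norm (\<Lambda> b))\<^sup>2)"
    unfolding s_def using weight_slice_square[OF b, of "single_seq \<xi>"] by simp_all
  define P where "P F = (\<Sum>e\<in>F. radj (T e) o\<^sub>L T e)" for F
  have P: "P F \<in> pos_cone M" "\<phi> (P F) = ennreal (\<Sum>e\<in>F. (norm (\<Lambda> (T e)))\<^sup>2)" if "finite F" for F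
    using weight_sum[OF that, of "\<lambda>e. radj (T e) o\<^sub>L T e"] square_pos_cone[OF TM]
    by (auto simp: P_def weight_square TN)
  have cP: "cinner (blinfun_apply (P F) \<zeta>) \<zeta> = of_real (\<Sum>e\<in>F. (norm (blinfun_apply (T e) \<zeta>))\<^sup>2)" for F \<zeta>
    using cinner_square[OF M_clin[OF TM]] by (simp add: P_def blinfun.sum_left cinner_sum_left)
  have cs: "cinner (blinfun_apply s \<zeta>) \<zeta> = of_real ((norm (blinfun_apply (\<Delta> b) (t \<xi> \<zeta>)))\<^sup>2)" for \<zeta>
    unfolding s_def slice_left_single t.cinner_lsl by (rule cinner_square[OF \<Delta>_clin[OF bM]])
  have pars: "((\<lambda>e. (norm (blinfun_apply (T e) \<zeta>))\<^sup>2) has_sum (norm (blinfun_apply (\<Delta> b) (t \<xi> \<zeta>)))\<^sup>2) onb" for \<zeta>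
    unfolding T_def t.lsl_apply by (rule t.parseval_left[OF is_onb])
  have sPpos: "positive_op (s - P F)" if F: "finite F" "F \<subseteq> onb" for F
  proof (rule positive_opI)
    show "clin (s - P F)" using s(1) P(1)[OF F(1)] by (auto simp: pos_cone_def intro: M_clin M_diff)
    show "cinner (blinfun_apply (s - P F) \<zeta>) \<zeta>
        = of_real ((norm (blinfun_apply (\<Delta> b) (t \<xi> \<zeta>)))\<^sup>2 - (\<Sum>e\<in>F. (norm (blinfun_apply (T e) \<zeta>))\<^sup>2))" for \<zeta>
      by (simp only: blinfun.diff_left cinner_diff_left cs cP of_real_diff)
    show "0 \<le> (norm (blinfun_apply (\<Delta> b) (t \<xi> \<zeta>)))\<^sup>2 - (\<Sum>e\<in>F. (norm (blinfun_apply (T e) \<zeta>))\<^sup>2)" for \<zeta>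
    proof -
      have "(\<Sum>e\<in>F. (norm (blinfun_apply (T e) \<zeta>))\<^sup>2) \<le> (norm (blinfun_apply (\<Delta> b) (t \<xi> \<zeta>)))\<^sup>2"
        by (rule has_sum_mono_neutral[OF has_sum_finite[OF F(1)] pars]) (use F(2) in auto)
      then show ?thesis by simp
    qed
  qed
  \<comment> \<open>The finite partial sums are directed by inclusion, and \<open>s\<close> is their
    least upper bound because a comparison of quadratic forms is made at one vector at a
    time.\<close>
  have sup: "\<phi> s = (SUP x\<in>P ` {F. finite F \<and> F \<subseteq> onb}. \<phi> x)"
  proof (rule normal)
    show "P ` {F. finite F \<and> F \<subseteq> onb} \<subseteq> pos_cone M" using P(1) by auto
    show "P ` {F. finite F \<and> F \<subseteq> onb} \<noteq> {}" by auto
    show "s \<in> pos_cone M" by (rule s(1))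
    show "positive_op (s - x)" if "x \<in> P ` {F. finite F \<and> F \<subseteq> onb}" for x
      using that sPpos by auto
    show "\<exists>z\<in>P ` {F. finite F \<and> F \<subseteq> onb}. positive_op (z - x) \<and> positive_op (z - y)"
      if xy: "x \<in> P ` {F. finite F \<and> F \<subseteq> onb}" "y \<in> P ` {F. finite F \<and> F \<subseteq> onb}" for x y
    proof -
      obtain F G where FG: "x = P F" "y = P G" "finite F" "finite G" "F \<subseteq> onb" "G \<subseteq> onb" using xy by auto
      have mono: "positive_op (P H - P K)" if "finite H" "K \<subseteq> H" for H K
      proof -
        have "P H - P K = P (H - K)"
          unfolding P_def using that by (simp add: sum_diff finite_subset)
        then show ?thesis using P(1)[of "H - K"] that by (simp add: pos_cone_def)
      qed
      show ?thesis
        using FG mono[of "F \<union> G" F] mono[of "F \<union> G" G] by (intro bexI[of _ "P (F \<union> G)"]) auto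
    qed
    fix u assume u: "u \<in> pos_cone M" "\<And>x. x \<in> P ` {F. finite F \<and> F \<subseteq> onb} \<Longrightarrow> positive_op (u - x)"
    have ur: "cinner (blinfun_apply u \<zeta>) \<zeta> = of_real (Re (cinner (blinfun_apply u \<zeta>) \<zeta>))" for \<zeta>
      using u(1) by (auto simp: pos_cone_def positive_op_def complex_nonneg_Reals_iff complex_eq_iff)
    show "positive_op (u - s)"
    proof (rule positive_opI)
      show "clin (u - s)" using s(1) u(1) by (auto simp: pos_cone_def intro: M_clin M_diff)
      show "cinner (blinfun_apply (u - s) \<zeta>) \<zeta>
          = of_real (Re (cinner (blinfun_apply u \<zeta>) \<zeta>) - (norm (blinfun_apply (\<Delta> b) (t \<xi> \<zeta>)))\<^sup>2)" for \<zeta>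
        unfolding blinfun.diff_left cinner_diff_left cs of_real_diff by (subst ur) simp
      show "0 \<le> Re (cinner (blinfun_apply u \<zeta>) \<zeta>) - (norm (blinfun_apply (\<Delta> b) (t \<xi> \<zeta>)))\<^sup>2" for \<zeta>
      proof -
        have "(norm (blinfun_apply (\<Delta> b) (t \<xi> \<zeta>)))\<^sup>2 \<le> Re (cinner (blinfun_apply u \<zeta>) \<zeta>)"
        proof (rule has_sum_le_finite_sums[OF pars])
          fix F assume F: "finite F" "F \<subseteq> onb"
          then have "positive_op (u - P F)" using u(2) by auto
          from positive_op_Re_nonneg[OF this, of \<zeta>]
          show "(\<Sum>e\<in>F. (norm (blinfun_apply (T e) \<zeta>))\<^sup>2) \<le> Re (cinner (blinfun_apply u \<zeta>) \<zeta>)"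
            by (simp add: blinfun.diff_left cinner_diff_left cP)
        qed
        then show ?thesis by simp
      qed
    qed
  qed
  show ?thesis
    unfolding T_def[symmetric]
  proof (rule has_sum_of_bounds)
    fix F assume F: "finite F" "F \<subseteq> onb"
    have "\<phi> (P F) \<le> \<phi> s" unfolding sup by (rule SUP_upper) (use F in auto)
    then show "(\<Sum>e\<in>F. (norm (\<Lambda> (T e)))\<^sup>2) \<le> (norm \<xi>)\<^sup>2 * (norm (\<Lambda> b))\<^sup>2"
      unfolding s(2) P(2)[OF F(1)] by simp
  next
    fix \<epsilon> :: real assume e: "\<epsilon> > 0"
    let ?S = "(norm \<xi>)\<^sup>2 * (norm (\<Lambda> b))\<^sup>2"
    show "\<exists>F. finite F \<and> F \<subseteq> onb \<and> ?S - \<epsilon> < (\<Sum>e\<in>F. (norm (\<Lambda> (T e)))\<^sup>2)"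
    proof (rule ccontr)
      assume "\<not> ?thesis"
      then have le: "(\<Sum>e\<in>F. (norm (\<Lambda> (T e)))\<^sup>2) \<le> ?S - \<epsilon>" if "finite F" "F \<subseteq> onb" for F
        using that by (meson linorder_not_less)
      from le[of "{}"] have nn: "0 \<le> ?S - \<epsilon>" by simp
      have "\<phi> s \<le> ennreal (?S - \<epsilon>)"
        unfolding sup by (rule SUP_least) (auto simp: P(2) intro!: ennreal_leI le)
      then have "?S \<le> ?S - \<epsilon>" unfolding s(2) using nn by simp
      then show False using e by simp
    qed
  qed simp
qed

text \<open>The value of \<open>Wst\<close> at \<open>t \<xi> (\<Lambda> b)\<close>, reassembled
  from its left slices. For \<open>\<xi> = \<Lambda> a\<close> it is formally (\<Lambda> \<otimes>
  \<Lambda>)(\<Delta>(b)(a \<otimes> 1)), an expression that would presuppose a tensor product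
  weight.\<close>

definition pre_W :: "'h \<Rightarrow> 'h oper \<Rightarrow> 'k" where
  "pre_W \<xi> b = (\<Sum>\<^sub>\<infinity>e\<in>onb. t e (\<Lambda> (lsl t \<xi> e (\<Delta> b))))"

lemma
  assumes b: "b \<in> N"
  shows norm_pre_W: "(norm (pre_W \<xi> b))\<^sup>2 = (norm \<xi>)\<^sup>2 * (norm (\<Lambda> b))\<^sup>2"
    and slice_pre_W: "blinfun_apply (radj (tleft t \<eta>)) (pre_W \<xi> b) = \<Lambda> (lsl t \<xi> \<eta> (\<Delta> b))"
proof -
  note one = onb_norm and orth = onb_orth
  have sm: "((\<lambda>e. (norm (t e (\<Lambda> (lsl t \<xi> e (\<Delta> b)))))\<^sup>2) has_sum (norm \<xi>)\<^sup>2 * (norm (\<Lambda> b))\<^sup>2) onb"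
    using has_sum_norm_slices[OF b, of \<xi>] by (rule has_sum_cong[THEN iffD1, rotated]) (simp add: t.norm_tensor one)
  obtain x where x: "((\<lambda>e. t e (\<Lambda> (lsl t \<xi> e (\<Delta> b)))) has_sum x) onb"
    by (rule summable_orthogonal[OF _ sm]) (auto simp: inner_eq_Re_cinner t.cinner_tensor orth)
  then have hs: "((\<lambda>e. t e (\<Lambda> (lsl t \<xi> e (\<Delta> b)))) has_sum pre_W \<xi> b) onb"
    unfolding pre_W_def by (meson has_sum_infsum summable_on_def)
  have on_B: "blinfun_apply (radj (tleft t e)) (pre_W \<xi> b) = \<Lambda> (lsl t \<xi> e (\<Delta> b))" if e: "e \<in> onb" for e
  proof -
    have "((\<lambda>f. blinfun_apply (radj (tleft t e)) (t f (\<Lambda> (lsl t \<xi> f (\<Delta> b))))) has_sum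
        blinfun_apply (radj (tleft t e)) (pre_W \<xi> b)) onb"
      by (rule has_sum_bounded_linear[OF blinfun.bounded_linear_right hs])
    moreover have "((\<lambda>f. blinfun_apply (radj (tleft t e)) (t f (\<Lambda> (lsl t \<xi> f (\<Delta> b))))) has_sum
        \<Lambda> (lsl t \<xi> e (\<Delta> b))) onb"
    proof (rule has_sum_finite_neutralI[of "{e}"])
      show "blinfun_apply (radj (tleft t e)) (t f (\<Lambda> (lsl t \<xi> f (\<Delta> b)))) = 0" if "f \<in> onb - {e}" for f
        using that e orth[of f e] by (simp add: t.radj_tleft_tensor)
    qed (use e one in \<open>auto simp: t.radj_tleft_tensor cinner_self\<close>)
    ultimately show ?thesis using has_sum_unique by blast
  qed
  have "((\<lambda>e. (norm (\<Lambda> (lsl t \<xi> e (\<Delta> b))))\<^sup>2) has_sum (norm (pre_W \<xi> b))\<^sup>2) onb"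
    using t.parseval_left[OF is_onb, of "pre_W \<xi> b"]
    by (rule has_sum_cong[THEN iffD1, rotated]) (simp add: on_B)
  then show "(norm (pre_W \<xi> b))\<^sup>2 = (norm \<xi>)\<^sup>2 * (norm (\<Lambda> b))\<^sup>2"
    using has_sum_norm_slices[OF b, of \<xi>] has_sum_unique by blast
  \<comment> \<open>For general \<open>\<eta>\<close>: both sides are bounded and conjugate linear
    in \<open>\<eta>\<close>, and they agree on the basis.\<close>
  let ?f = "\<lambda>\<eta>. blinfun_apply (radj (tleft t \<eta>)) (pre_W \<xi> b)" and ?g = "\<lambda>\<eta>. \<Lambda> (lsl t \<xi> \<eta> (\<Delta> b))"
  have f_add: "?f (x + y) = ?f x + ?f y" and f_sc: "?f (c *\<^sub>C x) = cnj c *\<^sub>C ?f x" for x y c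
    by (rule cinner_eqI, simp add: t.cinner_tleft t.add_left cinner_add_right cinner_add_left
        t.scale_left cinner_scaleC_left cinner_scaleC_right)+
  have g_add: "?g (x + y) = ?g x + ?g y" and g_sc: "?g (c *\<^sub>C x) = cnj c *\<^sub>C ?g x" for x y c
    by (simp_all add: t.lsl_add_right t.lsl_scale_right gns_add gns_scale N_lsl b)
  have fb: "bounded_linear ?f"
  proof (rule bounded_linear_intro[OF f_add])
    show "?f (r *\<^sub>R x) = r *\<^sub>R ?f x" for r x using f_sc[of "of_real r" x] by (simp add: scaleR_scaleC)
    show "norm (?f x) \<le> norm x * norm (pre_W \<xi> b)" for x
      using norm_blinfun[of "radj (tleft t x)" "pre_W \<xi> b"] t.norm_tleft_le[of x]
      by (simp add: order_trans[OF _ mult_right_mono])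
  qed
  have gb: "bounded_linear ?g"
  proof (rule bounded_linear_intro[OF g_add])
    show "?g (r *\<^sub>R x) = r *\<^sub>R ?g x" for r x using g_sc[of "of_real r" x] by (simp add: scaleR_scaleC)
    show "norm (?g x) \<le> norm x * (norm \<xi> * norm (\<Lambda> b))" for x
      using N_lsl(2)[OF b, of \<xi> x] by (simp add: mult.assoc)
  qed
  have "{\<eta>. ?f \<eta> = ?g \<eta>} = UNIV"
  proof (rule onb_closed_subspace_UNIV[OF is_onb])
    interpret f: bounded_linear ?f by (rule fb)
    interpret g: bounded_linear ?g by (rule gb)
    show "subspace {\<eta>. ?f \<eta> = ?g \<eta>}"
      unfolding subspace_def using f.zero g.zero f.add g.add f.scaleR g.scaleR by simp
    show "closed {\<eta>. ?f \<eta> = ?g \<eta>}"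
      by (intro closed_Collect_eq linear_continuous_on fb gb)
    show "c *\<^sub>C e \<in> {\<eta>. ?f \<eta> = ?g \<eta>}" if "e \<in> onb" for e c
      using on_B[OF that] f_sc[of c e] g_sc[of c e] by simp
  qed
  then show "?f \<eta> = ?g \<eta>" by blast
qed

text \<open>Only norms are known, so the identity is polarised twice: in the elements of the left
  ideal at a fixed vector, and then in the vectors. Linearity of \<open>pre_W\<close> in each
  argument is read off from its left slices.\<close>

lemma cinner_pre_W:
  assumes b: "b \<in> N" and b': "b' \<in> N"
  shows "cinner (pre_W \<xi> b) (pre_W \<xi>' b') = cinner \<xi> \<xi>' * cinner (\<Lambda> b) (\<Lambda> b')"
proof -
  have eqI: "v = w" if "\<And>\<eta>. blinfun_apply (radj (tleft t \<eta>)) v = blinfun_apply (radj (tleft t \<eta>)) w" for v w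
    by (rule t.tensor_cinner_eqI) (simp add: t.cinner_tleft[symmetric] that)
  have add1: "pre_W (x + y) b = pre_W x b + pre_W y b" if "b \<in> N" for x y b
    by (rule eqI) (simp add: slice_pre_W that blinfun.add_right t.lsl_add_left gns_add N_lsl)
  have sc1: "pre_W (c *\<^sub>C x) b = c *\<^sub>C pre_W x b" if "b \<in> N" for c x b
    by (rule eqI) (simp add: slice_pre_W that clinD t.lsl_scale_left \<Delta>_clin N_M gns_scale N_lsl)
  have add2: "pre_W x (b + c) = pre_W x b + pre_W x c" if "b \<in> N" "c \<in> N" for x b c
    by (rule eqI) (simp add: slice_pre_W that N_add blinfun.add_right \<Delta>_add N_M t.lsl_add gns_add N_lsl)
  have lsl_cs: "lsl t x y (cscale c X) = cscale c (lsl t x y X)" for x y c and X :: "'k oper"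
    by (rule oper_eqI) (simp add: t.cinner_lsl cinner_scaleC_left)
  have sc2: "pre_W x (cscale c b) = c *\<^sub>C pre_W x b" if "b \<in> N" for x b c
    by (rule eqI) (simp add: slice_pre_W that N_cscale clinD \<Delta>_cscale N_M lsl_cs gns_scale N_lsl)
  have sub1: "pre_W (x - y) b = pre_W x b - pre_W y b" if "b \<in> N" for x y b
    using add1[OF that, of "x - y" y] by simp
  have sub2: "pre_W x (b - c) = pre_W x b - pre_W x c" if "b \<in> N" "c \<in> N" for x b c
    using add2[of "b - c" c x] that by (simp add: N_diff)
  have step1: "cinner (pre_W \<xi> b) (pre_W \<xi> b') = cinner \<xi> \<xi> * cinner (\<Lambda> b) (\<Lambda> b')"
    if b: "b \<in> N" and b': "b' \<in> N" for \<xi> b b'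
  proof -
    note i = N_cscale[OF b', of \<i>]
    have "4 * cinner (pre_W \<xi> b) (pre_W \<xi> b')
      = of_real ((norm (pre_W \<xi> (b + b')))\<^sup>2) - of_real ((norm (pre_W \<xi> (b - b')))\<^sup>2)
       + \<i> * of_real ((norm (pre_W \<xi> (b + cscale \<i> b')))\<^sup>2) - \<i> * of_real ((norm (pre_W \<xi> (b - cscale \<i> b')))\<^sup>2)"
      unfolding add2[OF b b'] sub2[OF b b'] add2[OF b i] sub2[OF b i] sc2[OF b'] by (rule cpolarization)
    also have "\<dots> = cinner \<xi> \<xi> * (of_real ((norm (\<Lambda> b + \<Lambda> b'))\<^sup>2) - of_real ((norm (\<Lambda> b - \<Lambda> b'))\<^sup>2)
       + \<i> * of_real ((norm (\<Lambda> b + \<i> *\<^sub>C \<Lambda> b'))\<^sup>2) - \<i> * of_real ((norm (\<Lambda> b - \<i> *\<^sub>C \<Lambda> b'))\<^sup>2))"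
      unfolding norm_pre_W[OF N_add[OF b b']] norm_pre_W[OF N_diff[OF b b']] norm_pre_W[OF N_add[OF b i]]
        norm_pre_W[OF N_diff[OF b i]] gns_add[OF b b'] \<Lambda>_diff[OF b b'] gns_add[OF b i] \<Lambda>_diff[OF b i]
        gns_scale[OF b'] cinner_self of_real_mult by (simp add: algebra_simps)
    also have "\<dots> = 4 * (cinner \<xi> \<xi> * cinner (\<Lambda> b) (\<Lambda> b'))"
      unfolding cpolarization[symmetric] by simp
    finally show ?thesis by simp
  qed
  \<comment> \<open>Second polarisation: for fixed \<open>b\<close> and \<open>b'\<close>, a
    sesquilinear form is determined by its diagonal, which the first polarisation has
    computed.\<close>
  define c where "c = cinner (\<Lambda> b) (\<Lambda> b')"
  define s where "s x y = cinner (pre_W x b) (pre_W y b')" for x y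
  have s_rules: "s (x + y) z = s x z + s y z" "s z (x + y) = s z x + s z y"
    "s (x - y) z = s x z - s y z" "s z (x - y) = s z x - s z y"
    "s (a *\<^sub>C x) z = a * s x z" "s z (a *\<^sub>C x) = cnj a * s z x" for x y z a
    by (simp_all add: s_def add1 b b' sub1 sc1 cinner_add_left cinner_add_right cinner_diff_left
        cinner_diff_right cinner_scaleC_left cinner_scaleC_right)
  have diag: "s x x = c * cinner x x" for x
    unfolding s_def c_def using step1[OF b b', of x] by simp
  have "4 * s \<xi> \<xi>' = s (\<xi> + \<xi>') (\<xi> + \<xi>') - s (\<xi> - \<xi>') (\<xi> - \<xi>')
     + \<i> * s (\<xi> + \<i> *\<^sub>C \<xi>') (\<xi> + \<i> *\<^sub>C \<xi>') - \<i> * s (\<xi> - \<i> *\<^sub>C \<xi>') (\<xi> - \<i> *\<^sub>C \<xi>')"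
    by (simp add: s_rules algebra_simps)
  also have "\<dots> = c * (4 * cinner \<xi> \<xi>')"
    unfolding diag cpolarization cinner_self by (simp add: algebra_simps)
  finally show ?thesis by (simp add: s_def c_def)
qed

lemma W_star_ex:
  "\<exists>T :: 'k oper. (\<forall>\<xi>. \<forall>b\<in>N. blinfun_apply T (t \<xi> (\<Lambda> b)) = pre_W \<xi> b) \<and> (\<forall>v. norm (blinfun_apply T v) = norm v)"
proof -
  define S where "S = {(t \<xi> (\<Lambda> b), pre_W \<xi> b) | \<xi> b. b \<in> N}"
  have iso: "inner (snd p) (snd q) = inner (fst p) (fst q)" if "p \<in> span S" "q \<in> span S" for p q
    by (rule inner_eq_on_span[OF _ that])
      (auto simp: S_def t.cinner_tensor cinner_pre_W intro!: inner_eqI_cinner)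
  have nrm: "norm w = norm u" if "(u, w) \<in> span S" for u w
    using iso[OF that that] by (simp add: norm_eq_sqrt_inner)
  have fst_span: "fst ` span S = span (fst ` S)"
    by (rule linear_span_image[symmetric]) (rule linear_fst)
  have dn: "closure (fst ` span S) = UNIV"
  proof (rule t.closed_subspace_tensor_UNIV)
    show "subspace (closure (fst ` span S))"
      unfolding fst_span by (intro closed_subspace_closure subspace_span)
    show "t a b \<in> closure (fst ` span S)" for a b
    proof -
      have "b \<in> closure (\<Lambda> ` N)" using gns_dense by simp
      moreover have "t a ` closure (\<Lambda> ` N) \<subseteq> closure (fst ` span S)"
      proof (rule image_closure_subset)
        show "continuous_on (closure (\<Lambda> ` N)) (t a)"
          by (intro linear_continuous_on t.bb.bounded_linear_right)
        have "t a (\<Lambda> c) \<in> fst ` span S" if "c \<in> N" for c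
          unfolding fst_span using that by (intro span_base) (force simp: S_def)
        then have "t a ` \<Lambda> ` N \<subseteq> fst ` span S" by auto
        then show "t a ` \<Lambda> ` N \<subseteq> closure (fst ` span S)" using closure_subset by (rule order_trans)
      qed simp
      ultimately show ?thesis by blast
    qed
  qed simp
  have bd: "norm w \<le> 1 * norm u" if "(u, w) \<in> span S" for u w using nrm[OF that] by simp
  obtain T where T: "\<And>u w. (u, w) \<in> span S \<Longrightarrow> blinfun_apply T u = w"
    using bounded_extension[OF subspace_span bd dn, where thesis = thesis] by metis
  have "norm (blinfun_apply T v) = norm v" for v
  proof -
    have "closure (fst ` span S) \<subseteq> {v. norm (blinfun_apply T v) = norm v}"
    proof (rule closure_minimal)
      show "fst ` span S \<subseteq> {v. norm (blinfun_apply T v) = norm v}" using T nrm by fastforce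
      show "closed {v. norm (blinfun_apply T v) = norm v}"
        by (intro closed_Collect_eq continuous_intros linear_continuous_on blinfun.bounded_linear_right)
    qed
    then show ?thesis using dn by blast
  qed
  moreover have "blinfun_apply T (t \<xi> (\<Lambda> b)) = pre_W \<xi> b" if "b \<in> N" for \<xi> b
    by (rule T, rule span_base) (use that in \<open>auto simp: S_def\<close>)
  ultimately show ?thesis by blast
qed

end

lemma norm_expansion_tail:
  assumes t: "hilbert_tensor t" and B: "is_onb B" and F: "finite F" "F \<subseteq> B"
  shows "(norm (v - (\<Sum>e\<in>F. t e (blinfun_apply (radj (tleft t e)) v))))\<^sup>2
    = (norm v)\<^sup>2 - (\<Sum>e\<in>F. (norm (blinfun_apply (radj (tleft t e)) v))\<^sup>2)"
proof -
  interpret hilbert_tensor t by (rule t)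
  let ?p = "\<Sum>e\<in>F. t e (blinfun_apply (radj (tleft t e)) v)"
  let ?S = "\<Sum>e\<in>F. (norm (blinfun_apply (radj (tleft t e)) v))\<^sup>2"
  have orth: "inner (t e a) (t f b) = 0" if "e \<in> F" "f \<in> F" "e \<noteq> f" for e f a b
  proof -
    have "cinner e f = 0" using B F that by (simp add: is_onb_def subset_iff)
    then show ?thesis by (simp add: inner_eq_Re_cinner cinner_tensor)
  qed
  have one: "norm e = 1" if "e \<in> F" for e using B F that by (simp add: is_onb_def subset_iff)
  have n: "(norm ?p)\<^sup>2 = ?S"
    using F(1) orth one by (subst norm_sum_orthogonal) (auto simp: norm_tensor)
  have "inner v ?p = ?S"
    unfolding inner_sum_right
  proof (rule sum.cong)
    fix e assume "e \<in> F"
    have "cinner v (t e (blinfun_apply (radj (tleft t e)) v)) = of_real ((norm (blinfun_apply (radj (tleft t e)) v))\<^sup>2)"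
      by (simp add: cinner_tleft[symmetric] cinner_self)
    then show "inner v (t e (blinfun_apply (radj (tleft t e)) v)) = (norm (blinfun_apply (radj (tleft t e)) v))\<^sup>2"
      by (simp add: inner_eq_Re_cinner)
  qed simp
  then show ?thesis
    using n by (simp add: power2_norm_eq_inner inner_diff_left inner_diff_right inner_commute)
qed

section \<open>Slices of \<open>Wst\<close> and its relation to the coproduct\<close>

context quantum_group
begin

definition Wst :: "'k oper" where
  "Wst = (SOME T. (\<forall>\<xi>. \<forall>b\<in>N. blinfun_apply T (t \<xi> (\<Lambda> b)) = pre_W \<xi> b) \<and> (\<forall>v. norm (blinfun_apply T v) = norm v))"

lemma
  shows Wst_tensor: "b \<in> N \<Longrightarrow> blinfun_apply Wst (t \<xi> (\<Lambda> b)) = pre_W \<xi> b"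
    and norm_Wst [simp]: "norm (blinfun_apply Wst v) = norm v"
  using someI_ex[OF W_star_ex] unfolding Wst_def[symmetric] by blast+

lemma dense_blinfun_eqI:
  fixes X Y :: "'h \<Rightarrow>\<^sub>L 'd::real_normed_vector"
  assumes "\<And>b. b \<in> N \<Longrightarrow> blinfun_apply X (\<Lambda> b) = blinfun_apply Y (\<Lambda> b)"
  shows "X = Y"
proof (rule blinfun_eqI)
  fix x
  have "closure (\<Lambda> ` N) \<subseteq> {x. blinfun_apply X x = blinfun_apply Y x}"
    by (rule closure_minimal)
      (auto simp: assms intro!: closed_Collect_eq linear_continuous_on blinfun.bounded_linear_right)
  then show "blinfun_apply X x = blinfun_apply Y x" using gns_dense by auto
qed

lemma dense_tensor_eqI:
  fixes X Y :: "'k \<Rightarrow>\<^sub>L 'd::real_normed_vector"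
  assumes "\<And>\<xi> b. b \<in> N \<Longrightarrow> blinfun_apply X (t \<xi> (\<Lambda> b)) = blinfun_apply Y (t \<xi> (\<Lambda> b))"
  shows "X = Y"
proof (rule t.tensor_blinfun_eqI)
  fix a b
  have "X o\<^sub>L tleft t a = Y o\<^sub>L tleft t a"
    by (rule dense_blinfun_eqI) (simp add: assms)
  then have "blinfun_apply (X o\<^sub>L tleft t a) b = blinfun_apply (Y o\<^sub>L tleft t a) b" by simp
  then show "blinfun_apply X (t a b) = blinfun_apply Y (t a b)" by simp
qed

lemma vector_eqI_slices:
  assumes "\<And>\<eta>. blinfun_apply (radj (tleft t \<eta>)) v = blinfun_apply (radj (tleft t \<eta>)) w"
  shows "v = w"
  by (rule t.tensor_cinner_eqI) (simp add: t.cinner_tleft[symmetric] assms)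

lemma clin_Wst [simp]: "clin Wst"
proof -
  have "Wst o\<^sub>L cscale c id_blinfun = cscale c Wst" for c
  proof (rule dense_tensor_eqI)
    fix \<xi> b assume b: "b \<in> N"
    have "pre_W (c *\<^sub>C \<xi>) b = c *\<^sub>C pre_W \<xi> b"
      by (rule vector_eqI_slices)
        (simp add: slice_pre_W b clinD t.lsl_scale_left \<Delta>_clin N_M gns_scale N_lsl)
    then show "blinfun_apply (Wst o\<^sub>L cscale c id_blinfun) (t \<xi> (\<Lambda> b)) = blinfun_apply (cscale c Wst) (t \<xi> (\<Lambda> b))"
      by (simp add: t.scale_left[symmetric] Wst_tensor b)
  qed
  then have "blinfun_apply (Wst o\<^sub>L cscale c id_blinfun) v = blinfun_apply (cscale c Wst) v" for c v by simp
  then show ?thesis by (simp add: clin_def)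
qed

lemma cinner_Wst [simp]: "cinner (blinfun_apply Wst u) (blinfun_apply Wst v) = cinner u v"
proof -
  have "4 * cinner (blinfun_apply Wst u) (blinfun_apply Wst v) = 4 * cinner u v"
    unfolding cpolarization clinD[OF clin_Wst, symmetric] blinfun.add_right[symmetric]
      blinfun.diff_right[symmetric] norm_Wst ..
  then show ?thesis by simp
qed

lemma W_coisometry: "radj Wst o\<^sub>L Wst = id_blinfun"
  by (rule oper_eqI) (simp add: cinner_radj'[symmetric])

lemma lsl_Wst: "b \<in> N \<Longrightarrow> blinfun_apply (lsl t \<xi> \<eta> Wst) (\<Lambda> b) = \<Lambda> (lsl t \<xi> \<eta> (\<Delta> b))"
  by (simp add: t.lsl_apply Wst_tensor slice_pre_W)

lemma l2_tail:
  assumes "l2_seq \<xi>"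
  shows "l2_seq (\<lambda>n. \<xi> (n + K))" "(\<lambda>K. l2_norm (\<lambda>n. \<xi> (n + K))) \<longlonglongrightarrow> 0"
proof -
  have sm: "summable (\<lambda>n. (norm (\<xi> n))\<^sup>2)" using assms by (simp add: l2_seq_def)
  then show "l2_seq (\<lambda>n. \<xi> (n + K))"
    unfolding l2_seq_def by (rule summable_ignore_initial_segment)
  have "(\<lambda>K. sqrt (\<Sum>n. (norm (\<xi> (n + K)))\<^sup>2)) \<longlonglongrightarrow> sqrt 0"
  proof (rule tendsto_real_sqrt)
    have "(\<lambda>K. (\<Sum>n. (norm (\<xi> n))\<^sup>2) - (\<Sum>n<K. (norm (\<xi> n))\<^sup>2))
        \<longlonglongrightarrow> (\<Sum>n. (norm (\<xi> n))\<^sup>2) - (\<Sum>n. (norm (\<xi> n))\<^sup>2)"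
      by (intro tendsto_diff tendsto_const summable_LIMSEQ sm)
    then show "(\<lambda>K. \<Sum>n. (norm (\<xi> (n + K)))\<^sup>2) \<longlonglongrightarrow> 0"
      by (simp add: suminf_minus_initial_segment[OF sm])
  qed
  then show "(\<lambda>K. l2_norm (\<lambda>n. \<xi> (n + K))) \<longlonglongrightarrow> 0" by (simp add: l2_norm_def)
qed

text \<open>\<open>\<Lambda>\<close> is not norm continuous, so the series of slices cannot be
  exchanged with it directly. The remainder is again a slice by square-summable sequences, and
  \<open>N_slice_left\<close> bounds its GNS vector by the norms of their tails.\<close>

lemma slice_left_Wst:
  assumes b: "b \<in> N" and \<xi>: "l2_seq \<xi>" and \<eta>: "l2_seq \<eta>"
  shows "blinfun_apply (slice_left t \<xi> \<eta> Wst) (\<Lambda> b) = \<Lambda> (slice_left t \<xi> \<eta> (\<Delta> b))"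
proof -
  define x where "x K = (\<Sum>n<K. lsl t (\<xi> n) (\<eta> n) (\<Delta> b))" for K
  have xN: "x K \<in> N" for K unfolding x_def by (intro N_sum N_lsl b)
  have \<Lambda>x: "\<Lambda> (x K) = (\<Sum>n<K. blinfun_apply (lsl t (\<xi> n) (\<eta> n) Wst) (\<Lambda> b))" for K
    unfolding x_def by (subst \<Lambda>_sum) (auto simp: N_lsl b lsl_Wst)
  have "(\<lambda>n. lsl t (\<xi> n) (\<eta> n) Wst) sums slice_left t \<xi> \<eta> Wst"
    unfolding slice_left_eq[OF \<xi> \<eta>] by (rule summable_sums[OF summable_lsl[OF \<xi> \<eta>]])
  from bounded_linear.sums[OF blinfun.bounded_linear_left this, of "\<Lambda> b"]
  have lim1: "(\<lambda>K. \<Lambda> (x K)) \<longlonglongrightarrow> blinfun_apply (slice_left t \<xi> \<eta> Wst) (\<Lambda> b)"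
    unfolding \<Lambda>x sums_def .
  have tail: "slice_left t \<xi> \<eta> (\<Delta> b) - x K = slice_left t (\<lambda>n. \<xi> (n + K)) (\<lambda>n. \<eta> (n + K)) (\<Delta> b)" for K
    unfolding slice_left_eq[OF \<xi> \<eta>] slice_left_eq[OF l2_tail(1)[OF \<xi>] l2_tail(1)[OF \<eta>]] x_def
    by (rule suminf_minus_initial_segment[OF summable_lsl[OF \<xi> \<eta>], symmetric])
  have "(\<lambda>K. \<Lambda> (slice_left t \<xi> \<eta> (\<Delta> b)) - \<Lambda> (x K)) \<longlonglongrightarrow> 0"
  proof (rule Lim_null_comparison)
    show "\<forall>\<^sub>F K in sequentially. norm (\<Lambda> (slice_left t \<xi> \<eta> (\<Delta> b)) - \<Lambda> (x K))
        \<le> l2_norm (\<lambda>n. \<eta> (n + K)) * l2_norm (\<lambda>n. \<xi> (n + K)) * norm (\<Lambda> b)"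
      unfolding \<Lambda>_diff[OF N_slice_left(1)[OF b \<xi> \<eta>] xN, symmetric] tail
      by (intro always_eventually allI N_slice_left b l2_tail \<xi> \<eta>)
    show "(\<lambda>K. l2_norm (\<lambda>n. \<eta> (n + K)) * l2_norm (\<lambda>n. \<xi> (n + K)) * norm (\<Lambda> b)) \<longlonglongrightarrow> 0"
      by (intro tendsto_mult_left_zero tendsto_mult_zero l2_tail \<xi> \<eta>)
  qed
  then have "(\<lambda>K. \<Lambda> (slice_left t \<xi> \<eta> (\<Delta> b)) - (\<Lambda> (slice_left t \<xi> \<eta> (\<Delta> b)) - \<Lambda> (x K)))
      \<longlonglongrightarrow> \<Lambda> (slice_left t \<xi> \<eta> (\<Delta> b)) - 0"
    by (intro tendsto_diff tendsto_const)
  then have "(\<lambda>K. \<Lambda> (x K)) \<longlonglongrightarrow> \<Lambda> (slice_left t \<xi> \<eta> (\<Delta> b))" by simp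
  then show ?thesis using lim1 LIMSEQ_unique by blast
qed

text \<open>The defining condition fixes every left slice on the dense set of GNS vectors, which
  determines the operator. Unitarity is a separate matter, settled in
  \<open>W_unitary\<close>.\<close>

lemma mult_unitary_eq: "mult_unitary t M \<Delta> \<phi> \<Lambda> = radj Wst"
  unfolding mult_unitary_def
proof (rule the_equality)
  show "radj Wst \<in> bounded_ops \<and> (\<forall>\<xi> \<eta>. l2_seq \<xi> \<and> l2_seq \<eta> \<longrightarrow> (\<forall>x\<in>N.
      blinfun_apply (slice_left t \<xi> \<eta> (cadj (radj Wst))) (\<Lambda> x) = \<Lambda> (slice_left t \<xi> \<eta> (\<Delta> x))))"
    by (simp add: bounded_ops_iff cadj_eq_radj slice_left_Wst)
next
  fix V assume V: "V \<in> bounded_ops \<and> (\<forall>\<xi> \<eta>. l2_seq \<xi> \<and> l2_seq \<eta> \<longrightarrow> (\<forall>x\<in>N.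
      blinfun_apply (slice_left t \<xi> \<eta> (cadj V)) (\<Lambda> x) = \<Lambda> (slice_left t \<xi> \<eta> (\<Delta> x))))"
  then have cV: "clin V" by (simp add: bounded_ops_iff)
  have "radj V = Wst"
  proof (rule t.lsl_eqI, rule dense_blinfun_eqI)
    fix \<xi> \<eta> b assume b: "b \<in> N"
    have "blinfun_apply (slice_left t (single_seq \<xi>) (single_seq \<eta>) (cadj V)) (\<Lambda> b)
        = \<Lambda> (slice_left t (single_seq \<xi>) (single_seq \<eta>) (\<Delta> b))"
      using V b l2_seq_single by blast
    then show "blinfun_apply (lsl t \<xi> \<eta> (radj V)) (\<Lambda> b) = blinfun_apply (lsl t \<xi> \<eta> Wst) (\<Lambda> b)"
      by (simp add: cadj_eq_radj cV lsl_Wst b)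
  qed
  then show "V = radj Wst" by (metis radj_radj)
qed

lemma radj_tleft_op_tensor:
  assumes "clin u" "clin v"
  shows "blinfun_apply (radj (tleft t \<eta>)) (blinfun_apply (op_tensor t u v) w)
    = blinfun_apply v (blinfun_apply (radj (tleft t (blinfun_apply (radj u) \<eta>))) w)"
  by (rule cinner_eqI)
    (simp add: t.cinner_tleft cinner_radj[OF assms(2)] cinner_radj[OF t.clin_op_tensor[OF assms]] t.radj_op_tensor assms)

text \<open>The first leg of \<open>Wst\<close> lies in \<open>M\<close> because the left slices of
  \<open>Wst\<close> are prescribed by those of \<Delta>(b), whose first leg lies in
  \<open>M\<close>.\<close>

lemma Wst_commutes_left:
  assumes u: "u \<in> commutant M"
  shows "Wst o\<^sub>L op_tensor t u id_blinfun = op_tensor t u id_blinfun o\<^sub>L Wst"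
proof (rule dense_tensor_eqI, rule vector_eqI_slices)
  fix \<xi> b \<eta> assume b: "b \<in> N"
  note cu = commutant_clin[OF u]
  have "lsl t (blinfun_apply u \<xi>) \<eta> (\<Delta> b) = lsl t \<xi> (blinfun_apply (radj u) \<eta>) (\<Delta> b)"
  proof (rule oper_eqI)
    fix \<zeta> \<zeta>'
    have "cinner (blinfun_apply (\<Delta> b o\<^sub>L op_tensor t u id_blinfun) (t \<xi> \<zeta>)) (t \<eta> \<zeta>')
        = cinner (blinfun_apply (\<Delta> b) (t \<xi> \<zeta>)) (blinfun_apply (radj (op_tensor t u id_blinfun)) (t \<eta> \<zeta>'))"
      using cu by (simp add: MM_commutes_left[OF \<Delta>_MM[OF N_M[OF b]] u] cinner_radj)
    then show "cinner (blinfun_apply (lsl t (blinfun_apply u \<xi>) \<eta> (\<Delta> b)) \<zeta>) \<zeta>'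
        = cinner (blinfun_apply (lsl t \<xi> (blinfun_apply (radj u) \<eta>) (\<Delta> b)) \<zeta>) \<zeta>'"
      using cu by (simp add: t.cinner_lsl t.radj_op_tensor)
  qed
  then show "blinfun_apply (radj (tleft t \<eta>)) (blinfun_apply (Wst o\<^sub>L op_tensor t u id_blinfun) (t \<xi> (\<Lambda> b)))
      = blinfun_apply (radj (tleft t \<eta>)) (blinfun_apply (op_tensor t u id_blinfun o\<^sub>L Wst) (t \<xi> (\<Lambda> b)))"
    using cu by (simp add: radj_tleft_op_tensor Wst_tensor b slice_pre_W)
qed

lemma rsl_Wst_M: "rsl t \<zeta> \<zeta>' Wst \<in> M"
  by (rule rsl_in_M_if_commutes) (simp_all add: Wst_commutes_left)

text \<open>Supplies the positive element that dominates the remainder of an expansion in the first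
  leg: its quadratic form is the squared length of that remainder, and its weight follows by
  subtraction, all weights involved being finite.\<close>

lemma slice_tail:
  assumes b: "b \<in> N" and F: "finite F" "F \<subseteq> onb"
  obtains p where "p \<in> pos_cone M"
    "\<phi> p = ennreal ((norm \<xi>)\<^sup>2 * (norm (\<Lambda> b))\<^sup>2 - (\<Sum>e\<in>F. (norm (\<Lambda> (lsl t \<xi> e (\<Delta> b))))\<^sup>2))"
    "\<And>\<zeta>. Re (cinner (blinfun_apply p \<zeta>) \<zeta>) = (norm (blinfun_apply (\<Delta> b) (t \<xi> \<zeta>)
        - (\<Sum>e\<in>F. t e (blinfun_apply (lsl t \<xi> e (\<Delta> b)) \<zeta>))))\<^sup>2"
proof -
  define T where "T e = lsl t \<xi> e (\<Delta> b)" for e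
  define s where "s = lsl t \<xi> \<xi> (radj (\<Delta> b) o\<^sub>L \<Delta> b)"
  define P where "P = (\<Sum>e\<in>F. radj (T e) o\<^sub>L T e)"
  note bM = N_M[OF b]
  have TN: "T e \<in> N" for e unfolding T_def by (rule N_lsl(1)[OF b])
  have TM: "T e \<in> M" for e by (rule N_M[OF TN])
  have s: "s \<in> pos_cone M" "\<phi> s = ennreal ((norm \<xi>)\<^sup>2 * (norm (\<Lambda> b))\<^sup>2)"
    unfolding s_def using weight_slice_square[OF b, of "single_seq \<xi>"] by simp_all
  have P: "P \<in> pos_cone M" "\<phi> P = ennreal (\<Sum>e\<in>F. (norm (\<Lambda> (T e)))\<^sup>2)"
    using weight_sum[OF F(1), of "\<lambda>e. radj (T e) o\<^sub>L T e"] square_pos_cone[OF TM]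
    by (auto simp: P_def weight_square TN)
  have cP: "cinner (blinfun_apply P \<zeta>) \<zeta> = of_real (\<Sum>e\<in>F. (norm (blinfun_apply (T e) \<zeta>))\<^sup>2)" for \<zeta>
    using cinner_square[OF M_clin[OF TM]] by (simp add: P_def blinfun.sum_left cinner_sum_left)
  have cs: "cinner (blinfun_apply s \<zeta>) \<zeta> = of_real ((norm (blinfun_apply (\<Delta> b) (t \<xi> \<zeta>)))\<^sup>2)" for \<zeta>
    unfolding s_def t.cinner_lsl by (rule cinner_square[OF \<Delta>_clin[OF bM]])
  have diff: "cinner (blinfun_apply (s - P) \<zeta>) \<zeta> = of_real ((norm (blinfun_apply (\<Delta> b) (t \<xi> \<zeta>)
        - (\<Sum>e\<in>F. t e (blinfun_apply (T e) \<zeta>))))\<^sup>2)" for \<zeta>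
    using norm_expansion_tail[OF t.hilbert_tensor_axioms is_onb F, of "blinfun_apply (\<Delta> b) (t \<xi> \<zeta>)"]
    by (simp only: blinfun.diff_left cinner_diff_left cs cP of_real_diff T_def t.lsl_apply)
  have mem: "s - P \<in> pos_cone M"
    unfolding pos_cone_def
  proof (intro CollectI conjI)
    show "s - P \<in> M" using s(1) P(1) by (auto simp: pos_cone_def intro: M_diff)
    then show "positive_op (s - P)" by (intro positive_opI[OF _ diff] M_clin zero_le_power2)
  qed
  have sum: "\<phi> s = \<phi> (s - P) + \<phi> P" using weight_add[OF mem P(1)] by simp
  have nn: "0 \<le> (\<Sum>e\<in>F. (norm (\<Lambda> (T e)))\<^sup>2)" by (simp add: sum_nonneg)
  have "\<phi> (s - P) = \<phi> s - \<phi> P"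
    unfolding sum P(2) by simp
  also have "\<dots> = ennreal ((norm \<xi>)\<^sup>2 * (norm (\<Lambda> b))\<^sup>2 - (\<Sum>e\<in>F. (norm (\<Lambda> (T e)))\<^sup>2))"
    unfolding s(2) P(2) by (rule ennreal_minus[OF nn])
  finally show ?thesis
    using that[OF mem] diff by (simp add: T_def)
qed

text \<open>Left invariance controls the tail of the expansion of \<open>\<rho> W\<^sup>*\<close> in the first leg.\<close>

lemma gns_intertwine:
  fixes \<rho> :: "'k \<Rightarrow>\<^sub>L 'h"
  assumes b: "b \<in> N" and c: "clin \<rho>"
    and comm: "\<And>u. u \<in> commutant M \<Longrightarrow> \<rho> o\<^sub>L op_tensor t id_blinfun u = u o\<^sub>L \<rho>"
  shows "\<rho> o\<^sub>L (\<Delta> b o\<^sub>L tleft t \<xi>) \<in> N"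
    and "\<Lambda> (\<rho> o\<^sub>L (\<Delta> b o\<^sub>L tleft t \<xi>)) = blinfun_apply \<rho> (blinfun_apply Wst (t \<xi> (\<Lambda> b)))"
proof -
  note bM = N_M[OF b]
  define x where "x = \<rho> o\<^sub>L (\<Delta> b o\<^sub>L tleft t \<xi>)"
  have tl_comm: "op_tensor t id_blinfun u o\<^sub>L tleft t a = tleft t a o\<^sub>L u" if "clin u" for u a
    by (rule blinfun_eqI) (simp add: that)
  have xM: "x \<in> M"
  proof (rule M_I)
    show "clin x" unfolding x_def using c by (simp add: clin_compose \<Delta>_clin bM)
    fix u assume u: "u \<in> commutant M"
    let ?u = "op_tensor t id_blinfun u"
    have "x o\<^sub>L u = \<rho> o\<^sub>L ((\<Delta> b o\<^sub>L ?u) o\<^sub>L tleft t \<xi>)"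
      by (simp only: x_def compose_assoc tl_comm[OF commutant_clin[OF u]])
    also have "\<dots> = (\<rho> o\<^sub>L ?u) o\<^sub>L (\<Delta> b o\<^sub>L tleft t \<xi>)"
      by (simp only: MM_commutes_right[OF \<Delta>_MM[OF bM] u] compose_assoc)
    also have "\<dots> = u o\<^sub>L x" by (simp only: comm[OF u] x_def compose_assoc)
    finally show "x o\<^sub>L u = u o\<^sub>L x" .
  qed
  have yM: "\<rho> o\<^sub>L tleft t e \<in> M" for e
  proof (rule M_I)
    show "clin (\<rho> o\<^sub>L tleft t e)" using c by (simp add: clin_compose)
    fix u assume u: "u \<in> commutant M"
    have "(\<rho> o\<^sub>L tleft t e) o\<^sub>L u = (\<rho> o\<^sub>L op_tensor t id_blinfun u) o\<^sub>L tleft t e"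
      by (simp only: compose_assoc tl_comm[OF commutant_clin[OF u]])
    then show "(\<rho> o\<^sub>L tleft t e) o\<^sub>L u = u o\<^sub>L (\<rho> o\<^sub>L tleft t e)"
      by (simp only: comm[OF u] compose_assoc)
  qed
  \<comment> \<open>Truncation of the basis expansion: a finite sum of elements of \<open>M\<close>
    times elements of \<open>N\<close>, on which \<open>gns_module\<close> evaluates
    \<open>\<Lambda>\<close>.\<close>
  define xF where "xF F = (\<Sum>e\<in>F. (\<rho> o\<^sub>L tleft t e) o\<^sub>L lsl t \<xi> e (\<Delta> b))" for F
  have xFN: "xF F \<in> N" for F unfolding xF_def by (intro N_sum N_mult yM N_lsl b)
  have \<Lambda>xF: "\<Lambda> (xF F) = blinfun_apply \<rho> (\<Sum>e\<in>F. t e (blinfun_apply (radj (tleft t e)) (pre_W \<xi> b)))" for F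
    unfolding xF_def
    by (subst \<Lambda>_sum) (auto simp: N_mult yM N_lsl b gns_module slice_pre_W blinfun.sum_right)
  define S where "S = (norm \<xi>)\<^sup>2 * (norm (\<Lambda> b))\<^sup>2"
  define r where "r F = S - (\<Sum>e\<in>F. (norm (\<Lambda> (lsl t \<xi> e (\<Delta> b))))\<^sup>2)" for F
  have tail: "x - xF F \<in> N \<and> (norm (\<Lambda> (x - xF F)))\<^sup>2 \<le> (norm \<rho>)\<^sup>2 * r F" if F: "finite F" "F \<subseteq> onb" for F
  proof -
    have r0: "0 \<le> r F"
      unfolding r_def S_def
      using has_sum_mono_neutral[OF has_sum_finite[OF F(1)] has_sum_norm_slices[OF b, of \<xi>],
          of "\<lambda>e. (norm (\<Lambda> (lsl t \<xi> e (\<Delta> b))))\<^sup>2"] F(2) by auto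
    obtain p where p: "p \<in> pos_cone M" "\<phi> p = ennreal (r F)"
      "\<And>\<zeta>. Re (cinner (blinfun_apply p \<zeta>) \<zeta>) = (norm (blinfun_apply (\<Delta> b) (t \<xi> \<zeta>)
        - (\<Sum>e\<in>F. t e (blinfun_apply (lsl t \<xi> e (\<Delta> b)) \<zeta>))))\<^sup>2"
      using slice_tail[OF b F, of \<xi>, where thesis = thesis] unfolding r_def S_def by metis
    have M: "x - xF F \<in> M" by (intro M_diff xM N_M xFN)
    have "(norm (blinfun_apply (x - xF F) \<zeta>))\<^sup>2 \<le> (norm \<rho>)\<^sup>2 * Re (cinner (blinfun_apply p \<zeta>) \<zeta>)" for \<zeta>
    proof -
      let ?v = "blinfun_apply (\<Delta> b) (t \<xi> \<zeta>) - (\<Sum>e\<in>F. t e (blinfun_apply (lsl t \<xi> e (\<Delta> b)) \<zeta>))"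
      have "blinfun_apply (x - xF F) \<zeta> = blinfun_apply \<rho> ?v"
        by (simp add: x_def xF_def blinfun.diff_left blinfun.sum_left blinfun.diff_right blinfun.sum_right)
      then show ?thesis
        using power_mono[OF norm_blinfun[of \<rho> ?v], of 2] by (simp add: p(3) power_mult_distrib)
    qed
    from N_dominated[OF M p(1,2) _ this r0] show ?thesis by simp
  qed
  \<comment> \<open>The empty truncation is 0, so the remainder estimate for \<open>{}\<close>
    concerns \<open>x\<close> itself.\<close>
  show xN: "\<rho> o\<^sub>L (\<Delta> b o\<^sub>L tleft t \<xi>) \<in> N"
    using tail[of "{}"] by (simp add: xF_def x_def)
  have lim_r: "(r \<longlongrightarrow> 0) (finite_subsets_at_top onb)"
    using tendsto_diff[OF tendsto_const has_sum_norm_slices[OF b, of \<xi>, unfolded has_sum_def], of S]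
    by (simp add: r_def[abs_def] S_def)
  have lim1: "((\<lambda>F. \<Lambda> (xF F)) \<longlongrightarrow> blinfun_apply \<rho> (pre_W \<xi> b)) (finite_subsets_at_top onb)"
    unfolding \<Lambda>xF
    by (intro blinfun.tendsto tendsto_const t.tensor_expansion_left[OF is_onb, unfolded has_sum_def])
  have "((\<lambda>F. \<Lambda> x - \<Lambda> (xF F)) \<longlongrightarrow> 0) (finite_subsets_at_top onb)"
  proof (rule Lim_null_comparison)
    show "\<forall>\<^sub>F F in finite_subsets_at_top onb. norm (\<Lambda> x - \<Lambda> (xF F)) \<le> sqrt ((norm \<rho>)\<^sup>2 * r F)"
    proof (rule eventually_finite_subsets_at_top_weakI)
      fix F assume F: "finite F" "F \<subseteq> onb"
      have "(norm (\<Lambda> x - \<Lambda> (xF F)))\<^sup>2 \<le> (norm \<rho>)\<^sup>2 * r F"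
        using tail[OF F] \<Lambda>_diff[OF xN xFN, of F] by (simp add: x_def)
      then show "norm (\<Lambda> x - \<Lambda> (xF F)) \<le> sqrt ((norm \<rho>)\<^sup>2 * r F)" by (rule real_le_rsqrt)
    qed
    show "((\<lambda>F. sqrt ((norm \<rho>)\<^sup>2 * r F)) \<longlongrightarrow> 0) (finite_subsets_at_top onb)"
      using tendsto_real_sqrt[OF tendsto_mult_right_zero[OF lim_r, of "(norm \<rho>)\<^sup>2"]] by simp
  qed
  from tendsto_diff[OF tendsto_const this, of "\<Lambda> x"]
  have lim2: "((\<lambda>F. \<Lambda> (xF F)) \<longlongrightarrow> \<Lambda> x) (finite_subsets_at_top onb)" by simp
  have "\<Lambda> x = blinfun_apply \<rho> (pre_W \<xi> b)"
    using tendsto_unique[OF _ lim2 lim1] by (simp add: finite_subsets_at_top_neq_bot)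
  then show "\<Lambda> (\<rho> o\<^sub>L (\<Delta> b o\<^sub>L tleft t \<xi>)) = blinfun_apply \<rho> (blinfun_apply Wst (t \<xi> (\<Lambda> b)))"
    by (simp add: x_def Wst_tensor b)
qed

text \<open>\<open>gns_intertwine\<close> with \<rho> equal to a left slice following \<Delta>(y):
  multiplicativity turns \<Delta>(y)\<Delta>(b) into \<Delta>(yb), and the GNS vector of yb is y
  applied to that of b.\<close>

lemma \<Delta>_Wst:
  assumes y: "y \<in> M"
  shows "\<Delta> y o\<^sub>L Wst = Wst o\<^sub>L op_tensor t id_blinfun y"
proof (rule dense_tensor_eqI, rule vector_eqI_slices)
  fix \<xi> b \<eta> assume b: "b \<in> N"
  note bM = N_M[OF b]
  let ?\<rho> = "radj (tleft t \<eta>) o\<^sub>L \<Delta> y"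
  have c: "clin ?\<rho>" by (simp add: clin_compose \<Delta>_clin y)
  have comm: "?\<rho> o\<^sub>L op_tensor t id_blinfun u = u o\<^sub>L ?\<rho>" if u: "u \<in> commutant M" for u
  proof -
    have "radj (tleft t \<eta>) o\<^sub>L op_tensor t id_blinfun u = u o\<^sub>L radj (tleft t \<eta>)"
      by (rule blinfun_eqI) (simp add: radj_tleft_op_tensor commutant_clin[OF u])
    then show ?thesis
      by (simp only: compose_assoc MM_commutes_right[OF \<Delta>_MM[OF y] u]) (simp only: compose_assoc[symmetric])
  qed
  have "blinfun_apply (radj (tleft t \<eta>)) (blinfun_apply (\<Delta> y) (blinfun_apply Wst (t \<xi> (\<Lambda> b))))
      = \<Lambda> (?\<rho> o\<^sub>L (\<Delta> b o\<^sub>L tleft t \<xi>))"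
    using gns_intertwine(2)[OF b c comm] by simp
  also have "?\<rho> o\<^sub>L (\<Delta> b o\<^sub>L tleft t \<xi>) = lsl t \<xi> \<eta> (\<Delta> (y o\<^sub>L b))"
    by (simp add: lsl_def \<Delta>_mult y bM compose_assoc)
  also have "\<Lambda> \<dots> = blinfun_apply (radj (tleft t \<eta>)) (blinfun_apply Wst (t \<xi> (\<Lambda> (y o\<^sub>L b))))"
    by (simp add: Wst_tensor N_mult y b slice_pre_W)
  finally show "blinfun_apply (radj (tleft t \<eta>)) (blinfun_apply (\<Delta> y o\<^sub>L Wst) (t \<xi> (\<Lambda> b)))
      = blinfun_apply (radj (tleft t \<eta>)) (blinfun_apply (Wst o\<^sub>L op_tensor t id_blinfun y) (t \<xi> (\<Lambda> b)))"
    by (simp add: gns_module y b M_clin)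
qed

text \<open>Semifiniteness approximates the identity by elements of \<open>N\<close> in the
  seminorms that control a normal functional.\<close>

lemma normal_fun_zero_on_N:
  assumes l2: "l2_seq \<xi>" "l2_seq \<eta>" and z: "\<And>b. b \<in> N \<Longrightarrow> normal_fun \<xi> \<eta> b = 0"
  shows "normal_fun \<xi> \<eta> id_blinfun = 0"
proof (rule ccontr)
  assume nz: "normal_fun \<xi> \<eta> id_blinfun \<noteq> 0"
  define C where "C = (\<Sum>n. (norm (\<eta> n))\<^sup>2)"
  have C0: "0 \<le> C" unfolding C_def using l2(2) by (simp add: l2_seq_def suminf_nonneg)
  \<comment> \<open>Chosen so that Cauchy-Schwarz bounds the squared value at the identity by
    \<open>\<epsilon> * C\<close>, strictly below \<open>\<epsilon> * (C + 1)\<close>, which is that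
    very square; \<open>C + 1\<close> also avoids division by zero.\<close>
  define \<epsilon> where "\<epsilon> = (cmod (normal_fun \<xi> \<eta> id_blinfun))\<^sup>2 / (C + 1)"
  have "\<epsilon> > 0" using nz C0 by (simp add: \<epsilon>_def)
  then obtain d where d: "d \<in> N" "(\<Sum>n. (norm (\<xi> n - blinfun_apply d (\<xi> n)))\<^sup>2) < \<epsilon>"
    using N_approximates_id[OF l2(1)] by metis
  have sd: "summable (\<lambda>n. (norm (\<xi> n - blinfun_apply d (\<xi> n)))\<^sup>2)"
    using summable_apply_l2[OF l2(1), of "id_blinfun - d"] by (simp add: blinfun.diff_left)
  have se: "summable (\<lambda>n. (norm (\<eta> n))\<^sup>2)" using l2(2) by (simp add: l2_seq_def)
  note sp = summable_norm_mult[OF sd se]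
  have "normal_fun \<xi> \<eta> id_blinfun = normal_fun \<xi> \<eta> id_blinfun - normal_fun \<xi> \<eta> d"
    using z[OF d(1)] by simp
  also have "\<dots> = (\<Sum>n. cinner (\<xi> n - blinfun_apply d (\<xi> n)) (\<eta> n))"
    unfolding normal_fun_def
    by (subst suminf_diff[OF summable_normal_fun[OF l2] summable_normal_fun[OF l2]])
      (simp add: cinner_diff_left)
  finally have "cmod (normal_fun \<xi> \<eta> id_blinfun) \<le> (\<Sum>n. norm (\<xi> n - blinfun_apply d (\<xi> n)) * norm (\<eta> n))"
    using norm_suminf_le[OF cmod_cinner_le sp] by metis
  then have "(cmod (normal_fun \<xi> \<eta> id_blinfun))\<^sup>2 \<le> (\<Sum>n. norm (\<xi> n - blinfun_apply d (\<xi> n)) * norm (\<eta> n))\<^sup>2"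
    by (intro power_mono) auto
  also have "\<dots> \<le> (\<Sum>n. (norm (\<xi> n - blinfun_apply d (\<xi> n)))\<^sup>2) * C"
    unfolding C_def by (rule suminf_mult_le_l2[OF sd se])
  also have "\<dots> \<le> \<epsilon> * C" using d(2) C0 by (intro mult_right_mono) auto
  also have "\<dots> < \<epsilon> * (C + 1)" using \<open>\<epsilon> > 0\<close> by simp
  also have "\<dots> = (cmod (normal_fun \<xi> \<eta> id_blinfun))\<^sup>2" using C0 by (simp add: \<epsilon>_def)
  finally show False by simp
qed

text \<open>Normality of \<Delta> makes each matrix coefficient of \<rho>\<Delta>(x) a normal
  functional of x. It vanishes on \<open>N\<close>, hence at the identity, where \<Delta>(1) = 1
  gives back \<rho>.\<close>

lemma zero_if_zero_on_\<Delta>: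
  fixes \<rho> :: "'k \<Rightarrow>\<^sub>L 'd::complex_hilbert"
  assumes c: "clin \<rho>" and z: "\<And>b. b \<in> N \<Longrightarrow> \<rho> o\<^sub>L \<Delta> b = 0"
  shows "\<rho> = 0"
proof (rule oper_eqI)
  fix v \<zeta>
  obtain \<xi>' \<eta>' where n: "l2_seq \<xi>'" "l2_seq \<eta>'" "\<And>x. x \<in> M \<Longrightarrow>
      normal_fun (single_seq v) (single_seq (blinfun_apply (radj \<rho>) \<zeta>)) (\<Delta> x) = normal_fun \<xi>' \<eta>' x"
    using \<Delta>_normal[OF l2_seq_single l2_seq_single, where thesis = thesis] by metis
  have eq: "normal_fun \<xi>' \<eta>' x = cinner (blinfun_apply (\<rho> o\<^sub>L \<Delta> x) v) \<zeta>" if "x \<in> M" for x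
    using n(3)[OF that] c by (simp add: cinner_radj)
  have "normal_fun \<xi>' \<eta>' id_blinfun = 0"
    by (rule normal_fun_zero_on_N[OF n(1,2)]) (simp add: eq N_M z)
  then show "cinner (blinfun_apply \<rho> v) \<zeta> = cinner (blinfun_apply 0 v) \<zeta>"
    using eq[OF M_id] by simp
qed

text \<open>Stands in for surjectivity of \<open>Wst\<close>. By \<open>gns_intertwine\<close> the
  values of \<open>\<rho>\<close> on the range of \<open>Wst\<close> are the GNS vectors of
  \<rho>\<Delta>(b)(\<xi> \<otimes> \<cdot>), and the GNS map is injective.\<close>

lemma zero_if_zero_on_Wst:
  fixes \<rho> :: "'k \<Rightarrow>\<^sub>L 'h"
  assumes c: "clin \<rho>"
    and comm: "\<And>u. u \<in> commutant M \<Longrightarrow> \<rho> o\<^sub>L op_tensor t id_blinfun u = u o\<^sub>L \<rho>"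
    and z: "\<rho> o\<^sub>L Wst = 0"
  shows "\<rho> = 0"
proof (rule zero_if_zero_on_\<Delta>[OF c])
  fix b assume b: "b \<in> N"
  have "\<rho> o\<^sub>L (\<Delta> b o\<^sub>L tleft t \<xi>) = 0" for \<xi>
  proof (rule \<Lambda>_inject[OF gns_intertwine(1)[OF b c comm]])
    have "blinfun_apply (\<rho> o\<^sub>L Wst) (t \<xi> (\<Lambda> b)) = 0" by (simp add: z)
    then show "\<Lambda> (\<rho> o\<^sub>L (\<Delta> b o\<^sub>L tleft t \<xi>)) = 0"
      using gns_intertwine(2)[OF b c comm] by simp
  qed
  then have "blinfun_apply (\<rho> o\<^sub>L (\<Delta> b o\<^sub>L tleft t \<xi>)) \<zeta> = 0" for \<xi> \<zeta> by simp
  then show "\<rho> o\<^sub>L \<Delta> b = 0" by (intro t.tensor_blinfun_eqI) simp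
qed

text \<open>The sequences \<open>\<alpha>\<close>, \<open>\<beta>\<close> represent the convolution
  product of two vector functionals. Both iterated coproducts are evaluated on a vector functional
  of the triple tensor product; each value is a normal functional on \<open>MM\<close>, identified
  by its values on elementary tensors.\<close>

lemma coassoc_slices:
  assumes b: "b \<in> M" and l2: "l2_seq \<alpha>" "l2_seq \<beta>"
    and \<alpha>\<beta>: "\<And>x. x \<in> M \<Longrightarrow> cinner (blinfun_apply (\<Delta> x) (t \<xi>1 \<xi>2)) (t \<eta>1 \<eta>2) = normal_fun \<alpha> \<beta> x"
  shows "lsl t \<xi>2 \<eta>2 (\<Delta> (lsl t \<xi>1 \<eta>1 (\<Delta> b))) = slice_left t \<alpha> \<beta> (\<Delta> b)"
proof (rule oper_eqI)
  fix \<xi>3 \<eta>3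
  obtain \<Delta>_id id_\<Delta> where co:
    "normal_hom MM (vn_tensor tL MM M) \<Delta>_id" "normal_hom MM (vn_tensor tR M MM) id_\<Delta>"
    "\<And>x y. x \<in> M \<Longrightarrow> y \<in> M \<Longrightarrow> \<Delta>_id (op_tensor t x y) = op_tensor tL (\<Delta> x) y"
    "\<And>x y. x \<in> M \<Longrightarrow> y \<in> M \<Longrightarrow> id_\<Delta> (op_tensor t x y) = op_tensor tR x (\<Delta> y)"
    "\<And>x. x \<in> M \<Longrightarrow> \<Delta>_id (\<Delta> x) = id_\<Delta> (\<Delta> x)"
    using coassoc unfolding coassociative_def MM_def by blast
  define u where "u = tL (t \<xi>1 \<xi>2) \<xi>3"
  define v where "v = tL (t \<eta>1 \<eta>2) \<eta>3"
  have uv: "u = tR \<xi>1 (t \<xi>2 \<xi>3)" "v = tR \<eta>1 (t \<eta>2 \<eta>3)"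
    by (simp_all add: u_def v_def tensor_assoc)
  have "\<exists>\<xi>' \<eta>'. l2_seq \<xi>' \<and> l2_seq \<eta>' \<and>
      (\<forall>x\<in>MM. normal_fun (single_seq u) (single_seq v) (\<Delta>_id x) = normal_fun \<xi>' \<eta>' x)"
    using co(1) l2_seq_single unfolding normal_hom_def by blast
  then obtain \<gamma> \<delta> where g: "l2_seq \<gamma>" "l2_seq \<delta>"
    "\<And>X. X \<in> MM \<Longrightarrow> cinner (blinfun_apply (\<Delta>_id X) u) v = normal_fun \<gamma> \<delta> X"
    by auto
  have "\<exists>\<xi>' \<eta>'. l2_seq \<xi>' \<and> l2_seq \<eta>' \<and>
      (\<forall>x\<in>MM. normal_fun (single_seq u) (single_seq v) (id_\<Delta> x) = normal_fun \<xi>' \<eta>' x)"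
    using co(2) l2_seq_single unfolding normal_hom_def by blast
  then obtain \<gamma>' \<delta>' where g': "l2_seq \<gamma>'" "l2_seq \<delta>'"
    "\<And>X. X \<in> MM \<Longrightarrow> cinner (blinfun_apply (id_\<Delta> X) u) v = normal_fun \<gamma>' \<delta>' X"
    by auto
  obtain \<alpha>' \<beta>' where a': "l2_seq \<alpha>'" "l2_seq \<beta>'"
    "\<And>x. x \<in> M \<Longrightarrow> normal_fun (single_seq (t \<xi>2 \<xi>3)) (single_seq (t \<eta>2 \<eta>3)) (\<Delta> x) = normal_fun \<alpha>' \<beta>' x"
    using \<Delta>_normal[OF l2_seq_single l2_seq_single, where thesis = thesis] by metis
  have 1: "normal_fun \<gamma> \<delta> X = normal_fun (\<lambda>n. t (\<alpha> n) \<xi>3) (\<lambda>n. t (\<beta> n) \<eta>3) X" if X: "X \<in> MM" for X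
  proof (rule normal_fun_eq_on_MM[OF g(1,2) _ _ _ X])
    fix x y assume xy: "x \<in> M" "y \<in> M"
    have "normal_fun \<gamma> \<delta> (op_tensor t x y) = cinner (blinfun_apply (op_tensor tL (\<Delta> x) y) u) v"
      using g(3)[OF op_tensor_MM[OF xy]] xy by (simp add: co(3))
    also have "\<dots> = normal_fun \<alpha> \<beta> x * cinner (blinfun_apply y \<xi>3) \<eta>3"
      using xy by (simp add: u_def v_def \<Delta>_clin M_clin tL.cinner_tensor \<alpha>\<beta>)
    also have "\<dots> = normal_fun (\<lambda>n. t (\<alpha> n) \<xi>3) (\<lambda>n. t (\<beta> n) \<eta>3) (op_tensor t x y)"
      unfolding normal_fun_def suminf_mult2[OF summable_normal_fun[OF l2]]
      using xy by (simp add: M_clin t.cinner_tensor)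
    finally show "normal_fun \<gamma> \<delta> (op_tensor t x y) = normal_fun (\<lambda>n. t (\<alpha> n) \<xi>3) (\<lambda>n. t (\<beta> n) \<eta>3) (op_tensor t x y)" .
  qed (intro l2_seq_tensor l2)+
  have 2: "normal_fun \<gamma>' \<delta>' X = normal_fun (\<lambda>n. t \<xi>1 (\<alpha>' n)) (\<lambda>n. t \<eta>1 (\<beta>' n)) X" if X: "X \<in> MM" for X
  proof (rule normal_fun_eq_on_MM[OF g'(1,2) _ _ _ X])
    fix x y assume xy: "x \<in> M" "y \<in> M"
    have "normal_fun \<gamma>' \<delta>' (op_tensor t x y) = cinner (blinfun_apply (op_tensor tR x (\<Delta> y)) u) v"
      using g'(3)[OF op_tensor_MM[OF xy]] xy by (simp add: co(4))
    also have "\<dots> = cinner (blinfun_apply x \<xi>1) \<eta>1 * normal_fun \<alpha>' \<beta>' y"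
      using xy a'(3)[OF xy(2)] by (simp add: uv \<Delta>_clin M_clin tR.cinner_tensor)
    also have "\<dots> = normal_fun (\<lambda>n. t \<xi>1 (\<alpha>' n)) (\<lambda>n. t \<eta>1 (\<beta>' n)) (op_tensor t x y)"
      unfolding normal_fun_def suminf_mult[OF summable_normal_fun[OF a'(1,2)], symmetric]
      using xy by (simp add: M_clin t.cinner_tensor)
    finally show "normal_fun \<gamma>' \<delta>' (op_tensor t x y) = normal_fun (\<lambda>n. t \<xi>1 (\<alpha>' n)) (\<lambda>n. t \<eta>1 (\<beta>' n)) (op_tensor t x y)" .
  qed (intro l2_seq_tensor' a')+
  note D = \<Delta>_MM[OF b]
  have "cinner (blinfun_apply (slice_left t \<alpha> \<beta> (\<Delta> b)) \<xi>3) \<eta>3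
      = normal_fun (\<lambda>n. t (\<alpha> n) \<xi>3) (\<lambda>n. t (\<beta> n) \<eta>3) (\<Delta> b)"
    by (simp add: cinner_slice_left l2 normal_fun_def)
  also have "\<dots> = cinner (blinfun_apply (id_\<Delta> (\<Delta> b)) u) v"
    using 1[OF D] g(3)[OF D] co(5)[OF b] by simp
  also have "\<dots> = normal_fun (\<lambda>n. t \<xi>1 (\<alpha>' n)) (\<lambda>n. t \<eta>1 (\<beta>' n)) (\<Delta> b)"
    using 2[OF D] g'(3)[OF D] by simp
  also have "\<dots> = normal_fun \<alpha>' \<beta>' (lsl t \<xi>1 \<eta>1 (\<Delta> b))"
    by (simp add: normal_fun_def t.cinner_lsl)
  also have "\<dots> = cinner (blinfun_apply (lsl t \<xi>2 \<eta>2 (\<Delta> (lsl t \<xi>1 \<eta>1 (\<Delta> b)))) \<xi>3) \<eta>3"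
    using a'(3)[OF lsl_in_M[OF D]] by (simp add: t.cinner_lsl)
  finally show "cinner (blinfun_apply (lsl t \<xi>2 \<eta>2 (\<Delta> (lsl t \<xi>1 \<eta>1 (\<Delta> b)))) \<xi>3) \<eta>3
      = cinner (blinfun_apply (slice_left t \<alpha> \<beta> (\<Delta> b)) \<xi>3) \<eta>3" by simp
qed

text \<open>The pentagon equation in sliced form: slicing the first leg of \<open>Wst\<close> turns
  the convolution of functionals into the product of slices in the opposite order. The identity for
  \<open>Wst\<close> comes from coassociativity on GNS vectors.\<close>

lemma \<Delta>_rsl_Wst:
  "cinner (blinfun_apply (\<Delta> (rsl t \<zeta> \<zeta>' Wst)) (t \<xi>1 \<xi>2)) (t \<eta>1 \<eta>2)
    = cinner (blinfun_apply (lsl t \<xi>2 \<eta>2 Wst) (blinfun_apply (lsl t \<xi>1 \<eta>1 Wst) \<zeta>)) \<zeta>'"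
proof -
  obtain \<alpha> \<beta> where a: "l2_seq \<alpha>" "l2_seq \<beta>" "\<And>x. x \<in> M \<Longrightarrow>
      normal_fun (single_seq (t \<xi>1 \<xi>2)) (single_seq (t \<eta>1 \<eta>2)) (\<Delta> x) = normal_fun \<alpha> \<beta> x"
    using \<Delta>_normal[OF l2_seq_single l2_seq_single, where thesis = thesis] by metis
  have eq: "slice_left t \<alpha> \<beta> Wst = lsl t \<xi>2 \<eta>2 Wst o\<^sub>L lsl t \<xi>1 \<eta>1 Wst"
  proof (rule dense_blinfun_eqI)
    fix b assume b: "b \<in> N"
    have "slice_left t \<alpha> \<beta> (\<Delta> b) = lsl t \<xi>2 \<eta>2 (\<Delta> (lsl t \<xi>1 \<eta>1 (\<Delta> b)))"
      using a(3) by (intro coassoc_slices[OF N_M[OF b] a(1,2), symmetric]) simp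
    then show "blinfun_apply (slice_left t \<alpha> \<beta> Wst) (\<Lambda> b) = blinfun_apply (lsl t \<xi>2 \<eta>2 Wst o\<^sub>L lsl t \<xi>1 \<eta>1 Wst) (\<Lambda> b)"
      by (simp add: slice_left_Wst a b lsl_Wst N_lsl)
  qed
  have "cinner (blinfun_apply (\<Delta> (rsl t \<zeta> \<zeta>' Wst)) (t \<xi>1 \<xi>2)) (t \<eta>1 \<eta>2) = normal_fun \<alpha> \<beta> (rsl t \<zeta> \<zeta>' Wst)"
    using a(3)[OF rsl_Wst_M] by simp
  also have "\<dots> = cinner (blinfun_apply (slice_left t \<alpha> \<beta> Wst) \<zeta>) \<zeta>'"
    by (simp add: cinner_slice_left a normal_fun_def t.cinner_rsl)
  finally show ?thesis by (simp add: eq)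
qed

end

section \<open>The unitary antipode\<close>

text \<open>\<open>f - c\<close>, continued by zero above the real axis, is holomorphic across the
  axis because it is continuous there; it vanishes on the upper half plane, hence in the strip. This
  turns a trivial scaling group into a trivial analytic extension.\<close>

lemma constant_on_strip:
  fixes f :: "complex \<Rightarrow> complex"
  assumes cont: "continuous_on {z. -1/2 \<le> Im z \<and> Im z \<le> 0} f"
    and hol: "f holomorphic_on {z. -1/2 < Im z \<and> Im z < 0}"
    and const: "\<And>r. f (complex_of_real r) = c"
  shows "f (- \<i> / 2) = c"
proof -
  define S where "S = {z. -1/2 < Im z}"
  define g where "g z = (if Im z \<le> 0 then f z - c else 0)" for z
  have S: "open S" "connected S"
    unfolding S_def by (auto simp: open_halfspace_Im_gt convex_connected convex_halfspace_Im_gt)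
  have contg: "continuous_on S g"
  proof -
    have "continuous_on ({z\<in>S. Im z \<le> 0} \<union> {z\<in>S. 0 \<le> Im z}) g"
      unfolding g_def
    proof (rule continuous_on_cases_local)
      show "closedin (top_of_set ({z\<in>S. Im z \<le> 0} \<union> {z\<in>S. 0 \<le> Im z})) {z\<in>S. Im z \<le> 0}"
        using closedin_closed_Int[OF closed_halfspace_Im_le[of 0], of "{z\<in>S. Im z \<le> 0} \<union> {z\<in>S. 0 \<le> Im z}"]
        by (rule back_subst) auto
      show "closedin (top_of_set ({z\<in>S. Im z \<le> 0} \<union> {z\<in>S. 0 \<le> Im z})) {z\<in>S. 0 \<le> Im z}"
        using closedin_closed_Int[OF closed_halfspace_Im_ge[of 0], of "{z\<in>S. Im z \<le> 0} \<union> {z\<in>S. 0 \<le> Im z}"]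
        by (rule back_subst) auto
      show "continuous_on {z\<in>S. Im z \<le> 0} (\<lambda>z. f z - c)"
        by (intro continuous_intros continuous_on_subset[OF cont]) (auto simp: S_def)
      show "continuous_on {z\<in>S. 0 \<le> Im z} (\<lambda>z. 0 :: complex)" by (intro continuous_intros)
      fix z assume "z \<in> {z\<in>S. Im z \<le> 0} \<and> \<not> Im z \<le> 0 \<or> z \<in> {z\<in>S. 0 \<le> Im z} \<and> Im z \<le> 0"
      then have "z = complex_of_real (Re z)" by (auto simp: complex_eq_iff)
      then show "f z - c = 0" using const[of "Re z"] by simp
    qed
    moreover have "{z\<in>S. Im z \<le> 0} \<union> {z\<in>S. 0 \<le> Im z} = S" by auto
    ultimately show ?thesis by simp
  qed
  have dot: "\<i> \<bullet> z = Im z" for z by (simp add: inner_complex_def)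
  have holg: "g holomorphic_on S"
  proof (rule holomorphic_on_paste_across_line[OF S(1), of \<i> g 0])
    have "(\<lambda>z. f z - c) holomorphic_on S \<inter> {z. \<i> \<bullet> z < 0}"
      by (intro holomorphic_intros holomorphic_on_subset[OF hol]) (auto simp: S_def dot)
    then show "g holomorphic_on S \<inter> {z. \<i> \<bullet> z < 0}"
      by (rule holomorphic_transform) (auto simp: g_def dot)
    have "(\<lambda>z. 0) holomorphic_on S \<inter> {z. 0 < \<i> \<bullet> z}" by (intro holomorphic_intros)
    then show "g holomorphic_on S \<inter> {z. 0 < \<i> \<bullet> z}"
      by (rule holomorphic_transform) (auto simp: g_def dot)
  qed (use contg in auto)
  have zero: "g z = 0" if "z \<in> S" for z
  proof (rule analytic_continuation_open[of "{z. 0 < Im z}" S g "\<lambda>_. 0"])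
    show "open {z. 0 < Im z}" by (rule open_halfspace_Im_gt)
    show "{z. 0 < Im z} \<noteq> {}" by (auto intro: exI[of _ \<i>])
    show "{z. 0 < Im z} \<subseteq> S" by (auto simp: S_def)
  qed (use S holg that in \<open>auto simp: g_def\<close>)
  \<comment> \<open>Approaches the boundary point \<open>- \<i> / 2\<close> from inside the half
    plane where \<open>g\<close> is holomorphic; continuity gives the value at the limit.\<close>
  define s where "s n = - (\<i> / 2) * complex_of_real (1 - 1 / real (Suc n))" for n
  have lim: "s \<longlonglongrightarrow> - (\<i> / 2) * complex_of_real (1 - 0)"
    unfolding s_def
    by (intro tendsto_intros) (use LIMSEQ_inverse_real_of_nat in \<open>simp add: inverse_eq_divide\<close>)
  have Ims: "Im (s n) = - (1 - 1 / real (Suc n)) / 2" for n by (simp add: s_def field_simps)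
  have bnds: "-1/2 < Im (s n)" "Im (s n) \<le> 0" for n
    unfolding Ims by (simp_all add: field_simps)
  have fs: "f (s n) = c" for n
    using zero[of "s n"] bnds[of n] by (simp add: S_def g_def)
  have "(\<lambda>n. f (s n)) \<longlonglongrightarrow> f (- (\<i> / 2))"
  proof (rule continuous_on_tendsto_compose[OF cont])
    show "s \<longlonglongrightarrow> - (\<i> / 2)" using lim by simp
    show "\<forall>\<^sub>F n in sequentially. s n \<in> {z. -1/2 \<le> Im z \<and> Im z \<le> 0}"
      using bnds by (intro always_eventually) (auto intro: less_imp_le)
  qed simp
  then have "(\<lambda>n. c) \<longlonglongrightarrow> f (- (\<i> / 2))" by (simp add: fs)
  from LIMSEQ_unique[OF this tendsto_const] show ?thesis by simp
qed

section \<open>The linear extension of the weight and the core of the antipode\<close>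

context gns_weight
begin

lemma sum_lessThan_4: "(\<Sum>k<4::nat. f k) = f 0 + f 1 + f 2 + (f 3 :: 'a::comm_monoid_add)"
  by (simp add: eval_nat_numeral add_ac)

lemma i_pow_3: "\<i> ^ 3 = - \<i>"
  by (simp add: power3_eq_cube)

lemma radj_cscale_M: "x \<in> M \<Longrightarrow> radj (cscale c x) = cscale (cnj c) (radj x)"
  by (rule radj_cscale[OF M_clin])

text \<open>Polarisation: the quarter squares of \<open>b + \<i> ^ k y\<close> are the four positive
  elements of finite weight that \<open>weight_ext\<close> asks for, and the same identity among GNS
  vectors computes the value.\<close>

lemma weight_ext_product:
  assumes b: "b \<in> N" and y: "y \<in> N"
  shows "weight_ext M \<phi> (radj y o\<^sub>L b) (cinner (\<Lambda> b) (\<Lambda> y))"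
proof -
  note M = N_M[OF b] N_M[OF y]
  note c = M_clin[OF M(1)] M_clin[OF M(2)]
  define v where "v k = b + cscale (\<i> ^ k) y" for k :: nat
  define p where "p k = (1/4) *\<^sub>R (radj (v k) o\<^sub>L v k)" for k
  have vN: "v k \<in> N" for k unfolding v_def by (intro N_add N_cscale b y)
  have p_pos: "p k \<in> pos_cone M" for k
    using square_pos_cone[OF N_M[OF vN]]
    by (auto simp: p_def pos_cone_def M_scaleR positive_op_def bounded_ops_iff clin_scaleR
        blinfun.scaleR_left complex_nonneg_Reals_iff)
  have \<phi>p: "\<phi> (p k) = ennreal ((1/4) * (norm (\<Lambda> (v k)))\<^sup>2)" for k
    unfolding p_def using weight_scale[OF square_pos_cone[OF N_M[OF vN]], of "1/4" k]
    by (simp add: weight_square vN ennreal_mult[symmetric])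
  have "radj y o\<^sub>L b = (\<Sum>k<4. cscale (\<i> ^ k) (p k))"
  proof (rule oper_eqI)
    fix \<xi> \<eta>
    have q: "cinner (blinfun_apply (p k) \<xi>) \<eta> = (1/4) * cinner (blinfun_apply (v k) \<xi>) (blinfun_apply (v k) \<eta>)" for k
      using M_clin[OF N_M[OF vN[of k]]] by (simp add: p_def blinfun.scaleR_left cinner_radj'[symmetric])
    show "cinner (blinfun_apply (radj y o\<^sub>L b) \<xi>) \<eta> = cinner (blinfun_apply (\<Sum>k<4. cscale (\<i> ^ k) (p k)) \<xi>) \<eta>"
      unfolding sum_lessThan_4 using c
      by (simp add: blinfun.add_left cinner_add_left cinner_scaleC_left q v_def cinner_add_right
          cinner_scaleC_right i_pow_3 cinner_radj'[symmetric] algebra_simps)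
  qed
  moreover have "cinner (\<Lambda> b) (\<Lambda> y) = (\<Sum>k<4. \<i> ^ k * complex_of_real (enn2real (\<phi> (p k))))"
  proof -
    have \<Lambda>v: "\<Lambda> (v k) = \<Lambda> b + \<i> ^ k *\<^sub>C \<Lambda> y" for k
      unfolding v_def by (simp add: gns_add b N_cscale y gns_scale)
    have "complex_of_real (enn2real (\<phi> (p k))) = (1/4) * cinner (\<Lambda> (v k)) (\<Lambda> (v k))" for k
      unfolding \<phi>p cinner_self by simp
    then show ?thesis
      unfolding sum_lessThan_4
      by (simp add: \<Lambda>v cinner_add_left cinner_add_right cinner_scaleC_left cinner_scaleC_right i_pow_3 algebra_simps)
  qed
  moreover have "\<phi> (p k) < top" for k by (simp add: \<phi>p)
  ultimately show ?thesis unfolding weight_ext_def using p_pos by blast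
qed

lemma pos_cone_radj: "x \<in> pos_cone M \<Longrightarrow> radj x = x"
proof (rule radj_unique)
  fix \<xi> \<eta> assume x: "x \<in> pos_cone M"
  then have c: "clin x" and pos: "\<And>\<zeta>. cinner (blinfun_apply x \<zeta>) \<zeta> \<in> \<real>\<^sub>\<ge>\<^sub>0"
    by (auto simp: pos_cone_def positive_op_def bounded_ops_iff)
  have im: "Im (cinner (blinfun_apply x \<zeta>) \<zeta>) = 0" for \<zeta>
    using pos[of \<zeta>] by (simp add: complex_nonneg_Reals_iff)
  have "Im (cinner (blinfun_apply x \<xi>) (\<i> *\<^sub>C \<eta>)) + Im (cinner (blinfun_apply x (\<i> *\<^sub>C \<eta>)) \<xi>) = 0"
    using im[of "\<xi> + \<i> *\<^sub>C \<eta>"] im[of \<xi>] im[of "\<i> *\<^sub>C \<eta>"]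
    by (simp add: blinfun.add_right cinner_add_left cinner_add_right)
  then have "Re (cinner (blinfun_apply x \<xi>) \<eta>) = Re (cinner (blinfun_apply x \<eta>) \<xi>)"
    by (simp add: clinD[OF c] cinner_scaleC_left cinner_scaleC_right)
  then show "inner (blinfun_apply x \<xi>) \<eta> = inner \<xi> (blinfun_apply x \<eta>)"
    by (metis inner_commute inner_eq_Re_cinner)
qed

text \<open>Positive elements are self-adjoint, so the combination determines
  \<open>p 0 - p 2\<close> and \<open>p 1 - p 3\<close> by adding the adjoint. Moving the subtracted
  terms to the other side leaves sums of positive elements, where additivity and finiteness of the
  weight apply.\<close>

lemma weight_ext_unique:
  assumes "weight_ext M \<phi> y z" "weight_ext M \<phi> y z'"
  shows "z = z'"
proof -
  obtain p where p: "\<And>k. k < 4 \<Longrightarrow> p k \<in> pos_cone M" "\<And>k. k < 4 \<Longrightarrow> \<phi> (p k) < top"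
    "y = (\<Sum>k<4. cscale (\<i> ^ k) (p k))" "z = (\<Sum>k<4. \<i> ^ k * complex_of_real (enn2real (\<phi> (p k))))"
    using assms(1) unfolding weight_ext_def by blast
  obtain q where q: "\<And>k. k < 4 \<Longrightarrow> q k \<in> pos_cone M" "\<And>k. k < 4 \<Longrightarrow> \<phi> (q k) < top"
    "y = (\<Sum>k<4. cscale (\<i> ^ k) (q k))" "z' = (\<Sum>k<4. \<i> ^ k * complex_of_real (enn2real (\<phi> (q k))))"
    using assms(2) unfolding weight_ext_def by blast
  have form: "(\<Sum>k<4. cscale (\<i> ^ k) (r k)) = (r 0 - r 2) + cscale \<i> (r 1 - r 3)"
    "radj (\<Sum>k<4. cscale (\<i> ^ k) (r k)) = (r 0 - r 2) - cscale \<i> (r 1 - r 3)"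
    if r: "\<And>k. k < 4 \<Longrightarrow> r k \<in> pos_cone M" for r
  proof -
    have m: "cscale (- \<i>) x = - cscale \<i> x" "cscale (- 1) x = - x" for x :: "'h oper"
      by (rule blinfun_eqI, simp add: scaleC_minus_left scaleC_minus_one blinfun.minus_left)+
    show 1: "(\<Sum>k<4. cscale (\<i> ^ k) (r k)) = (r 0 - r 2) + cscale \<i> (r 1 - r 3)"
      unfolding sum_lessThan_4 by (simp add: i_pow_3 m cscale_diff)
    have rr: "radj (r k) = r k" "r k \<in> M" if "k < 4" for k
      using pos_cone_radj[OF r[OF that]] r[OF that] by (auto simp: pos_cone_def)
    show "radj (\<Sum>k<4. cscale (\<i> ^ k) (r k)) = (r 0 - r 2) - cscale \<i> (r 1 - r 3)"
      unfolding 1 using rr[of 0] rr[of 1] rr[of 2] rr[of 3]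
      by (simp add: radj_add radj_diff radj_cscale_M M_diff m)
  qed
  have yp: "y = (p 0 - p 2) + cscale \<i> (p 1 - p 3)" "radj y = (p 0 - p 2) - cscale \<i> (p 1 - p 3)"
    unfolding p(3) by (rule form, erule p(1))+
  have yq: "y = (q 0 - q 2) + cscale \<i> (q 1 - q 3)" "radj y = (q 0 - q 2) - cscale \<i> (q 1 - q 3)"
    unfolding q(3) by (rule form, erule q(1))+
  have e1: "(p 0 - p 2) + cscale \<i> (p 1 - p 3) = (q 0 - q 2) + cscale \<i> (q 1 - q 3)"
    by (rule trans[OF yp(1)[symmetric] yq(1)])
  have e2: "(p 0 - p 2) - cscale \<i> (p 1 - p 3) = (q 0 - q 2) - cscale \<i> (q 1 - q 3)"
    by (rule trans[OF yp(2)[symmetric] yq(2)])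
  have "2 *\<^sub>R (p 0 - p 2) = 2 *\<^sub>R (q 0 - q 2)"
    using arg_cong2[OF e1 e2, of "(+)"] by (simp add: scaleR_2)
  then have d0': "p 0 - p 2 = q 0 - q 2" by simp
  then have d0: "p 0 + q 2 = q 0 + p 2" by (simp add: algebra_simps)
  have "cscale \<i> (p 1 - p 3) = cscale \<i> (q 1 - q 3)" using e1 unfolding d0' by simp
  then have "cscale (- \<i>) (cscale \<i> (p 1 - p 3)) = cscale (- \<i>) (cscale \<i> (q 1 - q 3))" by simp
  then have "p 1 - p 3 = q 1 - q 3" by (simp add: cscale_cscale)
  then have d1: "p 1 + q 3 = q 1 + p 3" by (simp add: algebra_simps)
  have fin: "\<phi> a + \<phi> b = \<phi> c + \<phi> d \<Longrightarrow> \<phi> a < top \<Longrightarrow> \<phi> b < top \<Longrightarrow> \<phi> c < top \<Longrightarrow> \<phi> d < top \<Longrightarrow>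
      enn2real (\<phi> a) + enn2real (\<phi> b) = enn2real (\<phi> c) + enn2real (\<phi> d)" for a b c d
    by (metis enn2real_plus)
  have w: "\<phi> a + \<phi> b = \<phi> c + \<phi> d"
    if "a \<in> pos_cone M" "b \<in> pos_cone M" "c \<in> pos_cone M" "d \<in> pos_cone M" "a + b = c + d" for a b c d
    using weight_add[OF that(1,2)] weight_add[OF that(3,4)] that(5) by simp
  have "enn2real (\<phi> (p 0)) + enn2real (\<phi> (q 2)) = enn2real (\<phi> (q 0)) + enn2real (\<phi> (p 2))"
    by (rule fin[OF w[OF _ _ _ _ d0]]) (auto intro: p q)
  moreover have "enn2real (\<phi> (p 1)) + enn2real (\<phi> (q 3)) = enn2real (\<phi> (q 1)) + enn2real (\<phi> (p 3))"
    by (rule fin[OF w[OF _ _ _ _ d1]]) (auto intro: p q)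
  ultimately show ?thesis
    unfolding p(4) q(4) sum_lessThan_4 by (simp add: i_pow_3 complex_eq_iff)
qed

end

context quantum_group
begin

text \<open>Identifies the generators of the core of the antipode with right slices: the antipode
  sends a slice of W, the adjoint of \<open>Wst\<close>, by the functional of
  \<open>\<Lambda> b\<close> and \<open>\<Lambda> a\<close> to the same slice of
  \<open>Wst\<close>.\<close>

lemma weight_slice_Wst:
  assumes a: "a \<in> N" and b: "b \<in> N"
  shows "weight_slice t M \<phi> (\<Delta> (cadj a) o\<^sub>L op_tensor t id_blinfun b) (rsl t (\<Lambda> b) (\<Lambda> a) (radj Wst))"
    and "weight_slice t M \<phi> (op_tensor t id_blinfun (cadj a) o\<^sub>L \<Delta> b) (rsl t (\<Lambda> b) (\<Lambda> a) Wst)"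
proof -
  note aM = N_M[OF a] and bM = N_M[OF b]
  note ca = M_clin[OF aM] and cb = M_clin[OF bM]
  have M1: "rsl t (\<Lambda> b) (\<Lambda> a) (radj Wst) \<in> M"
    using M_radj[OF rsl_Wst_M[of "\<Lambda> a" "\<Lambda> b"]] by (simp add: t.radj_rsl)
  have s1: "slice_left t \<xi> \<eta> (\<Delta> (cadj a) o\<^sub>L op_tensor t id_blinfun b) = radj (slice_left t \<eta> \<xi> (\<Delta> a)) o\<^sub>L b"
    if l2: "l2_seq \<xi>" "l2_seq \<eta>" for \<xi> \<eta>
  proof (rule oper_eqI)
    fix \<zeta> \<zeta>'
    have "cinner (blinfun_apply (radj (slice_left t \<eta> \<xi> (\<Delta> a)) o\<^sub>L b) \<zeta>) \<zeta>'
        = cnj (cinner (blinfun_apply (slice_left t \<eta> \<xi> (\<Delta> a)) \<zeta>') (blinfun_apply b \<zeta>))"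
      using clin_slice_left[OF l2(2,1) \<Delta>_clin[OF aM]]
      by (simp add: cinner_radj'[symmetric]) (rule cinner_commute)
    also have "\<dots> = (\<Sum>n. cnj (cinner (blinfun_apply (\<Delta> a) (t (\<eta> n) \<zeta>')) (t (\<xi> n) (blinfun_apply b \<zeta>))))"
      unfolding cinner_slice_left[OF l2(2,1)]
      using slice_left_sums[OF l2(2,1)] by (intro bounded_linear.suminf[OF bounded_linear_cnj] sums_summable)
    also have "\<dots> = (\<Sum>n. cinner (blinfun_apply (\<Delta> (cadj a) o\<^sub>L op_tensor t id_blinfun b) (t (\<xi> n) \<zeta>)) (t (\<eta> n) \<zeta>'))"
      using cb \<Delta>_clin[OF aM]
      by (simp add: M_cadj aM \<Delta>_radj cinner_radj'[symmetric] cinner_commute[symmetric])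
    finally show "cinner (blinfun_apply (slice_left t \<xi> \<eta> (\<Delta> (cadj a) o\<^sub>L op_tensor t id_blinfun b)) \<zeta>) \<zeta>'
      = cinner (blinfun_apply (radj (slice_left t \<eta> \<xi> (\<Delta> a)) o\<^sub>L b) \<zeta>) \<zeta>'"
      by (simp add: cinner_slice_left l2)
  qed
  have s2: "slice_left t \<xi> \<eta> (op_tensor t id_blinfun (cadj a) o\<^sub>L \<Delta> b) = radj a o\<^sub>L slice_left t \<xi> \<eta> (\<Delta> b)"
    if l2: "l2_seq \<xi>" "l2_seq \<eta>" for \<xi> \<eta>
  proof (rule oper_eqI)
    fix \<zeta> \<zeta>'
    have "cinner (blinfun_apply (op_tensor t id_blinfun (radj a) o\<^sub>L \<Delta> b) (t x \<zeta>)) (t y \<zeta>')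
        = cinner (blinfun_apply (\<Delta> b) (t x \<zeta>)) (t y (blinfun_apply a \<zeta>'))" for x y
      using ca t.radj_op_tensor[OF clin_id ca]
        cinner_radj'[OF t.clin_op_tensor[OF clin_id ca], of "blinfun_apply (\<Delta> b) (t x \<zeta>)" "t y \<zeta>'"] by simp
    then show "cinner (blinfun_apply (slice_left t \<xi> \<eta> (op_tensor t id_blinfun (cadj a) o\<^sub>L \<Delta> b)) \<zeta>) \<zeta>'
        = cinner (blinfun_apply (radj a o\<^sub>L slice_left t \<xi> \<eta> (\<Delta> b)) \<zeta>) \<zeta>'"
      using ca by (simp add: cinner_slice_left l2 M_cadj aM cinner_radj'[symmetric])
  qed
  have w1: "normal_fun \<xi> \<eta> (rsl t (\<Lambda> b) (\<Lambda> a) (radj Wst)) = cinner (\<Lambda> b) (\<Lambda> (slice_left t \<eta> \<xi> (\<Delta> a)))"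
    if l2: "l2_seq \<xi>" "l2_seq \<eta>" for \<xi> \<eta>
  proof -
    have "cinner (\<Lambda> b) (\<Lambda> (slice_left t \<eta> \<xi> (\<Delta> a))) = cnj (cinner (blinfun_apply (slice_left t \<eta> \<xi> Wst) (\<Lambda> a)) (\<Lambda> b))"
      unfolding slice_left_Wst[OF a l2(2,1)] by (rule cinner_commute)
    also have "\<dots> = (\<Sum>n. cnj (cinner (blinfun_apply Wst (t (\<eta> n) (\<Lambda> a))) (t (\<xi> n) (\<Lambda> b))))"
      unfolding cinner_slice_left[OF l2(2,1)]
      using slice_left_sums[OF l2(2,1)] by (intro bounded_linear.suminf[OF bounded_linear_cnj] sums_summable)
    also have "\<dots> = normal_fun \<xi> \<eta> (rsl t (\<Lambda> b) (\<Lambda> a) (radj Wst))"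
      by (simp add: normal_fun_def t.cinner_rsl cinner_radj'[symmetric] cinner_commute[symmetric])
    finally show ?thesis by simp
  qed
  have w2: "normal_fun \<xi> \<eta> (rsl t (\<Lambda> b) (\<Lambda> a) Wst) = cinner (\<Lambda> (slice_left t \<xi> \<eta> (\<Delta> b))) (\<Lambda> a)"
    if l2: "l2_seq \<xi>" "l2_seq \<eta>" for \<xi> \<eta>
    unfolding slice_left_Wst[OF b l2, symmetric] cinner_slice_left[OF l2] normal_fun_def
    by (simp add: t.cinner_rsl)
  show "weight_slice t M \<phi> (\<Delta> (cadj a) o\<^sub>L op_tensor t id_blinfun b) (rsl t (\<Lambda> b) (\<Lambda> a) (radj Wst))"
    unfolding weight_slice_def using M1
    by (simp add: s1 w1 weight_ext_product N_slice_left(1) a b)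
  show "weight_slice t M \<phi> (op_tensor t id_blinfun (cadj a) o\<^sub>L \<Delta> b) (rsl t (\<Lambda> b) (\<Lambda> a) Wst)"
    unfolding weight_slice_def
    by (simp add: s2 w2 weight_ext_product N_slice_left(1) a b rsl_Wst_M)
qed

lemma weight_slice_unique:
  assumes "weight_slice t M \<phi> X x" "weight_slice t M \<phi> X y"
  shows "x = y"
proof (rule oper_eqI)
  fix \<xi> \<eta>
  have "weight_ext M \<phi> (slice_left t (single_seq \<xi>) (single_seq \<eta>) X) (normal_fun (single_seq \<xi>) (single_seq \<eta>) x)"
    "weight_ext M \<phi> (slice_left t (single_seq \<xi>) (single_seq \<eta>) X) (normal_fun (single_seq \<xi>) (single_seq \<eta>) y)"
    using assms l2_seq_single unfolding weight_slice_def by blast+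
  then show "cinner (blinfun_apply x \<xi>) \<eta> = cinner (blinfun_apply y \<xi>) \<eta>"
    using weight_ext_unique by fastforce
qed

lemma antipode_core_eq:
  "antipode_core t M \<Delta> \<phi> = {(rsl t (\<Lambda> b) (\<Lambda> a) (radj Wst), rsl t (\<Lambda> b) (\<Lambda> a) Wst) | a b. a \<in> N \<and> b \<in> N}"
proof (intro set_eqI iffI)
  fix z assume "z \<in> antipode_core t M \<Delta> \<phi>"
  then obtain x y a b where ab: "z = (x, y)" "a \<in> N" "b \<in> N"
      "weight_slice t M \<phi> (\<Delta> (cadj a) o\<^sub>L op_tensor t id_blinfun b) x"
      "weight_slice t M \<phi> (op_tensor t id_blinfun (cadj a) o\<^sub>L \<Delta> b) y"
    unfolding antipode_core_def by blast
  then have "x = rsl t (\<Lambda> b) (\<Lambda> a) (radj Wst)" "y = rsl t (\<Lambda> b) (\<Lambda> a) Wst"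
    using weight_slice_unique weight_slice_Wst by blast+
  then show "z \<in> {(rsl t (\<Lambda> b) (\<Lambda> a) (radj Wst), rsl t (\<Lambda> b) (\<Lambda> a) Wst) | a b. a \<in> N \<and> b \<in> N}"
    using ab(1-3) by blast
next
  fix z assume "z \<in> {(rsl t (\<Lambda> b) (\<Lambda> a) (radj Wst), rsl t (\<Lambda> b) (\<Lambda> a) Wst) | a b. a \<in> N \<and> b \<in> N}"
  then show "z \<in> antipode_core t M \<Delta> \<phi>"
    unfolding antipode_core_def using weight_slice_Wst by blast
qed

end

text \<open>The Kac hypotheses in the form in which they are used: with a trivial scaling group the
  antipode is the graph of \<open>R\<close> over all of \<open>M\<close>. This contains both the
  values of \<open>R\<close> on the slices of W and the density of those slices.\<close>

locale kac_group = quantum_group t tL tR M \<Delta> \<phi> \<Lambda>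
  for t :: "'h::complex_hilbert \<Rightarrow> 'h \<Rightarrow> 'k::complex_hilbert"
    and tL :: "'k \<Rightarrow> 'h \<Rightarrow> 'l::complex_hilbert"
    and tR :: "'h \<Rightarrow> 'k \<Rightarrow> 'l"
    and M :: "'h oper set"
    and \<Delta> :: "'h oper \<Rightarrow> 'k oper"
    and \<phi> :: "'h oper \<Rightarrow> ennreal"
    and \<Lambda> :: "'h oper \<Rightarrow> 'h" +
  fixes R :: "'h oper \<Rightarrow> 'h oper" and \<delta> :: "('h \<times> 'h) set"
  assumes R_anti: "involutive_antiautomorphism M R"
    and R_antipode: "antipode t M \<Delta> \<phi> = {(x, R x) | x. x \<in> M}"
    and R_modular: "modular_element M \<phi> R \<delta>"

lemma kac_group_exists:
  assumes "kac_algebra t tL tR M \<Delta> \<phi> \<Lambda>"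
  obtains R \<delta> where "kac_group t tL tR M \<Delta> \<phi> \<Lambda> R \<delta>"
proof -
  interpret kac_algebra t tL tR M \<Delta> \<phi> \<Lambda> by (rule assms)
  interpret quantum_group t tL tR M \<Delta> \<phi> \<Lambda> by unfold_locales
  obtain R \<tau> \<delta> where K: "antipode_polar_decomposition t M \<Delta> \<phi> R \<tau>" "\<And>r x. x \<in> M \<Longrightarrow> \<tau> r x = x"
    "modular_element M \<phi> R \<delta>"
    using kac by blast
  \<comment> \<open>For a trivial group each function \<open>F\<close> is constant on the real axis,
    so its value at \<open>- \<i> / 2\<close> is the same constant.\<close>
  have "(x, y) \<in> analytic_extension M \<tau> \<longleftrightarrow> x \<in> M \<and> y = x" for x y
  proof
    assume "(x, y) \<in> analytic_extension M \<tau>"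
    then obtain F where F: "x \<in> M" "\<And>r. F (complex_of_real r) = \<tau> r x" "F (- \<i> / 2) = y"
      "\<And>\<xi> \<eta>. l2_seq \<xi> \<Longrightarrow> l2_seq \<eta> \<Longrightarrow>
        continuous_on {z. -1/2 \<le> Im z \<and> Im z \<le> 0} (\<lambda>z. normal_fun \<xi> \<eta> (F z))"
      "\<And>\<xi> \<eta>. l2_seq \<xi> \<Longrightarrow> l2_seq \<eta> \<Longrightarrow>
        (\<lambda>z. normal_fun \<xi> \<eta> (F z)) holomorphic_on {z. -1/2 < Im z \<and> Im z < 0}"
      unfolding analytic_extension_def by blast
    have "y = x"
    proof (rule oper_eqI)
      fix \<xi> \<eta>
      have "normal_fun (single_seq \<xi>) (single_seq \<eta>) (F (- \<i> / 2)) = normal_fun (single_seq \<xi>) (single_seq \<eta>) x"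
        by (rule constant_on_strip[OF F(4,5)]) (simp_all add: F(2) K(2)[OF F(1)])
      then show "cinner (blinfun_apply y \<xi>) \<eta> = cinner (blinfun_apply x \<xi>) \<eta>" unfolding F(3) by simp
    qed
    then show "x \<in> M \<and> y = x" using F(1) by blast
  next
    assume "x \<in> M \<and> y = x"
    then show "(x, y) \<in> analytic_extension M \<tau>"
      unfolding analytic_extension_def using K(2) by (auto intro!: exI[of _ "\<lambda>_. x"] continuous_intros holomorphic_intros)
  qed
  then have "kac_group t tL tR M \<Delta> \<phi> \<Lambda> R \<delta>"
    using K unfolding antipode_polar_decomposition_def by unfold_locales auto
  then show ?thesis by (rule that)
qed

context kac_group
begin

lemma
  shows R_M: "x \<in> M \<Longrightarrow> R x \<in> M"
    and R_R: "x \<in> M \<Longrightarrow> R (R x) = x"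
    and R_add: "x \<in> M \<Longrightarrow> y \<in> M \<Longrightarrow> R (x + y) = R x + R y"
    and R_mult: "x \<in> M \<Longrightarrow> y \<in> M \<Longrightarrow> R (x o\<^sub>L y) = R y o\<^sub>L R x"
    and R_cscale: "x \<in> M \<Longrightarrow> R (cscale c x) = cscale c (R x)"
  using R_anti unfolding involutive_antiautomorphism_def by blast+

lemma R_radj: "x \<in> M \<Longrightarrow> R (radj x) = radj (R x)"
  using R_anti M_cadj R_M unfolding involutive_antiautomorphism_def by metis

lemma R_zero [simp]: "R 0 = 0"
  using R_cscale[OF M_zero, of 0] by simp

lemma R_diff: "x \<in> M \<Longrightarrow> y \<in> M \<Longrightarrow> R (x - y) = R x - R y"
  using R_add[of "x - y" y] by (simp add: M_diff)

lemma R_sum: "(\<And>i. i \<in> I \<Longrightarrow> f i \<in> M) \<Longrightarrow> R (\<Sum>i\<in>I. f i) = (\<Sum>i\<in>I. R (f i))"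
  by (induction I rule: infinite_finite_induct) (auto simp: R_add M_sum)

lemma R_id [simp]: "R id_blinfun = id_blinfun"
proof -
  have "R (id_blinfun o\<^sub>L R id_blinfun) = R (R id_blinfun) o\<^sub>L R id_blinfun"
    by (intro R_mult R_M M_id)
  then show ?thesis by (simp add: R_R)
qed

end

context hilbert_square
begin

lemma flip_exists:
  obtains F :: "'k oper" where "clin F" "\<And>a b. blinfun_apply F (t a b) = t b a"
proof -
  define S where "S = {(t a b, t b a) | a b. True}"
  have iso: "inner (snd p) (snd q) = inner (fst p) (fst q)" if "p \<in> span S" "q \<in> span S" for p q
    by (rule inner_eq_on_span[OF _ that])
      (auto simp: S_def cinner_tensor mult.commute intro!: inner_eqI_cinner)
  have bd: "norm w \<le> 1 * norm u" if "(u, w) \<in> span S" for u w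
    using iso[OF that that] by (simp add: norm_eq_sqrt_inner)
  have "fst ` span S = span (fst ` S)"
    by (rule linear_span_image[symmetric]) (rule linear_fst)
  moreover have "fst ` S = {t a b | a b. True}" by (force simp: S_def)
  ultimately have dn: "closure (fst ` span S) = UNIV" using dense by simp
  obtain F where F: "\<And>u w. (u, w) \<in> span S \<Longrightarrow> blinfun_apply F u = w"
    using bounded_extension[OF subspace_span bd dn, where thesis = thesis] by metis
  have Ft: "blinfun_apply F (t a b) = t b a" for a b
    by (rule F, rule span_base) (auto simp: S_def)
  have "F o\<^sub>L cscale c id_blinfun = cscale c F" for c
    by (rule tensor_blinfun_eqI) (simp add: scale_left[symmetric] Ft, simp add: scale_left scale_right Ft)
  then have "blinfun_apply (F o\<^sub>L cscale c id_blinfun) v = blinfun_apply (cscale c F) v" for c v by simp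
  then have "clin F" by (simp add: clin_def)
  then show ?thesis using Ft that by blast
qed

end

section \<open>The pentagon equation\<close>

context quantum_group
begin

lemma dense_cinner_eqI:
  assumes "\<And>a. a \<in> N \<Longrightarrow> cinner v (\<Lambda> a) = cinner w (\<Lambda> a)"
  shows "v = w"
proof -
  have "closure (\<Lambda> ` N) \<subseteq> {z. inner (v - w) z = 0}"
  proof (rule closure_minimal)
    show "closed {z. inner (v - w) z = 0}" by (intro closed_Collect_eq continuous_intros)
  qed (auto simp: assms inner_eq_Re_cinner cinner_diff_left)
  then have "inner (v - w) (v - w) = 0" using gns_dense by blast
  then show ?thesis by simp
qed

text \<open>The coproduct of a right slice \<open>y\<close> of \<open>Wst\<close> is known in two
  ways, through \<open>\<Delta>_Wst\<close> and through \<open>\<Delta>_rsl_Wst\<close>. Eliminating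
  \<open>y\<close> leaves an identity for \<open>Wst\<close> alone. Its right-hand side lies in the
  range of \<open>Wst\<close>, so that range is invariant under the left slices of
  \<open>Wst\<close> acting in the first leg; \<open>\<Theta>\<close> depends on
  \<open>\<beta>\<close> and \<open>q\<close> only.\<close>

lemma pentagon_slice:
  obtains \<Theta> :: "'k oper" where "clin \<Theta>" "\<And>a b. blinfun_apply \<Theta> (t a b) = t b (blinfun_apply (lsl t a \<beta> Wst) q)"
    "\<And>\<xi> p. blinfun_apply (op_tensor t (lsl t \<xi> \<beta> Wst) id_blinfun) (blinfun_apply Wst (t p q))
      = blinfun_apply Wst (blinfun_apply \<Theta> (blinfun_apply Wst (t \<xi> p)))"
proof -
  obtain F :: "'k oper" where F: "clin F" "\<And>a b. blinfun_apply F (t a b) = t b a"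
    by (rule flip_exists) (rule that)
  define A where "A = radj (tleft t \<beta>) o\<^sub>L (Wst o\<^sub>L tright t q)"
  have A: "clin A" "blinfun_apply A a = blinfun_apply (lsl t a \<beta> Wst) q" for a
    by (simp_all add: A_def clin_compose t.lsl_apply)
  define \<Theta> where "\<Theta> = F o\<^sub>L op_tensor t A id_blinfun"
  have \<Theta>: "clin \<Theta>" "blinfun_apply \<Theta> (t a b) = t b (blinfun_apply (lsl t a \<beta> Wst) q)" for a b
    by (simp_all add: \<Theta>_def clin_compose F A)
  have "blinfun_apply (op_tensor t (lsl t \<xi> \<beta> Wst) id_blinfun) (blinfun_apply Wst (t p q))
      = blinfun_apply Wst (blinfun_apply \<Theta> (blinfun_apply Wst (t \<xi> p)))" for \<xi> p
  proof (rule t.tensor_cinner_eqI)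
    fix x c
    define y where "y = rsl t q c Wst"
    have yM: "y \<in> M" unfolding y_def by (rule rsl_Wst_M)
    define l where "l = lsl t \<xi> \<beta> Wst"
    have cl: "clin l" by (simp add: l_def)
    have eq: "blinfun_apply (radj (\<Delta> y)) (t \<beta> x) = blinfun_apply (radj (Wst o\<^sub>L \<Theta>)) (t x c)"
    proof (rule t.tensor_cinner_eqI)
      fix a b
      have "cinner (t a b) (blinfun_apply (radj (\<Delta> y)) (t \<beta> x)) = cinner (blinfun_apply (\<Delta> y) (t a b)) (t \<beta> x)"
        by (simp add: cinner_radj \<Delta>_clin yM)
      also have "\<dots> = cinner (blinfun_apply (lsl t b x Wst) (blinfun_apply (lsl t a \<beta> Wst) q)) c"
        unfolding y_def by (rule \<Delta>_rsl_Wst)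
      also have "\<dots> = cinner (blinfun_apply (Wst o\<^sub>L \<Theta>) (t a b)) (t x c)"
        by (simp add: \<Theta> t.cinner_lsl)
      also have "\<dots> = cinner (t a b) (blinfun_apply (radj (Wst o\<^sub>L \<Theta>)) (t x c))"
        by (rule cinner_radj) (simp add: clin_compose \<Theta>)
      finally show "cinner (blinfun_apply (radj (\<Delta> y)) (t \<beta> x)) (t a b)
          = cinner (blinfun_apply (radj (Wst o\<^sub>L \<Theta>)) (t x c)) (t a b)"
        by (metis cinner_commute)
    qed
    have "cinner (blinfun_apply (op_tensor t l id_blinfun) (blinfun_apply Wst (t p q))) (t x c)
        = cinner (blinfun_apply Wst (t p q)) (t (blinfun_apply (radj l) x) c)"
      by (simp add: cinner_radj cl t.radj_op_tensor)
    also have "\<dots> = cinner (blinfun_apply l (blinfun_apply y p)) x"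
      by (simp add: cinner_radj cl y_def t.cinner_rsl)
    also have "\<dots> = cinner (blinfun_apply (Wst o\<^sub>L op_tensor t id_blinfun y) (t \<xi> p)) (t \<beta> x)"
      by (simp add: l_def t.cinner_lsl M_clin yM)
    also have "\<dots> = cinner (blinfun_apply (\<Delta> y) (blinfun_apply Wst (t \<xi> p))) (t \<beta> x)"
      by (simp add: \<Delta>_Wst[OF yM, symmetric])
    also have "\<dots> = cinner (blinfun_apply Wst (blinfun_apply \<Theta> (blinfun_apply Wst (t \<xi> p)))) (t x c)"
      by (simp add: cinner_radj \<Delta>_clin yM eq clin_compose \<Theta> radj_compose)
    finally show "cinner (blinfun_apply (op_tensor t (lsl t \<xi> \<beta> Wst) id_blinfun) (blinfun_apply Wst (t p q))) (t x c)
        = cinner (blinfun_apply Wst (blinfun_apply \<Theta> (blinfun_apply Wst (t \<xi> p)))) (t x c)"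
      by (simp add: l_def)
  qed
  then show ?thesis using that \<Theta> by blast
qed

end

section \<open>A conjugate-linear isometry implementing \<open>R\<close>\<close>

context kac_group
begin

lemma R_Wst_core:
  assumes "a \<in> N" "b \<in> N"
  shows "R (rsl t (\<Lambda> b) (\<Lambda> a) (radj Wst)) = rsl t (\<Lambda> b) (\<Lambda> a) Wst"
proof -
  let ?x = "rsl t (\<Lambda> b) (\<Lambda> a) (radj Wst)" and ?y = "rsl t (\<Lambda> b) (\<Lambda> a) Wst"
  have core: "(?x, ?y) \<in> span (antipode_core t M \<Delta> \<phi>)"
    unfolding antipode_core_eq using assms by (intro span_base) blast
  have M: "?x \<in> M" "?y \<in> M"
    using weight_slice_Wst[OF assms] unfolding weight_slice_def by auto
  have "sstar \<xi> 0 = 0" for \<xi> :: "nat \<Rightarrow> 'h"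
    by (simp add: sstar_def cadj_eq_radj)
  then have "(?x, ?y) \<in> antipode t M \<Delta> \<phi>"
    unfolding antipode_def using M core by (auto intro!: bexI[OF _ core])
  then show ?thesis unfolding R_antipode by auto
qed

text \<open>The GNS space of \<phi> \<circ> R has two models: one sends \<open>a\<close> to the GNS
  vector of the adjoint of \<open>R a\<close>, the other sends it to the GNS vector of the closure
  \<open>b\<close> of \<open>a\<close> times the square root of the modular element.
  \<open>J\<close> carries the first to the second. It is conjugate linear because the adjoint
  occurs in the first model only.\<close>

lemma J_ex:
  "\<exists>J :: 'h oper. aclin J \<and> (\<forall>v. norm (blinfun_apply J v) = norm v) \<and>
    (\<forall>y\<in>M. \<forall>v. blinfun_apply y (blinfun_apply J v) = blinfun_apply J (blinfun_apply (radj (R y)) v))"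
proof -
  obtain h where h: "let K = {(a, b). a \<in> M \<and> b \<in> N \<and> (\<forall>(\<xi>, \<eta>)\<in>h. blinfun_apply b \<xi> = blinfun_apply a \<eta>)}
       in (\<forall>(a, b)\<in>K. \<phi> (R (cadj a o\<^sub>L a)) = \<phi> (cadj b o\<^sub>L b)) \<and>
          (\<forall>x\<in>nideal M (\<phi> \<circ> R). \<forall>\<xi> \<epsilon>. l2_seq \<xi> \<and> 0 < \<epsilon> \<longrightarrow>
             (\<exists>(a, b)\<in>K. sstar \<xi> (x - a) < \<epsilon> \<and> \<phi> (R (cadj (x - a) o\<^sub>L (x - a))) < ennreal \<epsilon>))"
    using R_modular unfolding modular_element_def by blast
  define K where "K = {(a, b). a \<in> M \<and> b \<in> N \<and> (\<forall>(\<xi>, \<eta>)\<in>h. blinfun_apply b \<xi> = blinfun_apply a \<eta>)}"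
  have K1: "\<phi> (R (cadj a o\<^sub>L a)) = \<phi> (cadj b o\<^sub>L b)" if "(a, b) \<in> K" for a b
    using h that unfolding Let_def K_def[symmetric] by fast
  have K2: "\<exists>(a, b)\<in>K. \<phi> (R (cadj (x - a) o\<^sub>L (x - a))) < ennreal \<epsilon>"
    if x: "x \<in> nideal M (\<phi> \<circ> R)" and e: "0 < \<epsilon>" for x \<epsilon>
  proof -
    have "\<exists>(a, b)\<in>K. sstar (single_seq 0) (x - a) < \<epsilon> \<and> \<phi> (R (cadj (x - a) o\<^sub>L (x - a))) < ennreal \<epsilon>"
      using h x e l2_seq_single unfolding Let_def K_def[symmetric] by blast
    then show ?thesis by blast
  qed
  have K_iff: "(a, b) \<in> K \<longleftrightarrow> a \<in> M \<and> b \<in> N \<and> (\<forall>\<xi> \<eta>. (\<xi>, \<eta>) \<in> h \<longrightarrow> blinfun_apply b \<xi> = blinfun_apply a \<eta>)" for a b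
    by (auto simp: K_def)
  have KM: "a \<in> M" "b \<in> N" if "(a, b) \<in> K" for a b using that by (auto simp: K_iff)
  have K_add: "(a + a', b + b') \<in> K" if "(a, b) \<in> K" "(a', b') \<in> K" for a b a' b'
    using that by (auto simp: K_iff M_add N_add blinfun.add_left)
  have K_mult: "(y o\<^sub>L a, y o\<^sub>L b) \<in> K" if "(a, b) \<in> K" "y \<in> M" for a b y
    using that by (auto simp: K_iff M_compose N_mult)
  have K_zero: "(0, 0) \<in> K" by (auto simp: K_iff)
  have K_cscale: "(cscale c a, cscale c b) \<in> K" if "(a, b) \<in> K" for a b c
    using K_mult[OF that M_cscale[OF M_id, of c]] by (simp add: compose_cscale_left)
  \<comment> \<open>\<open>R\<close> and the adjoint both reverse products, so \<open>u\<close> is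
    multiplicative; this gives the commutation relation of \<open>J\<close> with
    \<open>M\<close>.\<close>
  define u where "u a = radj (R a)" for a
  have uM: "u a \<in> M" if "a \<in> M" for a unfolding u_def by (intro M_radj R_M that)
  have sq: "radj (u a) o\<^sub>L u a = R (radj a o\<^sub>L a)" if "a \<in> M" for a
    using that by (simp add: u_def R_mult M_radj R_radj)
  have uN: "u a \<in> N" and normu: "norm (\<Lambda> (u a)) = norm (\<Lambda> b)" if ab: "(a, b) \<in> K" for a b
  proof -
    note m = KM[OF ab]
    have e: "\<phi> (radj (u a) o\<^sub>L u a) = ennreal ((norm (\<Lambda> b))\<^sup>2)"
      using K1[OF ab] m by (simp add: sq M_cadj N_M weight_square)
    show N: "u a \<in> N" unfolding N_iff using e uM[OF m(1)] by simp
    have "(norm (\<Lambda> (u a)))\<^sup>2 = (norm (\<Lambda> b))\<^sup>2"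
      using e by (simp add: weight_square[OF N])
    then show "norm (\<Lambda> (u a)) = norm (\<Lambda> b)" by simp
  qed
  have u_add: "u (a + a') = u a + u a'" if "a \<in> M" "a' \<in> M" for a a'
    using that by (simp add: u_def R_add radj_add)
  have u_cscale: "u (cscale c a) = cscale (cnj c) (u a)" if "a \<in> M" for a c
    using that by (simp add: u_def R_cscale radj_cscale_M R_M)
  define G where "G = {(\<Lambda> (u a), \<Lambda> b) | a b. (a, b) \<in> K}"
  have sG: "subspace G"
  proof (rule subspaceI)
    have "u 0 = 0" by (simp add: u_def)
    then show "0 \<in> G" unfolding G_def using K_zero by (auto simp: zero_prod_def intro!: exI[of _ 0])
  next
    fix x y assume "x \<in> G" "y \<in> G"
    then obtain a b a' b' where *: "(a, b) \<in> K" "(a', b') \<in> K" "x = (\<Lambda> (u a), \<Lambda> b)" "y = (\<Lambda> (u a'), \<Lambda> b')"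
      unfolding G_def by blast
    then have "x + y = (\<Lambda> (u (a + a')), \<Lambda> (b + b'))"
      using KM uN by (simp add: u_add gns_add)
    then show "x + y \<in> G" unfolding G_def using K_add[OF *(1,2)] by blast
  next
    fix r x assume "x \<in> G"
    then obtain a b where *: "(a, b) \<in> K" "x = (\<Lambda> (u a), \<Lambda> b)" unfolding G_def by blast
    have "r *\<^sub>R x = (\<Lambda> (u (cscale (of_real r) a)), \<Lambda> (cscale (of_real r) b))"
      using KM[OF *(1)] uN[OF *(1)] by (simp add: *(2) u_cscale gns_scale scaleR_scaleC)
    then show "r *\<^sub>R x \<in> G" unfolding G_def using K_cscale[OF *(1)] by blast
  qed
  have bd: "norm w \<le> 1 * norm v" if "(v, w) \<in> G" for v w
    using that normu unfolding G_def by auto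
  have "\<Lambda> c \<in> closure (fst ` G)" if c: "c \<in> N" for c
  proof -
    \<comment> \<open>The preimage of \<open>c\<close> under \<open>u\<close>. An approximant of
      \<open>x\<close> in the norm of \<phi> \<circ> R becomes, under \<open>u\<close>, an
      approximant of \<open>\<Lambda> c\<close>; this is the density of the domain.\<close>
    define x where "x = R (radj c)"
    note cM = N_M[OF c]
    have xM: "x \<in> M" by (simp add: x_def R_M M_radj cM)
    have ux: "u x = c" by (simp add: u_def x_def R_R M_radj cM)
    have "R (radj x o\<^sub>L x) = radj c o\<^sub>L c" using sq[OF xM] by (simp add: ux)
    then have x: "x \<in> nideal M (\<phi> \<circ> R)"
      using xM c by (simp add: nideal_def M_cadj N_iff cM)
    have "\<exists>y\<in>fst ` G. dist y (\<Lambda> c) < \<epsilon>" if "\<epsilon> > 0" for \<epsilon>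
    proof -
      have "0 < \<epsilon>\<^sup>2" using that by simp
      then obtain a b where ab: "(a, b) \<in> K" "\<phi> (R (cadj (x - a) o\<^sub>L (x - a))) < ennreal (\<epsilon>\<^sup>2)"
        using K2[OF x] by blast
      note aM = KM(1)[OF ab(1)]
      have "u (x - a) = c - u a"
        using xM aM ux by (simp add: u_def R_diff radj_diff)
      then have "\<phi> (radj (c - u a) o\<^sub>L (c - u a)) < ennreal (\<epsilon>\<^sup>2)"
        using ab(2) sq[OF M_diff[OF xM aM]] by (simp add: M_cadj M_diff xM aM)
      then have "ennreal ((norm (\<Lambda> c - \<Lambda> (u a)))\<^sup>2) < ennreal (\<epsilon>\<^sup>2)"
        by (simp add: weight_square N_diff c uN[OF ab(1)] \<Lambda>_diff)
      then have "norm (\<Lambda> c - \<Lambda> (u a)) < \<epsilon>"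
        using that by (simp add: ennreal_less_iff power2_less_imp_less)
      then have "dist (\<Lambda> (u a)) (\<Lambda> c) < \<epsilon>" by (simp add: dist_norm norm_minus_commute)
      moreover have "\<Lambda> (u a) \<in> fst ` G" using ab(1) unfolding G_def by force
      ultimately show ?thesis by blast
    qed
    then show ?thesis unfolding closure_approachable by blast
  qed
  then have "closure (\<Lambda> ` N) \<subseteq> closure (fst ` G)" by (intro closure_minimal) auto
  then have dn: "closure (fst ` G) = UNIV" using gns_dense by auto
  obtain J where J: "\<And>v w. (v, w) \<in> G \<Longrightarrow> blinfun_apply J v = w"
    using bounded_extension[OF sG bd dn, where thesis = thesis] by metis
  have J': "blinfun_apply J (\<Lambda> (u a)) = \<Lambda> b" if "(a, b) \<in> K" for a b
    by (rule J) (use that in \<open>auto simp: G_def\<close>)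
  have eqI: "X = Y" if "\<And>a b. (a, b) \<in> K \<Longrightarrow> blinfun_apply X (\<Lambda> (u a)) = blinfun_apply Y (\<Lambda> (u a))"
    for X Y :: "'h oper"
  proof (rule blinfun_eqI)
    fix v
    have "closure (fst ` G) \<subseteq> {v. blinfun_apply X v = blinfun_apply Y v}"
    proof (rule closure_minimal)
      show "fst ` G \<subseteq> {v. blinfun_apply X v = blinfun_apply Y v}" using that unfolding G_def by auto
      show "closed {v. blinfun_apply X v = blinfun_apply Y v}"
        by (intro closed_Collect_eq linear_continuous_on blinfun.bounded_linear_right)
    qed
    then show "blinfun_apply X v = blinfun_apply Y v" using dn by blast
  qed
  have "aclin J"
  proof -
    have "J o\<^sub>L cscale c id_blinfun = cscale (cnj c) J" for c
    proof (rule eqI)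
      fix a b assume ab: "(a, b) \<in> K"
      have "c *\<^sub>C \<Lambda> (u a) = \<Lambda> (u (cscale (cnj c) a))"
        using KM[OF ab] uN[OF ab] by (simp add: u_cscale gns_scale)
      then show "blinfun_apply (J o\<^sub>L cscale c id_blinfun) (\<Lambda> (u a)) = blinfun_apply (cscale (cnj c) J) (\<Lambda> (u a))"
        using KM[OF ab] by (simp add: J'[OF K_cscale[OF ab]] J'[OF ab] gns_scale)
    qed
    then have "blinfun_apply (J o\<^sub>L cscale c id_blinfun) v = blinfun_apply (cscale (cnj c) J) v" for c v by simp
    then show ?thesis by (simp add: aclin_def)
  qed
  moreover have "norm (blinfun_apply J v) = norm v" for v
  proof -
    have "closure (fst ` G) \<subseteq> {v. norm (blinfun_apply J v) = norm v}"
    proof (rule closure_minimal)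
      show "fst ` G \<subseteq> {v. norm (blinfun_apply J v) = norm v}" using J' normu unfolding G_def by auto
      show "closed {v. norm (blinfun_apply J v) = norm v}"
        by (intro closed_Collect_eq continuous_intros linear_continuous_on blinfun.bounded_linear_right)
    qed
    then show ?thesis using dn by blast
  qed
  moreover have "blinfun_apply y (blinfun_apply J v) = blinfun_apply J (blinfun_apply (radj (R y)) v)"
    if y: "y \<in> M" for y v
  proof -
    have "y o\<^sub>L J = J o\<^sub>L radj (R y)"
    proof (rule eqI)
      fix a b assume ab: "(a, b) \<in> K"
      note m = KM[OF ab]
      have "u (y o\<^sub>L a) = radj (R y) o\<^sub>L u a"
        using m y by (simp add: u_def R_mult radj_compose)
      then have "blinfun_apply (radj (R y)) (\<Lambda> (u a)) = \<Lambda> (u (y o\<^sub>L a))"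
        using gns_module[OF M_radj[OF R_M[OF y]] uN[OF ab]] by simp
      then show "blinfun_apply (y o\<^sub>L J) (\<Lambda> (u a)) = blinfun_apply (J o\<^sub>L radj (R y)) (\<Lambda> (u a))"
        by (simp add: J'[OF ab] J'[OF K_mult[OF ab y]] gns_module y m)
    qed
    then have "blinfun_apply (y o\<^sub>L J) v = blinfun_apply (J o\<^sub>L radj (R y)) v" by simp
    then show ?thesis by simp
  qed
  ultimately show ?thesis by blast
qed

definition J :: "'h oper" where
  "J = (SOME J. aclin J \<and> (\<forall>v. norm (blinfun_apply J v) = norm v) \<and>
    (\<forall>y\<in>M. \<forall>v. blinfun_apply y (blinfun_apply J v) = blinfun_apply J (blinfun_apply (radj (R y)) v)))"

lemma
  shows aclin_J: "aclin J"
    and norm_J [simp]: "norm (blinfun_apply J v) = norm v"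
    and M_J: "y \<in> M \<Longrightarrow> blinfun_apply y (blinfun_apply J v) = blinfun_apply J (blinfun_apply (radj (R y)) v)"
  using someI_ex[OF J_ex] unfolding J_def[symmetric] by blast+

lemma cinner_J [simp]: "cinner (blinfun_apply J x) (blinfun_apply J y) = cinner y x"
proof -
  have e: "blinfun_apply J x + \<i> *\<^sub>C blinfun_apply J y = blinfun_apply J (x - \<i> *\<^sub>C y)"
    "blinfun_apply J x - \<i> *\<^sub>C blinfun_apply J y = blinfun_apply J (x + \<i> *\<^sub>C y)"
    by (simp_all add: blinfun.diff_right blinfun.add_right aclinD[OF aclin_J] scaleC_minus_left)
  have "4 * cinner (blinfun_apply J x) (blinfun_apply J y) = cnj (4 * cinner x y)"
    unfolding cpolarization e blinfun.add_right[symmetric] blinfun.diff_right[symmetric] norm_J by simp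
  then show ?thesis by (simp add: cinner_commute[symmetric])
qed

text \<open>\<open>R\<close> carries the vector functional of \<open>\<xi>\<close>,
  \<open>\<eta>\<close> to that of \<open>J \<eta>\<close>, \<open>J \<xi>\<close>, so normal
  functionals composed with \<open>R\<close> are normal.\<close>

lemma cinner_R:
  "y \<in> M \<Longrightarrow> cinner (blinfun_apply (R y) \<xi>) \<eta> = cinner (blinfun_apply y (blinfun_apply J \<eta>)) (blinfun_apply J \<xi>)"
  by (simp add: M_J cinner_radj M_clin R_M)

lemma lsl_Wst_J:
  "lsl t \<xi> \<eta> Wst = lsl t (blinfun_apply J \<eta>) (blinfun_apply J \<xi>) (radj Wst)"
proof (rule dense_blinfun_eqI, rule dense_cinner_eqI)
  fix a b assume b: "b \<in> N" and a: "a \<in> N"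
  have M: "rsl t (\<Lambda> b) (\<Lambda> a) (radj Wst) \<in> M"
    using weight_slice_Wst(1)[OF a b] by (simp add: weight_slice_def)
  show "cinner (blinfun_apply (lsl t \<xi> \<eta> Wst) (\<Lambda> b)) (\<Lambda> a)
      = cinner (blinfun_apply (lsl t (blinfun_apply J \<eta>) (blinfun_apply J \<xi>) (radj Wst)) (\<Lambda> b)) (\<Lambda> a)"
    using cinner_R[OF M, of \<xi> \<eta>] unfolding R_Wst_core[OF a b] by (simp add: t.cinner_rsl t.cinner_lsl)
qed

text \<open>The second leg of \<open>Wst\<close> is closed under adjoints: \<open>R\<close>
  exchanges the slices of \<open>Wst\<close> with those of its adjoint, and \<open>J\<close> moves
  \<open>R\<close> onto the vectors.\<close>

lemma radj_lsl_Wst: "radj (lsl t \<xi> \<eta> Wst) = lsl t (blinfun_apply J \<xi>) (blinfun_apply J \<eta>) Wst"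
  unfolding lsl_Wst_J[of \<xi> \<eta>] by (simp add: t.radj_lsl)

lemma rsl_W_M: "rsl t \<zeta> \<zeta>' (radj Wst) \<in> M"
  using M_radj[OF rsl_Wst_M[of \<zeta>' \<zeta>]] by (simp add: t.radj_rsl)

lemma R_rsl_W: "R (rsl t \<zeta> \<zeta>' (radj Wst)) = rsl t \<zeta> \<zeta>' Wst"
proof (rule oper_eqI)
  fix \<xi> \<eta>
  have "cinner (blinfun_apply (lsl t \<xi> \<eta> Wst) \<zeta>) \<zeta>'
      = cinner (blinfun_apply (lsl t (blinfun_apply J \<eta>) (blinfun_apply J \<xi>) (radj Wst)) \<zeta>) \<zeta>'"
    by (simp add: lsl_Wst_J)
  then show "cinner (blinfun_apply (R (rsl t \<zeta> \<zeta>' (radj Wst))) \<xi>) \<eta> = cinner (blinfun_apply (rsl t \<zeta> \<zeta>' Wst) \<xi>) \<eta>"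
    by (simp add: cinner_R rsl_W_M t.cinner_rsl t.cinner_lsl)
qed

lemma R_rsl_Wst: "R (rsl t \<zeta> \<zeta>' Wst) = rsl t \<zeta> \<zeta>' (radj Wst)"
  using R_R[OF rsl_W_M] by (metis R_rsl_W)

text \<open>The range projection of \<open>W\<^sup>*\<close> commutes with the second leg of \<open>W\<close>: by the pentagon equation that leg
  leaves the range invariant, and it is self-adjoint because \<open>S = R\<close> is a \<open>*\<close>-map.\<close>

lemma range_projection_commutes:
  "op_tensor t (lsl t \<xi> \<eta> Wst) id_blinfun o\<^sub>L (Wst o\<^sub>L radj Wst) = (Wst o\<^sub>L radj Wst) o\<^sub>L op_tensor t (lsl t \<xi> \<eta> Wst) id_blinfun"
proof -
  define P where "P = Wst o\<^sub>L radj Wst"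
  define L where "L \<xi> \<eta> = op_tensor t (lsl t \<xi> \<eta> Wst) id_blinfun" for \<xi> \<eta>
  have PW: "P o\<^sub>L Wst = Wst" unfolding P_def compose_assoc W_coisometry by simp
  have radjP: "radj P = P" by (simp add: P_def radj_compose)
  have radjL: "radj (L \<xi> \<eta>) = L (blinfun_apply J \<xi>) (blinfun_apply J \<eta>)" for \<xi> \<eta>
    by (simp add: L_def t.radj_op_tensor radj_lsl_Wst)
  have inv: "P o\<^sub>L (L \<xi> \<eta> o\<^sub>L P) = L \<xi> \<eta> o\<^sub>L P" for \<xi> \<eta>
  proof -
    have "P o\<^sub>L (L \<xi> \<eta> o\<^sub>L Wst) = L \<xi> \<eta> o\<^sub>L Wst"
    proof (rule t.tensor_blinfun_eqI)
      fix p q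
      obtain \<Theta> :: "'k oper" where \<Theta>: "\<And>\<xi> p. blinfun_apply (op_tensor t (lsl t \<xi> \<eta> Wst) id_blinfun) (blinfun_apply Wst (t p q))
        = blinfun_apply Wst (blinfun_apply \<Theta> (blinfun_apply Wst (t \<xi> p)))"
        by (rule pentagon_slice) (rule that)
      have "blinfun_apply (P o\<^sub>L Wst) v = blinfun_apply Wst v" for v by (simp only: PW)
      then show "blinfun_apply (P o\<^sub>L (L \<xi> \<eta> o\<^sub>L Wst)) (t p q) = blinfun_apply (L \<xi> \<eta> o\<^sub>L Wst) (t p q)"
        by (simp add: L_def \<Theta>)
    qed
    then have "(P o\<^sub>L (L \<xi> \<eta> o\<^sub>L Wst)) o\<^sub>L radj Wst = (L \<xi> \<eta> o\<^sub>L Wst) o\<^sub>L radj Wst" by simp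
    then show ?thesis by (simp add: compose_assoc P_def)
  qed
  \<comment> \<open>Invariance for the adjoint slice, which is again a slice by
    \<open>radjL\<close>; its adjoint says that \<open>L \<xi> \<eta>\<close> also preserves the
    orthogonal complement.\<close>
  have "radj (P o\<^sub>L (L (blinfun_apply J \<xi>) (blinfun_apply J \<eta>) o\<^sub>L P)) = radj (L (blinfun_apply J \<xi>) (blinfun_apply J \<eta>) o\<^sub>L P)"
    by (simp only: inv)
  then have "P o\<^sub>L (L \<xi> \<eta> o\<^sub>L P) = P o\<^sub>L L \<xi> \<eta>"
    unfolding radjL[symmetric] by (simp add: radj_compose radjP compose_assoc)
  then show ?thesis using inv[of \<xi> \<eta>] by (simp add: P_def L_def)
qed

text \<open>Prepares \<open>W_injective\<close>: the right-hand side pairs a vector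
  \<open>Wst X\<close> with \<open>t \<beta> c\<close>, where \<open>X\<close> depends on neither
  \<open>\<beta>\<close> nor \<open>c\<close>. Conjugating the slice by \<open>Wst\<close> is
  controlled by the pentagon equation.\<close>

lemma W_slice_product:
  "cinner (blinfun_apply (radj Wst) (t (blinfun_apply (lsl t \<xi> \<beta> Wst) \<zeta>) v)) (t \<zeta>' c)
    = cinner (blinfun_apply Wst (blinfun_apply (op_tensor t (radj (tright t \<zeta>') o\<^sub>L (Wst o\<^sub>L tleft t \<xi>)) id_blinfun)
        (blinfun_apply (radj Wst) (t \<zeta> v)))) (t \<beta> c)"
proof -
  define A where "A = radj (tright t \<zeta>') o\<^sub>L (Wst o\<^sub>L tleft t \<xi>)"
  define L where "L = op_tensor t (lsl t \<xi> \<beta> Wst) id_blinfun"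
  have cA: "clin A" by (simp add: A_def clin_compose)
  have cL: "clin L" by (simp add: L_def)
  have ext: "blinfun_apply (radj (radj Wst o\<^sub>L (L o\<^sub>L Wst))) (t \<zeta>' c)
      = blinfun_apply (radj (Wst o\<^sub>L op_tensor t A id_blinfun)) (t \<beta> c)"
  proof (rule t.tensor_cinner_eqI)
    fix p q
    obtain \<Theta> :: "'k oper" where \<Theta>: "clin \<Theta>" "\<And>a b. blinfun_apply \<Theta> (t a b) = t b (blinfun_apply (lsl t a \<beta> Wst) q)"
      "\<And>\<xi> p. blinfun_apply (op_tensor t (lsl t \<xi> \<beta> Wst) id_blinfun) (blinfun_apply Wst (t p q))
        = blinfun_apply Wst (blinfun_apply \<Theta> (blinfun_apply Wst (t \<xi> p)))"
      by (rule pentagon_slice) (rule that)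
    have WW: "blinfun_apply (radj Wst) (blinfun_apply Wst x) = x" for x
      using arg_cong[OF W_coisometry, of "\<lambda>X. blinfun_apply X x"] by simp
    define D where "D = radj (tleft t \<beta>) o\<^sub>L (Wst o\<^sub>L tright t q)"
    have cD: "clin D" by (simp add: D_def clin_compose)
    have two: "blinfun_apply (radj \<Theta>) (t \<zeta>' c) = t (blinfun_apply (radj D) c) \<zeta>'"
    proof (rule t.tensor_cinner_eqI)
      fix a b
      have "cinner (t a b) (blinfun_apply (radj \<Theta>) (t \<zeta>' c)) = cinner b \<zeta>' * cinner (blinfun_apply D a) c"
        by (simp add: cinner_radj[OF \<Theta>(1), symmetric] \<Theta>(2) t.cinner_tensor D_def t.lsl_apply)
      also have "\<dots> = cinner (t a b) (t (blinfun_apply (radj D) c) \<zeta>')"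
        by (simp add: cinner_radj[OF cD] t.cinner_tensor)
      finally show "cinner (blinfun_apply (radj \<Theta>) (t \<zeta>' c)) (t a b) = cinner (t (blinfun_apply (radj D) c) \<zeta>') (t a b)"
        by (metis cinner_commute)
    qed
    have "cinner (blinfun_apply (radj Wst o\<^sub>L (L o\<^sub>L Wst)) (t p q)) (t \<zeta>' c)
        = cinner (blinfun_apply \<Theta> (blinfun_apply Wst (t \<xi> p))) (t \<zeta>' c)"
      by (simp add: L_def \<Theta>(3) WW)
    also have "\<dots> = cinner (blinfun_apply Wst (t \<xi> p)) (t (blinfun_apply (radj D) c) \<zeta>')"
      by (simp add: cinner_radj[OF \<Theta>(1)] two)
    also have "\<dots> = cinner (blinfun_apply D (blinfun_apply A p)) c"
      by (simp add: A_def cinner_radj[OF cD] t.cinner_tright)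
    also have "\<dots> = cinner (blinfun_apply (Wst o\<^sub>L op_tensor t A id_blinfun) (t p q)) (t \<beta> c)"
      by (simp add: D_def cA t.cinner_tleft)
    finally show "cinner (blinfun_apply (radj (radj Wst o\<^sub>L (L o\<^sub>L Wst))) (t \<zeta>' c)) (t p q)
        = cinner (blinfun_apply (radj (Wst o\<^sub>L op_tensor t A id_blinfun)) (t \<beta> c)) (t p q)"
      using cinner_radj[of "radj Wst o\<^sub>L (L o\<^sub>L Wst)" "t p q" "t \<zeta>' c"]
        cinner_radj[of "Wst o\<^sub>L op_tensor t A id_blinfun" "t p q" "t \<beta> c"]
        cinner_commute[of _ "t p q"]
      by (simp add: clin_compose cA cL)
  qed
  \<comment> \<open>As \<open>range_projection_commutes\<close>, the range projection can be
    inserted and moved past \<open>L\<close>, which produces the conjugated slice computed in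
    \<open>ext\<close>.\<close>
  have "radj Wst o\<^sub>L L = radj Wst o\<^sub>L ((Wst o\<^sub>L radj Wst) o\<^sub>L L)"
    by (simp add: compose_assoc[symmetric] W_coisometry)
  also have "\<dots> = (radj Wst o\<^sub>L (L o\<^sub>L Wst)) o\<^sub>L radj Wst"
    unfolding L_def range_projection_commutes[symmetric] by (simp add: compose_assoc)
  finally have "blinfun_apply (radj Wst o\<^sub>L L) (t \<zeta> v) = blinfun_apply ((radj Wst o\<^sub>L (L o\<^sub>L Wst)) o\<^sub>L radj Wst) (t \<zeta> v)"
    by simp
  then have "cinner (blinfun_apply (radj Wst) (t (blinfun_apply (lsl t \<xi> \<beta> Wst) \<zeta>) v)) (t \<zeta>' c)
      = cinner (blinfun_apply (radj Wst o\<^sub>L (L o\<^sub>L Wst)) (blinfun_apply (radj Wst) (t \<zeta> v))) (t \<zeta>' c)"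
    by (simp add: L_def)
  also have "\<dots> = cinner (blinfun_apply (Wst o\<^sub>L op_tensor t A id_blinfun) (blinfun_apply (radj Wst) (t \<zeta> v))) (t \<beta> c)"
    by (subst (1 2) cinner_radj) (simp_all only: ext, simp_all add: clin_compose cA cL)
  finally show ?thesis by (simp add: A_def)
qed

end

context quantum_group
begin

lemma normal_fun_bound:
  assumes l2: "l2_seq \<xi>" "l2_seq \<eta>"
  shows "(cmod (normal_fun \<xi> \<eta> X))\<^sup>2 \<le> sstar \<xi> X * (\<Sum>n. (norm (\<eta> n))\<^sup>2)"
proof -
  have sx: "summable (\<lambda>n. (norm (blinfun_apply Y (\<xi> n)))\<^sup>2)" for Y
    by (rule summable_apply_l2[OF l2(1)])
  have se: "summable (\<lambda>n. (norm (\<eta> n))\<^sup>2)" using l2(2) by (simp add: l2_seq_def)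
  note sp = summable_norm_mult[OF sx[of X] se]
  have "cmod (normal_fun \<xi> \<eta> X) \<le> (\<Sum>n. norm (blinfun_apply X (\<xi> n)) * norm (\<eta> n))"
    unfolding normal_fun_def by (rule norm_suminf_le[OF cmod_cinner_le sp])
  then have "(cmod (normal_fun \<xi> \<eta> X))\<^sup>2 \<le> (\<Sum>n. norm (blinfun_apply X (\<xi> n)) * norm (\<eta> n))\<^sup>2"
    by (intro power_mono) auto
  also have "\<dots> \<le> (\<Sum>n. (norm (blinfun_apply X (\<xi> n)))\<^sup>2) * (\<Sum>n. (norm (\<eta> n))\<^sup>2)"
    by (rule suminf_mult_le_l2[OF sx se])
  also have "\<dots> \<le> sstar \<xi> X * (\<Sum>n. (norm (\<eta> n))\<^sup>2)"
    unfolding sstar_def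
    by (intro mult_right_mono suminf_le suminf_nonneg se summable_add sx) auto
  finally show ?thesis .
qed

lemma normal_fun_linear:
  assumes l2: "l2_seq \<xi>" "l2_seq \<eta>"
  shows "normal_fun \<xi> \<eta> (X + Y) = normal_fun \<xi> \<eta> X + normal_fun \<xi> \<eta> Y"
    and "normal_fun \<xi> \<eta> (X - Y) = normal_fun \<xi> \<eta> X - normal_fun \<xi> \<eta> Y"
    and "normal_fun \<xi> \<eta> (r *\<^sub>R X) = of_real r * normal_fun \<xi> \<eta> X"
proof -
  note s = summable_normal_fun[OF l2]
  show "normal_fun \<xi> \<eta> (X + Y) = normal_fun \<xi> \<eta> X + normal_fun \<xi> \<eta> Y"
    unfolding normal_fun_def suminf_add[OF s s] by (simp add: blinfun.add_left cinner_add_left)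
  show "normal_fun \<xi> \<eta> (X - Y) = normal_fun \<xi> \<eta> X - normal_fun \<xi> \<eta> Y"
    unfolding normal_fun_def suminf_diff[OF s s] by (simp add: blinfun.diff_left cinner_diff_left)
  show "normal_fun \<xi> \<eta> (r *\<^sub>R X) = of_real r * normal_fun \<xi> \<eta> X"
    unfolding normal_fun_def suminf_mult[OF s, symmetric] by (simp add: blinfun.scaleR_left)
qed

end

section \<open>Unitarity of the multiplicative unitary\<close>

context kac_group
begin

text \<open>Slices of \<open>Wst\<close> applied to the second leg of \<open>s\<close> form an
  operator in the variable \<open>\<zeta>'\<close>. Its adjoint \<open>\<rho>\<close> meets the
  conditions of \<open>zero_if_zero_on_Wst\<close>: by \<open>W_slice_product\<close> the
  coefficients of \<open>\<rho>\<close> on the range of \<open>Wst\<close> are pairings of some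
  \<open>Wst X\<close> with \<open>s\<close>, that is, of \<open>X\<close> with
  \<open>radj Wst s = 0\<close>. So the operator vanishes, and \<open>Wst\<close> being isometric
  forces \<open>s = 0\<close>.\<close>

lemma W_injective:
  assumes s: "blinfun_apply (radj Wst) s = 0"
  shows "s = 0"
proof -
  have zero: "blinfun_apply (op_tensor t id_blinfun (radj (tright t v) o\<^sub>L (Wst o\<^sub>L tleft t \<zeta>'))) s = 0" for v \<zeta>'
  proof -
    define B where "B \<zeta> = radj (tright t v) o\<^sub>L (Wst o\<^sub>L tleft t \<zeta>)" for \<zeta>
    have cB: "clin (B \<zeta>)" for \<zeta> by (simp add: B_def clin_compose)
    have Bapp: "blinfun_apply (B \<zeta>) c = blinfun_apply (radj (tright t v)) (blinfun_apply Wst (t \<zeta> c))" for \<zeta> c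
      by (simp add: B_def)
    have B_add: "B (x + y) = B x + B y" for x y
      by (rule blinfun_eqI) (simp add: Bapp blinfun.add_left t.bb.add_left blinfun.add_right)
    have B_cscale: "B (c *\<^sub>C x) = cscale c (B x)" for c x
      by (rule blinfun_eqI) (simp add: Bapp t.scale_left clinD)
    define f where "f \<zeta> = blinfun_apply (op_tensor t id_blinfun (B \<zeta>)) s" for \<zeta>
    have f_cscale: "f (c *\<^sub>C x) = c *\<^sub>C f x" for c x
      by (simp add: f_def B_cscale t.op_tensor_cscale cB)
    have "bounded_linear f"
    proof (rule bounded_linear_intro)
      show "f (x + y) = f x + f y" for x y
        by (simp add: f_def B_add t.op_tensor_add_right cB blinfun.add_left)
      show "f (r *\<^sub>R x) = r *\<^sub>R f x" for r x
        using f_cscale[of "of_real r" x] by (simp add: scaleR_scaleC)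
      show "norm (f x) \<le> norm x * (norm v * norm s)" for x
      proof -
        have Bn: "norm (B x) \<le> norm v * norm x"
        proof (rule norm_blinfun_bound)
          fix c
          have "norm (blinfun_apply (B x) c) \<le> norm (radj (tright t v)) * norm (blinfun_apply Wst (t x c))"
            unfolding Bapp by (rule norm_blinfun)
          also have "\<dots> \<le> norm v * (norm x * norm c)"
            using t.norm_tright_le[of v] by (simp add: t.norm_tensor mult_right_mono)
          finally show "norm (blinfun_apply (B x) c) \<le> norm v * norm x * norm c" by (simp add: mult.assoc)
        qed simp
        have "norm (f x) \<le> norm (op_tensor t id_blinfun (B x)) * norm s"
          unfolding f_def by (rule norm_blinfun)
        also have "\<dots> \<le> (norm v * norm x) * norm s"
          using t.norm_op_tensor_id_right_le[OF cB[of x]] Bn by (intro mult_right_mono) auto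
        finally show ?thesis by (simp add: mult_ac)
      qed
    qed
    then have Fapp: "blinfun_apply (Blinfun f) = f" by (rule bounded_linear_Blinfun_apply)
    \<comment> \<open>The criterion concerns operators defined on the tensor square, hence the
      adjoint of \<open>f\<close>.\<close>
    define \<rho> where "\<rho> = radj (Blinfun f)"
    have cF: "clin (Blinfun f)" by (simp add: clin_def Fapp f_cscale)
    have "\<rho> = 0"
    proof (rule zero_if_zero_on_Wst)
      show "clin \<rho>" by (simp add: \<rho>_def cF)
      fix u assume u: "u \<in> commutant M"
      have cu: "clin (radj u)" by (simp add: commutant_clin[OF u])
      have "op_tensor t id_blinfun (radj u) o\<^sub>L Blinfun f = Blinfun f o\<^sub>L radj u"
      proof (rule blinfun_eqI)
        fix \<zeta>
        \<comment> \<open>The first leg of \<open>Wst\<close> lies in \<open>M\<close>, so the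
          commutant passes through the slice; this is the intertwining property, seen on the adjoint
          side.\<close>
        have "B (blinfun_apply (radj u) \<zeta>) = radj u o\<^sub>L B \<zeta>"
        proof (rule blinfun_eqI)
          fix c
          have "blinfun_apply (Wst o\<^sub>L op_tensor t (radj u) id_blinfun) (t \<zeta> c)
              = blinfun_apply (op_tensor t (radj u) id_blinfun o\<^sub>L Wst) (t \<zeta> c)"
            using Wst_commutes_left[OF commutant_radj[OF u]] by simp
          then have 1: "blinfun_apply Wst (t (blinfun_apply (radj u) \<zeta>) c) = blinfun_apply (op_tensor t (radj u) id_blinfun) (blinfun_apply Wst (t \<zeta> c))"
            using cu by simp
          have 2: "blinfun_apply (radj (tright t v)) (blinfun_apply (op_tensor t (radj u) id_blinfun) w)
              = blinfun_apply (radj u) (blinfun_apply (radj (tright t v)) w)" for w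
            by (rule cinner_eqI)
              (simp add: t.cinner_tright cinner_radj[OF cu] cinner_radj[OF t.clin_op_tensor[OF cu clin_id]] t.radj_op_tensor cu commutant_clin[OF u])
          show "blinfun_apply (B (blinfun_apply (radj u) \<zeta>)) c = blinfun_apply (radj u o\<^sub>L B \<zeta>) c"
            by (simp add: Bapp 1 2)
        qed
        then have "op_tensor t id_blinfun (B (blinfun_apply (radj u) \<zeta>)) = op_tensor t id_blinfun (radj u) o\<^sub>L op_tensor t id_blinfun (B \<zeta>)"
          using cu cB by (simp add: t.op_tensor_compose)
        then show "blinfun_apply (op_tensor t id_blinfun (radj u) o\<^sub>L Blinfun f) \<zeta> = blinfun_apply (Blinfun f o\<^sub>L radj u) \<zeta>"
          by (simp add: Fapp f_def)
      qed
      from arg_cong[OF this, of radj] show "\<rho> o\<^sub>L op_tensor t id_blinfun u = u o\<^sub>L \<rho>"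
        by (simp add: \<rho>_def radj_compose t.radj_op_tensor commutant_clin[OF u])
    next
      show "\<rho> o\<^sub>L Wst = 0"
      proof (rule t.tensor_blinfun_eqI, rule cinner_eqI)
        fix \<xi> \<zeta> \<zeta>'
        define X where "X = blinfun_apply (op_tensor t (radj (tright t \<zeta>') o\<^sub>L (Wst o\<^sub>L tleft t \<xi>)) id_blinfun) (blinfun_apply (radj Wst) (t \<zeta> v))"
        have eq: "blinfun_apply (radj (op_tensor t id_blinfun (B \<zeta>'))) (blinfun_apply Wst (t \<xi> \<zeta>)) = blinfun_apply Wst X"
        proof (rule t.tensor_cinner_eqI)
          fix b c
          have "cinner (blinfun_apply (radj (op_tensor t id_blinfun (B \<zeta>'))) (blinfun_apply Wst (t \<xi> \<zeta>))) (t b c)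
              = cinner (blinfun_apply Wst (t \<xi> \<zeta>)) (t b (blinfun_apply (B \<zeta>') c))"
            using cB by (simp add: cinner_radj'[symmetric])
          also have "\<dots> = cinner (blinfun_apply (lsl t \<xi> b Wst) \<zeta>) (blinfun_apply (B \<zeta>') c)"
            by (simp add: t.cinner_lsl)
          also have "\<dots> = cinner (t (blinfun_apply (lsl t \<xi> b Wst) \<zeta>) v) (blinfun_apply Wst (t \<zeta>' c))"
            by (simp add: Bapp t.cinner_tright')
          also have "\<dots> = cinner (blinfun_apply (radj Wst) (t (blinfun_apply (lsl t \<xi> b Wst) \<zeta>) v)) (t \<zeta>' c)"
            by (simp add: cinner_radj')
          also have "\<dots> = cinner (blinfun_apply Wst X) (t b c)"
            unfolding X_def by (rule W_slice_product)
          finally show "cinner (blinfun_apply (radj (op_tensor t id_blinfun (B \<zeta>'))) (blinfun_apply Wst (t \<xi> \<zeta>))) (t b c)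
              = cinner (blinfun_apply Wst X) (t b c)" .
        qed
        have "cinner (blinfun_apply (\<rho> o\<^sub>L Wst) (t \<xi> \<zeta>)) \<zeta>' = cinner (blinfun_apply Wst (t \<xi> \<zeta>)) (f \<zeta>')"
          by (simp add: \<rho>_def cinner_radj'[OF cF, symmetric] Fapp)
        also have "\<dots> = cinner (blinfun_apply Wst X) s"
          using cB by (simp add: f_def cinner_radj' eq)
        also have "\<dots> = 0" by (simp add: cinner_radj s)
        finally show "cinner (blinfun_apply (\<rho> o\<^sub>L Wst) (t \<xi> \<zeta>)) \<zeta>' = cinner (blinfun_apply 0 (t \<xi> \<zeta>)) \<zeta>'" by simp
      qed
    qed
    then have "radj \<rho> = 0" by simp
    then have "f \<zeta>' = 0" using Fapp by (simp add: \<rho>_def) (metis blinfun.zero_left)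
    then show ?thesis by (simp add: f_def B_def)
  qed
  have "blinfun_apply (radj (tleft t a)) s = 0" for a
  proof -
    let ?c = "blinfun_apply (radj (tleft t a)) s"
    \<comment> \<open>\<open>?c\<close> is a left slice of \<open>s\<close>. With \<open>?c\<close>
      itself in place of \<open>\<zeta>'\<close>, the isometry \<open>Wst\<close> kills
      \<open>t ?c ?c\<close>, so \<open>?c = 0\<close>.\<close>
    have "blinfun_apply Wst (t \<zeta>' ?c) = 0" for \<zeta>'
    proof (rule t.tensor_cinner_eqI)
      fix p v
      let ?B = "radj (tright t v) o\<^sub>L (Wst o\<^sub>L tleft t \<zeta>')"
      have "blinfun_apply (radj (tleft t a)) (blinfun_apply (op_tensor t id_blinfun ?B) s) = blinfun_apply ?B ?c"
        by (simp add: radj_tleft_op_tensor clin_compose)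
      then have "blinfun_apply ?B ?c = 0" by (simp only: zero blinfun.zero_right)
      then have "cinner (blinfun_apply ?B ?c) p = 0" by simp
      then show "cinner (blinfun_apply Wst (t \<zeta>' ?c)) (t p v) = cinner 0 (t p v)"
        by (simp add: t.cinner_tright)
    qed
    then have "norm (t ?c ?c) = 0" by (metis norm_Wst norm_zero)
    then show ?thesis by (simp add: t.norm_tensor)
  qed
  then show ?thesis by (intro t.tensor_cinner_eqI) (simp add: t.cinner_tleft[symmetric])
qed

lemma W_unitary: "Wst o\<^sub>L radj Wst = id_blinfun"
proof (rule blinfun_eqI)
  fix v
  have WW: "blinfun_apply (radj Wst) (blinfun_apply Wst x) = x" for x
    using arg_cong[OF W_coisometry, of "\<lambda>X. blinfun_apply X x"] by simp
  have "v - blinfun_apply Wst (blinfun_apply (radj Wst) v) = 0"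
    by (rule W_injective) (simp add: blinfun.diff_right WW)
  then show "blinfun_apply (Wst o\<^sub>L radj Wst) v = blinfun_apply id_blinfun v" by simp
qed

lemma \<Delta>_eq: "y \<in> M \<Longrightarrow> \<Delta> y = Wst o\<^sub>L (op_tensor t id_blinfun y o\<^sub>L radj Wst)"
  using \<Delta>_Wst[of y] W_unitary by (metis compose_assoc compose_id(1))

lemma W_\<Delta>: "y \<in> M \<Longrightarrow> radj Wst o\<^sub>L \<Delta> y = op_tensor t id_blinfun y o\<^sub>L radj Wst"
  using \<Delta>_eq[of y] W_coisometry by (metis compose_assoc compose_id(2))

text \<open>The antipode is defined on all of \<open>M\<close>, so every element of \<open>M\<close>
  is approximated by first components of its core, that is, by combinations of slices of W. A normal
  functional is continuous for this approximation.\<close>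

lemma normal_fun_zero_on_slices:
  assumes l2: "l2_seq \<xi>" "l2_seq \<eta>" and y: "y \<in> M"
    and z: "\<And>\<zeta> \<zeta>'. normal_fun \<xi> \<eta> (rsl t \<zeta> \<zeta>' (radj Wst)) = 0"
  shows "normal_fun \<xi> \<eta> y = 0"
proof (rule ccontr)
  assume nz: "normal_fun \<xi> \<eta> y \<noteq> 0"
  define C where "C = (\<Sum>n. (norm (\<eta> n))\<^sup>2)"
  have C0: "0 \<le> C" unfolding C_def using l2(2) by (simp add: l2_seq_def suminf_nonneg)
  define \<epsilon> where "\<epsilon> = (cmod (normal_fun \<xi> \<eta> y))\<^sup>2 / (C + 1)"
  have e0: "\<epsilon> > 0" using nz C0 by (simp add: \<epsilon>_def)
  have "(y, R y) \<in> antipode t M \<Delta> \<phi>" unfolding R_antipode using y by blast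
  then obtain x' y' where x': "(x', y') \<in> span (antipode_core t M \<Delta> \<phi>)" "sstar \<xi> (y - x') < \<epsilon>"
    unfolding antipode_def using l2(1) e0 by blast
  have "span (antipode_core t M \<Delta> \<phi>) \<subseteq> {p. normal_fun \<xi> \<eta> (fst p) = 0}"
  proof (rule span_minimal)
    show "antipode_core t M \<Delta> \<phi> \<subseteq> {p. normal_fun \<xi> \<eta> (fst p) = 0}"
      unfolding antipode_core_eq using z by auto
    show "subspace {p. normal_fun \<xi> \<eta> (fst p) = 0}"
      by (auto simp: subspace_def normal_fun_linear[OF l2]) (simp add: normal_fun_def)
  qed
  then have "normal_fun \<xi> \<eta> y = normal_fun \<xi> \<eta> (y - x')"
    using x'(1) by (auto simp: normal_fun_linear[OF l2])
  then have "(cmod (normal_fun \<xi> \<eta> y))\<^sup>2 \<le> sstar \<xi> (y - x') * C"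
    using normal_fun_bound[OF l2, of "y - x'"] by (simp add: C_def)
  also have "\<dots> \<le> \<epsilon> * C" using x'(2) C0 by (intro mult_right_mono) auto
  also have "\<dots> < \<epsilon> * (C + 1)" using e0 by simp
  also have "\<dots> = (cmod (normal_fun \<xi> \<eta> y))\<^sup>2" using C0 by (simp add: \<epsilon>_def)
  finally show False by simp
qed

lemma l2_seq_J: "l2_seq \<xi> \<Longrightarrow> l2_seq (\<lambda>n. blinfun_apply J (\<xi> n))"
  by (simp add: l2_seq_def)

text \<open>\<open>\<Delta> \<circ> R = \<sigma> \<circ> (R \<otimes> R) \<circ> \<Delta>\<close>, in terms of vector functionals.\<close>

lemma \<Delta>_R:
  assumes y: "y \<in> M"
  shows "cinner (blinfun_apply (\<Delta> (R y)) (t \<xi>1 \<xi>2)) (t \<eta>1 \<eta>2)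
    = cinner (blinfun_apply (\<Delta> y) (t (blinfun_apply J \<eta>2) (blinfun_apply J \<eta>1))) (t (blinfun_apply J \<xi>2) (blinfun_apply J \<xi>1))"
proof -
  obtain \<alpha> \<beta> where a: "l2_seq \<alpha>" "l2_seq \<beta>" "\<And>x. x \<in> M \<Longrightarrow>
      normal_fun (single_seq (t \<xi>1 \<xi>2)) (single_seq (t \<eta>1 \<eta>2)) (\<Delta> x) = normal_fun \<alpha> \<beta> x"
    using \<Delta>_normal[OF l2_seq_single l2_seq_single, where thesis = thesis] by metis
  obtain \<alpha>' \<beta>' where a': "l2_seq \<alpha>'" "l2_seq \<beta>'" "\<And>x. x \<in> M \<Longrightarrow>
      normal_fun (single_seq (t (blinfun_apply J \<eta>2) (blinfun_apply J \<eta>1)))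
        (single_seq (t (blinfun_apply J \<xi>2) (blinfun_apply J \<xi>1))) (\<Delta> x) = normal_fun \<alpha>' \<beta>' x"
    using \<Delta>_normal[OF l2_seq_single l2_seq_single, where thesis = thesis] by metis
  let ?Ja = "\<lambda>n. blinfun_apply J (\<alpha> n)" and ?Jb = "\<lambda>n. blinfun_apply J (\<beta> n)"
  note l = l2_seq_J[OF a(2)] l2_seq_J[OF a(1)] a'(1) l2_seq_minus[OF a'(2)]
  have lhs: "cinner (blinfun_apply (\<Delta> (R x)) (t \<xi>1 \<xi>2)) (t \<eta>1 \<eta>2) = normal_fun ?Jb ?Ja x" if "x \<in> M" for x
  proof -
    have "normal_fun \<alpha> \<beta> (R x) = normal_fun ?Jb ?Ja x"
      by (simp add: normal_fun_def cinner_R that)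
    then show ?thesis using a(3)[OF R_M[OF that]] by simp
  qed
  have rhs: "cinner (blinfun_apply (\<Delta> x) (t (blinfun_apply J \<eta>2) (blinfun_apply J \<eta>1)))
      (t (blinfun_apply J \<xi>2) (blinfun_apply J \<xi>1)) = normal_fun \<alpha>' \<beta>' x" if "x \<in> M" for x
    using a'(3)[OF that] by simp
  have nf: "normal_fun (interleave ?Jb \<alpha>') (interleave ?Ja (\<lambda>n. - \<beta>' n)) x = normal_fun ?Jb ?Ja x - normal_fun \<alpha>' \<beta>' x" for x
    by (simp add: normal_fun_interleave[OF l] normal_fun_minus[OF a'(1,2)])
  \<comment> \<open>Both sides are normal functionals of \<open>y\<close>, so slices of W suffice.
    There \<open>R\<close> produces a slice of \<open>Wst\<close>, the adjoint produces another one,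
    and \<open>\<Delta>_rsl_Wst\<close> evaluates both; reversing the two factors is the
    flip.\<close>
  have on_slices: "normal_fun ?Jb ?Ja (rsl t \<zeta> \<zeta>' (radj Wst)) = normal_fun \<alpha>' \<beta>' (rsl t \<zeta> \<zeta>' (radj Wst))" for \<zeta> \<zeta>'
  proof -
    let ?r = "rsl t \<zeta>' \<zeta> Wst"
    have r: "rsl t \<zeta> \<zeta>' (radj Wst) = radj ?r" by (simp add: t.radj_rsl)
    have "cinner (blinfun_apply (\<Delta> (radj ?r)) (t (blinfun_apply J \<eta>2) (blinfun_apply J \<eta>1))) (t (blinfun_apply J \<xi>2) (blinfun_apply J \<xi>1))
        = cnj (cinner (blinfun_apply (\<Delta> ?r) (t (blinfun_apply J \<xi>2) (blinfun_apply J \<xi>1))) (t (blinfun_apply J \<eta>2) (blinfun_apply J \<eta>1)))"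
      by (simp add: \<Delta>_radj rsl_Wst_M cinner_radj'[OF \<Delta>_clin[OF rsl_Wst_M], symmetric]) (rule cinner_commute)
    also have "\<dots> = cnj (cinner (blinfun_apply (lsl t (blinfun_apply J \<xi>1) (blinfun_apply J \<eta>1) Wst)
        (blinfun_apply (lsl t (blinfun_apply J \<xi>2) (blinfun_apply J \<eta>2) Wst) \<zeta>')) \<zeta>)"
      by (simp only: \<Delta>_rsl_Wst)
    also have "\<dots> = cinner (blinfun_apply (lsl t \<xi>2 \<eta>2 Wst) (blinfun_apply (lsl t \<xi>1 \<eta>1 Wst) \<zeta>)) \<zeta>'"
      by (simp add: radj_lsl_Wst[symmetric] cinner_radj'[symmetric] cinner_commute[symmetric])
    also have "\<dots> = cinner (blinfun_apply (\<Delta> (rsl t \<zeta> \<zeta>' Wst)) (t \<xi>1 \<xi>2)) (t \<eta>1 \<eta>2)"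
      by (rule \<Delta>_rsl_Wst[symmetric])
    finally show ?thesis
      unfolding lhs[OF rsl_W_M, symmetric] rhs[OF rsl_W_M, symmetric] by (simp add: R_rsl_W r[symmetric])
  qed
  have "normal_fun (interleave ?Jb \<alpha>') (interleave ?Ja (\<lambda>n. - \<beta>' n)) y = 0"
    by (rule normal_fun_zero_on_slices[OF l2_seq_interleave[OF l(1,3)] l2_seq_interleave[OF l(2,4)] y])
      (simp add: nf on_slices)
  then show ?thesis unfolding lhs[OF y] rhs[OF y] by (simp add: nf)
qed

text \<open>For \<open>g = R z\<close> the coproduct is g \<otimes> 1, which relates W with
  \<open>g\<close> in either leg. Applying \<open>R\<close> to right slices of that relation
  replaces \<open>g\<close> in the first leg by \<open>z\<close> and W by \<open>Wst\<close>;
  cancelling \<open>Wst\<close> leaves 1 \<otimes> g = z \<otimes> 1, which forces scalars.\<close>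

lemma \<Delta>_eq_one_tensor_imp_scalar:
  assumes z: "z \<in> M" and \<Delta>z: "\<Delta> z = op_tensor t id_blinfun z"
  obtains c where "z = cscale c id_blinfun"
proof -
  define g where "g = R z"
  have gM: "g \<in> M" by (simp add: g_def R_M z)
  note cz = M_clin[OF z] and cg = M_clin[OF gM]
  have \<Delta>g: "\<Delta> g = op_tensor t g id_blinfun"
    by (rule t.tensor_oper_eqI)
      (simp add: g_def \<Delta>_R z \<Delta>z cz cg[unfolded g_def] t.cinner_tensor cinner_R mult.commute)
  have eq: "op_tensor t id_blinfun g o\<^sub>L radj Wst = radj Wst o\<^sub>L op_tensor t g id_blinfun"
    using W_\<Delta>[OF gM] \<Delta>g by simp
  have sl: "rsl t \<zeta> (blinfun_apply (radj g) \<zeta>') (radj Wst) = rsl t \<zeta> \<zeta>' (radj Wst) o\<^sub>L g" for \<zeta> \<zeta>'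
  proof (rule oper_eqI)
    fix \<xi> \<eta>
    have "cinner (blinfun_apply (op_tensor t id_blinfun g o\<^sub>L radj Wst) (t \<xi> \<zeta>)) (t \<eta> \<zeta>')
        = cinner (blinfun_apply (radj Wst o\<^sub>L op_tensor t g id_blinfun) (t \<xi> \<zeta>)) (t \<eta> \<zeta>')"
      by (simp only: eq)
    then show "cinner (blinfun_apply (rsl t \<zeta> (blinfun_apply (radj g) \<zeta>') (radj Wst)) \<xi>) \<eta>
        = cinner (blinfun_apply (rsl t \<zeta> \<zeta>' (radj Wst) o\<^sub>L g) \<xi>) \<eta>"
      using cg by (simp add: t.cinner_rsl cinner_radj t.radj_op_tensor)
  qed
  have sl': "rsl t \<zeta> (blinfun_apply (radj g) \<zeta>') Wst = z o\<^sub>L rsl t \<zeta> \<zeta>' Wst" for \<zeta> \<zeta>'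
    using arg_cong[OF sl[of \<zeta> \<zeta>'], of R] by (simp add: R_rsl_W R_mult rsl_W_M gM) (simp add: g_def R_R z)
  have "op_tensor t id_blinfun g o\<^sub>L Wst = op_tensor t z id_blinfun o\<^sub>L Wst"
  proof (rule t.tensor_oper_eqI)
    fix \<xi> \<zeta> \<eta> \<zeta>'
    have "cinner (blinfun_apply (rsl t \<zeta> (blinfun_apply (radj g) \<zeta>') Wst) \<xi>) \<eta> = cinner (blinfun_apply (z o\<^sub>L rsl t \<zeta> \<zeta>' Wst) \<xi>) \<eta>"
      by (simp only: sl')
    then show "cinner (blinfun_apply (op_tensor t id_blinfun g o\<^sub>L Wst) (t \<xi> \<zeta>)) (t \<eta> \<zeta>')
        = cinner (blinfun_apply (op_tensor t z id_blinfun o\<^sub>L Wst) (t \<xi> \<zeta>)) (t \<eta> \<zeta>')"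
      using cg cz by (simp add: t.cinner_rsl cinner_radj t.radj_op_tensor)
  qed
  then have "(op_tensor t id_blinfun g o\<^sub>L Wst) o\<^sub>L radj Wst = (op_tensor t z id_blinfun o\<^sub>L Wst) o\<^sub>L radj Wst" by simp
  then have e: "op_tensor t id_blinfun g = op_tensor t z id_blinfun" by (simp add: compose_assoc W_unitary)
  have prod: "cinner \<xi> \<eta> * cinner (blinfun_apply g \<zeta>) \<zeta>' = cinner (blinfun_apply z \<xi>) \<eta> * cinner \<zeta> \<zeta>'" for \<xi> \<eta> \<zeta> \<zeta>'
    using arg_cong[OF e, of "\<lambda>X. cinner (blinfun_apply X (t \<xi> \<zeta>)) (t \<eta> \<zeta>')"] cg cz by (simp add: t.cinner_tensor)
  show ?thesis
  \<comment> \<open>The Hilbert space may be zero; then there is no vector to divide by and every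
    operator is the scalar 0.\<close>
  proof (cases "\<exists>v::'h. v \<noteq> 0")
    case True
    then obtain v :: 'h where v: "v \<noteq> 0" by blast
    then have nz: "cinner v v \<noteq> 0" by (simp add: cinner_self)
    have "z = cscale (cinner (blinfun_apply g v) v / cinner v v) id_blinfun"
      by (rule oper_eqI) (use prod[of _ _ v v] nz in \<open>simp add: cinner_scaleC_left field_simps\<close>)
    then show ?thesis by (rule that)
  next
    case False
    then have "z = cscale 0 id_blinfun" by (intro blinfun_eqI) metis
    then show ?thesis by (rule that)
  qed
qed

end

section \<open>The reduced C*-algebra\<close>

lemma (in vn_algebra) M_closed: "closed M"
  unfolding closed_sequential_limits
proof (intro allI impI, elim conjE)
  fix f x assume f: "\<forall>n. f n \<in> M" "f \<longlonglongrightarrow> x"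
  show "x \<in> M"
  proof (rule M_I)
    show "clin x" by (rule clin_limit[OF M_clin f(2)]) (rule f(1)[rule_format])
    fix u assume u: "u \<in> commutant M"
    have "(\<lambda>n. f n o\<^sub>L u) \<longlonglongrightarrow> (x o\<^sub>L u)" "(\<lambda>n. u o\<^sub>L f n) \<longlonglongrightarrow> (u o\<^sub>L x)"
      by (rule bounded_bilinear.tendsto[OF bounded_bilinear_blinfun_compose], rule f(2) tendsto_const, rule f(2) tendsto_const)+
    moreover have "(\<lambda>n. f n o\<^sub>L u) = (\<lambda>n. u o\<^sub>L f n)" using f(1) commutant_commutes[OF u] by auto
    ultimately show "x o\<^sub>L u = u o\<^sub>L x" by (metis LIMSEQ_unique)
  qed
qed

lemma closure_span_image:
  fixes T :: "'a::real_normed_vector \<Rightarrow> 'b::real_normed_vector"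
  assumes T: "bounded_linear T" and S: "\<And>s. s \<in> S \<Longrightarrow> T s \<in> closure (span S')" and x: "x \<in> closure (span S)"
  shows "T x \<in> closure (span S')"
proof -
  interpret T: bounded_linear T by (rule T)
  have "span S \<subseteq> {x. T x \<in> closure (span S')}"
  proof (rule span_minimal)
    show "subspace {x. T x \<in> closure (span S')}"
      using closed_subspace_closure[OF subspace_span[of S']]
      by (auto simp: subspace_def T.add T.scaleR T.zero)
  qed (use S in auto)
  then have "T ` closure (span S) \<subseteq> closure (span S')"
    by (intro image_closure_subset linear_continuous_on T) auto
  then show ?thesis using x by blast
qed

context hilbert_square
begin

lemma flip_square: "hilbert_square (\<lambda>b a. t a b)"
  by (rule hilbert_square.intro[OF flip_tensor])

lemma slice_right_flip: "slice_right t = slice_left (\<lambda>b a. t a b)"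
  by (simp add: fun_eq_iff slice_right_def slice_left_def)

lemma slice_right_eq:
  assumes "l2_seq \<xi>" "l2_seq \<eta>"
  shows "slice_right t \<xi> \<eta> X = (\<Sum>n. rsl t (\<xi> n) (\<eta> n) X)" "summable (\<lambda>n. rsl t (\<xi> n) (\<eta> n) X)"
  using hilbert_square.slice_left_eq[OF flip_square assms] hilbert_square.summable_lsl[OF flip_square assms]
  by (simp_all only: slice_right_flip lsl_flip[of t])

lemma norm_rsl_le: "norm (rsl t \<xi> \<eta> X) \<le> norm X * (norm \<xi> * norm \<eta>)"
  using hilbert_tensor.norm_lsl_le[OF flip_tensor, of \<xi> \<eta> X] by (simp only: lsl_flip[of t])

lemma rsl_add_right: "rsl t \<xi> (\<eta> + \<eta>') X = rsl t \<xi> \<eta> X + rsl t \<xi> \<eta>' X"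
  using hilbert_tensor.lsl_add_right[OF flip_tensor, of \<xi> \<eta> \<eta>' X] by (simp only: lsl_flip[of t])

lemma rsl_scale_right: "rsl t \<xi> (c *\<^sub>C \<eta>) X = cscale (cnj c) (rsl t \<xi> \<eta> X)"
  using hilbert_tensor.lsl_scale_right[OF flip_tensor, of \<xi> c \<eta> X] by (simp only: lsl_flip[of t])

lemma rsl_scale_left: "clin X \<Longrightarrow> rsl t (c *\<^sub>C \<xi>) \<eta> X = cscale c (rsl t \<xi> \<eta> X)"
  using hilbert_tensor.lsl_scale_left[OF flip_tensor, of X c \<xi> \<eta>] by (simp only: lsl_flip[of t])

lemma bounded_linear_rsl_right: "bounded_linear (\<lambda>\<eta>. rsl t \<xi> \<eta> X)"
proof (rule bounded_linear_intro)
  show "rsl t \<xi> (r *\<^sub>R x) X = r *\<^sub>R rsl t \<xi> x X" for r x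
    using rsl_scale_right[of \<xi> "of_real r" x X] by (simp add: scaleR_scaleC cscale_of_real)
  show "norm (rsl t \<xi> x X) \<le> norm x * (norm X * norm \<xi>)" for x
    using norm_rsl_le[of \<xi> x X] by (simp add: mult_ac)
qed (rule rsl_add_right)

text \<open>Slices by normal functionals are norm limits of sums of slices by vector functionals.
  Conversely they already form a subspace, sums being realised by interleaving the
  sequences.\<close>

lemma closure_slice_right:
  assumes X: "clin X"
  shows "closure {slice_right t \<xi> \<eta> X | \<xi> \<eta>. l2_seq \<xi> \<and> l2_seq \<eta>} = closure (span {rsl t \<zeta> \<zeta>' X | \<zeta> \<zeta>'. True})"
proof (rule antisym)
  let ?A = "{slice_right t \<xi> \<eta> X | \<xi> \<eta>. l2_seq \<xi> \<and> l2_seq \<eta>}" and ?G = "{rsl t \<zeta> \<zeta>' X | \<zeta> \<zeta>'. True}"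
  show "closure ?A \<subseteq> closure (span ?G)"
  proof (rule closure_minimal)
    show "?A \<subseteq> closure (span ?G)"
    proof
      fix x assume "x \<in> ?A"
      then obtain \<xi> \<eta> where x: "x = slice_right t \<xi> \<eta> X" "l2_seq \<xi>" "l2_seq \<eta>" by blast
      have "(\<lambda>K. \<Sum>n<K. rsl t (\<xi> n) (\<eta> n) X) \<longlonglongrightarrow> x"
        unfolding x(1) slice_right_eq(1)[OF x(2,3)] by (rule summable_LIMSEQ[OF slice_right_eq(2)[OF x(2,3)]])
      moreover have "(\<Sum>n<K. rsl t (\<xi> n) (\<eta> n) X) \<in> span ?G" for K
        by (intro span_sum span_base) blast
      ultimately show "x \<in> closure (span ?G)" unfolding closure_sequential by (intro exI conjI allI)
    qed
  qed simp
  have "span ?G \<subseteq> ?A"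
  proof (rule span_minimal)
    show "?G \<subseteq> ?A"
    proof
      fix x assume "x \<in> ?G"
      then obtain \<zeta> \<zeta>' where x: "x = rsl t \<zeta> \<zeta>' X" by blast
      have "rsl t 0 0 X = 0" by (rule oper_eqI) (simp add: cinner_rsl bb.zero_right)
      then have "slice_right t (single_seq \<zeta>) (single_seq \<zeta>') X = rsl t \<zeta> \<zeta>' X"
        by (simp add: slice_right_eq suminf_single_seq[of "\<lambda>a b. rsl t a b X"])
      then show "x \<in> ?A" unfolding x using l2_seq_single by (metis (mono_tags, lifting) mem_Collect_eq)
    qed
    show "subspace ?A"
    proof (rule subspaceI)
      have "slice_right t (\<lambda>_. 0) (\<lambda>_. 0) X = 0"
        using bb.zero_right by (simp add: slice_right_eq l2_seq_def rsl_def)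
          (simp add: tright_def zero_blinfun.abs_eq[symmetric])
      moreover have "l2_seq (\<lambda>_. 0 :: 'h)" by (simp add: l2_seq_def)
      ultimately show "0 \<in> ?A" by (metis (mono_tags, lifting) mem_Collect_eq)
    next
      fix x y assume "x \<in> ?A" "y \<in> ?A"
      then obtain \<xi> \<eta> \<xi>' \<eta>' where xy: "x = slice_right t \<xi> \<eta> X" "l2_seq \<xi>" "l2_seq \<eta>"
        "y = slice_right t \<xi>' \<eta>' X" "l2_seq \<xi>'" "l2_seq \<eta>'" by blast
      have l: "l2_seq (interleave \<xi> \<xi>')" "l2_seq (interleave \<eta> \<eta>')"
        using xy by (auto intro: l2_seq_interleave)
      have "slice_right t (interleave \<xi> \<xi>') (interleave \<eta> \<eta>') X = x + y"
        unfolding slice_right_eq(1)[OF l] interleave_map[of "\<lambda>a b. rsl t a b X"] xy(1,4)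
          slice_right_eq(1)[OF xy(2,3)] slice_right_eq(1)[OF xy(5,6)]
        by (rule sums_unique[symmetric], rule sums_interleave)
          (intro summable_sums slice_right_eq(2) xy)+
      then show "x + y \<in> ?A" using l by (metis (mono_tags, lifting) mem_Collect_eq)
    next
      fix r x assume "x \<in> ?A"
      then obtain \<xi> \<eta> where x: "x = slice_right t \<xi> \<eta> X" "l2_seq \<xi>" "l2_seq \<eta>" by blast
      have l: "l2_seq (\<lambda>n. r *\<^sub>R \<xi> n)"
        using x(2) by (simp add: l2_seq_def power_mult_distrib summable_mult)
      have "rsl t (r *\<^sub>R \<xi> n) (\<eta> n) X = r *\<^sub>R rsl t (\<xi> n) (\<eta> n) X" for n
        using rsl_scale_left[OF X, of "of_real r"] by (simp add: scaleR_scaleC cscale_of_real)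
      then have "slice_right t (\<lambda>n. r *\<^sub>R \<xi> n) \<eta> X = r *\<^sub>R x"
        unfolding x(1) slice_right_eq(1)[OF l x(3)] slice_right_eq(1)[OF x(2,3)]
        by (simp add: suminf_scaleR_right[OF slice_right_eq(2)[OF x(2,3)]])
      then show "r *\<^sub>R x \<in> ?A" using l x(3) by (metis (mono_tags, lifting) mem_Collect_eq)
    qed
  qed
  then show "closure (span ?G) \<subseteq> closure ?A" by (rule closure_mono)
qed

end

section \<open>The reduced algebra as a closed span of slices\<close>

context kac_group
begin

definition slices :: "'h oper set" where
  "slices = {rsl t \<zeta> \<zeta>' (radj Wst) | \<zeta> \<zeta>'. True}"

definition C_red :: "'h oper set" where "C_red = closure (span slices)"

lemma C0_eq: "C0 t M \<Delta> \<phi> \<Lambda> = C_red"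
  unfolding C0_def mult_unitary_eq C_red_def slices_def by (rule closure_slice_right) simp

lemma subspace_C_red: "subspace C_red"
  unfolding C_red_def by (rule closed_subspace_closure[OF subspace_span])

lemma slice_in_C_red: "rsl t \<zeta> \<zeta>' (radj Wst) \<in> C_red"
  unfolding C_red_def slices_def by (rule subsetD[OF closure_subset], rule span_base) blast

lemma C_red_M: "C_red \<subseteq> M"
proof -
  have "subspace M" by (simp add: subspace_def M_add M_scaleR)
  then have "span slices \<subseteq> M" unfolding slices_def by (intro span_minimal) (auto simp: rsl_W_M)
  then show ?thesis unfolding C_red_def by (rule closure_minimal) (rule M_closed)
qed

lemma C_red_map:
  assumes "bounded_linear T" "\<And>\<zeta> \<zeta>'. T (rsl t \<zeta> \<zeta>' (radj Wst)) \<in> C_red" "x \<in> C_red"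
  shows "T x \<in> C_red"
  unfolding C_red_def by (rule closure_span_image[OF assms(1) _ assms(3)[unfolded C_red_def]])
    (use assms(2) in \<open>auto simp: slices_def C_red_def\<close>)

text \<open>\<open>J\<close> is constructed as an isometry and its range is left open, so the range
  of \<open>J\<close> in the first leg replaces the whole space. W and \<open>Wst\<close> preserve
  this subspace because their first legs lie in \<open>M\<close>, which moves past \<open>J\<close>
  by \<open>M_J\<close>.\<close>

definition J_tensors :: "'k set" where
  "J_tensors = closure (span {t (blinfun_apply J x) u | x u. True})"

lemma J_tensors_I:
  assumes "\<And>q. blinfun_apply (radj (tright t q)) s \<in> range (blinfun_apply J)"
  shows "s \<in> J_tensors"
proof -
  have hs: "((\<lambda>e. t (blinfun_apply (radj (tright t e)) s) e) has_sum s) onb"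
    using hilbert_tensor.tensor_expansion_left[OF t.flip_tensor is_onb, of s] by (simp only: tleft_flip(1)[of t])
  have "(\<Sum>e\<in>F. t (blinfun_apply (radj (tright t e)) s) e) \<in> J_tensors" for F
    unfolding J_tensors_def
  proof (intro subsetD[OF closure_subset] span_sum span_base)
    fix e
    obtain x where "blinfun_apply (radj (tright t e)) s = blinfun_apply J x" using assms[of e] by (rule rangeE)
    then show "t (blinfun_apply (radj (tright t e)) s) e \<in> {t (blinfun_apply J x) u | x u. True}" by auto
  qed
  then show ?thesis
    using Lim_in_closed_set[of J_tensors "\<lambda>F. \<Sum>e\<in>F. t (blinfun_apply (radj (tright t e)) s) e" "finite_subsets_at_top onb" s]
      hs unfolding has_sum_def by (simp add: J_tensors_def finite_subsets_at_top_neq_bot)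
qed

lemma Wst_J_tensors: "blinfun_apply Wst (t (blinfun_apply J x) u) \<in> J_tensors"
  by (rule J_tensors_I) (simp only: t.rsl_apply[symmetric] M_J[OF rsl_Wst_M] rangeI)

lemma W_J_tensors: "blinfun_apply (radj Wst) (t (blinfun_apply J x) u) \<in> J_tensors"
  by (rule J_tensors_I) (simp only: t.rsl_apply[symmetric] M_J[OF rsl_W_M] rangeI)

lemma radj_J_J: "blinfun_apply (radj J) (blinfun_apply J x) = x"
proof (rule inner_eqI)
  fix z
  show "inner z (blinfun_apply (radj J) (blinfun_apply J x)) = inner z x"
    by (subst inner_radj[symmetric], subst inner_commute[of z]) (simp add: inner_eq_Re_cinner)
qed

lemma aclin_radj_J: "blinfun_apply (radj J) (c *\<^sub>C x) = cnj c *\<^sub>C blinfun_apply (radj J) x"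
proof (rule inner_eqI)
  fix z
  have "inner (blinfun_apply J z) (c *\<^sub>C x) = inner (cnj c *\<^sub>C blinfun_apply J z) x"
    by (simp add: inner_eq_Re_cinner cinner_scaleC_left cinner_scaleC_right)
  also have "cnj c *\<^sub>C blinfun_apply J z = blinfun_apply J (c *\<^sub>C z)"
    by (simp add: aclinD[OF aclin_J])
  finally have "inner (blinfun_apply J z) (c *\<^sub>C x) = inner (c *\<^sub>C z) (blinfun_apply (radj J) x)"
    by (simp only: inner_radj)
  moreover have "inner (c *\<^sub>C z) (blinfun_apply (radj J) x) = inner z (cnj c *\<^sub>C blinfun_apply (radj J) x)"
    by (simp add: inner_eq_Re_cinner cinner_scaleC_left cinner_scaleC_right)
  ultimately show "inner z (blinfun_apply (radj J) (c *\<^sub>C x)) = inner z (cnj c *\<^sub>C blinfun_apply (radj J) x)"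
    by (simp only: inner_radj)
qed

text \<open>The conjugate-linear map \<open>s \<mapsto> \<Gamma>(s)\<close> interpolates between the products \<open>a b\<^sup>*\<close> of slices and the slices
  themselves: it takes the former values on \<open>J\<xi> \<otimes> \<zeta>\<close> and the latter on \<open>W\<^sup>*(Jx \<otimes> u)\<close>.\<close>

lemma slice_product_map:
  obtains \<Gamma> :: "'k \<Rightarrow> 'h oper" where "bounded_linear \<Gamma>"
    "\<And>\<xi> \<zeta>. \<Gamma> (t (blinfun_apply J \<xi>) \<zeta>) = rsl t \<xi> \<eta> (radj Wst) o\<^sub>L rsl t \<zeta>' \<zeta> Wst"
    "\<And>x u. \<Gamma> (blinfun_apply Wst (t (blinfun_apply J x) u)) = rsl t x (blinfun_apply (rsl t u \<zeta>' (radj Wst)) \<eta>) (radj Wst)"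
proof -
  \<comment> \<open>The right slice is conjugate linear in \<open>q\<close>, and the adjoint of
    \<open>J\<close> makes it linear again. A vector of the form J\<xi> \<otimes> \<zeta> is thereby
    encoded as the rank-one operator that sends \<open>q\<close> to the multiple of
    \<open>\<xi>\<close> by its inner product with \<open>\<zeta>\<close>.\<close>
  define c where "c s q = blinfun_apply (radj J) (blinfun_apply (radj (tright t q)) s)" for s q
  have trs_add: "blinfun_apply (radj (tright t (p + q))) s = blinfun_apply (radj (tright t p)) s + blinfun_apply (radj (tright t q)) s"
    and trs_scale: "blinfun_apply (radj (tright t (a *\<^sub>C p))) s = cnj a *\<^sub>C blinfun_apply (radj (tright t p)) s" for p q s a
    by (rule cinner_eqI, simp add: t.cinner_tright cinner_add_left t.add_right cinner_add_right
        t.scale_right cinner_scaleC_left cinner_scaleC_right)+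
  have c_add: "c s (p + q) = c s p + c s q" for s p q by (simp add: c_def trs_add blinfun.add_right)
  have c_scale: "c s (a *\<^sub>C q) = a *\<^sub>C c s q" for s a q by (simp add: c_def trs_scale aclin_radj_J)
  have c_norm: "norm (c s q) \<le> norm s * norm q" for s q
  proof -
    have "norm J \<le> 1" by (rule norm_blinfun_bound) simp_all
    have "norm (c s q) \<le> norm (radj J) * norm (blinfun_apply (radj (tright t q)) s)"
      unfolding c_def by (rule norm_blinfun)
    also have "\<dots> \<le> 1 * (norm (radj (tright t q)) * norm s)"
      using \<open>norm J \<le> 1\<close> by (intro mult_mono norm_blinfun) simp_all
    also have "\<dots> \<le> norm q * norm s"
      using t.norm_tright_le[of q] by (simp add: mult_right_mono)
    finally show ?thesis by (simp add: mult.commute)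
  qed
  have c_bl: "bounded_linear (c s)" for s
  proof (rule bounded_linear_intro[OF c_add])
    show "c s (r *\<^sub>R x) = r *\<^sub>R c s x" for r x using c_scale[of s "of_real r" x] by (simp add: scaleR_scaleC)
    show "norm (c s x) \<le> norm x * norm s" for x using c_norm[of s x] by (simp add: mult.commute)
  qed
  define Cc where "Cc s = Blinfun (c s)" for s
  have Capp: "blinfun_apply (Cc s) = c s" for s unfolding Cc_def by (rule bounded_linear_Blinfun_apply[OF c_bl])
  have Ccl: "clin (Cc s)" for s by (simp add: clin_def Capp c_scale)
  have C_add: "Cc (s + s') = Cc s + Cc s'" for s s'
    by (rule blinfun_eqI) (simp add: Capp c_def blinfun.add_left blinfun.add_right)
  have C_scaleR: "Cc (r *\<^sub>R s) = cscale (of_real r) (Cc s)" for r s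
    by (rule blinfun_eqI) (simp add: Capp c_def blinfun.scaleR_right blinfun.scaleR_left cscale_of_real)
  have C_norm: "norm (Cc s) \<le> norm s" for s
    by (rule norm_blinfun_bound) (simp_all add: Capp c_norm)
  define \<Gamma> where "\<Gamma> s = rsl t \<zeta>' \<eta> (radj Wst o\<^sub>L (op_tensor t id_blinfun (Cc s) o\<^sub>L Wst))" for s
  have rsl_lin: "rsl t a b (X + Y) = rsl t a b X + rsl t a b Y" "rsl t a b (cscale z X) = cscale z (rsl t a b X)"
    for a b and X Y :: "'k oper" and z
    by (rule oper_eqI, simp add: t.cinner_rsl blinfun.add_left cinner_add_left cinner_scaleC_left)+
  have bl: "bounded_linear \<Gamma>"
  proof (rule bounded_linear_intro)
    show "\<Gamma> (x + y) = \<Gamma> x + \<Gamma> y" for x y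
      by (simp add: \<Gamma>_def C_add t.op_tensor_add_right Ccl compose_add_left compose_add_right rsl_lin)
    have "\<Gamma> (r *\<^sub>R x) = cscale (of_real r) (\<Gamma> x)" for r x
      by (simp add: \<Gamma>_def C_scaleR t.op_tensor_cscale Ccl compose_cscale_left compose_cscale_right rsl_lin del: cscale_of_real)
    then show "\<Gamma> (r *\<^sub>R x) = r *\<^sub>R \<Gamma> x" for r x by (simp add: cscale_of_real)
    show "norm (\<Gamma> x) \<le> norm x * (norm (radj Wst) * norm Wst * (norm \<zeta>' * norm \<eta>))" for x
    proof -
      have "norm (radj Wst o\<^sub>L (op_tensor t id_blinfun (Cc x) o\<^sub>L Wst)) \<le> norm (radj Wst) * norm (op_tensor t id_blinfun (Cc x) o\<^sub>L Wst)"
        by (rule norm_blinfun_compose)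
      also have "\<dots> \<le> norm (radj Wst) * (norm (op_tensor t id_blinfun (Cc x)) * norm Wst)"
        by (intro mult_left_mono norm_blinfun_compose) simp
      also have "\<dots> \<le> norm (radj Wst) * (norm x * norm Wst)"
        using t.norm_op_tensor_id_right_le[OF Ccl[of x]] C_norm[of x]
        by (intro mult_left_mono mult_right_mono) auto
      finally have "norm (\<Gamma> x) \<le> norm (radj Wst) * (norm x * norm Wst) * (norm \<zeta>' * norm \<eta>)"
        unfolding \<Gamma>_def by (rule order_trans[OF norm_rsl_le mult_right_mono]) simp
      then show ?thesis by (simp add: mult_ac)
    qed
  qed
  have on_J_tensors: "\<Gamma> (t (blinfun_apply J \<xi>) \<zeta>) = rsl t \<xi> \<eta> (radj Wst) o\<^sub>L rsl t \<zeta>' \<zeta> Wst" for \<xi> \<zeta>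
  proof -
    have "blinfun_apply (Cc (t (blinfun_apply J \<xi>) \<zeta>)) q = cinner q \<zeta> *\<^sub>C \<xi>" for q
      by (simp add: Capp c_def t.radj_tright_tensor aclin_radj_J radj_J_J cinner_commute[symmetric])
    then have "op_tensor t id_blinfun (Cc (t (blinfun_apply J \<xi>) \<zeta>)) = tright t \<xi> o\<^sub>L radj (tright t \<zeta>)"
      by (intro t.tensor_blinfun_eqI) (simp add: Ccl t.radj_tright_tensor t.scale_left t.scale_right)
    then show ?thesis by (simp add: \<Gamma>_def rsl_def compose_assoc)
  qed
  have on_W: "\<Gamma> (blinfun_apply Wst (t (blinfun_apply J x) u)) = rsl t x (blinfun_apply (rsl t u \<zeta>' (radj Wst)) \<eta>) (radj Wst)" for x u
  proof -
    define D where "D = Cc (blinfun_apply Wst (t (blinfun_apply J x) u))"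
    have cD: "clin D" by (simp add: D_def Ccl)
    have Dq: "blinfun_apply D q = blinfun_apply (rsl t q u Wst) x" for q
      by (simp add: D_def Capp c_def t.rsl_apply[symmetric] M_J[OF rsl_Wst_M] radj_J_J R_rsl_Wst t.radj_rsl)
    define y where "y = rsl t \<zeta>' u Wst"
    have yM: "y \<in> M" unfolding y_def by (rule rsl_Wst_M)
    have ry: "radj y = rsl t u \<zeta>' (radj Wst)" by (simp add: y_def t.radj_rsl)
    \<comment> \<open>The sliced pentagon: the operator encoding
      \<open>Wst (J x \<otimes> u)\<close>, placed behind \<open>Wst\<close>, acts as the coproduct
      of a slice \<open>y\<close>. Then \<open>W_\<Delta>\<close> moves \<open>y\<close> across W
      and onto the vector \<open>\<eta>\<close>.\<close>
    have key: "blinfun_apply (op_tensor t id_blinfun D) (blinfun_apply Wst (t a \<zeta>')) = blinfun_apply (\<Delta> y) (t a x)" for a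
    proof (rule t.tensor_cinner_eqI)
      fix b c
      have "cinner (blinfun_apply (op_tensor t id_blinfun D) (blinfun_apply Wst (t a \<zeta>'))) (t b c)
          = cinner (blinfun_apply D (blinfun_apply (lsl t a b Wst) \<zeta>')) c"
        by (simp add: cinner_radj cD t.radj_op_tensor t.cinner_lsl)
      also have "\<dots> = cinner (blinfun_apply (lsl t x c Wst) (blinfun_apply (lsl t a b Wst) \<zeta>')) u"
        by (simp add: Dq t.cinner_rsl t.cinner_lsl)
      also have "\<dots> = cinner (blinfun_apply (\<Delta> y) (t a x)) (t b c)"
        unfolding y_def by (rule \<Delta>_rsl_Wst[symmetric])
      finally show "cinner (blinfun_apply (op_tensor t id_blinfun D) (blinfun_apply Wst (t a \<zeta>'))) (t b c)
          = cinner (blinfun_apply (\<Delta> y) (t a x)) (t b c)" .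
    qed
    show ?thesis
    proof (rule oper_eqI)
      fix a b
      have "cinner (blinfun_apply (\<Gamma> (blinfun_apply Wst (t (blinfun_apply J x) u))) a) b
          = cinner (blinfun_apply (radj Wst o\<^sub>L \<Delta> y) (t a x)) (t b \<eta>)"
        by (simp add: \<Gamma>_def t.cinner_rsl key D_def[symmetric])
      also have "\<dots> = cinner (blinfun_apply (radj Wst) (t a x)) (t b (blinfun_apply (radj y) \<eta>))"
        unfolding W_\<Delta>[OF yM] by (simp add: cinner_radj M_clin yM t.radj_op_tensor)
      finally show "cinner (blinfun_apply (\<Gamma> (blinfun_apply Wst (t (blinfun_apply J x) u))) a) b
          = cinner (blinfun_apply (rsl t x (blinfun_apply (rsl t u \<zeta>' (radj Wst)) \<eta>) (radj Wst)) a) b"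
        by (simp add: t.cinner_rsl ry)
    qed
  qed
  show ?thesis using that[OF bl on_J_tensors on_W] .
qed

definition slice_products :: "'h oper set" where
  "slice_products = {rsl t \<xi> \<eta> (radj Wst) o\<^sub>L rsl t \<zeta>' \<zeta> Wst | \<xi> \<eta> \<zeta>' \<zeta>. True}"

text \<open>By unitarity J\<xi> \<otimes> \<zeta> is \<open>Wst\<close> applied to an element of
  \<open>J_tensors\<close>, and on such vectors \<open>\<Gamma>\<close> takes values in
  \<open>C_red\<close>.\<close>

lemma slice_products_subset_C_red: "slice_products \<subseteq> C_red"
proof
  fix y assume "y \<in> slice_products"
  then obtain \<xi> \<eta> \<zeta>' \<zeta> where y: "y = rsl t \<xi> \<eta> (radj Wst) o\<^sub>L rsl t \<zeta>' \<zeta> Wst" unfolding slice_products_def by blast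
  obtain \<Gamma> :: "'k \<Rightarrow> 'h oper" where \<Gamma>: "bounded_linear \<Gamma>"
    "\<And>\<xi> \<zeta>. \<Gamma> (t (blinfun_apply J \<xi>) \<zeta>) = rsl t \<xi> \<eta> (radj Wst) o\<^sub>L rsl t \<zeta>' \<zeta> Wst"
    "\<And>x u. \<Gamma> (blinfun_apply Wst (t (blinfun_apply J x) u)) = rsl t x (blinfun_apply (rsl t u \<zeta>' (radj Wst)) \<eta>) (radj Wst)"
    by (rule slice_product_map) (rule that)
  have bl: "bounded_linear (\<lambda>s. \<Gamma> (blinfun_apply Wst s))"
    by (rule bounded_linear_compose[OF \<Gamma>(1) blinfun.bounded_linear_right])
  have "blinfun_apply (Wst o\<^sub>L radj Wst) (t (blinfun_apply J \<xi>) \<zeta>) = t (blinfun_apply J \<xi>) \<zeta>"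
    by (simp add: W_unitary)
  then have "y = \<Gamma> (blinfun_apply Wst (blinfun_apply (radj Wst) (t (blinfun_apply J \<xi>) \<zeta>)))"
    using \<Gamma>(2) y by simp
  also have "\<dots> \<in> C_red"
    unfolding C_red_def
    by (rule closure_span_image[OF bl _ W_J_tensors[unfolded J_tensors_def]]) (auto simp: \<Gamma>(3) slice_in_C_red[unfolded C_red_def])
  finally show "y \<in> C_red" .
qed

text \<open>The same map read in the other direction: \<open>Wst (J x \<otimes> u)\<close> is a
  limit of combinations of vectors J\<xi> \<otimes> \<zeta>, on which \<open>\<Gamma>\<close> gives
  products. This reaches slices of W whose second vector is itself a slice of W applied to a vector;
  such vectors are total because \<open>Wst\<close> is isometric.\<close>

lemma C_red_subset_slice_products: "C_red \<subseteq> closure (span slice_products)"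
proof -
  have base: "rsl t x (blinfun_apply (rsl t u \<zeta>' (radj Wst)) \<eta>) (radj Wst) \<in> closure (span slice_products)" for x u \<zeta>' \<eta>
  proof -
    obtain \<Gamma> :: "'k \<Rightarrow> 'h oper" where \<Gamma>: "bounded_linear \<Gamma>"
      "\<And>\<xi> \<zeta>. \<Gamma> (t (blinfun_apply J \<xi>) \<zeta>) = rsl t \<xi> \<eta> (radj Wst) o\<^sub>L rsl t \<zeta>' \<zeta> Wst"
      "\<And>x u. \<Gamma> (blinfun_apply Wst (t (blinfun_apply J x) u)) = rsl t x (blinfun_apply (rsl t u \<zeta>' (radj Wst)) \<eta>) (radj Wst)"
      by (rule slice_product_map) (rule that)
    have "\<Gamma> (t (blinfun_apply J \<xi>) \<zeta>) \<in> closure (span slice_products)" for \<xi> \<zeta>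
      unfolding \<Gamma>(2) slice_products_def by (rule subsetD[OF closure_subset], rule span_base) blast
    then show ?thesis
      unfolding \<Gamma>(3)[symmetric]
      by (intro closure_span_image[OF \<Gamma>(1) _ Wst_J_tensors[unfolded J_tensors_def]]) auto
  qed
  have "rsl t x w (radj Wst) \<in> closure (span slice_products)" for x w
  proof -
    interpret b: bounded_linear "\<lambda>w. rsl t x w (radj Wst)" by (rule bounded_linear_rsl_right)
    have "{w. rsl t x w (radj Wst) \<in> closure (span slice_products)} = UNIV"
    proof (rule closed_subspace_eq_UNIV)
      show "subspace {w. rsl t x w (radj Wst) \<in> closure (span slice_products)}"
        using closed_subspace_closure[OF subspace_span[of slice_products]]
        by (auto simp: subspace_def b.add b.scaleR b.zero)
      show "closed {w. rsl t x w (radj Wst) \<in> closure (span slice_products)}"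
        by (rule continuous_closed_vimage[unfolded vimage_def]) (auto intro: b.isCont continuous_ident)
      fix v assume v: "\<And>s. s \<in> {w. rsl t x w (radj Wst) \<in> closure (span slice_products)} \<Longrightarrow> inner v s = 0"
      have "blinfun_apply Wst (t v \<zeta>') = 0" for \<zeta>'
      proof (rule t.tensor_cinner_eqI)
        fix \<eta> u
        have z: "inner v (blinfun_apply (rsl t u \<zeta>' (radj Wst)) \<eta>) = 0" for \<eta>
          using v base by blast
        from z[of \<eta>] z[of "\<i> *\<^sub>C \<eta>"]
        have "cinner v (blinfun_apply (rsl t u \<zeta>' (radj Wst)) \<eta>) = 0"
          by (simp add: cinner_eq_inner complex_eq_iff clinD)
        then have "cinner (blinfun_apply (rsl t u \<zeta>' (radj Wst)) \<eta>) v = 0"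
          by (metis cinner_commute complex_cnj_zero)
        then have "cinner (t \<eta> u) (blinfun_apply Wst (t v \<zeta>')) = 0"
          by (simp add: t.cinner_rsl cinner_radj'[symmetric])
        then show "cinner (blinfun_apply Wst (t v \<zeta>')) (t \<eta> u) = cinner 0 (t \<eta> u)"
          by (metis cinner_commute cinner_zero(1) complex_cnj_zero)
      qed
      then have "norm (t v v) = 0" by (metis norm_Wst norm_zero)
      then show "v = 0" by (simp add: t.norm_tensor)
    qed
    then show ?thesis by blast
  qed
  then have "slices \<subseteq> closure (span slice_products)" unfolding slices_def by blast
  then have "span slices \<subseteq> closure (span slice_products)"
    by (intro span_minimal closed_subspace_closure subspace_span)
  then show ?thesis unfolding C_red_def by (intro closure_minimal) auto
qed

text \<open>Adjoints turn slices of W into slices of \<open>Wst\<close>, so the defining span shows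
  no symmetry. The products of a slice of W with the adjoint of another one are visibly stable under
  adjoints, and they span a dense subspace.\<close>

lemma C_red_radj: "x \<in> C_red \<Longrightarrow> radj x \<in> C_red"
proof -
  assume "x \<in> C_red"
  then have x: "x \<in> closure (span slice_products)" using C_red_subset_slice_products by blast
  show "radj x \<in> C_red"
    unfolding C_red_def
  proof (rule closure_span_image[OF bounded_linear_radj _ x])
    fix s assume "s \<in> slice_products"
    then obtain \<xi> \<eta> \<zeta>' \<zeta> where s: "s = rsl t \<xi> \<eta> (radj Wst) o\<^sub>L rsl t \<zeta>' \<zeta> Wst" unfolding slice_products_def by blast
    have "radj s = rsl t \<zeta> \<zeta>' (radj Wst) o\<^sub>L rsl t \<eta> \<xi> Wst"
      by (simp add: s radj_compose t.radj_rsl)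
    then have "radj s \<in> slice_products" unfolding slice_products_def by blast
    then show "radj s \<in> closure (span slices)" using slice_products_subset_C_red C_red_def by blast
  qed
qed

lemma R_C_red: "x \<in> C_red \<Longrightarrow> R x \<in> C_red"
proof -
  assume x: "x \<in> C_red"
  \<comment> \<open>\<open>R\<close> continued from \<open>M\<close> to a bounded linear map on all
    operators by means of \<open>J\<close>, as the density argument requires.\<close>
  define T where "T y = radj (radj J o\<^sub>L (y o\<^sub>L J))" for y
  have RT: "R y = T y" if "y \<in> M" for y
    unfolding T_def
  proof (rule radj_unique[symmetric])
    fix \<xi> \<eta>
    have "inner (blinfun_apply (radj J o\<^sub>L (y o\<^sub>L J)) \<xi>) \<eta> = inner (blinfun_apply y (blinfun_apply J \<xi>)) (blinfun_apply J \<eta>)"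
      by (simp add: inner_radj'[symmetric])
    also have "\<dots> = inner (blinfun_apply (R y) \<eta>) \<xi>" by (simp add: inner_eq_Re_cinner cinner_R that)
    finally show "inner (blinfun_apply (radj J o\<^sub>L (y o\<^sub>L J)) \<xi>) \<eta> = inner \<xi> (blinfun_apply (R y) \<eta>)"
      by (simp add: inner_commute)
  qed
  have blT: "bounded_linear T"
    unfolding T_def
    by (intro bounded_linear_compose[OF bounded_linear_radj]
      bounded_linear_compose[OF bounded_bilinear.bounded_linear_right[OF bounded_bilinear_blinfun_compose]]
      bounded_bilinear.bounded_linear_left[OF bounded_bilinear_blinfun_compose])
  have "T x \<in> C_red"
  proof (rule C_red_map[OF blT _ x])
    fix \<zeta> \<zeta>'
    have "T (rsl t \<zeta> \<zeta>' (radj Wst)) = radj (rsl t \<zeta>' \<zeta> (radj Wst))"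
      by (simp add: RT[OF rsl_W_M, symmetric] R_rsl_W t.radj_rsl)
    then show "T (rsl t \<zeta> \<zeta>' (radj Wst)) \<in> C_red" by (simp add: C_red_radj slice_in_C_red)
  qed
  then show ?thesis using RT C_red_M x by auto
qed

lemma multiplier_iff: "x \<in> multiplier_C0 t M \<Delta> \<phi> \<Lambda> \<longleftrightarrow> x \<in> M \<and> (\<forall>a\<in>C_red. x o\<^sub>L a \<in> C_red \<and> a o\<^sub>L x \<in> C_red)"
  by (simp add: multiplier_C0_def C0_eq)

end

section \<open>Finite-rank coproducts and corepresentations\<close>

definition cindep :: "nat set \<Rightarrow> (nat \<Rightarrow> 'h::complex_hilbert oper) \<Rightarrow> bool" where
  "cindep I y \<longleftrightarrow> (\<forall>c. (\<Sum>i\<in>I. cscale (c i) (y i)) = 0 \<longrightarrow> (\<forall>i\<in>I. c i = 0))"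

lemma cindepD: "cindep I y \<Longrightarrow> (\<Sum>i\<in>I. cscale (c i) (y i)) = 0 \<Longrightarrow> i \<in> I \<Longrightarrow> c i = 0"
  unfolding cindep_def by blast

lemma not_cindepE:
  assumes "finite I" "\<not> cindep I y"
  obtains a c where "a \<in> I" "y a = (\<Sum>i\<in>I - {a}. cscale (c i) (y i))"
proof -
  obtain c a where c: "(\<Sum>i\<in>I. cscale (c i) (y i)) = 0" "a \<in> I" "c a \<noteq> 0"
    using assms(2) unfolding cindep_def by blast
  have "cscale (c a) (y a) = - (\<Sum>i\<in>I - {a}. cscale (c i) (y i))"
    using c(1) sum.remove[OF assms(1) c(2), of "\<lambda>i. cscale (c i) (y i)"] by (simp add: eq_neg_iff_add_eq_0)
  then have "cscale (- inverse (c a)) (cscale (c a) (y a)) = cscale (- inverse (c a)) (cscale (-1) (\<Sum>i\<in>I - {a}. cscale (c i) (y i)))"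
    by (simp add: cscale_minus_one)
  then have "cscale (-1) (y a) = cscale (-1) (\<Sum>i\<in>I - {a}. cscale (- inverse (c a) * c i) (y i))"
    using c(3) by (simp add: cscale_cscale cscale_sum)
  then have "y a = (\<Sum>i\<in>I - {a}. cscale (- inverse (c a) * c i) (y i))"
    by (simp only: cscale_minus_one neg_equal_iff_equal)
  then show ?thesis using c(2) that[of a "\<lambda>i. - inverse (c a) * c i"] by blast
qed

text \<open>A linear space of vectors that no nonzero linear form annihilates contains all unit
  vectors on the index set. In \<open>coefficient_coproduct\<close> the vectors are lists of values
  of a functional, so no dual basis of functionals has to be chosen.\<close>

lemma dual_basis_in_subspace:
  fixes U :: "(nat \<Rightarrow> complex) set"
  assumes "finite I"
    and add: "\<And>u v. u \<in> U \<Longrightarrow> v \<in> U \<Longrightarrow> (\<lambda>i. u i + v i) \<in> U"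
    and scale: "\<And>c u. u \<in> U \<Longrightarrow> (\<lambda>i. c * u i) \<in> U"
    and nondegenerate: "\<And>c i. (\<And>u. u \<in> U \<Longrightarrow> (\<Sum>i\<in>I. c i * u i) = 0) \<Longrightarrow> i \<in> I \<Longrightarrow> c i = 0"
    and "j \<in> I"
  shows "\<exists>u\<in>U. \<forall>i\<in>I. u i = (if i = j then 1 else 0)"
  using assms(1) nondegenerate \<open>j \<in> I\<close>
proof (induction I arbitrary: j rule: finite_induct)
  case (insert a F)
  have "\<exists>u\<in>U. \<forall>i\<in>F. u i = (if i = j then 1 else 0)" if "j \<in> F" for j
  proof (rule insert.IH[OF _ that])
    fix c i assume c: "\<And>u. u \<in> U \<Longrightarrow> (\<Sum>i\<in>F. c i * u i) = 0" and i: "i \<in> F"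
    have "(\<Sum>i\<in>insert a F. (if i = a then 0 else c i) * u i) = 0" if "u \<in> U" for u
    proof -
      have "(\<Sum>i\<in>F. (if i = a then 0 else c i) * u i) = (\<Sum>i\<in>F. c i * u i)"
        using insert.hyps(2) by (intro sum.cong) auto
      then show ?thesis using insert.hyps c[OF that] by simp
    qed
    from insert.prems(1)[OF this, of i] i insert.hyps(2) show "c i = 0" by (auto split: if_splits)
  qed
  then obtain e where e: "\<And>j. j \<in> F \<Longrightarrow> e j \<in> U" "\<And>j i. j \<in> F \<Longrightarrow> i \<in> F \<Longrightarrow> e j i = (if i = j then 1 else 0)"
    by metis
  \<comment> \<open>Subtracts from \<open>w\<close> its coordinates on \<open>F\<close>, by the unit
    vectors of the induction hypothesis; only the coordinate at \<open>a\<close> can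
    survive.\<close>
  define r where "r w = (\<lambda>i. w i + (\<Sum>j\<in>F. - w j * e j i))" for w :: "nat \<Rightarrow> complex"
  have sumU: "(\<lambda>i. w i + (\<Sum>j\<in>G. - w j * e j i)) \<in> U" if "finite G" "G \<subseteq> F" "w \<in> U" for w G
    using that
  proof (induction G rule: finite_induct)
    case (insert b G)
    then have 1: "(\<lambda>i. w i + (\<Sum>j\<in>G. - w j * e j i)) \<in> U" and b: "b \<in> F" by auto
    have "(\<lambda>i. (w i + (\<Sum>j\<in>G. - w j * e j i)) + - w b * e b i) \<in> U"
      by (rule add[OF 1 scale[OF e(1)[OF b]]])
    then show ?case using insert.hyps by (simp add: add_ac)
  qed simp
  have rU: "r w \<in> U" if "w \<in> U" for w
    unfolding r_def by (rule sumU[OF insert.hyps(1) order_refl that])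
  have rF: "r w i = 0" if "i \<in> F" for w i
  proof -
    have "(\<Sum>j\<in>F. - w j * e j i) = (\<Sum>j\<in>F. if j = i then - w j else 0)"
      using that by (intro sum.cong) (auto simp: e(2))
    then show ?thesis using that insert.hyps(1) by (simp add: r_def)
  qed
  have "\<exists>w\<in>U. r w a \<noteq> 0"
  proof (rule ccontr)
    assume "\<not> ?thesis"
    then have z: "r w a = 0" if "w \<in> U" for w using that by blast
    \<comment> \<open>If the surviving coordinate were always zero, this linear form, with
      coefficient 1 at \<open>a\<close>, would annihilate \<open>U\<close>.\<close>
    have "(\<Sum>i\<in>insert a F. (if i = a then 1 else - e i a) * w i) = 0" if "w \<in> U" for w
    proof -
      have "(\<Sum>i\<in>F. (if i = a then 1 else - e i a) * w i) = (\<Sum>j\<in>F. - w j * e j a)"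
        using insert.hyps(2) by (intro sum.cong) auto
      then show ?thesis using insert.hyps z[OF that] by (simp add: r_def)
    qed
    from insert.prems(1)[OF this, of a] show False by simp
  qed
  then obtain w where w: "w \<in> U" "r w a \<noteq> 0" by blast
  define v where "v i = inverse (r w a) * r w i" for i
  have v: "v \<in> U" "v a = 1" "\<And>i. i \<in> F \<Longrightarrow> v i = 0"
    using scale[OF rU[OF w(1)], of "inverse (r w a)"] w(2) by (simp_all add: v_def[abs_def] rF)
  show ?case
  proof (cases "j = a")
    case True
    then show ?thesis using v insert.hyps(2) by (intro bexI[of _ v]) auto
  next
    case False
    then have j: "j \<in> F" using insert.prems(2) by simp
    have "(\<lambda>i. e j i + (- e j a) * v i) \<in> U" by (rule add[OF e(1)[OF j] scale[OF v(1)]])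
    then show ?thesis
      by (rule bexI[rotated]) (use False j v in \<open>auto simp: e(2)\<close>)
  qed
qed simp

lemma (in hilbert_tensor) tensor_coefficients_unique:
  assumes I: "cindep I y" and c: "\<And>i. i \<in> I \<Longrightarrow> clin (X i)" "\<And>i. i \<in> I \<Longrightarrow> clin (Z i)" "\<And>i. i \<in> I \<Longrightarrow> clin (y i)"
    and eq: "(\<Sum>i\<in>I. op_tensor t (X i) (y i)) = (\<Sum>i\<in>I. op_tensor t (Z i) (y i))" and k: "k \<in> I"
  shows "X k = Z k"
proof (rule oper_eqI)
  fix \<xi> \<eta>
  have lsum: "lsl t \<xi> \<eta> (\<Sum>i\<in>I. op_tensor t (X i) (y i)) = (\<Sum>i\<in>I. cscale (cinner (blinfun_apply (X i) \<xi>) \<eta>) (y i))"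
    if "\<And>i. i \<in> I \<Longrightarrow> clin (X i)" for X
  proof -
    have "lsl t \<xi> \<eta> (\<Sum>i\<in>I. op_tensor t (X i) (y i)) = (\<Sum>i\<in>I. lsl t \<xi> \<eta> (op_tensor t (X i) (y i)))"
      by (simp add: lsl_def compose_sum_left compose_sum_right)
    then show ?thesis using that c(3) by (simp add: lsl_op_tensor)
  qed
  have "(\<Sum>i\<in>I. cscale (cinner (blinfun_apply (X i) \<xi>) \<eta> - cinner (blinfun_apply (Z i) \<xi>) \<eta>) (y i)) = 0"
  proof -
    have "cscale (a - b) u = cscale a u - cscale b u" for a b and u :: "'b oper"
      using cscale_add_left[of "a - b" b u] by simp
    then show ?thesis using arg_cong[OF eq, of "lsl t \<xi> \<eta>"] c by (simp add: lsum sum_subtractf)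
  qed
  from cindepD[OF I this k] show "cinner (blinfun_apply (X k) \<xi>) \<eta> = cinner (blinfun_apply (Z k) \<xi>) \<eta>" by simp
qed

lemma normal_hom_sum:
  assumes "normal_hom A B \<Phi>" "0 \<in> A" "\<And>x y. x \<in> A \<Longrightarrow> y \<in> A \<Longrightarrow> x + y \<in> A" "\<And>i. i \<in> I \<Longrightarrow> f i \<in> A"
  shows "\<Phi> (\<Sum>i\<in>I. f i) = (\<Sum>i\<in>I. \<Phi> (f i))"
proof -
  have "\<Phi> (cscale 0 0) = cscale 0 (\<Phi> 0)" using assms(1,2) unfolding normal_hom_def by blast
  then have 0: "\<Phi> 0 = 0" by simp
  have add: "\<Phi> (x + y) = \<Phi> x + \<Phi> y" if "x \<in> A" "y \<in> A" for x y
    using assms(1) that unfolding normal_hom_def by blast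
  have "(\<Sum>i\<in>J. f i) \<in> A \<and> \<Phi> (\<Sum>i\<in>J. f i) = (\<Sum>i\<in>J. \<Phi> (f i))" if "finite J" "J \<subseteq> I" for J
    using that by (induction J rule: finite_induct) (auto simp: 0 add assms(2-4))
  then show ?thesis using 0 by (cases "finite I") auto
qed

context quantum_group
begin

text \<open>Coassociativity with the first leg sliced away. It shows which combinations of the
  \<Delta>(q i) have their right legs in the span of the \<open>q i\<close>: those whose
  coefficients are the values of one functional on the \<open>p i\<close>.\<close>

lemma coassoc_finite_rank:
  assumes x: "x \<in> M" and pq: "\<And>i. i \<in> I \<Longrightarrow> p i \<in> M" "\<And>i. i \<in> I \<Longrightarrow> q i \<in> M"
    and \<Delta>x: "\<Delta> x = (\<Sum>i\<in>I. op_tensor t (p i) (q i))"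
  shows "(\<Sum>i\<in>I. op_tensor t (lsl t \<xi> \<eta> (\<Delta> (p i))) (q i))
    = (\<Sum>i\<in>I. cscale (cinner (blinfun_apply (p i) \<xi>) \<eta>) (\<Delta> (q i)))"
proof (rule t.tensor_oper_eqI)
  fix \<xi>2 \<xi>3 \<eta>2 \<eta>3
  obtain \<Delta>_id id_\<Delta> where co:
    "normal_hom MM (vn_tensor tL MM M) \<Delta>_id" "normal_hom MM (vn_tensor tR M MM) id_\<Delta>"
    "\<And>x y. x \<in> M \<Longrightarrow> y \<in> M \<Longrightarrow> \<Delta>_id (op_tensor t x y) = op_tensor tL (\<Delta> x) y"
    "\<And>x y. x \<in> M \<Longrightarrow> y \<in> M \<Longrightarrow> id_\<Delta> (op_tensor t x y) = op_tensor tR x (\<Delta> y)"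
    "\<And>x. x \<in> M \<Longrightarrow> \<Delta>_id (\<Delta> x) = id_\<Delta> (\<Delta> x)"
    using coassoc unfolding coassociative_def MM_def by blast
  have mm: "op_tensor t (p i) (q i) \<in> MM" if "i \<in> I" for i using that pq by (intro op_tensor_MM)
  have "\<Delta>_id (\<Delta> x) = (\<Sum>i\<in>I. op_tensor tL (\<Delta> (p i)) (q i))"
    unfolding \<Delta>x by (rule trans[OF normal_hom_sum[OF co(1) MM.M_zero MM.M_add]]) (simp_all add: mm co pq)
  moreover have "id_\<Delta> (\<Delta> x) = (\<Sum>i\<in>I. op_tensor tR (p i) (\<Delta> (q i)))"
    unfolding \<Delta>x by (rule trans[OF normal_hom_sum[OF co(2) MM.M_zero MM.M_add]]) (simp_all add: mm co pq)
  ultimately have "(\<Sum>i\<in>I. op_tensor tL (\<Delta> (p i)) (q i)) = (\<Sum>i\<in>I. op_tensor tR (p i) (\<Delta> (q i)))"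
    using co(5)[OF x] by simp
  then have "cinner (blinfun_apply (\<Sum>i\<in>I. op_tensor tL (\<Delta> (p i)) (q i)) (tL (t \<xi> \<xi>2) \<xi>3)) (tL (t \<eta> \<eta>2) \<eta>3)
      = cinner (blinfun_apply (\<Sum>i\<in>I. op_tensor tR (p i) (\<Delta> (q i))) (tR \<xi> (t \<xi>2 \<xi>3))) (tR \<eta> (t \<eta>2 \<eta>3))"
    by (simp only: tensor_assoc)
  then show "cinner (blinfun_apply (\<Sum>i\<in>I. op_tensor t (lsl t \<xi> \<eta> (\<Delta> (p i))) (q i)) (t \<xi>2 \<xi>3)) (t \<eta>2 \<eta>3)
      = cinner (blinfun_apply (\<Sum>i\<in>I. cscale (cinner (blinfun_apply (p i) \<xi>) \<eta>) (\<Delta> (q i))) (t \<xi>2 \<xi>3)) (t \<eta>2 \<eta>3)"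
    by (simp add: blinfun.sum_left cinner_sum_left pq M_clin \<Delta>_clin tL.cinner_tensor tR.cinner_tensor
        t.cinner_tensor t.cinner_lsl cinner_scaleC_left)
qed

end

context hilbert_tensor
begin

lemma eliminate_right:
  assumes I: "finite I" "a \<in> I" and y: "y a = (\<Sum>i\<in>I - {a}. cscale (c i) (y i))"
    and cl: "\<And>i. i \<in> I \<Longrightarrow> clin (x i)" "\<And>i. i \<in> I \<Longrightarrow> clin (y i)"
  shows "(\<Sum>i\<in>I. op_tensor t (x i) (y i)) = (\<Sum>i\<in>I - {a}. op_tensor t (x i + cscale (c i) (x a)) (y i))"
proof -
  have "op_tensor t (x a) (y a) = (\<Sum>i\<in>I - {a}. op_tensor t (cscale (c i) (x a)) (y i))"
    unfolding y using cl I(2) by (subst op_tensor_sum_right) (simp_all add: clin_cscale op_tensor_cscale)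
  moreover have "(\<Sum>i\<in>I - {a}. op_tensor t (x i + cscale (c i) (x a)) (y i))
      = (\<Sum>i\<in>I - {a}. op_tensor t (x i) (y i)) + (\<Sum>i\<in>I - {a}. op_tensor t (cscale (c i) (x a)) (y i))"
    using cl I(2) by (simp add: op_tensor_add_left clin_cscale sum.distrib)
  ultimately show ?thesis using sum.remove[OF I, of "\<lambda>i. op_tensor t (x i) (y i)"] by (simp add: add.commute)
qed

lemma eliminate_left:
  assumes I: "finite I" "a \<in> I" and x: "x a = (\<Sum>i\<in>I - {a}. cscale (c i) (x i))"
    and cl: "\<And>i. i \<in> I \<Longrightarrow> clin (x i)" "\<And>i. i \<in> I \<Longrightarrow> clin (y i)"
  shows "(\<Sum>i\<in>I. op_tensor t (x i) (y i)) = (\<Sum>i\<in>I - {a}. op_tensor t (x i) (y i + cscale (c i) (y a)))"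
proof -
  have "op_tensor t (x a) (y a) = (\<Sum>i\<in>I - {a}. op_tensor t (x i) (cscale (c i) (y a)))"
    unfolding x using cl I(2) by (subst op_tensor_sum_left) (simp_all add: clin_cscale op_tensor_cscale)
  moreover have "(\<Sum>i\<in>I - {a}. op_tensor t (x i) (y i + cscale (c i) (y a)))
      = (\<Sum>i\<in>I - {a}. op_tensor t (x i) (y i)) + (\<Sum>i\<in>I - {a}. op_tensor t (x i) (cscale (c i) (y a)))"
    using cl I(2) by (simp add: op_tensor_add_right clin_cscale sum.distrib)
  ultimately show ?thesis using sum.remove[OF I, of "\<lambda>i. op_tensor t (x i) (y i)"] by (simp add: add.commute)
qed

end

text \<open>Linear independence is obtained from minimality: a dependent family would allow one
  index to be deleted.\<close>

lemma minimal_card: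
  fixes P :: "nat set \<Rightarrow> bool"
  assumes "P I"
  obtains J where "P J" "\<And>a. a \<in> J \<Longrightarrow> finite J \<Longrightarrow> \<not> P (J - {a})"
proof -
  define n where "n = (LEAST n. \<exists>J. P J \<and> card J = n)"
  have "\<exists>J. P J \<and> card J = n" unfolding n_def by (rule LeastI_ex) (use assms in blast)
  then obtain J where J: "P J" "card J = n" by blast
  have "\<not> P (J - {a})" if "a \<in> J" "finite J" for a
  proof
    assume "P (J - {a})"
    then have "n \<le> card (J - {a})" unfolding n_def by (intro Least_le) blast
    then show False using that J(2) card_Diff1_less[of J a] by simp
  qed
  then show ?thesis using J(1) that by blast
qed

section \<open>Finite-dimensional comodules from finite-rank coproducts\<close>

context quantum_group
begin

text \<open>The span of the \<open>y i\<close> is a left comodule with coefficient matrix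
  \<open>V\<close>. The index set is any finite set of numbers, so that indices can be adjoined and
  deleted without renumbering.\<close>

definition comodule_basis :: "nat set \<Rightarrow> (nat \<Rightarrow> nat \<Rightarrow> 'h oper) \<Rightarrow> (nat \<Rightarrow> 'h oper) \<Rightarrow> bool" where
  "comodule_basis I V y \<longleftrightarrow> finite I \<and> cindep I y \<and> (\<forall>i\<in>I. y i \<in> M) \<and> (\<forall>i\<in>I. \<forall>j\<in>I. V i j \<in> M) \<and>
    (\<forall>j\<in>I. \<Delta> (y j) = (\<Sum>i\<in>I. op_tensor t (V j i) (y i)))"

lemma alg_tensor_minimal:
  assumes "X \<in> alg_tensor t M M"
  obtains I p q where "finite I" "cindep I p" "\<And>i. i \<in> I \<Longrightarrow> p i \<in> M" "\<And>i. i \<in> I \<Longrightarrow> q i \<in> M"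
    "X = (\<Sum>i\<in>I. op_tensor t (p i) (q i))"
proof -
  define P where "P I \<longleftrightarrow> finite I \<and> (\<exists>p q. (\<forall>i\<in>I. p i \<in> M \<and> q i \<in> M) \<and> X = (\<Sum>i\<in>I. op_tensor t (p i) (q i)))" for I :: "nat set"
  have P_I: "P I" if "finite I" "\<And>i. i \<in> I \<Longrightarrow> p i \<in> M" "\<And>i. i \<in> I \<Longrightarrow> q i \<in> M"
    "X = (\<Sum>i\<in>I. op_tensor t (p i) (q i))" for I p q unfolding P_def using that by blast
  obtain n :: nat and p q where npq: "X = (\<Sum>i<n. op_tensor t (p i) (q i))" "\<forall>i<n. p i \<in> M \<and> q i \<in> M"
    using assms unfolding alg_tensor_def by blast
  have "P {..<n}" by (rule P_I[of _ p q]) (use npq in auto)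
  then obtain I where I: "P I" "\<And>a. a \<in> I \<Longrightarrow> finite I \<Longrightarrow> \<not> P (I - {a})"
    by (rule minimal_card) (rule that)
  from I(1) obtain p q where pq: "finite I" "\<And>i. i \<in> I \<Longrightarrow> p i \<in> M" "\<And>i. i \<in> I \<Longrightarrow> q i \<in> M"
    "X = (\<Sum>i\<in>I. op_tensor t (p i) (q i))" unfolding P_def by metis
  have "cindep I p"
  proof (rule ccontr)
    assume "\<not> cindep I p"
    with pq(1) obtain a c where a: "a \<in> I" "p a = (\<Sum>i\<in>I - {a}. cscale (c i) (p i))" by (rule not_cindepE)
    have "X = (\<Sum>i\<in>I - {a}. op_tensor t (p i) (q i + cscale (c i) (q a)))"
      unfolding pq(4) by (rule t.eliminate_left[OF pq(1) a(1), of p c q, OF a(2)]) (auto intro: M_clin pq)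
    then have "P (I - {a})"
      by (rule P_I[rotated 3]) (use pq(1-3) a(1) in \<open>auto intro: M_add M_cscale\<close>)
    then show False using I(2) a(1) pq(1) by blast
  qed
  then show ?thesis using pq that by blast
qed

text \<open>Independence of the \<open>p i\<close> says that the vectors of values of functionals on
  them are annihilated by no nonzero linear form. Hence the unit vector at \<open>j\<close> is a
  combination of such vectors, and the same combination of the identities in
  \<open>coassoc_finite_rank\<close> isolates \<Delta>(q j).\<close>

lemma coefficient_coproduct:
  assumes x: "x \<in> M" and I: "finite I" "cindep I p"
    and pq: "\<And>i. i \<in> I \<Longrightarrow> p i \<in> M" "\<And>i. i \<in> I \<Longrightarrow> q i \<in> M"
    and \<Delta>x: "\<Delta> x = (\<Sum>i\<in>I. op_tensor t (p i) (q i))" and j: "j \<in> I"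
  obtains v where "\<And>i. i \<in> I \<Longrightarrow> v i \<in> M" "\<Delta> (q j) = (\<Sum>i\<in>I. op_tensor t (v i) (q i))"
proof -
  \<comment> \<open>The coefficient vectors for which the combination of the \<Delta>(q i) keeps its
    right legs in the span of the \<open>q i\<close>; a linear space containing all vectors of
    values on the \<open>p i\<close>.\<close>
  define U where "U = {u. \<exists>F. (\<forall>i\<in>I. F i \<in> M) \<and>
    (\<Sum>i\<in>I. cscale (u i) (\<Delta> (q i))) = (\<Sum>i\<in>I. op_tensor t (F i) (q i))}"
  have U_I: "u \<in> U" if "\<And>i. i \<in> I \<Longrightarrow> F i \<in> M"
    "(\<Sum>i\<in>I. cscale (u i) (\<Delta> (q i))) = (\<Sum>i\<in>I. op_tensor t (F i) (q i))" for u F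
    unfolding U_def using that by blast
  have "\<exists>u\<in>U. \<forall>i\<in>I. u i = (if i = j then 1 else 0)"
  proof (rule dual_basis_in_subspace[OF I(1) _ _ _ j])
    fix u u' assume "u \<in> U" "u' \<in> U"
    then obtain F F' where F: "\<And>i. i \<in> I \<Longrightarrow> F i \<in> M" "(\<Sum>i\<in>I. cscale (u i) (\<Delta> (q i))) = (\<Sum>i\<in>I. op_tensor t (F i) (q i))"
      "\<And>i. i \<in> I \<Longrightarrow> F' i \<in> M" "(\<Sum>i\<in>I. cscale (u' i) (\<Delta> (q i))) = (\<Sum>i\<in>I. op_tensor t (F' i) (q i))"
      unfolding U_def by blast
    show "(\<lambda>i. u i + u' i) \<in> U"
      by (rule U_I[of "\<lambda>i. F i + F' i"])
        (simp_all add: F M_add M_clin pq t.op_tensor_add_left cscale_add_left sum.distrib)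
  next
    fix c u assume "u \<in> U"
    then obtain F where F: "\<And>i. i \<in> I \<Longrightarrow> F i \<in> M" "(\<Sum>i\<in>I. cscale (u i) (\<Delta> (q i))) = (\<Sum>i\<in>I. op_tensor t (F i) (q i))"
      unfolding U_def by blast
    show "(\<lambda>i. c * u i) \<in> U"
    proof (rule U_I[of "\<lambda>i. cscale c (F i)"])
      show "(\<Sum>i\<in>I. cscale (c * u i) (\<Delta> (q i))) = (\<Sum>i\<in>I. op_tensor t (cscale c (F i)) (q i))"
        using arg_cong[OF F(2), of "cscale c"] F(1)
        by (simp add: cscale_sum cscale_cscale t.op_tensor_cscale M_clin pq)
    qed (simp add: F M_cscale)
  next
    fix c i assume c: "\<And>u. u \<in> U \<Longrightarrow> (\<Sum>i\<in>I. c i * u i) = 0" and i: "i \<in> I"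
    have "(\<Sum>i\<in>I. cscale (c i) (p i)) = 0"
    proof (rule oper_eqI)
      fix \<xi> \<eta>
      have "(\<lambda>i. cinner (blinfun_apply (p i) \<xi>) \<eta>) \<in> U"
        by (rule U_I[of "\<lambda>i. lsl t \<xi> \<eta> (\<Delta> (p i))"])
          (simp_all add: lsl_in_M \<Delta>_MM pq coassoc_finite_rank[OF x pq \<Delta>x])
      from c[OF this] show "cinner (blinfun_apply (\<Sum>i\<in>I. cscale (c i) (p i)) \<xi>) \<eta> = cinner (blinfun_apply 0 \<xi>) \<eta>"
        by (simp add: blinfun.sum_left cinner_sum_left cinner_scaleC_left)
    qed
    then show "c i = 0" using cindepD[OF I(2) _ i] by blast
  qed
  then obtain u F where u: "\<And>i. i \<in> I \<Longrightarrow> u i = (if i = j then 1 else 0)" and F: "\<And>i. i \<in> I \<Longrightarrow> F i \<in> M"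
    "(\<Sum>i\<in>I. cscale (u i) (\<Delta> (q i))) = (\<Sum>i\<in>I. op_tensor t (F i) (q i))" unfolding U_def by blast
  have "(\<Sum>i\<in>I. cscale (u i) (\<Delta> (q i))) = (\<Sum>i\<in>I. if i = j then \<Delta> (q j) else 0)"
    by (intro sum.cong) (auto simp: u)
  then have "\<Delta> (q j) = (\<Sum>i\<in>I. op_tensor t (F i) (q i))" using F(2) I(1) j by simp
  then show ?thesis using F(1) that by blast
qed

lemma finite_rank_imp_comodule_basis:
  assumes x: "x \<in> M" "\<Delta> x \<in> alg_tensor t M M"
  obtains I V y d where "comodule_basis I V y" "x = (\<Sum>j\<in>I. cscale (d j) (y j))"
proof -
  define P where "P I \<longleftrightarrow> finite I \<and> (\<exists>V y d. (\<forall>i\<in>I. y i \<in> M) \<and> (\<forall>i\<in>I. \<forall>j\<in>I. V i j \<in> M) \<and>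
    (\<forall>j\<in>I. \<Delta> (y j) = (\<Sum>i\<in>I. op_tensor t (V j i) (y i))) \<and> x = (\<Sum>j\<in>I. cscale (d j) (y j)))" for I :: "nat set"
  have P_I: "P I" if "finite I" "\<And>i. i \<in> I \<Longrightarrow> y i \<in> M" "\<And>i j. i \<in> I \<Longrightarrow> j \<in> I \<Longrightarrow> V i j \<in> M"
    "\<And>j. j \<in> I \<Longrightarrow> \<Delta> (y j) = (\<Sum>i\<in>I. op_tensor t (V j i) (y i))" "x = (\<Sum>j\<in>I. cscale (d j) (y j))" for I V y d
    unfolding P_def using that by blast
  obtain I p q where I: "finite I" "cindep I p" and pq: "\<And>i. i \<in> I \<Longrightarrow> p i \<in> M" "\<And>i. i \<in> I \<Longrightarrow> q i \<in> M"
    and \<Delta>x: "\<Delta> x = (\<Sum>i\<in>I. op_tensor t (p i) (q i))"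
    by (rule alg_tensor_minimal[OF x(2)]) (rule that)
  have "\<exists>v. \<forall>j\<in>I. (\<forall>i\<in>I. v j i \<in> M) \<and> \<Delta> (q j) = (\<Sum>i\<in>I. op_tensor t (v j i) (q i))"
    by (intro bchoice ballI) (metis coefficient_coproduct[OF x(1) I pq \<Delta>x])
  then obtain v where v: "\<And>j i. j \<in> I \<Longrightarrow> i \<in> I \<Longrightarrow> v j i \<in> M"
    "\<And>j. j \<in> I \<Longrightarrow> \<Delta> (q j) = (\<Sum>i\<in>I. op_tensor t (v j i) (q i))" by blast
  \<comment> \<open>\<open>x\<close> is not yet known to lie in the span of the \<open>q i\<close>,
    so it is adjoined at a new index. The column of \<open>V\<close> at that index is 0 because no
    coproduct has \<open>x\<close> in its right leg.\<close>
  obtain a :: nat where a: "a \<notin> I" using I(1) ex_new_if_finite by auto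
  define y where "y j = (if j = a then x else q j)" for j
  define V where "V j i = (if i = a then 0 else if j = a then p i else v j i)" for j i
  have "P (insert a I)"
  proof (rule P_I[of "insert a I" y V "\<lambda>j. if j = a then 1 else 0"])
    show "finite (insert a I)" using I(1) by simp
    show "y i \<in> M" if "i \<in> insert a I" for i using that x(1) pq a by (auto simp: y_def)
    show "V i j \<in> M" if "i \<in> insert a I" "j \<in> insert a I" for i j using that v(1) pq a by (auto simp: V_def)
    show "\<Delta> (y j) = (\<Sum>i\<in>insert a I. op_tensor t (V j i) (y i))" if "j \<in> insert a I" for j
    proof -
      have "(\<Sum>i\<in>I. op_tensor t (V j i) (y i)) = (\<Sum>i\<in>I. op_tensor t (if j = a then p i else v j i) (q i))"
        using a by (intro sum.cong) (auto simp: V_def y_def)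
      also have "\<dots> = \<Delta> (y j)" using that v(2) \<Delta>x by (auto simp: y_def)
      finally show ?thesis using a I(1) M_clin[OF x(1)] by (simp add: V_def y_def)
    qed
    have "(\<Sum>j\<in>I. cscale (if j = a then 1 else 0) (y j)) = 0" using a by (intro sum.neutral) auto
    then show "x = (\<Sum>j\<in>insert a I. cscale (if j = a then 1 else 0) (y j))"
      using a I(1) by (simp add: y_def)
  qed
  then obtain K where K: "P K" "\<And>a. a \<in> K \<Longrightarrow> finite K \<Longrightarrow> \<not> P (K - {a})"
    by (rule minimal_card) (rule that)
  from K(1) obtain V y d where fin: "finite K" and yM: "\<And>i. i \<in> K \<Longrightarrow> y i \<in> M"
    and VM: "\<And>i j. i \<in> K \<Longrightarrow> j \<in> K \<Longrightarrow> V i j \<in> M"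
    and \<Delta>y: "\<And>j. j \<in> K \<Longrightarrow> \<Delta> (y j) = (\<Sum>i\<in>K. op_tensor t (V j i) (y i))"
    and xd: "x = (\<Sum>j\<in>K. cscale (d j) (y j))" unfolding P_def by blast
  have "cindep K y"
  proof (rule ccontr)
    assume "\<not> cindep K y"
    with fin obtain a c where a: "a \<in> K" "y a = (\<Sum>i\<in>K - {a}. cscale (c i) (y i))" by (rule not_cindepE)
    have "P (K - {a})"
    \<comment> \<open>Substituting the dependent \<open>y a\<close> adds to column \<open>j\<close>
      of \<open>V\<close> the multiple \<open>c j\<close> of column \<open>a\<close>, and to the
      coefficient of \<open>x\<close> at \<open>j\<close> the amount
      \<open>d a * c j\<close>.\<close>
    proof (rule P_I[of "K - {a}" y "\<lambda>i j. V i j + cscale (c j) (V i a)" "\<lambda>j. d a * c j + d j"])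
      show "finite (K - {a})" using fin by simp
      show "y i \<in> M" if "i \<in> K - {a}" for i using that yM by simp
      show "V i j + cscale (c j) (V i a) \<in> M" if "i \<in> K - {a}" "j \<in> K - {a}" for i j
        using that VM a(1) by (intro M_add M_cscale) auto
      show "\<Delta> (y j) = (\<Sum>i\<in>K - {a}. op_tensor t (V j i + cscale (c i) (V j a)) (y i))" if "j \<in> K - {a}" for j
        unfolding \<Delta>y[of j, OF DiffD1[OF that]]
        by (rule t.eliminate_right[OF fin a(1), of y c, OF a(2)]) (use that VM yM in \<open>auto intro: M_clin\<close>)
      have "x = cscale (d a) (y a) + (\<Sum>j\<in>K - {a}. cscale (d j) (y j))"
        unfolding xd by (rule sum.remove[OF fin a(1)])
      then show "x = (\<Sum>j\<in>K - {a}. cscale (d a * c j + d j) (y j))"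
        unfolding a(2) by (simp add: cscale_sum cscale_cscale cscale_add_left sum.distrib)
    qed
    then show False using K(2) a(1) fin by blast
  qed
  then have "comodule_basis K V y" unfolding comodule_basis_def using fin yM VM \<Delta>y by blast
  then show ?thesis using xd that by blast
qed

text \<open>Slice the first leg of the two iterated coproducts of \<open>y j\<close> and compare
  coefficients of the independent \<open>y l\<close>.\<close>

lemma comodule_coefficients:
  assumes cb: "comodule_basis I V y" and j: "j \<in> I" and k: "k \<in> I"
  shows "\<Delta> (V j k) = (\<Sum>i\<in>I. op_tensor t (V j i) (V i k))"
proof (rule t.lsl_eqI)
  fix \<xi> \<eta>
  note cb' = cb[unfolded comodule_basis_def]
  have yM: "y i \<in> M" if "i \<in> I" for i using cb' that by blast
  have VM: "V i l \<in> M" if "i \<in> I" "l \<in> I" for i l using cb' that by blast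
  have \<Delta>y: "\<Delta> (y i) = (\<Sum>l\<in>I. op_tensor t (V i l) (y l))" if "i \<in> I" for i using cb' that by blast
  let ?b = "\<lambda>i. cinner (blinfun_apply (V j i) \<xi>) \<eta>"
  have "(\<Sum>i\<in>I. op_tensor t (lsl t \<xi> \<eta> (\<Delta> (V j i))) (y i)) = (\<Sum>i\<in>I. cscale (?b i) (\<Delta> (y i)))"
    by (rule coassoc_finite_rank[OF yM[OF j] _ _ \<Delta>y[OF j]]) (simp_all add: VM yM j)
  also have "\<dots> = (\<Sum>i\<in>I. \<Sum>l\<in>I. op_tensor t (cscale (?b i) (V i l)) (y l))"
    by (simp add: \<Delta>y cscale_sum t.op_tensor_cscale M_clin VM yM)
  also have "\<dots> = (\<Sum>l\<in>I. \<Sum>i\<in>I. op_tensor t (cscale (?b i) (V i l)) (y l))"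
    by (rule sum.swap)
  also have "\<dots> = (\<Sum>l\<in>I. op_tensor t (\<Sum>i\<in>I. cscale (?b i) (V i l)) (y l))"
    by (simp add: t.op_tensor_sum_left M_clin VM yM clin_cscale)
  finally have "lsl t \<xi> \<eta> (\<Delta> (V j k)) = (\<Sum>i\<in>I. cscale (?b i) (V i k))"
    using cb' by (intro t.tensor_coefficients_unique[of I y "\<lambda>i. lsl t \<xi> \<eta> (\<Delta> (V j i))" "\<lambda>l. \<Sum>i\<in>I. cscale (?b i) (V i l)" k])
      (auto simp: M_clin \<Delta>_clin VM j k intro!: clin_sum clin_cscale)
  also have "\<dots> = lsl t \<xi> \<eta> (\<Sum>i\<in>I. op_tensor t (V j i) (V i k))"
  proof -
    have "lsl t \<xi> \<eta> (\<Sum>i\<in>I. op_tensor t (V j i) (V i k)) = (\<Sum>i\<in>I. lsl t \<xi> \<eta> (op_tensor t (V j i) (V i k)))"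
      by (simp add: lsl_def compose_sum_left compose_sum_right)
    then show ?thesis using VM j k by (simp add: t.lsl_op_tensor M_clin)
  qed
  finally show "lsl t \<xi> \<eta> (\<Delta> (V j k)) = lsl t \<xi> \<eta> (\<Sum>i\<in>I. op_tensor t (V j i) (V i k))" .
qed

text \<open>The adjoint comodule; its antipode identity becomes, after taking adjoints again, the
  one for the transpose of \<open>V\<close>.\<close>

lemma comodule_basis_radj:
  assumes cb: "comodule_basis I V y"
  shows "comodule_basis I (\<lambda>i j. radj (V i j)) (\<lambda>i. radj (y i))"
proof -
  note cb' = cb[unfolded comodule_basis_def]
  have yM: "y i \<in> M" if "i \<in> I" for i using cb' that by blast
  have VM: "V i l \<in> M" if "i \<in> I" "l \<in> I" for i l using cb' that by blast
  have "cindep I (\<lambda>i. radj (y i))"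
    unfolding cindep_def
  proof (intro allI impI ballI)
    fix c i assume z: "(\<Sum>i\<in>I. cscale (c i) (radj (y i))) = 0" and i: "i \<in> I"
    have "(\<Sum>i\<in>I. cscale (cnj (c i)) (y i)) = radj (\<Sum>i\<in>I. cscale (c i) (radj (y i)))"
      by (simp add: radj_sum radj_cscale M_clin M_radj yM)
    also have "\<dots> = 0" unfolding z by simp
    finally have "(\<Sum>i\<in>I. cscale (cnj (c i)) (y i)) = 0" .
    from cindepD[OF _ this i] have "cnj (c i) = 0" using cb' by blast
    then show "c i = 0" by simp
  qed
  moreover have "\<Delta> (radj (y j)) = (\<Sum>i\<in>I. op_tensor t (radj (V j i)) (radj (y i)))" if "j \<in> I" for j
    using cb' that by (simp add: \<Delta>_radj radj_sum t.radj_op_tensor M_clin)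
  ultimately show ?thesis unfolding comodule_basis_def using cb' yM VM by (simp add: M_radj)
qed

end

section \<open>Inverses of the coefficient matrix, multipliers and the counit\<close>

context kac_group
begin

text \<open>\<open>R\<close> reverses products and exchanges slices of W with slices of
  \<open>Wst\<close>, so it moves the coefficients from the right of W to the left of
  \<open>Wst\<close>. There \<open>Wst (1 \<otimes> y i)\<close> is \<Delta>(y i) followed by
  \<open>Wst\<close>; cancelling \<open>Wst\<close> leaves an identity of finite-rank tensors, whose
  coefficients at the independent \<open>y l\<close> can be compared.\<close>

lemma comodule_R_V:
  assumes cb: "comodule_basis I V y" and j: "j \<in> I" and k: "k \<in> I"
  shows "(\<Sum>i\<in>I. R (V j i) o\<^sub>L V i k) = (if j = k then id_blinfun else 0)"
proof -
  note cb' = cb[unfolded comodule_basis_def]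
  have fin: "finite I" and ind: "cindep I y" using cb' by blast+
  have yM: "y i \<in> M" if "i \<in> I" for i using cb' that by blast
  have VM: "V i l \<in> M" if "i \<in> I" "l \<in> I" for i l using cb' that by blast
  have \<Delta>y: "\<Delta> (y i) = (\<Sum>l\<in>I. op_tensor t (V i l) (y l))" if "i \<in> I" for i using cb' that by blast
  note cl = M_clin[OF VM] M_clin[OF yM] M_clin[OF R_M[OF VM]]
  have W: "(\<Sum>i\<in>I. rsl t (blinfun_apply (y i) \<zeta>) \<zeta>' (radj Wst) o\<^sub>L V j i) = rsl t \<zeta> (blinfun_apply (radj (y j)) \<zeta>') (radj Wst)" for \<zeta> \<zeta>'
  proof (rule oper_eqI)
    fix \<xi> \<eta>
    have "cinner (blinfun_apply (radj Wst o\<^sub>L \<Delta> (y j)) (t \<xi> \<zeta>)) (t \<eta> \<zeta>')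
        = cinner (blinfun_apply (op_tensor t id_blinfun (y j) o\<^sub>L radj Wst) (t \<xi> \<zeta>)) (t \<eta> \<zeta>')"
      by (simp only: W_\<Delta>[OF yM[OF j]])
    then show "cinner (blinfun_apply (\<Sum>i\<in>I. rsl t (blinfun_apply (y i) \<zeta>) \<zeta>' (radj Wst) o\<^sub>L V j i) \<xi>) \<eta>
        = cinner (blinfun_apply (rsl t \<zeta> (blinfun_apply (radj (y j)) \<zeta>') (radj Wst)) \<xi>) \<eta>"
      using j by (simp add: \<Delta>y blinfun.sum_left blinfun.sum_right cinner_sum_left t.cinner_rsl cl cinner_radj t.radj_op_tensor)
  qed
  have Ws: "(\<Sum>i\<in>I. R (V j i) o\<^sub>L rsl t (blinfun_apply (y i) \<zeta>) \<zeta>' Wst) = rsl t \<zeta> (blinfun_apply (radj (y j)) \<zeta>') Wst" for \<zeta> \<zeta>'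
    using arg_cong[OF W[of \<zeta> \<zeta>'], of R] j by (simp add: R_sum M_compose rsl_W_M VM R_mult R_rsl_W)
  have "(\<Sum>i\<in>I. op_tensor t (R (V j i)) id_blinfun o\<^sub>L (Wst o\<^sub>L op_tensor t id_blinfun (y i))) = op_tensor t id_blinfun (y j) o\<^sub>L Wst"
  proof (rule t.tensor_oper_eqI)
    fix \<xi> \<zeta> \<eta> \<zeta>'
    have "cinner (blinfun_apply (\<Sum>i\<in>I. R (V j i) o\<^sub>L rsl t (blinfun_apply (y i) \<zeta>) \<zeta>' Wst) \<xi>) \<eta>
        = cinner (blinfun_apply (rsl t \<zeta> (blinfun_apply (radj (y j)) \<zeta>') Wst) \<xi>) \<eta>"
      by (simp only: Ws)
    then show "cinner (blinfun_apply (\<Sum>i\<in>I. op_tensor t (R (V j i)) id_blinfun o\<^sub>L (Wst o\<^sub>L op_tensor t id_blinfun (y i))) (t \<xi> \<zeta>)) (t \<eta> \<zeta>')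
        = cinner (blinfun_apply (op_tensor t id_blinfun (y j) o\<^sub>L Wst) (t \<xi> \<zeta>)) (t \<eta> \<zeta>')"
      using j by (simp add: blinfun.sum_left cinner_sum_left t.cinner_rsl cl cinner_radj t.radj_op_tensor)
  qed
  then have "(\<Sum>i\<in>I. op_tensor t (R (V j i)) id_blinfun o\<^sub>L \<Delta> (y i)) o\<^sub>L Wst = op_tensor t id_blinfun (y j) o\<^sub>L Wst"
    by (simp add: compose_sum_left compose_assoc \<Delta>_Wst yM)
  then have "((\<Sum>i\<in>I. op_tensor t (R (V j i)) id_blinfun o\<^sub>L \<Delta> (y i)) o\<^sub>L Wst) o\<^sub>L radj Wst = (op_tensor t id_blinfun (y j) o\<^sub>L Wst) o\<^sub>L radj Wst"
    by simp
  then have eq: "(\<Sum>i\<in>I. op_tensor t (R (V j i)) id_blinfun o\<^sub>L \<Delta> (y i)) = op_tensor t id_blinfun (y j)"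
    by (simp add: compose_assoc W_unitary)
  have "(\<Sum>l\<in>I. op_tensor t (\<Sum>i\<in>I. R (V j i) o\<^sub>L V i l) (y l)) = (\<Sum>l\<in>I. \<Sum>i\<in>I. op_tensor t (R (V j i) o\<^sub>L V i l) (y l))"
    using j by (intro sum.cong refl t.op_tensor_sum_left) (simp_all add: cl clin_compose)
  also have "\<dots> = (\<Sum>i\<in>I. \<Sum>l\<in>I. op_tensor t (R (V j i) o\<^sub>L V i l) (y l))" by (rule sum.swap)
  also have "\<dots> = (\<Sum>i\<in>I. op_tensor t (R (V j i)) id_blinfun o\<^sub>L \<Delta> (y i))"
    using j by (intro sum.cong refl) (simp add: \<Delta>y compose_sum_right t.op_tensor_compose cl)
  also have "\<dots> = (\<Sum>l\<in>I. op_tensor t (if j = l then id_blinfun else 0) (y l))"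
  proof -
    have "(\<Sum>l\<in>I. op_tensor t (if j = l then id_blinfun else 0) (y l)) = (\<Sum>l\<in>I. if j = l then op_tensor t id_blinfun (y j) else 0)"
      by (intro sum.cong) (auto simp: cl)
    then show ?thesis unfolding eq using fin j by simp
  qed
  finally show ?thesis
    by (intro t.tensor_coefficients_unique[OF ind, of "\<lambda>l. \<Sum>i\<in>I. R (V j i) o\<^sub>L V i l" "\<lambda>l. if j = l then id_blinfun else 0" k])
      (use j k in \<open>auto simp: cl clin_compose intro!: clin_sum\<close>)
qed

text \<open>A one-sided inverse of the transpose. It uses that \<open>R\<close> commutes with
  adjoints, so that the identity for the adjoint family can be read back for
  \<open>V\<close>.\<close>

lemma comodule_V_R:
  assumes cb: "comodule_basis I V y" and j: "j \<in> I" and k: "k \<in> I"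
  shows "(\<Sum>i\<in>I. V i j o\<^sub>L R (V k i)) = (if j = k then id_blinfun else 0)"
proof -
  have VM: "V i l \<in> M" if "i \<in> I" "l \<in> I" for i l using cb that unfolding comodule_basis_def by blast
  show ?thesis
    using arg_cong[OF comodule_R_V[OF comodule_basis_radj[OF cb] k j], of radj] j k
    by (auto simp: radj_sum radj_compose R_radj VM)
qed

lemma R_if_id: "R (if P then id_blinfun else 0) = (if P then id_blinfun else 0)"
  by simp

text \<open>\<open>R\<close> reverses products and is involutive, so applied to an inverse identity
  for the transpose it gives one for the matrix itself, on the side still missing.\<close>

lemma comodule_V_R':
  assumes cb: "comodule_basis I V y" and j: "j \<in> I" and k: "k \<in> I"
  shows "(\<Sum>i\<in>I. V j i o\<^sub>L R (V i k)) = (if j = k then id_blinfun else 0)"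
proof -
  have VM: "V i l \<in> M" if "i \<in> I" "l \<in> I" for i l using cb that unfolding comodule_basis_def by blast
  show ?thesis
    using arg_cong[OF comodule_V_R[OF cb k j], of R] j k by (simp only: R_if_id eq_commute[of k j]) (simp add: R_sum R_mult R_M R_R VM M_compose)
qed

lemma comodule_R_V':
  assumes cb: "comodule_basis I V y" and j: "j \<in> I" and k: "k \<in> I"
  shows "(\<Sum>i\<in>I. R (V i j) o\<^sub>L V k i) = (if j = k then id_blinfun else 0)"
proof -
  have VM: "V i l \<in> M" if "i \<in> I" "l \<in> I" for i l using cb that unfolding comodule_basis_def by blast
  show ?thesis
    using arg_cong[OF comodule_R_V[OF cb k j], of R] j k by (simp only: R_if_id eq_commute[of k j]) (simp add: R_sum R_mult R_M R_R VM M_compose)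
qed

text \<open>By \<open>comodule_V_R'\<close> the operator V j l \<otimes> 1 is a sum of \<Delta>(V j
  k) (1 \<otimes> R(V k l)). W moves the coproduct to the second leg, so all factors act there and
  are absorbed into the two vectors of the slice.\<close>

lemma slice_coefficient_product:
  assumes cb: "comodule_basis I V y" and j: "j \<in> I" and l: "l \<in> I"
  shows "rsl t \<zeta> \<zeta>' (radj Wst) o\<^sub>L V j l
    = (\<Sum>k\<in>I. rsl t (blinfun_apply (R (V k l)) \<zeta>) (blinfun_apply (radj (V j k)) \<zeta>') (radj Wst))"
proof (rule oper_eqI)
  fix \<xi> \<eta>
  have fin: "finite I" using cb unfolding comodule_basis_def by blast
  have VM: "V i l \<in> M" if "i \<in> I" "l \<in> I" for i l using cb that unfolding comodule_basis_def by blast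
  note cl = M_clin[OF VM] M_clin[OF R_M[OF VM]]
  have "(\<Sum>k\<in>I. \<Delta> (V j k) o\<^sub>L op_tensor t id_blinfun (R (V k l)))
      = (\<Sum>k\<in>I. \<Sum>i\<in>I. op_tensor t (V j i) (V i k o\<^sub>L R (V k l)))"
    using j l by (intro sum.cong refl) (simp add: comodule_coefficients[OF cb] compose_sum_left t.op_tensor_compose cl)
  also have "\<dots> = (\<Sum>i\<in>I. \<Sum>k\<in>I. op_tensor t (V j i) (V i k o\<^sub>L R (V k l)))" by (rule sum.swap)
  also have "\<dots> = (\<Sum>i\<in>I. op_tensor t (V j i) (\<Sum>k\<in>I. V i k o\<^sub>L R (V k l)))"
    using j l by (intro sum.cong refl t.op_tensor_sum_right[symmetric]) (simp_all add: cl clin_compose)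
  also have "\<dots> = (\<Sum>i\<in>I. if i = l then op_tensor t (V j l) id_blinfun else 0)"
    using j l by (intro sum.cong refl) (auto simp: comodule_V_R'[OF cb] cl)
  finally have eq: "op_tensor t (V j l) id_blinfun = (\<Sum>k\<in>I. \<Delta> (V j k) o\<^sub>L op_tensor t id_blinfun (R (V k l)))"
    using fin l by simp
  have "radj Wst o\<^sub>L op_tensor t (V j l) id_blinfun
      = (\<Sum>k\<in>I. op_tensor t id_blinfun (V j k) o\<^sub>L (radj Wst o\<^sub>L op_tensor t id_blinfun (R (V k l))))"
    unfolding eq compose_sum_right using j
    by (intro sum.cong refl) (simp add: compose_assoc[symmetric] W_\<Delta> VM)
  then have "cinner (blinfun_apply (radj Wst o\<^sub>L op_tensor t (V j l) id_blinfun) (t \<xi> \<zeta>)) (t \<eta> \<zeta>')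
      = cinner (blinfun_apply (\<Sum>k\<in>I. op_tensor t id_blinfun (V j k) o\<^sub>L (radj Wst o\<^sub>L op_tensor t id_blinfun (R (V k l)))) (t \<xi> \<zeta>)) (t \<eta> \<zeta>')"
    by (simp only:)
  then show "cinner (blinfun_apply (rsl t \<zeta> \<zeta>' (radj Wst) o\<^sub>L V j l) \<xi>) \<eta>
      = cinner (blinfun_apply (\<Sum>k\<in>I. rsl t (blinfun_apply (R (V k l)) \<zeta>) (blinfun_apply (radj (V j k)) \<zeta>') (radj Wst)) \<xi>) \<eta>"
    using j l by (simp add: blinfun.sum_left cinner_sum_left t.cinner_rsl cl cinner_radj t.radj_op_tensor)
qed

lemma C_red_sum: "(\<And>i. i \<in> I \<Longrightarrow> f i \<in> C_red) \<Longrightarrow> (\<Sum>i\<in>I. f i) \<in> C_red"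
  by (rule subspace_sum[OF subspace_C_red])

lemma C_red_coefficient:
  assumes cb: "comodule_basis I V y" and j: "j \<in> I" and l: "l \<in> I" and a: "a \<in> C_red"
  shows "a o\<^sub>L V j l \<in> C_red"
proof (rule C_red_map[OF _ _ a])
  show "bounded_linear (\<lambda>a. a o\<^sub>L V j l)"
    by (rule bounded_bilinear.bounded_linear_left[OF bounded_bilinear_blinfun_compose])
  show "rsl t \<zeta> \<zeta>' (radj Wst) o\<^sub>L V j l \<in> C_red" for \<zeta> \<zeta>'
    unfolding slice_coefficient_product[OF cb j l] by (rule C_red_sum) (rule slice_in_C_red)
qed

text \<open>Right multiplication is covered by \<open>C_red_coefficient\<close>; left multiplication
  is its adjoint, applied to the adjoint comodule.\<close>

lemma coefficient_multiplier:
  assumes cb: "comodule_basis I V y" and j: "j \<in> I" and l: "l \<in> I"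
  shows "V j l \<in> multiplier_C0 t M \<Delta> \<phi> \<Lambda>"
proof -
  have VM: "V j l \<in> M" using cb j l unfolding comodule_basis_def by blast
  have "V j l o\<^sub>L a \<in> C_red" if "a \<in> C_red" for a
    using C_red_radj[OF C_red_coefficient[OF comodule_basis_radj[OF cb] j l C_red_radj[OF that]]] by (simp add: radj_compose)
  then show ?thesis using VM C_red_coefficient[OF cb j l] by (simp add: multiplier_iff)
qed

lemma R_multiplier:
  assumes "x \<in> multiplier_C0 t M \<Delta> \<phi> \<Lambda>"
  shows "R x \<in> multiplier_C0 t M \<Delta> \<phi> \<Lambda>"
proof -
  have x: "x \<in> M" "\<And>a. a \<in> C_red \<Longrightarrow> x o\<^sub>L a \<in> C_red" "\<And>a. a \<in> C_red \<Longrightarrow> a o\<^sub>L x \<in> C_red"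
    using assms by (auto simp: multiplier_iff)
  have "R x o\<^sub>L a \<in> C_red \<and> a o\<^sub>L R x \<in> C_red" if a: "a \<in> C_red" for a
  proof -
    have aM: "a \<in> M" "R a \<in> M" using a C_red_M R_M by auto
    have "R (R a o\<^sub>L x) \<in> C_red" "R (x o\<^sub>L R a) \<in> C_red" by (intro R_C_red x a)+
    then show ?thesis by (simp add: R_mult R_R x aM)
  qed
  then show ?thesis using R_M[OF x(1)] by (simp add: multiplier_iff)
qed

text \<open>In Hopf algebra notation \<open>z k\<close> is the antipode of the first leg of the
  coproduct of \<open>y k\<close> times the second leg, which is the counit of \<open>y k\<close>
  times the identity. The resulting formula for \<open>y j\<close> is the counit axiom.\<close>

lemma comodule_basis_scalars:
  assumes cb: "comodule_basis I V y"
  obtains c where "\<And>j. j \<in> I \<Longrightarrow> y j = (\<Sum>k\<in>I. cscale (c k) (V j k))"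
proof -
  note cb' = cb[unfolded comodule_basis_def]
  have fin: "finite I" using cb' by blast
  have yM: "y i \<in> M" if "i \<in> I" for i using cb' that by blast
  have VM: "V i l \<in> M" if "i \<in> I" "l \<in> I" for i l using cb' that by blast
  have \<Delta>y: "\<Delta> (y i) = (\<Sum>l\<in>I. op_tensor t (V i l) (y l))" if "i \<in> I" for i using cb' that by blast
  note cl = M_clin[OF VM] M_clin[OF yM] M_clin[OF R_M[OF VM]]
  define z where "z k = (\<Sum>j\<in>I. R (V k j) o\<^sub>L y j)" for k
  have zM: "z k \<in> M" if "k \<in> I" for k unfolding z_def using that by (intro M_sum M_compose R_M VM yM)
  \<comment> \<open>The antipode reverses the legs of the coproduct, so the summation index ends up
    first in the left factor and last in the right one.\<close>
  have \<Delta>R: "\<Delta> (R (V k j)) = (\<Sum>l\<in>I. op_tensor t (R (V l j)) (R (V k l)))" if "k \<in> I" "j \<in> I" for k j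
  proof (rule t.tensor_oper_eqI)
    fix \<xi>1 \<xi>2 \<eta>1 \<eta>2
    show "cinner (blinfun_apply (\<Delta> (R (V k j))) (t \<xi>1 \<xi>2)) (t \<eta>1 \<eta>2)
        = cinner (blinfun_apply (\<Sum>l\<in>I. op_tensor t (R (V l j)) (R (V k l))) (t \<xi>1 \<xi>2)) (t \<eta>1 \<eta>2)"
      using that by (simp add: \<Delta>_R VM comodule_coefficients[OF cb] blinfun.sum_left cinner_sum_left cl
          t.cinner_tensor cinner_R mult.commute)
  qed
  have "\<Delta> (z k) = op_tensor t id_blinfun (z k)" if k: "k \<in> I" for k
  proof -
    have "\<Delta> (z k) = (\<Sum>j\<in>I. \<Delta> (R (V k j)) o\<^sub>L \<Delta> (y j))"
      unfolding z_def using k by (subst \<Delta>_sum) (auto simp: \<Delta>_mult M_compose R_M VM yM)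
    also have "\<dots> = (\<Sum>j\<in>I. \<Sum>l\<in>I. \<Sum>i\<in>I. op_tensor t (R (V l j) o\<^sub>L V j i) (R (V k l) o\<^sub>L y i))"
      using k by (intro sum.cong refl) (simp add: \<Delta>R \<Delta>y compose_sum_left compose_sum_right t.op_tensor_compose cl, rule sum.swap)
    also have "\<dots> = (\<Sum>l\<in>I. \<Sum>j\<in>I. \<Sum>i\<in>I. op_tensor t (R (V l j) o\<^sub>L V j i) (R (V k l) o\<^sub>L y i))"
      by (rule sum.swap)
    also have "\<dots> = (\<Sum>l\<in>I. \<Sum>i\<in>I. \<Sum>j\<in>I. op_tensor t (R (V l j) o\<^sub>L V j i) (R (V k l) o\<^sub>L y i))"
      by (rule sum.cong[OF refl]) (rule sum.swap)
    also have "\<dots> = (\<Sum>l\<in>I. \<Sum>i\<in>I. op_tensor t (\<Sum>j\<in>I. R (V l j) o\<^sub>L V j i) (R (V k l) o\<^sub>L y i))"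
      using k by (intro sum.cong refl t.op_tensor_sum_left[symmetric]) (simp_all add: cl clin_compose)
    also have "\<dots> = (\<Sum>l\<in>I. \<Sum>i\<in>I. if l = i then op_tensor t id_blinfun (R (V k l) o\<^sub>L y l) else 0)"
      using k by (intro sum.cong refl) (auto simp: comodule_R_V[OF cb] cl clin_compose)
    also have "\<dots> = (\<Sum>l\<in>I. op_tensor t id_blinfun (R (V k l) o\<^sub>L y l))"
      using fin by simp
    also have "\<dots> = op_tensor t id_blinfun (z k)"
      unfolding z_def using k by (intro t.op_tensor_sum_right[symmetric]) (simp_all add: cl clin_compose)
    finally show ?thesis .
  qed
  then have "\<exists>c. z k = cscale c id_blinfun" if "k \<in> I" for k
    using \<Delta>_eq_one_tensor_imp_scalar[OF zM[OF that], where thesis = "\<exists>c. z k = cscale c id_blinfun"] that by blast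
  then obtain c where c: "\<And>k. k \<in> I \<Longrightarrow> z k = cscale (c k) id_blinfun" by metis
  have "y j = (\<Sum>k\<in>I. cscale (c k) (V j k))" if j: "j \<in> I" for j
  proof -
    have "(\<Sum>k\<in>I. cscale (c k) (V j k)) = (\<Sum>k\<in>I. V j k o\<^sub>L z k)"
      using j by (intro sum.cong refl) (simp add: c compose_cscale_right cl)
    also have "\<dots> = (\<Sum>k\<in>I. \<Sum>i\<in>I. (V j k o\<^sub>L R (V k i)) o\<^sub>L y i)"
      by (simp add: z_def compose_sum_right compose_assoc)
    also have "\<dots> = (\<Sum>i\<in>I. (\<Sum>k\<in>I. V j k o\<^sub>L R (V k i)) o\<^sub>L y i)"
      unfolding compose_sum_left by (rule sum.swap)
    also have "\<dots> = (\<Sum>i\<in>I. if j = i then y j else 0)"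
      using j by (intro sum.cong refl) (auto simp: comodule_V_R'[OF cb])
    finally show ?thesis using fin j by simp
  qed
  then show ?thesis by (rule that)
qed

text \<open>\<open>h\<close> renumbers the index set as corepresentations demand. The entrywise
  image under \<open>R\<close> is the inverse for the matrix and, transposed, for the
  transpose.\<close>

lemma comodule_admissible:
  assumes cb: "comodule_basis I V y" and h: "bij_betw h {..<n} I"
  shows "admissible t M \<Delta> \<phi> \<Lambda> n (\<lambda>i j. V (h i) (h j))"
proof -
  have hI: "h i \<in> I" if "i < n" for i using h that by (auto simp: bij_betw_def)
  have heq: "h i = h j \<longleftrightarrow> i = j" if "i < n" "j < n" for i j
    using h that by (auto simp: bij_betw_def inj_on_def)
  have s: "(\<Sum>k<n. f (h k)) = (\<Sum>k\<in>I. f k)" for f :: "nat \<Rightarrow> 'x::real_normed_vector oper"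
    by (rule sum.reindex_bij_betw[OF h])
  note m = coefficient_multiplier[OF cb] R_multiplier[OF coefficient_multiplier[OF cb]]
  have "corepresentation t M \<Delta> \<phi> \<Lambda> n (\<lambda>i j. V (h i) (h j))"
    unfolding corepresentation_def
    by (simp add: m hI comodule_coefficients[OF cb] s[of "\<lambda>k. op_tensor t (V (h _) k) (V k (h _))"])
  moreover have "invertible_matrix (multiplier_C0 t M \<Delta> \<phi> \<Lambda>) n (\<lambda>i j. V (h i) (h j))"
    unfolding invertible_matrix_def
    by (rule exI[of _ "\<lambda>i j. R (V (h i) (h j))"])
      (simp add: m hI heq s[of "\<lambda>k. V (h _) k o\<^sub>L R (V k (h _))"] s[of "\<lambda>k. R (V (h _) k) o\<^sub>L V k (h _)"]
        comodule_V_R'[OF cb] comodule_R_V[OF cb])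
  moreover have "invertible_matrix (multiplier_C0 t M \<Delta> \<phi> \<Lambda>) n (\<lambda>i j. V (h j) (h i))"
    unfolding invertible_matrix_def
    by (rule exI[of _ "\<lambda>i j. R (V (h j) (h i))"])
      (simp add: m hI heq s[of "\<lambda>k. V k (h _) o\<^sub>L R (V (h _) k)"] s[of "\<lambda>k. R (V k (h _)) o\<^sub>L V (h _) k"]
        comodule_V_R[OF cb] comodule_R_V'[OF cb])
  ultimately show ?thesis unfolding admissible_def by blast
qed

end

text \<open>\<open>cspan\<close> sums over sets of operators, so coefficients belonging to equal
  entries must be collected first.\<close>

lemma cspan_sum:
  fixes x :: "'j \<Rightarrow> 'h::complex_hilbert oper"
  assumes "finite J" "\<And>j. j \<in> J \<Longrightarrow> x j \<in> S"
  shows "(\<Sum>j\<in>J. cscale (c j) (x j)) \<in> cspan S"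
proof -
  define d where "d z = (\<Sum>j | j \<in> J \<and> x j = z. c j)" for z
  have "(\<Sum>j\<in>J. cscale (c j) (x j)) = (\<Sum>z\<in>x ` J. \<Sum>j | j \<in> J \<and> x j = z. cscale (c j) (x j))"
    by (rule sum.image_gen[OF assms(1)])
  also have "\<dots> = (\<Sum>z\<in>x ` J. cscale (d z) z)"
  proof (rule sum.cong[OF refl])
    fix z :: "'h oper"
    have "cscale (\<Sum>j\<in>K. c j) z = (\<Sum>j\<in>K. cscale (c j) z)" if "finite K" for K
      using that by (induction K rule: finite_induct) (auto simp: cscale_add_left)
    then show "(\<Sum>j | j \<in> J \<and> x j = z. cscale (c j) (x j)) = cscale (d z) z"
      unfolding d_def using assms(1) by simp
  qed
  finally show ?thesis
    unfolding cspan_def using assms by blast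
qed

lemma alg_tensor_I:
  "(\<And>i. i < (n::nat) \<Longrightarrow> x i \<in> A \<and> y i \<in> B) \<Longrightarrow> (\<Sum>i<n. op_tensor t (x i) (y i)) \<in> alg_tensor t A B"
  unfolding alg_tensor_def by blast

section \<open>Comparison of admissible coefficients with finite-rank coproducts\<close>

context quantum_group
begin

lemma alg_tensor_zero: "0 \<in> alg_tensor t M M"
  using alg_tensor_I[of 0 undefined M undefined M t] by simp

lemma alg_tensor_add:
  assumes "X \<in> alg_tensor t M M" "Y \<in> alg_tensor t M M"
  shows "X + Y \<in> alg_tensor t M M"
proof -
  obtain n :: nat and x y where X: "X = (\<Sum>i<n. op_tensor t (x i) (y i))" "\<forall>i<n. x i \<in> M \<and> y i \<in> M"
    using assms(1) unfolding alg_tensor_def by blast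
  obtain m :: nat and x' y' where Y: "Y = (\<Sum>i<m. op_tensor t (x' i) (y' i))" "\<forall>i<m. x' i \<in> M \<and> y' i \<in> M"
    using assms(2) unfolding alg_tensor_def by blast
  let ?x = "\<lambda>i. if i < n then x i else x' (i - n)" and ?y = "\<lambda>i. if i < n then y i else y' (i - n)"
  have "(\<Sum>i<n + m. op_tensor t (?x i) (?y i)) = (\<Sum>i<n. op_tensor t (?x i) (?y i)) + (\<Sum>i<m. op_tensor t (?x (n + i)) (?y (n + i)))"
    by (induction m) (simp_all add: add.assoc)
  also have "\<dots> = X + Y" unfolding X(1) Y(1) by simp
  finally show ?thesis using X(2) Y(2) alg_tensor_I[of "n + m" ?x M ?y M t] by auto
qed

lemma alg_tensor_cscale:
  assumes "X \<in> alg_tensor t M M"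
  shows "cscale c X \<in> alg_tensor t M M"
proof -
  obtain n :: nat and x y where X: "X = (\<Sum>i<n. op_tensor t (x i) (y i))" "\<forall>i<n. x i \<in> M \<and> y i \<in> M"
    using assms unfolding alg_tensor_def by blast
  have "cscale c X = (\<Sum>i<n. op_tensor t (cscale c (x i)) (y i))"
    using X(2) unfolding X(1) by (simp add: cscale_sum t.op_tensor_cscale M_clin)
  also have "\<dots> \<in> alg_tensor t M M" by (rule alg_tensor_I) (use X(2) in \<open>simp add: M_cscale\<close>)
  finally show ?thesis .
qed

lemma AP_alg_subset_Pinf_alg: "AP_alg t M \<Delta> \<phi> \<Lambda> \<subseteq> Pinf_alg t M \<Delta>"
proof
  fix x assume "x \<in> AP_alg t M \<Delta> \<phi> \<Lambda>"
  then obtain F c where F: "finite F" "F \<subseteq> {U i j | n U i j. admissible t M \<Delta> \<phi> \<Lambda> n U \<and> i < n \<and> j < n}"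
    and x: "x = (\<Sum>u\<in>F. cscale (c u) u)" unfolding AP_alg_def cspan_def by blast
  have u: "u \<in> M \<and> \<Delta> u \<in> alg_tensor t M M" if uF: "u \<in> F" for u
  proof -
    obtain n U i j where U: "admissible t M \<Delta> \<phi> \<Lambda> n U" "i < n" "j < n" "u = U i j" using F(2) uF by blast
    then have c: "\<And>i j. i < n \<Longrightarrow> j < n \<Longrightarrow> U i j \<in> M \<and> \<Delta> (U i j) = (\<Sum>k<n. op_tensor t (U i k) (U k j))"
      unfolding admissible_def corepresentation_def multiplier_C0_def by blast
    have "\<Delta> u \<in> alg_tensor t M M"
      using alg_tensor_I[of n "U i" M "\<lambda>k. U k j" M t] c U by simp
    then show ?thesis using c U by simp
  qed
  have "(\<Sum>u\<in>G. cscale (c u) u) \<in> M \<and> \<Delta> (\<Sum>u\<in>G. cscale (c u) u) \<in> alg_tensor t M M" if "finite G" "G \<subseteq> F" for G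
    using that
  proof (induction G rule: finite_induct)
    case (insert a G)
    then have "a \<in> M" "\<Delta> a \<in> alg_tensor t M M" using u by auto
    with insert show ?case by (simp add: M_add M_cscale \<Delta>_add \<Delta>_cscale alg_tensor_add alg_tensor_cscale)
  qed (simp add: alg_tensor_zero)
  then show "x \<in> Pinf_alg t M \<Delta>" unfolding Pinf_alg_def x using F(1) by simp
qed

end

lemma (in kac_group) Pinf_alg_subset_AP_alg: "Pinf_alg t M \<Delta> \<subseteq> AP_alg t M \<Delta> \<phi> \<Lambda>"
proof
  fix x assume "x \<in> Pinf_alg t M \<Delta>"
  then have x: "x \<in> M" "\<Delta> x \<in> alg_tensor t M M" by (simp_all add: Pinf_alg_def)
  obtain I V y d where cb: "comodule_basis I V y" and xd: "x = (\<Sum>j\<in>I. cscale (d j) (y j))"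
    by (rule finite_rank_imp_comodule_basis[OF x]) (rule that)
  obtain c where c: "\<And>j. j \<in> I \<Longrightarrow> y j = (\<Sum>k\<in>I. cscale (c k) (V j k))"
    by (rule comodule_basis_scalars[OF cb]) (rule that)
  have fin: "finite I" using cb unfolding comodule_basis_def by blast
  obtain h where h: "bij_betw h {..<card I} I" using ex_bij_betw_nat_finite[OF fin] by (auto simp: atLeast0LessThan)
  have mem: "V j k \<in> {U i j | n U i j. admissible t M \<Delta> \<phi> \<Lambda> n U \<and> i < n \<and> j < n}" if "j \<in> I" "k \<in> I" for j k
  proof -
    have "j \<in> h ` {..<card I}" "k \<in> h ` {..<card I}" using h that by (simp_all add: bij_betw_def)
    then obtain a b where "a < card I" "j = h a" "b < card I" "k = h b" by auto
    then show ?thesis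
      by (intro CollectI exI[of _ "card I"] exI[of _ "\<lambda>i j. V (h i) (h j)"] exI[of _ a] exI[of _ b])
        (simp add: comodule_admissible[OF cb h])
  qed
  have "x = (\<Sum>j\<in>I. \<Sum>k\<in>I. cscale (d j * c k) (V j k))"
    unfolding xd by (simp add: c cscale_sum cscale_cscale)
  also have "\<dots> = (\<Sum>p\<in>I \<times> I. cscale (d (fst p) * c (snd p)) (V (fst p) (snd p)))"
    by (simp add: sum.cartesian_product split_beta)
  also have "\<dots> \<in> AP_alg t M \<Delta> \<phi> \<Lambda>"
    unfolding AP_alg_def by (rule cspan_sum) (use fin mem in auto)
  finally show "x \<in> AP_alg t M \<Delta> \<phi> \<Lambda>" .
qed

theorem corollary4p17:
  fixes t :: "'h::complex_hilbert \<Rightarrow> 'h \<Rightarrow> 'k::complex_hilbert"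
    and tL :: "'k \<Rightarrow> 'h \<Rightarrow> 'l::complex_hilbert"
    and tR :: "'h \<Rightarrow> 'k \<Rightarrow> 'l"
    and M :: "'h oper set"
    and \<Delta> :: "'h oper \<Rightarrow> 'k oper"
    and \<phi> :: "'h oper \<Rightarrow> ennreal"
    and \<Lambda> :: "'h oper \<Rightarrow> 'h"
  assumes "kac_algebra t tL tR M \<Delta> \<phi> \<Lambda>"
  shows "AP_alg t M \<Delta> \<phi> \<Lambda> = Pinf_alg t M \<Delta> \<and> AP t M \<Delta> \<phi> \<Lambda> = Pinf t M \<Delta>"
proof -
  obtain R \<delta> where "kac_group t tL tR M \<Delta> \<phi> \<Lambda> R \<delta>"
    by (rule kac_group_exists[OF assms]) (rule that)
  then interpret kac_group t tL tR M \<Delta> \<phi> \<Lambda> R \<delta> .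
  have "AP_alg t M \<Delta> \<phi> \<Lambda> = Pinf_alg t M \<Delta>"
    using AP_alg_subset_Pinf_alg Pinf_alg_subset_AP_alg by (rule antisym)
  then show ?thesis by (simp add: AP_def Pinf_def)
qed

end
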